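(* Let $H$ be a Hopf algebra over a field $k$ with antipode $S$, $B$ a unital algebra, and $B\#_\sigma H$ a cocycle cross product with data $(\triangleright,\sigma)$. Then $B^e\otimes H$, with elements written $b\otimes b'\#_\sigma h$, is a left Hopf algebroid over $B$ (denoted $B^e\#_\sigma H$) with product $$(b\otimes b'\#_\sigma h)(c\otimes c'\#_\sigma g)=b(h_{(1)}\triangleright c)\sigma(h_{(2)},g_{(1)})\otimes c'(S(g_{(4)})\triangleright b')\sigma(S(g_{(3)}),S(h_{(4)}))\#_\sigma h_{(3)}g_{(2)},$$ source and target $s(b)=b\otimes1\#_\sigma1$, $t(b)=1\otimes b\#_\sigma1$ (so $\eta(b\otimes b')=s(b)t(b')=b\otimes b'\#_\sigma1$), coproduct $$\Delta(b\otimes b'\#_\sigma h)=(b\otimes\sigma^{-1}(S(h_{(2)}),h_{(3)})\#_\sigma h_{(1)})\otimes_B(1\otimes b'\#_\sigma h_{(4)}),$$ where the $B$-bimodule structure is $c.(b\otimes b'\#_\sigma h).c'=cb\otimes b'(S(h_{(2)})\triangleright c')\#_\sigma h_{(1)}$, and counit $$\epsilon(b\otimes b'\#_\sigma h)=b(h_{(1)}\triangleright b')\sigma(h_{(2)},S(h_{(3)})).$$ For $X=b\otimes b'\#_\sigma h$ and $Y\in B^e\#_\sigma H$, the inverse of $\lambda(X\otimes_{B^{op}}Y)=X_{(1)}\otimes_BX_{(2)}Y$ is given by $$\lambda^{-1}(X\otimes_BY)=(b\otimes1\#_\sigma h_{(1)})\otimes_{B^{op}}\big(b'\otimes\sigma^{-1}(S^2(h_{(3)}),S(h_{(2)}))\#_\sigma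 S(h_{(4)})\big)Y.$$
   Context: Sumless Sweedler notation is used; $B^e=B\otimes B^{op}$. Cocycle cross product: a linear map $\triangleright:H\otimes B\to B$ with $h\triangleright(ab)=(h_{(1)}\triangleright a)(h_{(2)}\triangleright b)$, $h\triangleright 1=\epsilon(h)1$ (a measuring, not necessarily an action), and a convolution-invertible $\sigma:H\otimes H\to B$ (inverse $\sigma^{-1}$) with (1) $1\triangleright b=b$; (2) $h\triangleright(g\triangleright b)=\sigma(h_{(1)},g_{(1)})(h_{(2)}g_{(2)}\triangleright b)\sigma^{-1}(h_{(3)},g_{(3)})$; (3) $\sigma(h,1)=\sigma(1,h)=\epsilon(h)1$; (4) $(h_{(1)}\triangleright\sigma(g_{(1)},f_{(1)}))\sigma(h_{(2)},g_{(2)}f_{(2)})=\sigma(h_{(1)},g_{(1)})\sigma(h_{(2)}g_{(2)},f)$. Then $B\#_\sigma H$ is $B\otimes H$ with product $(b\#_\sigma h)(c\#_\sigma g)=b(h_{(1)}\triangleright c)\sigma(h_{(2)},g_{(1)})\#_\sigma h_{(3)}g_{(2)}$. Left $B$-bialgebroid: an algebra $\mathcal{L}$ with algebra maps $s:B\to\mathcal{L}$, $t:B^{op}\to\mathcal{L}$ with commuting images, and a $B$-coring structure $(\Delta,\epsilon)$ (coalgebra in $B$-bimodules) for the bimodule structure $b.X.c=s(b)t(c)X$, such that (i) $\Delta$ corestricts to an algebra map $\mathcal{L}\to\mathcal{L}\times_B\mathcal{L}=\{\sum_i X_i\otimes_B Y_i\mid \sum_i X_it(b)\otimes_B Y_i=\sum_i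 X_i\otimes_B Y_is(b)\ \forall b\in B\}\subseteq\mathcal{L}\otimes_B\mathcal{L}$ with factorwise product; (ii) $\epsilon(1)=1$, $\epsilon(s(b)X)=b\epsilon(X)$, $\epsilon(Xs(\epsilon(Y)))=\epsilon(XY)=\epsilon(Xt(\epsilon(Y)))$. Left Hopf algebroid: a left $B$-bialgebroid such that $\lambda:\mathcal{L}\otimes_{B^{op}}\mathcal{L}\to\mathcal{L}\otimes_B\mathcal{L}$, $\lambda(X\otimes_{B^{op}}Y)=X_{(1)}\otimes_B X_{(2)}Y$, is invertible, where $Xt(b)\otimes_{B^{op}}Y=X\otimes_{B^{op}}t(b)Y$ and $t(b)X\otimes_B Y=X\otimes_B s(b)Y$. *)

theory Defs
  imports "HOL-Algebra.Algebra"
begin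

section \<open>Associative unital algebras over a field\<close>

text \<open>
  The library's \<^locale>\<open>algebra\<close> assumes commutativity, so noncommutative algebras need their own locale.
\<close>

locale unital_algebra = F: field k + A: ring A + module k A
  for k :: "('k, 'p) ring_scheme" (structure) and A :: "('k, 'a, 'm) module_scheme" (structure) +
  assumes smult_mult_left:
      "\<lbrakk>a \<in> carrier k; x \<in> carrier A; y \<in> carrier A\<rbrakk>
        \<Longrightarrow> (a \<odot>\<^bsub>A\<^esub> x) \<otimes>\<^bsub>A\<^esub> y = a \<odot>\<^bsub>A\<^esub> (x \<otimes>\<^bsub>A\<^esub> y)"
    and smult_mult_right:
      "\<lbrakk>a \<in> carrier k; x \<in> carrier A; y \<in> carrier A\<rbrakk>
        \<Longrightarrow> x \<otimes>\<^bsub>A\<^esub> (a \<odot>\<^bsub>A\<^esub> y) = a \<odot>\<^bsub>A\<^esub> (x \<otimes>\<^bsub>A\<^esub> y)"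

definition opposite :: "('a, 'm) ring_scheme \<Rightarrow> ('a, 'm) ring_scheme"
  where "opposite A = A\<lparr>monoid.mult := \<lambda>x y. y \<otimes>\<^bsub>A\<^esub> x\<rparr>"

definition linear_map ::
    "('k, 'p) ring_scheme \<Rightarrow> ('k, 'a, 'm) module_scheme \<Rightarrow> ('k, 'b, 'n) module_scheme
      \<Rightarrow> ('a \<Rightarrow> 'b) \<Rightarrow> bool"
  where "linear_map k M N f \<longleftrightarrow>
    f \<in> hom (add_monoid M) (add_monoid N) \<and>
    (\<forall>a\<in>carrier k. \<forall>x\<in>carrier M. f (a \<odot>\<^bsub>M\<^esub> x) = a \<odot>\<^bsub>N\<^esub> f x)"

definition bilinear_map ::
    "('k, 'p) ring_scheme \<Rightarrow> ('k, 'a, 'm) module_scheme \<Rightarrow> ('k, 'b, 'n) module_scheme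
      \<Rightarrow> ('k, 'c, 'q) module_scheme \<Rightarrow> ('a \<Rightarrow> 'b \<Rightarrow> 'c) \<Rightarrow> bool"
  where "bilinear_map k M N P f \<longleftrightarrow>
    (\<forall>x\<in>carrier M. linear_map k N P (f x)) \<and>
    (\<forall>y\<in>carrier N. linear_map k M P (\<lambda>x. f x y))"

definition algebra_hom ::
    "('k, 'p) ring_scheme \<Rightarrow> ('k, 'a, 'm) module_scheme \<Rightarrow> ('k, 'b, 'n) module_scheme
      \<Rightarrow> ('a \<Rightarrow> 'b) \<Rightarrow> bool"
  where "algebra_hom k A C f \<longleftrightarrow> f \<in> ring_hom A C \<and> linear_map k A C f"


section \<open>Tensor products\<close>

text \<open>
  The tensor product of abelian groups \<open>M\<close>, \<open>N\<close>, balanced over the set \<open>R\<close> acting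
  by \<open>ra\<close> on \<open>M\<close> (from the right) and by \<open>la\<close> on \<open>N\<close> (from the left): the free abelian group
  on pairs modulo the usual relations. Abelian groups are given as monoid records, so
  a module \<open>L\<close> enters as \<open>add_monoid L\<close>, and the tensor product is itself written
  multiplicatively.
\<close>

definition tensor_relators ::
    "'r set \<Rightarrow> ('m \<Rightarrow> 'r \<Rightarrow> 'm) \<Rightarrow> ('r \<Rightarrow> 'n \<Rightarrow> 'n) \<Rightarrow> ('m, 'p) monoid_scheme
      \<Rightarrow> ('n, 'q) monoid_scheme \<Rightarrow> ('m \<times> 'n \<Rightarrow>\<^sub>0 int) set"
  where "tensor_relators R ra la M N =
    {frag_of (x \<otimes>\<^bsub>M\<^esub> x', y) - frag_of (x, y) - frag_of (x', y) | x x' y.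
      x \<in> carrier M \<and> x' \<in> carrier M \<and> y \<in> carrier N} \<union>
    {frag_of (x, y \<otimes>\<^bsub>N\<^esub> y') - frag_of (x, y) - frag_of (x, y') | x y y'.
      x \<in> carrier M \<and> y \<in> carrier N \<and> y' \<in> carrier N} \<union>
    {frag_of (ra x r, y) - frag_of (x, la r y) | x r y.
      x \<in> carrier M \<and> r \<in> R \<and> y \<in> carrier N}"

definition tensor_group ::
    "'r set \<Rightarrow> ('m \<Rightarrow> 'r \<Rightarrow> 'm) \<Rightarrow> ('r \<Rightarrow> 'n \<Rightarrow> 'n) \<Rightarrow> ('m, 'p) monoid_scheme
      \<Rightarrow> ('n, 'q) monoid_scheme \<Rightarrow> ('m \<times> 'n \<Rightarrow>\<^sub>0 int) set monoid"
  where "tensor_group R ra la M N =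
    (let F = free_Abelian_group (carrier M \<times> carrier N)
     in F Mod (generate F (tensor_relators R ra la M N)))"

text \<open>
  The neutral element of a tensor product \<open>T\<close> is the subgroup that was factored out, so
  \<open>pure_tensor T x y\<close> is the coset of \<open>(x, y)\<close>.
\<close>

definition pure_tensor :: "('m \<times> 'n \<Rightarrow>\<^sub>0 int) set monoid \<Rightarrow> 'm \<Rightarrow> 'n \<Rightarrow> ('m \<times> 'n \<Rightarrow>\<^sub>0 int) set"
  where "pure_tensor T x y = (\<lambda>u. u + frag_of (x, y)) ` \<one>\<^bsub>T\<^esub>"

text \<open>
  The value at \<open>t\<close> of the homomorphism into the abelian group \<open>G\<close> induced by the map \<open>F\<close>:
  a representative \<open>\<Sum>\<^sub>i n\<^sub>i (x\<^sub>i, y\<^sub>i)\<close> of \<open>t\<close> goes to \<open>\<Sum>\<^sub>i n\<^sub>i F x\<^sub>i y\<^sub>i\<close>. This is independent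
  of the representative whenever \<open>F\<close> is biadditive and balanced on the carriers.
\<close>

definition tensor_lift ::
    "('g, 'p) monoid_scheme \<Rightarrow> ('m \<Rightarrow> 'n \<Rightarrow> 'g) \<Rightarrow> ('m \<times> 'n \<Rightarrow>\<^sub>0 int) set \<Rightarrow> 'g"
  where "tensor_lift G F t =
    (let u = (SOME u. u \<in> t)
     in finprod G (\<lambda>(x, y). F x y [^]\<^bsub>G\<^esub> Poly_Mapping.lookup u (x, y)) (Poly_Mapping.keys u))"

definition tensor_over ::
    "('k, 'p) ring_scheme \<Rightarrow> ('k, 'a, 'm) module_scheme \<Rightarrow> ('k, 'b, 'n) module_scheme
      \<Rightarrow> ('a \<times> 'b \<Rightarrow>\<^sub>0 int) set monoid"
  where "tensor_over k M N =
    tensor_group (carrier k) (\<lambda>x a. a \<odot>\<^bsub>M\<^esub> x) (\<lambda>a y. a \<odot>\<^bsub>N\<^esub> y) (add_monoid M) (add_monoid N)"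

definition tensor_algebra ::
    "('k, 'p) ring_scheme \<Rightarrow> ('k, 'a, 'm) module_scheme \<Rightarrow> ('k, 'b, 'n) module_scheme
      \<Rightarrow> ('k, ('a \<times> 'b \<Rightarrow>\<^sub>0 int) set) module"
  where "tensor_algebra k A C =
    (let T = tensor_over k A C in
     \<lparr>carrier = carrier T,
      monoid.mult = (\<lambda>p q. tensor_lift T (\<lambda>a c.
                tensor_lift T (\<lambda>a' c'. pure_tensor T (a \<otimes>\<^bsub>A\<^esub> a') (c \<otimes>\<^bsub>C\<^esub> c')) q) p),
      one = pure_tensor T \<one>\<^bsub>A\<^esub> \<one>\<^bsub>C\<^esub>,
      ring.zero = \<one>\<^bsub>T\<^esub>,
      ring.add = (\<lambda>p q. p \<otimes>\<^bsub>T\<^esub> q),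
      module.smult = (\<lambda>r. tensor_lift T (\<lambda>a c. pure_tensor T (r \<odot>\<^bsub>A\<^esub> a) c))\<rparr>)"

definition enveloping_algebra ::
    "('k, 'p) ring_scheme \<Rightarrow> ('k, 'b, 'm) module_scheme \<Rightarrow> ('k, ('b \<times> 'b \<Rightarrow>\<^sub>0 int) set) module"
  where "enveloping_algebra k B = tensor_algebra k B (opposite B)"


section \<open>Hopf algebras\<close>

record ('k, 'h) hopf_data = "('k, 'h) module" +
  comul :: "'h \<Rightarrow> ('h \<times> 'h \<Rightarrow>\<^sub>0 int) set"
  counit :: "'h \<Rightarrow> 'k"
  antipode :: "'h \<Rightarrow> 'h"

text \<open>
  Sweedler sums: for \<open>F\<close> multilinear with values in the abelian group \<open>G\<close>,
  \<open>sweedler3 H G F h\<close> is \<open>F h\<^sub>(\<^sub>1\<^sub>) h\<^sub>(\<^sub>2\<^sub>) h\<^sub>(\<^sub>3\<^sub>)\<close>, with the iterated coproduct bracketed to the right.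
\<close>

definition sweedler2 ::
    "('k, 'h, 'm) hopf_data_scheme \<Rightarrow> ('g, 'p) monoid_scheme \<Rightarrow> ('h \<Rightarrow> 'h \<Rightarrow> 'g) \<Rightarrow> 'h \<Rightarrow> 'g"
  where "sweedler2 H G F h = tensor_lift G F (comul H h)"

definition sweedler3 ::
    "('k, 'h, 'm) hopf_data_scheme \<Rightarrow> ('g, 'p) monoid_scheme \<Rightarrow> ('h \<Rightarrow> 'h \<Rightarrow> 'h \<Rightarrow> 'g) \<Rightarrow> 'h \<Rightarrow> 'g"
  where "sweedler3 H G F h = sweedler2 H G (\<lambda>h1 x. sweedler2 H G (F h1) x) h"

definition sweedler4 ::
    "('k, 'h, 'm) hopf_data_scheme \<Rightarrow> ('g, 'p) monoid_scheme
      \<Rightarrow> ('h \<Rightarrow> 'h \<Rightarrow> 'h \<Rightarrow> 'h \<Rightarrow> 'g) \<Rightarrow> 'h \<Rightarrow> 'g"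
  where "sweedler4 H G F h = sweedler2 H G (\<lambda>h1 x. sweedler3 H G (F h1) x) h"

text \<open>
  Coassociativity is stated in \<open>H \<otimes> (H \<otimes> H)\<close>. The field \<open>k\<close>, as a ring, carries no
  \<^const>\<open>module.smult\<close>, so linearity of the counit is spelled out.
\<close>

locale hopf_algebra = unital_algebra k H
  for k :: "('k, 'p) ring_scheme" (structure) and H :: "('k, 'h, 'm) hopf_data_scheme" (structure) +
  assumes comul_hom: "algebra_hom k H (tensor_algebra k H H) (comul H)"
    and counit_hom: "counit H \<in> ring_hom H k"
    and counit_smult: "\<lbrakk>a \<in> carrier k; h \<in> carrier H\<rbrakk>
          \<Longrightarrow> counit H (a \<odot>\<^bsub>H\<^esub> h) = a \<otimes>\<^bsub>k\<^esub> counit H h"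
    and antipode_linear: "linear_map k H H (antipode H)"
    and comul_coassoc: "h \<in> carrier H \<Longrightarrow>
          (let HH = tensor_over k H H; HHH = tensor_over k H (tensor_algebra k H H)
           in sweedler2 H HHH (\<lambda>x h3.
                sweedler2 H HHH (\<lambda>h1 h2. pure_tensor HHH h1 (pure_tensor HH h2 h3)) x) h
            = sweedler2 H HHH (\<lambda>h1 y. pure_tensor HHH h1 (comul H y)) h)"
    and counit_left: "h \<in> carrier H \<Longrightarrow>
          sweedler2 H (add_monoid H) (\<lambda>h1 h2. counit H h1 \<odot>\<^bsub>H\<^esub> h2) h = h"
    and counit_right: "h \<in> carrier H \<Longrightarrow>
          sweedler2 H (add_monoid H) (\<lambda>h1 h2. counit H h2 \<odot>\<^bsub>H\<^esub> h1) h = h"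
    and antipode_left: "h \<in> carrier H \<Longrightarrow>
          sweedler2 H (add_monoid H) (\<lambda>h1 h2. antipode H h1 \<otimes>\<^bsub>H\<^esub> h2) h = counit H h \<odot>\<^bsub>H\<^esub> \<one>\<^bsub>H\<^esub>"
    and antipode_right: "h \<in> carrier H \<Longrightarrow>
          sweedler2 H (add_monoid H) (\<lambda>h1 h2. h1 \<otimes>\<^bsub>H\<^esub> antipode H h2) h = counit H h \<odot>\<^bsub>H\<^esub> \<one>\<^bsub>H\<^esub>"


section \<open>Cocycle cross products\<close>

text \<open>
  \<open>act h b\<close> is the measuring \<open>h \<triangleright> b\<close>, \<open>\<sigma>\<close> the cocycle and \<open>\<sigma>'\<close> its convolution inverse.
  Linear maps out of \<open>H \<otimes> B\<close> and \<open>H \<otimes> H\<close> are given as bilinear maps.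
\<close>

locale cocycle_cross_product =
  hopf: hopf_algebra k H + base: unital_algebra k B
  for k :: "('k, 'p) ring_scheme" (structure)
    and B :: "('k, 'b, 'n) module_scheme" (structure)
    and H :: "('k, 'h, 'm) hopf_data_scheme" (structure)
    and act :: "'h \<Rightarrow> 'b \<Rightarrow> 'b"
    and \<sigma> :: "'h \<Rightarrow> 'h \<Rightarrow> 'b"
    and \<sigma>' :: "'h \<Rightarrow> 'h \<Rightarrow> 'b" +
  assumes act_bilinear: "bilinear_map k H B B act"
    and act_mult: "\<lbrakk>h \<in> carrier H; a \<in> carrier B; b \<in> carrier B\<rbrakk> \<Longrightarrow>
      act h (a \<otimes>\<^bsub>B\<^esub> b) = sweedler2 H (add_monoid B) (\<lambda>h1 h2. act h1 a \<otimes>\<^bsub>B\<^esub> act h2 b) h"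
    and act_one: "h \<in> carrier H \<Longrightarrow> act h \<one>\<^bsub>B\<^esub> = counit H h \<odot>\<^bsub>B\<^esub> \<one>\<^bsub>B\<^esub>"
    and sigma_bilinear: "bilinear_map k H H B \<sigma>"
    and sigma_inv_bilinear: "bilinear_map k H H B \<sigma>'"
    and sigma_inv_right: "\<lbrakk>h \<in> carrier H; g \<in> carrier H\<rbrakk> \<Longrightarrow>
      sweedler2 H (add_monoid B) (\<lambda>h1 h2. sweedler2 H (add_monoid B) (\<lambda>g1 g2.
        \<sigma> h1 g1 \<otimes>\<^bsub>B\<^esub> \<sigma>' h2 g2) g) h = (counit H h \<otimes>\<^bsub>k\<^esub> counit H g) \<odot>\<^bsub>B\<^esub> \<one>\<^bsub>B\<^esub>"
    and sigma_inv_left: "\<lbrakk>h \<in> carrier H; g \<in> carrier H\<rbrakk> \<Longrightarrow>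
      sweedler2 H (add_monoid B) (\<lambda>h1 h2. sweedler2 H (add_monoid B) (\<lambda>g1 g2.
        \<sigma>' h1 g1 \<otimes>\<^bsub>B\<^esub> \<sigma> h2 g2) g) h = (counit H h \<otimes>\<^bsub>k\<^esub> counit H g) \<odot>\<^bsub>B\<^esub> \<one>\<^bsub>B\<^esub>"
    and one_act: "b \<in> carrier B \<Longrightarrow> act \<one>\<^bsub>H\<^esub> b = b"
    and act_act: "\<lbrakk>h \<in> carrier H; g \<in> carrier H; b \<in> carrier B\<rbrakk> \<Longrightarrow>
      act h (act g b) =
        sweedler3 H (add_monoid B) (\<lambda>h1 h2 h3. sweedler3 H (add_monoid B) (\<lambda>g1 g2 g3.
          \<sigma> h1 g1 \<otimes>\<^bsub>B\<^esub> act (h2 \<otimes>\<^bsub>H\<^esub> g2) b \<otimes>\<^bsub>B\<^esub> \<sigma>' h3 g3) g) h"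
    and sigma_one_right: "h \<in> carrier H \<Longrightarrow> \<sigma> h \<one>\<^bsub>H\<^esub> = counit H h \<odot>\<^bsub>B\<^esub> \<one>\<^bsub>B\<^esub>"
    and sigma_one_left: "h \<in> carrier H \<Longrightarrow> \<sigma> \<one>\<^bsub>H\<^esub> h = counit H h \<odot>\<^bsub>B\<^esub> \<one>\<^bsub>B\<^esub>"
    and sigma_cocycle: "\<lbrakk>h \<in> carrier H; g \<in> carrier H; f \<in> carrier H\<rbrakk> \<Longrightarrow>
      sweedler2 H (add_monoid B) (\<lambda>h1 h2. sweedler2 H (add_monoid B) (\<lambda>g1 g2.
        sweedler2 H (add_monoid B) (\<lambda>f1 f2.
          act h1 (\<sigma> g1 f1) \<otimes>\<^bsub>B\<^esub> \<sigma> h2 (g2 \<otimes>\<^bsub>H\<^esub> f2)) f) g) h =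
      sweedler2 H (add_monoid B) (\<lambda>h1 h2. sweedler2 H (add_monoid B) (\<lambda>g1 g2.
        \<sigma> h1 g1 \<otimes>\<^bsub>B\<^esub> \<sigma> (h2 \<otimes>\<^bsub>H\<^esub> g2) f) g) h"

text \<open>The element \<open>b \<otimes> b' # h\<close> of the vector space \<open>B\<^sup>e \<otimes> H\<close>.\<close>

definition env_elem ::
    "('k, 'p) ring_scheme \<Rightarrow> ('k, 'b, 'n) module_scheme \<Rightarrow> ('k, 'h, 'm) module_scheme
      \<Rightarrow> 'b \<Rightarrow> 'b \<Rightarrow> 'h \<Rightarrow> (('b \<times> 'b \<Rightarrow>\<^sub>0 int) set \<times> 'h \<Rightarrow>\<^sub>0 int) set"
  where "env_elem k B H b b' h =
    pure_tensor (tensor_over k (enveloping_algebra k B) H)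
      (pure_tensor (tensor_over k B (opposite B)) b b') h"


section \<open>Left bialgebroids and left Hopf algebroids\<close>

record ('k, 'b, 'l) bialgebroid_data = "('k, 'l) module" +
  source :: "'b \<Rightarrow> 'l"
  target :: "'b \<Rightarrow> 'l"
  coprod :: "'l \<Rightarrow> ('l \<times> 'l \<Rightarrow>\<^sub>0 int) set"
  bcounit :: "'l \<Rightarrow> 'b"

text \<open>\<open>L \<otimes>\<^sub>B L\<close>, where \<open>t b x \<otimes> y = x \<otimes> s b y\<close>.\<close>

definition tensor_base ::
    "('b, 'n) ring_scheme \<Rightarrow> ('k, 'b, 'l, 'm) bialgebroid_data_scheme \<Rightarrow> ('l \<times> 'l \<Rightarrow>\<^sub>0 int) set monoid"
  where "tensor_base B L =
    tensor_group (carrier B) (\<lambda>x b. target L b \<otimes>\<^bsub>L\<^esub> x) (\<lambda>b y. source L b \<otimes>\<^bsub>L\<^esub> y)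
      (add_monoid L) (add_monoid L)"

text \<open>\<open>L \<otimes>\<^sub>B (L \<otimes>\<^sub>B L)\<close>, with \<open>B\<close> acting by \<open>s\<close> on the first factor of \<open>L \<otimes>\<^sub>B L\<close>.\<close>

definition tensor_base3 ::
    "('b, 'n) ring_scheme \<Rightarrow> ('k, 'b, 'l, 'm) bialgebroid_data_scheme
      \<Rightarrow> ('l \<times> ('l \<times> 'l \<Rightarrow>\<^sub>0 int) set \<Rightarrow>\<^sub>0 int) set monoid"
  where "tensor_base3 B L =
    (let T = tensor_base B L
     in tensor_group (carrier B) (\<lambda>x b. target L b \<otimes>\<^bsub>L\<^esub> x)
          (\<lambda>b. tensor_lift T (\<lambda>x y. pure_tensor T (source L b \<otimes>\<^bsub>L\<^esub> x) y))
          (add_monoid L) T)"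

text \<open>\<open>L \<otimes>\<^bsub>B\<^sup>o\<^sup>p\<^esub> L\<close>, where \<open>x t b \<otimes> y = x \<otimes> t b y\<close>.\<close>

definition tensor_base_op ::
    "('b, 'n) ring_scheme \<Rightarrow> ('k, 'b, 'l, 'm) bialgebroid_data_scheme \<Rightarrow> ('l \<times> 'l \<Rightarrow>\<^sub>0 int) set monoid"
  where "tensor_base_op B L =
    tensor_group (carrier B) (\<lambda>x b. x \<otimes>\<^bsub>L\<^esub> target L b) (\<lambda>b y. target L b \<otimes>\<^bsub>L\<^esub> y)
      (add_monoid L) (add_monoid L)"

definition takeuchi ::
    "('b, 'n) ring_scheme \<Rightarrow> ('k, 'b, 'l, 'm) bialgebroid_data_scheme \<Rightarrow> ('l \<times> 'l \<Rightarrow>\<^sub>0 int) set set"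
  where "takeuchi B L =
    (let T = tensor_base B L
     in {P \<in> carrier T. \<forall>b\<in>carrier B.
           tensor_lift T (\<lambda>x y. pure_tensor T (x \<otimes>\<^bsub>L\<^esub> target L b) y) P
         = tensor_lift T (\<lambda>x y. pure_tensor T x (y \<otimes>\<^bsub>L\<^esub> source L b)) P})"

text \<open>
  The factorwise product \<open>P Q\<close> is well defined for \<open>P\<close> in the Takeuchi product and \<open>Q\<close> arbitrary;
  this needs the expansion of \<open>P\<close> inside that of \<open>Q\<close>.
\<close>

definition factorwise_mult ::
    "('b, 'n) ring_scheme \<Rightarrow> ('k, 'b, 'l, 'm) bialgebroid_data_scheme
      \<Rightarrow> ('l \<times> 'l \<Rightarrow>\<^sub>0 int) set \<Rightarrow> ('l \<times> 'l \<Rightarrow>\<^sub>0 int) set \<Rightarrow> ('l \<times> 'l \<Rightarrow>\<^sub>0 int) set"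
  where "factorwise_mult B L P Q =
    (let T = tensor_base B L
     in tensor_lift T (\<lambda>x' y'.
          tensor_lift T (\<lambda>x y. pure_tensor T (x \<otimes>\<^bsub>L\<^esub> x') (y \<otimes>\<^bsub>L\<^esub> y')) P) Q)"

text \<open>
  The \<open>B\<close>-bimodule structures are \<open>b.x.c = s b t c x\<close> on \<open>L\<close> and
  \<open>b.(x \<otimes> y).c = s b x \<otimes> t c y\<close> on \<open>L \<otimes>\<^sub>B L\<close>.
\<close>

locale left_bialgebroid =
  base: unital_algebra k B + total: unital_algebra k L
  for k :: "('k, 'p) ring_scheme" (structure)
    and B :: "('k, 'b, 'n) module_scheme" (structure)
    and L :: "('k, 'b, 'l, 'm) bialgebroid_data_scheme" (structure) +
  assumes source_hom: "algebra_hom k B L (source L)"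
    and target_hom: "algebra_hom k (opposite B) L (target L)"
    and source_target_commute: "\<lbrakk>b \<in> carrier B; c \<in> carrier B\<rbrakk>
      \<Longrightarrow> source L b \<otimes>\<^bsub>L\<^esub> target L c = target L c \<otimes>\<^bsub>L\<^esub> source L b"
    and coprod_hom: "coprod L \<in> hom (add_monoid L) (tensor_base B L)"
    and coprod_bimodule: "\<lbrakk>b \<in> carrier B; c \<in> carrier B; x \<in> carrier L\<rbrakk> \<Longrightarrow>
      coprod L (source L b \<otimes>\<^bsub>L\<^esub> target L c \<otimes>\<^bsub>L\<^esub> x) =
        tensor_lift (tensor_base B L) (\<lambda>x1 x2.
          pure_tensor (tensor_base B L) (source L b \<otimes>\<^bsub>L\<^esub> x1) (target L c \<otimes>\<^bsub>L\<^esub> x2)) (coprod L x)"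
    and coprod_coassoc: "x \<in> carrier L \<Longrightarrow>
      (let T = tensor_base B L; T3 = tensor_base3 B L
       in tensor_lift T3 (\<lambda>y x3. tensor_lift T3 (\<lambda>x1 x2.
            pure_tensor T3 x1 (pure_tensor T x2 x3)) (coprod L y)) (coprod L x)
        = tensor_lift T3 (\<lambda>x1 y. pure_tensor T3 x1 (coprod L y)) (coprod L x))"
    and bcounit_hom: "bcounit L \<in> hom (add_monoid L) (add_monoid B)"
    and bcounit_bimodule: "\<lbrakk>b \<in> carrier B; c \<in> carrier B; x \<in> carrier L\<rbrakk> \<Longrightarrow>
      bcounit L (source L b \<otimes>\<^bsub>L\<^esub> target L c \<otimes>\<^bsub>L\<^esub> x) = b \<otimes>\<^bsub>B\<^esub> bcounit L x \<otimes>\<^bsub>B\<^esub> c"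
    and bcounit_left: "x \<in> carrier L \<Longrightarrow>
      tensor_lift (add_monoid L) (\<lambda>x1 x2. source L (bcounit L x1) \<otimes>\<^bsub>L\<^esub> x2) (coprod L x) = x"
    and bcounit_right: "x \<in> carrier L \<Longrightarrow>
      tensor_lift (add_monoid L) (\<lambda>x1 x2. target L (bcounit L x2) \<otimes>\<^bsub>L\<^esub> x1) (coprod L x) = x"
    and coprod_takeuchi: "x \<in> carrier L \<Longrightarrow> coprod L x \<in> takeuchi B L"
    and coprod_one: "coprod L \<one>\<^bsub>L\<^esub> = pure_tensor (tensor_base B L) \<one>\<^bsub>L\<^esub> \<one>\<^bsub>L\<^esub>"
    and coprod_mult: "\<lbrakk>x \<in> carrier L; y \<in> carrier L\<rbrakk> \<Longrightarrow>
      coprod L (x \<otimes>\<^bsub>L\<^esub> y) = factorwise_mult B L (coprod L x) (coprod L y)"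
    and bcounit_one: "bcounit L \<one>\<^bsub>L\<^esub> = \<one>\<^bsub>B\<^esub>"
    and bcounit_source: "\<lbrakk>b \<in> carrier B; x \<in> carrier L\<rbrakk> \<Longrightarrow>
      bcounit L (source L b \<otimes>\<^bsub>L\<^esub> x) = b \<otimes>\<^bsub>B\<^esub> bcounit L x"
    and bcounit_mult_source: "\<lbrakk>x \<in> carrier L; y \<in> carrier L\<rbrakk> \<Longrightarrow>
      bcounit L (x \<otimes>\<^bsub>L\<^esub> source L (bcounit L y)) = bcounit L (x \<otimes>\<^bsub>L\<^esub> y)"
    and bcounit_mult_target: "\<lbrakk>x \<in> carrier L; y \<in> carrier L\<rbrakk> \<Longrightarrow>
      bcounit L (x \<otimes>\<^bsub>L\<^esub> y) = bcounit L (x \<otimes>\<^bsub>L\<^esub> target L (bcounit L y))"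

text \<open>The map \<open>\<lambda>(x \<otimes> y) = x\<^sub>(\<^sub>1\<^sub>) \<otimes> x\<^sub>(\<^sub>2\<^sub>) y\<close> from \<open>L \<otimes>\<^bsub>B\<^sup>o\<^sup>p\<^esub> L\<close> to \<open>L \<otimes>\<^sub>B L\<close>.\<close>

definition galois_map ::
    "('b, 'n) ring_scheme \<Rightarrow> ('k, 'b, 'l, 'm) bialgebroid_data_scheme
      \<Rightarrow> ('l \<times> 'l \<Rightarrow>\<^sub>0 int) set \<Rightarrow> ('l \<times> 'l \<Rightarrow>\<^sub>0 int) set"
  where "galois_map B L =
    (let T = tensor_base B L
     in tensor_lift T (\<lambda>x y. tensor_lift T (\<lambda>x1 x2. pure_tensor T x1 (x2 \<otimes>\<^bsub>L\<^esub> y)) (coprod L x)))"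

locale left_hopf_algebroid = left_bialgebroid +
  assumes galois_bij:
    "bij_betw (galois_map B L) (carrier (tensor_base_op B L)) (carrier (tensor_base B L))"

end

theory Submission
  imports Defs
begin

text \<open>
  The free \<open>B\<close>-bimodule on \<open>H\<close>, spanned by elements \<open>b\<cdot>u(h)\<cdot>c\<close>, is identified with
  \<open>B\<^sup>e \<otimes> H\<close> by a change of basis through the antipode. In the new basis the coproduct is
  \<open>u(h) \<mapsto> u(h\<^sub>1) \<otimes> u(h\<^sub>2)\<close>, the counit is \<open>b\<cdot>u(h)\<cdot>c \<mapsto> \<epsilon>(h)bc\<close>, and left multiplication by
  \<open>u(h)\<close> is an extension of the measuring \<open>h \<triangleright>\<close> to the bimodule, determined by
  \<open>h \<triangleright> u(g) = \<sigma>(h\<^sub>1,g\<^sub>1)\<cdot>u(h\<^sub>2g\<^sub>2)\<cdot>\<sigma>'(h\<^sub>3,g\<^sub>3)\<close>.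
  Extending the measuring multiplicatively to the tensor ring of the bimodule, truncated in degree two, the cocycle
  condition says that it is again a twisted action. Every bimodule map that respects the generators \<open>u(h)\<close>
  is then equivariant, which gives the associativity of the product and the multiplicativity of the coproduct and of the
  counit. The antipode is needed only to return to the original coordinates and to invert the Galois map,
  which rests on two antipode identities for the elements \<open>1 \<otimes> 1 # h\<close>.

  Sums over the coproduct are products in the convolution algebras \<open>Hom(H\<^sup>n, R)\<close>, built by iterating
  \<open>Hom(H, -)\<close>; for \<open>R = B\<close> their product is written \<open>*\<^sub>n\<close>, for the truncated tensor ring \<open>\<star>\<^sub>n\<close>.
\<close>

section \<open>Balanced tensor products\<close>

text \<open>The generator u(h) is what the stated coproduct puts into its first factor, 1 \<otimes>
  \<sigma>'(S h2, h3) # h1. With u(h) known, the rest of the change of basis is forced: the counit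
  law x = x1.\<epsilon>(x2) makes 1 \<otimes> b' # h the sum of the u(h1).\<open>pp b' h2\<close>,
  where \<open>pp b' h\<close> = (h1 \<triangleright> b')\<sigma>(h2, S h3) is the prescribed counit
  of 1 \<otimes> b' # h. That \<open>pp\<close> can be undone, by \<open>qq\<close>, is not formal;
  it uses the cocycle condition. Degree two is dictated by the coproduct: to say that it is
  equivariant one needs an action on \<open>V \<otimes>\<^sub>B V\<close>. The measuring composes
  only up to conjugation by \<sigma>, and conjugation respects products; hence h \<triangleright> (g
  \<triangleright> x) need be compared with (hg) \<triangleright> x on the b and the u(h) alone.
  Each rearrangement of a Sweedler sum has to be justified by linearity in every leg, which
  equations between ring elements avoid. Explicit sums remain where an antipode joins two legs of
  one element, since h \<mapsto> h1 \<otimes> S h2 is in general no coalgebra map.\<close>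

lemma (in comm_group) finprod_int_pow_add:
  assumes "finite A" "f \<in> A \<rightarrow> carrier G"
  shows "(\<Otimes>p\<in>A. f p [^] (m p + n p :: int)) = (\<Otimes>p\<in>A. f p [^] m p) \<otimes> (\<Otimes>p\<in>A. f p [^] n p)"
proof -
  have "(\<Otimes>p\<in>A. f p [^] (m p + n p)) = (\<Otimes>p\<in>A. f p [^] m p \<otimes> f p [^] n p)"
    by (rule finprod_cong') (use assms in \<open>auto simp: int_pow_mult Pi_iff\<close>)
  also have "... = (\<Otimes>p\<in>A. f p [^] m p) \<otimes> (\<Otimes>p\<in>A. f p [^] n p)"
    by (rule finprod_multf) (use assms in auto)
  finally show ?thesis .
qed

text \<open>The expression inside \<open>tensor_lift\<close>, but at a given formal sum instead of a
  chosen representative of a coset.\<close>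

definition frag_eval :: "('g, 'p) monoid_scheme \<Rightarrow> ('m \<times> 'n \<Rightarrow> 'g) \<Rightarrow> ('m \<times> 'n \<Rightarrow>\<^sub>0 int) \<Rightarrow> 'g"
  where "frag_eval G f u = finprod G (%p. f p [^]\<^bsub>G\<^esub> Poly_Mapping.lookup u p) (Poly_Mapping.keys u)"

context comm_group
begin

text \<open>Indices with coefficient zero contribute the neutral element. Two formal sums can
  therefore be evaluated over one common index set, which is how additivity is obtained.\<close>

lemma frag_eval_superset:
  assumes "finite A" "Poly_Mapping.keys u \<subseteq> A" "f \<in> A \<rightarrow> carrier G"
  shows "frag_eval G f u = (\<Otimes>p\<in>A. f p [^] Poly_Mapping.lookup u p)"
proof -
  have "(\<Otimes>p\<in>A. f p [^] Poly_Mapping.lookup u p) = (\<Otimes>p\<in>Poly_Mapping.keys u. f p [^] Poly_Mapping.lookup u p)"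
    by (rule finprod_mono_neutral_cong_left[symmetric])
       (use assms in \<open>auto simp: Pi_iff in_keys_iff\<close>)
  then show ?thesis by (simp add: frag_eval_def)
qed

lemma frag_eval_closed:
  assumes "Poly_Mapping.keys u \<subseteq> A" "f \<in> A \<rightarrow> carrier G"
  shows "frag_eval G f u \<in> carrier G"
  unfolding frag_eval_def by (rule finprod_closed) (use assms in auto)

lemma frag_eval_add:
  assumes "Poly_Mapping.keys u \<subseteq> A" "Poly_Mapping.keys v \<subseteq> A" "f \<in> A \<rightarrow> carrier G"
  shows "frag_eval G f (u + v) = frag_eval G f u \<otimes> frag_eval G f v"
proof -
  let ?K = "Poly_Mapping.keys u \<union> Poly_Mapping.keys v"
  have K: "finite ?K" "f \<in> ?K \<rightarrow> carrier G"
    using assms by auto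
  have "Poly_Mapping.keys (u + v) \<subseteq> ?K" by (rule Poly_Mapping.keys_add)
  then show ?thesis
    using K by (simp add: frag_eval_superset[where A = ?K] lookup_add finprod_int_pow_add)
qed

lemma frag_eval_of:
  assumes "f p \<in> carrier G"
  shows "frag_eval G f (frag_of p) = f p"
  using assms by (simp add: frag_eval_def int_pow_1)

lemma frag_eval_hom:
  assumes "f \<in> A \<rightarrow> carrier G"
  shows "frag_eval G f \<in> hom (free_Abelian_group A) G"
  using frag_eval_closed[OF _ assms] frag_eval_add[OF _ _ assms] by (intro homI) simp_all

end

section \<open>Presentation and universal property of a balanced tensor product\<close>

locale balanced_pair = M: comm_group M + N: comm_group N
  for M :: "('m, 'p) monoid_scheme" (structure) and N :: "('n, 'q) monoid_scheme" (structure) +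
  fixes R :: "'r set" and ra :: "'m \<Rightarrow> 'r \<Rightarrow> 'm" and la :: "'r \<Rightarrow> 'n \<Rightarrow> 'n"
  assumes ra_closed: "[|x \<in> carrier M; r \<in> R|] ==> ra x r \<in> carrier M"
    and la_closed: "[|y \<in> carrier N; r \<in> R|] ==> la r y \<in> carrier N"
begin

definition T :: "('m \<times> 'n \<Rightarrow>\<^sub>0 int) set monoid"
  where "T = tensor_group R ra la M N"

definition balanced :: "('g, 's) monoid_scheme \<Rightarrow> ('m \<Rightarrow> 'n \<Rightarrow> 'g) \<Rightarrow> bool"
  where "balanced G F \<longleftrightarrow>
    (\<forall>x\<in>carrier M. F x \<in> hom N G) \<and>
    (\<forall>y\<in>carrier N. (%x. F x y) \<in> hom M G) \<and>
    (\<forall>x\<in>carrier M. \<forall>r\<in>R. \<forall>y\<in>carrier N. F (ra x r) y = F x (la r y))"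

abbreviation "free_pairs \<equiv> free_Abelian_group (carrier M \<times> carrier N)"

definition relations :: "('m \<times> 'n \<Rightarrow>\<^sub>0 int) set"
  where "relations = generate free_pairs (tensor_relators R ra la M N)"

interpretation free: comm_group free_pairs
  by (rule abelian_free_Abelian_group)

lemma free_diff_closed:
  "[|u \<in> carrier free_pairs; v \<in> carrier free_pairs|] ==> u - v \<in> carrier free_pairs"
  using keys_diff[of u v] by auto

lemma free_add_closed:
  "[|u \<in> carrier free_pairs; v \<in> carrier free_pairs|] ==> u + v \<in> carrier free_pairs"
  using free.m_closed[of u v] by simp

lemma relatorI:
  "[|x \<in> carrier M; x' \<in> carrier M; y \<in> carrier N|]
    ==> frag_of (x \<otimes> x', y) - frag_of (x, y) - frag_of (x', y) \<in> tensor_relators R ra la M N"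
  "[|x \<in> carrier M; y \<in> carrier N; y' \<in> carrier N|]
    ==> frag_of (x, y \<otimes>\<^bsub>N\<^esub> y') - frag_of (x, y) - frag_of (x, y') \<in> tensor_relators R ra la M N"
  "[|x \<in> carrier M; r \<in> R; y \<in> carrier N|]
    ==> frag_of (ra x r, y) - frag_of (x, la r y) \<in> tensor_relators R ra la M N"
  unfolding tensor_relators_def by blast+

lemma relators_subset: "tensor_relators R ra la M N \<subseteq> carrier free_pairs"
proof
  fix r assume "r \<in> tensor_relators R ra la M N"
  then show "r \<in> carrier free_pairs"
    unfolding tensor_relators_def
  proof (elim UnE CollectE exE conjE)
    fix x x' y assume "r = frag_of (x \<otimes> x', y) - frag_of (x, y) - frag_of (x', y)"
      and *: "x \<in> carrier M" "x' \<in> carrier M" "y \<in> carrier N"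
    then show ?thesis by (simp only: free_diff_closed) (intro free_diff_closed; simp)
  next
    fix x y y' assume "r = frag_of (x, y \<otimes>\<^bsub>N\<^esub> y') - frag_of (x, y) - frag_of (x, y')"
      and *: "x \<in> carrier M" "y \<in> carrier N" "y' \<in> carrier N"
    then show ?thesis by (simp only: free_diff_closed) (intro free_diff_closed; simp)
  next
    fix x b y assume "r = frag_of (ra x b, y) - frag_of (x, la b y)"
      and *: "x \<in> carrier M" "b \<in> R" "y \<in> carrier N"
    then show ?thesis by (simp only: free_diff_closed) (intro free_diff_closed; simp add: ra_closed la_closed)
  qed
qed

lemma relations_subgroup: "subgroup relations free_pairs"
  unfolding relations_def by (rule free.generate_is_subgroup[OF relators_subset])

lemma relations_normal: "normal relations free_pairs"
  by (simp add: free.normal_iff_subgroup relations_subgroup)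

lemma T_Mod: "T = free_pairs Mod relations"
  by (simp add: T_def tensor_group_def relations_def Let_def)

sublocale T: comm_group T
  unfolding T_Mod by (rule free.abelian_FactGroup[OF relations_subgroup])

definition coset :: "('m \<times> 'n \<Rightarrow>\<^sub>0 int) \<Rightarrow> ('m \<times> 'n \<Rightarrow>\<^sub>0 int) set"
  where "coset u = relations #>\<^bsub>free_pairs\<^esub> u"

lemma coset_hom: "coset \<in> hom free_pairs T"
  unfolding T_Mod coset_def using normal.r_coset_hom_Mod[OF relations_normal] by blast

lemma carrier_T: "carrier T = coset ` carrier free_pairs"
  by (simp add: T_Mod carrier_FactGroup coset_def)

lemma pure_tensor_coset: "pure_tensor T x y = coset (frag_of (x, y))"
  by (auto simp: pure_tensor_def T_Mod coset_def r_coset_def)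

lemma coset_diff:
  assumes "u \<in> carrier free_pairs" "v \<in> carrier free_pairs" "u - v \<in> relations"
  shows "coset u = coset v"
proof -
  have d: "u - v \<in> carrier free_pairs"
    using assms(3) relations_subgroup subgroup.mem_carrier by fastforce
  have "coset (u - v) = \<one>\<^bsub>T\<^esub>"
    unfolding coset_def T_Mod using free.coset_join2[OF d relations_subgroup assms(3)] by simp
  moreover have "coset u = coset ((u - v) + v)" by simp
  moreover have "coset ((u - v) + v) = coset (u - v) \<otimes>\<^bsub>T\<^esub> coset v"
    using hom_mult[OF coset_hom d assms(2)] by simp
  ultimately show ?thesis
    using hom_in_carrier[OF coset_hom assms(2)] by simp
qed

lemma relator_relations: "r \<in> tensor_relators R ra la M N ==> r \<in> relations"
  unfolding relations_def by (rule generate.incl)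

lemma pure_closed [simp]: "[|x \<in> carrier M; y \<in> carrier N|] ==> pure_tensor T x y \<in> carrier T"
  unfolding pure_tensor_coset by (rule hom_in_carrier[OF coset_hom]) simp

lemma coset_relator:
  assumes "frag_of p - frag_of q - frag_of r \<in> tensor_relators R ra la M N"
    "p \<in> carrier M \<times> carrier N" "q \<in> carrier M \<times> carrier N" "r \<in> carrier M \<times> carrier N"
  shows "coset (frag_of p) = coset (frag_of q) \<otimes>\<^bsub>T\<^esub> coset (frag_of r)"
proof -
  have m: "frag_of p \<in> carrier free_pairs" "frag_of q \<in> carrier free_pairs" "frag_of r \<in> carrier free_pairs"
    using assms by simp_all
  have "frag_of p - (frag_of q + frag_of r) \<in> relations"
    using relator_relations[OF assms(1)] by (simp only: diff_diff_eq)
  then have "coset (frag_of p) = coset (frag_of q + frag_of r)"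
    by (rule coset_diff[OF m(1) free_add_closed[OF m(2,3)]])
  then show ?thesis
    using hom_mult[OF coset_hom m(2,3)] by simp
qed

text \<open>Negatives of pure tensors are again pure, -(x \<otimes> y) being (-x) \<otimes> y, so
  closure under the group operation is enough and no case for inverses is needed.\<close>

lemma T_induct [consumes 1, case_names pure mult]:
  assumes t: "t \<in> carrier T"
    and pure: "!!x y. [|x \<in> carrier M; y \<in> carrier N|] ==> P (pure_tensor T x y)"
    and mult: "!!s t. [|s \<in> carrier T; t \<in> carrier T; P s; P t|] ==> P (s \<otimes>\<^bsub>T\<^esub> t)"
  shows "P t"
proof -
  have gh2: "group_hom free_pairs T coset"
    by (simp add: group_hom_def group_hom_axioms_def free.is_group T.is_group coset_hom)
  have one: "P \<one>\<^bsub>T\<^esub>" and inv: "P (inv\<^bsub>T\<^esub> (pure_tensor T x y))"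
    if xy: "x \<in> carrier M" "y \<in> carrier N" for x y
  proof -
    have add: "pure_tensor T (x \<otimes> x') y = pure_tensor T x y \<otimes>\<^bsub>T\<^esub> pure_tensor T x' y"
      if "x \<in> carrier M" "x' \<in> carrier M" for x x'
      unfolding pure_tensor_coset by (rule coset_relator[OF relatorI(1)]) (use that xy in auto)
    have o: "pure_tensor T \<one> y = \<one>\<^bsub>T\<^esub>"
      using add[of \<one> \<one>] xy T.l_cancel_one' by (metis M.one_closed M.r_one pure_closed)
    then show "P \<one>\<^bsub>T\<^esub>" using pure[of \<one> y] xy by simp
    have "pure_tensor T (inv x) y \<otimes>\<^bsub>T\<^esub> pure_tensor T x y = \<one>\<^bsub>T\<^esub>"
      using add[of "inv x" x] xy o by simp
    then have "inv\<^bsub>T\<^esub> (pure_tensor T x y) = pure_tensor T (inv x) y"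
      using xy T.inv_equality by simp
    then show "P (inv\<^bsub>T\<^esub> (pure_tensor T x y))" using pure[of "inv x" y] xy by simp
  qed
  obtain u where u: "u \<in> carrier free_pairs" "t = coset u"
    using t by (auto simp: carrier_T)
  have "Poly_Mapping.keys u \<subseteq> carrier M \<times> carrier N" using u by simp
  \<comment> \<open>The induction principle of the free abelian group builds its elements by
    differences, so the claim is carried along together with the claim for the inverse.\<close>
  then have "P (coset u) \<and> P (inv\<^bsub>T\<^esub> (coset u))"
  proof (induction u rule: free_Abelian_group_induct[consumes 1, case_names zero diff of])
    case zero
    show ?case using group_hom.hom_one[OF gh2] one[of \<one> "\<one>\<^bsub>N\<^esub>"] by simp
  next
    case (diff u v)
    have k: "u \<in> carrier free_pairs" "v \<in> carrier free_pairs" using diff.hyps by simp_all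
    have uv: "u - v = u \<otimes>\<^bsub>free_pairs\<^esub> inv\<^bsub>free_pairs\<^esub> v" using diff.hyps by simp
    have c: "coset u \<in> carrier T" "coset v \<in> carrier T"
      using k hom_in_carrier[OF coset_hom] by auto
    have "coset (u - v) = coset u \<otimes>\<^bsub>T\<^esub> inv\<^bsub>T\<^esub> (coset v)" unfolding uv
      using k group_hom.hom_mult[OF gh2 k(1) free.inv_closed[OF k(2)]] group_hom.hom_inv[OF gh2 k(2)] by simp
    moreover have "inv\<^bsub>T\<^esub> (coset u \<otimes>\<^bsub>T\<^esub> inv\<^bsub>T\<^esub> (coset v)) = inv\<^bsub>T\<^esub> (coset u) \<otimes>\<^bsub>T\<^esub> coset v"
      using c by (simp add: T.inv_mult)
    ultimately show ?case
      using diff.IH c by (simp add: mult)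
  next
    case (of a)
    then show ?case
      by (cases a) (simp add: pure_tensor_coset[symmetric] pure inv)
  qed
  then show ?thesis using u by simp
qed

lemma pure_balanced: "balanced T (pure_tensor T)"
proof -
  show ?thesis
    unfolding balanced_def
  proof (intro conjI ballI homI)
    fix x r y assume *: "x \<in> carrier M" "r \<in> R" "y \<in> carrier N"
    show "pure_tensor T (ra x r) y = pure_tensor T x (la r y)"
      unfolding pure_tensor_coset
      by (rule coset_diff[OF _ _ relator_relations[OF relatorI(3)]]) (use * ra_closed la_closed in auto)
  next
    fix x y y' assume *: "x \<in> carrier M" "y \<in> carrier N" "y' \<in> carrier N"
    show "pure_tensor T x (y \<otimes>\<^bsub>N\<^esub> y') = pure_tensor T x y \<otimes>\<^bsub>T\<^esub> pure_tensor T x y'"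
      unfolding pure_tensor_coset by (rule coset_relator[OF relatorI(2)]) (use * in auto)
  next
    fix y x x' assume *: "y \<in> carrier N" "x \<in> carrier M" "x' \<in> carrier M"
    show "pure_tensor T (x \<otimes> x') y = pure_tensor T x y \<otimes>\<^bsub>T\<^esub> pure_tensor T x' y"
      unfolding pure_tensor_coset by (rule coset_relator[OF relatorI(1)]) (use * in auto)
  qed auto
qed

text \<open>The representative that \<open>tensor_lift\<close> chooses differs from u by an element
  generated by relators, and a balanced map evaluates every relator to the neutral element. From
  here on the choice is invisible.\<close>

lemma lift_coset:
  assumes G: "comm_group G" and F: "balanced G F" and u: "u \<in> carrier free_pairs"
  shows "tensor_lift G F (coset u) = frag_eval G (%(x, y). F x y) u"
proof -
  interpret G: comm_group G by (rule G)
  let ?f = "%(x, y). F x y"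
  have cl: "?f \<in> carrier M \<times> carrier N \<rightarrow> carrier G"
    using F by (auto simp: balanced_def hom_def)
  have h: "frag_eval G ?f \<in> hom free_pairs G" by (rule G.frag_eval_hom[OF cl])
  then interpret h: group_hom free_pairs G "frag_eval G ?f"
    by (simp add: group_hom_def group_hom_axioms_def free.is_group G.is_group)
  have diff: "frag_eval G ?f (a - b) = frag_eval G ?f a \<otimes>\<^bsub>G\<^esub> inv\<^bsub>G\<^esub> (frag_eval G ?f b)"
    if "a \<in> carrier free_pairs" "b \<in> carrier free_pairs" for a b
  proof -
    have "a - b = a \<otimes>\<^bsub>free_pairs\<^esub> inv\<^bsub>free_pairs\<^esub> b" using that by simp
    then show ?thesis using that by (simp only: h.hom_mult h.hom_inv free.inv_closed)
  qed
  have of: "frag_eval G ?f (frag_of (x, y)) = F x y" "F x y \<in> carrier G"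
    if "x \<in> carrier M" "y \<in> carrier N" for x y
    using cl that by (auto simp: G.frag_eval_of Pi_iff)
  have kill: "frag_eval G ?f r = \<one>\<^bsub>G\<^esub>" if "r \<in> tensor_relators R ra la M N" for r
  proof -
    have m1: "F (x \<otimes> x') y = F x y \<otimes>\<^bsub>G\<^esub> F x' y" if "x \<in> carrier M" "x' \<in> carrier M" "y \<in> carrier N" for x x' y
      using F that by (auto simp: balanced_def hom_def)
    have m2: "F x (y \<otimes>\<^bsub>N\<^esub> y') = F x y \<otimes>\<^bsub>G\<^esub> F x y'" if "x \<in> carrier M" "y \<in> carrier N" "y' \<in> carrier N" for x y y'
      using F that by (auto simp: balanced_def hom_def)
    have m3: "F (ra x r) y = F x (la r y)" if "x \<in> carrier M" "r \<in> R" "y \<in> carrier N" for x r y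
      using F that by (auto simp: balanced_def)
    have D: "frag_eval G ?f (frag_of p - frag_of q - frag_of r) = ?f p \<otimes>\<^bsub>G\<^esub> inv\<^bsub>G\<^esub> (?f q) \<otimes>\<^bsub>G\<^esub> inv\<^bsub>G\<^esub> (?f r)"
      if "p \<in> carrier M \<times> carrier N" "q \<in> carrier M \<times> carrier N" "r \<in> carrier M \<times> carrier N" for p q r
    proof -
      have "frag_of p - frag_of q \<in> carrier free_pairs"
        using that keys_diff[of "frag_of p" "frag_of q"] by auto
      then show ?thesis using that by (auto simp: diff of)
    qed
    from that show ?thesis
      unfolding tensor_relators_def
    proof (elim UnE CollectE exE conjE)
      fix x x' y assume "r = frag_of (x \<otimes> x', y) - frag_of (x, y) - frag_of (x', y)"
        and *: "x \<in> carrier M" "x' \<in> carrier M" "y \<in> carrier N"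
      then have "frag_eval G ?f r = (F x y \<otimes>\<^bsub>G\<^esub> F x' y) \<otimes>\<^bsub>G\<^esub> inv\<^bsub>G\<^esub> (F x y) \<otimes>\<^bsub>G\<^esub> inv\<^bsub>G\<^esub> (F x' y)"
        by (simp add: D m1)
      then show ?thesis using * of by (simp add: G.m_ac)
    next
      fix x y y' assume "r = frag_of (x, y \<otimes>\<^bsub>N\<^esub> y') - frag_of (x, y) - frag_of (x, y')"
        and *: "x \<in> carrier M" "y \<in> carrier N" "y' \<in> carrier N"
      then have "frag_eval G ?f r = (F x y \<otimes>\<^bsub>G\<^esub> F x y') \<otimes>\<^bsub>G\<^esub> inv\<^bsub>G\<^esub> (F x y) \<otimes>\<^bsub>G\<^esub> inv\<^bsub>G\<^esub> (F x y')"
        by (simp add: D m2)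
      then show ?thesis using * of by (simp add: G.m_ac)
    next
      fix x b y assume "r = frag_of (ra x b, y) - frag_of (x, la b y)"
        and *: "x \<in> carrier M" "b \<in> R" "y \<in> carrier N"
      then show ?thesis using ra_closed la_closed by (simp add: diff of m3)
    qed
  qed
  have N: "frag_eval G ?f n = \<one>\<^bsub>G\<^esub>" if "n \<in> relations" for n
    using that unfolding relations_def
  proof (induction rule: generate.induct)
    case one show ?case using h.hom_one by simp
  next
    case (incl h) then show ?case by (rule kill)
  next
    case (inv x)
    have "x \<in> carrier free_pairs" using relators_subset inv by blast
    then show ?case using kill[OF inv] by (simp only: h.hom_inv G.inv_one)
  next
    case (eng a b)
    then have "a \<in> carrier free_pairs" "b \<in> carrier free_pairs"
      using free.generate_in_carrier[OF relators_subset] by auto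
    then show ?case using eng.IH h.hom_mult[of a b] by (simp only: G.l_one G.one_closed)
  qed
  \<comment> \<open>The representative on which \<open>tensor_lift\<close> actually
    computes.\<close>
  define v where "v = (SOME u'. u' \<in> coset u)"
  have "u \<in> coset u" unfolding coset_def
    by (rule free.rcos_self[OF u relations_subgroup])
  then have "v \<in> coset u" unfolding v_def by (rule someI)
  then obtain n where n: "n \<in> relations" "v = n + u" by (auto simp: coset_def r_coset_def)
  have nc: "n \<in> carrier free_pairs" using n(1) relations_subgroup subgroup.mem_carrier by fastforce
  have "frag_eval G ?f v = frag_eval G ?f n \<otimes>\<^bsub>G\<^esub> frag_eval G ?f u"
    using h.hom_mult[OF nc u] n by simp
  also have "... = frag_eval G ?f u" using N[OF n(1)] h.hom_closed[OF u] by simp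
  moreover have "tensor_lift G F (coset u) = frag_eval G ?f v"
    by (simp add: tensor_lift_def frag_eval_def v_def case_prod_beta' Let_def)
  ultimately show ?thesis by simp
qed

lemma lift_hom:
  assumes "comm_group G" "balanced G F"
  shows "tensor_lift G F \<in> hom T G"
proof -
  interpret G: comm_group G by fact
  have cl: "(%(x, y). F x y) \<in> carrier M \<times> carrier N \<rightarrow> carrier G"
    using assms(2) by (auto simp: balanced_def hom_def)
  have h: "frag_eval G (%(x, y). F x y) \<in> hom free_pairs G" by (rule G.frag_eval_hom[OF cl])
  show ?thesis
  proof (rule homI)
    fix t assume "t \<in> carrier T"
    then show "tensor_lift G F t \<in> carrier G"
      using hom_in_carrier[OF h] by (auto simp: carrier_T lift_coset[OF assms] simp del: carrier_free_Abelian_group_iff)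
  next
    fix s t assume "s \<in> carrier T" "t \<in> carrier T"
    then obtain u v where *: "u \<in> carrier free_pairs" "s = coset u" "v \<in> carrier free_pairs" "t = coset v"
      by (auto simp: carrier_T simp del: carrier_free_Abelian_group_iff)
    then have "s \<otimes>\<^bsub>T\<^esub> t = coset (u \<otimes>\<^bsub>free_pairs\<^esub> v)" using hom_mult[OF coset_hom] by metis
    then show "tensor_lift G F (s \<otimes>\<^bsub>T\<^esub> t) = tensor_lift G F s \<otimes>\<^bsub>G\<^esub> tensor_lift G F t"
      using * hom_mult[OF h *(1,3)] free.m_closed[OF *(1,3)]
      by (simp only: lift_coset[OF assms])
  qed
qed

lemma lift_pure:
  assumes "comm_group G" "balanced G F" "x \<in> carrier M" "y \<in> carrier N"
  shows "tensor_lift G F (pure_tensor T x y) = F x y"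
proof -
  interpret G: comm_group G by fact
  have "F x y \<in> carrier G" using assms by (auto simp: balanced_def hom_def)
  then show ?thesis
    using assms by (simp add: pure_tensor_coset lift_coset G.frag_eval_of)
qed

end

section \<open>Linear and multilinear maps\<close>

lemma lin_I:
  assumes "!!x. x \<in> carrier M ==> f x \<in> carrier N"
    and "!!x y. [|x \<in> carrier M; y \<in> carrier M|] ==> f (x \<oplus>\<^bsub>M\<^esub> y) = f x \<oplus>\<^bsub>N\<^esub> f y"
    and "!!a x. [|a \<in> carrier k; x \<in> carrier M|] ==> f (a \<odot>\<^bsub>M\<^esub> x) = a \<odot>\<^bsub>N\<^esub> f x"
  shows "linear_map k M N f"
  using assms by (auto simp: linear_map_def hom_def)

lemma lin_closed: "[|linear_map k M N f; x \<in> carrier M|] ==> f x \<in> carrier N"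
  by (auto simp: linear_map_def hom_def)

lemma lin_add:
  "[|linear_map k M N f; x \<in> carrier M; y \<in> carrier M|] ==> f (x \<oplus>\<^bsub>M\<^esub> y) = f x \<oplus>\<^bsub>N\<^esub> f y"
  by (auto simp: linear_map_def hom_def)

lemma lin_smult:
  "[|linear_map k M N f; a \<in> carrier k; x \<in> carrier M|] ==> f (a \<odot>\<^bsub>M\<^esub> x) = a \<odot>\<^bsub>N\<^esub> f x"
  by (auto simp: linear_map_def)

lemma lin_hom: "linear_map k M N f ==> f \<in> hom (add_monoid M) (add_monoid N)"
  by (simp add: linear_map_def)

lemma lin_zero:
  assumes "module k M" "module k N" "linear_map k M N f"
  shows "f \<zero>\<^bsub>M\<^esub> = \<zero>\<^bsub>N\<^esub>"
proof -
  interpret M: module k M by fact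
  interpret N: module k N by fact
  have "f \<zero>\<^bsub>M\<^esub> = f (\<zero>\<^bsub>k\<^esub> \<odot>\<^bsub>M\<^esub> \<zero>\<^bsub>M\<^esub>)" by (simp add: M.smult_l_null)
  also have "... = \<zero>\<^bsub>k\<^esub> \<odot>\<^bsub>N\<^esub> f \<zero>\<^bsub>M\<^esub>" by (rule lin_smult[OF assms(3)]) simp_all
  also have "... = \<zero>\<^bsub>N\<^esub>" by (rule N.smult_l_null) (rule lin_closed[OF assms(3)], simp)
  finally show ?thesis .
qed

lemma lin_comp:
  assumes "linear_map k N P f" "linear_map k M N g"
  shows "linear_map k M P (%x. f (g x))"
  by (rule lin_I)
     (simp_all add: lin_closed[OF assms(1)] lin_closed[OF assms(2)]
       lin_add[OF assms(1)] lin_add[OF assms(2)]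
       lin_smult[OF assms(1)] lin_smult[OF assms(2)])

lemma lin_id: "linear_map k M M (%x. x)"
  by (rule lin_I) simp_all

lemma lin_cong:
  assumes "module k M" "linear_map k M N f" "!!x. x \<in> carrier M ==> f x = g x"
  shows "linear_map k M N g"
proof -
  interpret module k M by fact
  show ?thesis
    by (rule lin_I)
       (use assms(2,3) in \<open>auto simp: lin_closed lin_add lin_smult simp flip: assms(3)\<close>)
qed

lemma lin_plus:
  assumes N: "module k N" and f: "linear_map k M N f" and g: "linear_map k M N g"
  shows "linear_map k M N (%x. f x \<oplus>\<^bsub>N\<^esub> g x)"
proof -
  interpret N: module k N by fact
  show ?thesis
    by (rule lin_I)
       (simp_all add: lin_closed[OF f] lin_closed[OF g] lin_add[OF f] lin_add[OF g]
         lin_smult[OF f] lin_smult[OF g] N.smult_r_distr N.a_ac)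
qed

lemma lin_zero_fun:
  assumes "module k N"
  shows "linear_map k M N (%_. \<zero>\<^bsub>N\<^esub>)"
proof -
  interpret N: module k N by fact
  show ?thesis by (rule lin_I) (simp_all add: N.smult_r_null)
qed

lemma lin_scale:
  assumes "module k N" "linear_map k M N f" "a \<in> carrier k"
  shows "linear_map k M N (%x. a \<odot>\<^bsub>N\<^esub> f x)"
proof -
  interpret N: module k N by fact
  show ?thesis
  proof (rule lin_I)
    fix b x assume *: "b \<in> carrier k" "x \<in> carrier M"
    have "a \<odot>\<^bsub>N\<^esub> (b \<odot>\<^bsub>N\<^esub> f x) = b \<odot>\<^bsub>N\<^esub> (a \<odot>\<^bsub>N\<^esub> f x)"
      using * assms(3) lin_closed[OF assms(2)] N.smult_assoc1 N.R.m_comm by metis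
    then show "a \<odot>\<^bsub>N\<^esub> f (b \<odot>\<^bsub>M\<^esub> x) = b \<odot>\<^bsub>N\<^esub> (a \<odot>\<^bsub>N\<^esub> f x)"
      using lin_smult[OF assms(2) *] by simp
  qed (use assms in \<open>auto simp: lin_closed lin_add N.smult_r_distr\<close>)
qed

lemma bil_I:
  assumes "!!x. x \<in> carrier M ==> linear_map k N P (f x)"
    and "!!y. y \<in> carrier N ==> linear_map k M P (%x. f x y)"
  shows "bilinear_map k M N P f"
  using assms by (simp add: bilinear_map_def)

lemma bil_D:
  assumes "bilinear_map k M N P f"
  shows "x \<in> carrier M ==> linear_map k N P (f x)"
    and "y \<in> carrier N ==> linear_map k M P (%x. f x y)"
  using assms by (simp_all add: bilinear_map_def)

lemma bil_closed:
  "[|bilinear_map k M N P f; x \<in> carrier M; y \<in> carrier N|] ==> f x y \<in> carrier P"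
  by (meson bil_D(1) lin_closed)

lemma bil_left:
  assumes "bilinear_map k M N P f" "linear_map k W M g" "y \<in> carrier N"
  shows "linear_map k W P (%x. f (g x) y)"
  by (rule lin_comp[OF bil_D(2)[OF assms(1,3)] assms(2)])

lemma bil_right:
  assumes "bilinear_map k M N P f" "linear_map k W N g" "y \<in> carrier M"
  shows "linear_map k W P (%x. f y (g x))"
  by (rule lin_comp[OF bil_D(1)[OF assms(1,3)] assms(2)])

lemma bil_comp:
  assumes "bilinear_map k M N P f" "linear_map k W M g" "linear_map k Y N h"
  shows "bilinear_map k W Y P (%x y. f (g x) (h y))"
  by (rule bil_I)
     (auto intro: bil_left[OF assms(1,2)] bil_right[OF assms(1,3)]
       lin_closed[OF assms(2)] lin_closed[OF assms(3)])

lemma bil_post: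
  assumes "linear_map k P Q g" "bilinear_map k M N P f"
  shows "bilinear_map k M N Q (%x y. g (f x y))"
  by (rule bil_I)
     (auto intro: lin_comp[OF assms(1)] bil_D[OF assms(2)])

lemma bil_swap: "bilinear_map k M N P f ==> bilinear_map k N M P (%y x. f x y)"
  by (simp add: bilinear_map_def)

definition trilinear_map ::
    "('k, 'p) ring_scheme \<Rightarrow> ('k, 'a, 'm) module_scheme \<Rightarrow> ('k, 'b, 'n) module_scheme
      \<Rightarrow> ('k, 'c, 'q) module_scheme \<Rightarrow> ('k, 'd, 'r) module_scheme \<Rightarrow> ('a \<Rightarrow> 'b \<Rightarrow> 'c \<Rightarrow> 'd) \<Rightarrow> bool"
  where "trilinear_map k A B C M F \<longleftrightarrow>
    (\<forall>x\<in>carrier A. bilinear_map k B C M (F x)) \<and>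
    (\<forall>y\<in>carrier B. \<forall>z\<in>carrier C. linear_map k A M (%x. F x y z))"

lemma tril_I:
  assumes "!!y z. [|y \<in> carrier B; z \<in> carrier C|] ==> linear_map k A M (%x. F x y z)"
    and "!!x z. [|x \<in> carrier A; z \<in> carrier C|] ==> linear_map k B M (%y. F x y z)"
    and "!!x y. [|x \<in> carrier A; y \<in> carrier B|] ==> linear_map k C M (%z. F x y z)"
  shows "trilinear_map k A B C M F"
  using assms by (auto simp: trilinear_map_def intro!: bil_I)

lemma tril_D:
  assumes "trilinear_map k A B C M F"
  shows "[|y \<in> carrier B; z \<in> carrier C|] ==> linear_map k A M (%x. F x y z)"
    and "[|x \<in> carrier A; z \<in> carrier C|] ==> linear_map k B M (%y. F x y z)"
    and "[|x \<in> carrier A; y \<in> carrier B|] ==> linear_map k C M (%z. F x y z)"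
    and "x \<in> carrier A ==> bilinear_map k B C M (F x)"
    and "y \<in> carrier B ==> bilinear_map k A C M (%x z. F x y z)"
    and "z \<in> carrier C ==> bilinear_map k A B M (%x y. F x y z)"
  using assms by (auto simp: trilinear_map_def bilinear_map_def)

lemma tril_closed:
  "[|trilinear_map k A B C M F; x \<in> carrier A; y \<in> carrier B; z \<in> carrier C|] ==> F x y z \<in> carrier M"
  using tril_D(1)[of k A B C M F y z] lin_closed[of k A M "%x. F x y z" x] by simp

lemma (in module) comm_group_add_monoid: "comm_group (add_monoid M)"
  by (rule M.a_comm_group)

lemma unital_algebraI:
  assumes F: "field k" and M: "module k A" and m: "bilinear_map k A A A (%x y. x \<otimes>\<^bsub>A\<^esub> y)"
    and assoc: "!!x y z. [|x \<in> carrier A; y \<in> carrier A; z \<in> carrier A|]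
        ==> (x \<otimes>\<^bsub>A\<^esub> y) \<otimes>\<^bsub>A\<^esub> z = x \<otimes>\<^bsub>A\<^esub> (y \<otimes>\<^bsub>A\<^esub> z)"
    and one: "\<one>\<^bsub>A\<^esub> \<in> carrier A" "!!x. x \<in> carrier A ==> \<one>\<^bsub>A\<^esub> \<otimes>\<^bsub>A\<^esub> x = x"
      "!!x. x \<in> carrier A ==> x \<otimes>\<^bsub>A\<^esub> \<one>\<^bsub>A\<^esub> = x"
  shows "unital_algebra k A"
proof -
  interpret F: field k by fact
  interpret M: module k A by fact
  have "ring A"
    by (rule ringI)
       (use bil_closed[OF m] assoc one lin_add[OF bil_D(1)[OF m]]
          lin_add[OF bil_D(2)[OF m]] M.abelian_group_axioms in \<open>auto intro!: monoidI\<close>)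
  then interpret A: ring A .
  show ?thesis
    by unfold_locales
       (use lin_smult[OF bil_D(1)[OF m]] lin_smult[OF bil_D(2)[OF m]] in auto)
qed

context unital_algebra
begin

lemma mult_bilinear: "bilinear_map k A A A (%x y. x \<otimes>\<^bsub>A\<^esub> y)"
  by (intro bil_I lin_I) (simp_all add: A.l_distr A.r_distr smult_mult_left smult_mult_right)

lemma linear_mult_left:
  "[|linear_map k W A f; y \<in> carrier A|] ==> linear_map k W A (%x. f x \<otimes>\<^bsub>A\<^esub> y)"
  by (rule bil_left[OF mult_bilinear])

lemma linear_mult_right:
  "[|linear_map k W A f; y \<in> carrier A|] ==> linear_map k W A (%x. y \<otimes>\<^bsub>A\<^esub> f x)"
  by (rule bil_right[OF mult_bilinear])

lemma module_A: "module k A"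
  by (rule module_axioms)

lemma field_k: "field k"
  by (rule F.field_axioms)

end

lemma hom_I:
  assumes "linear_map k A C f"
    and "!!x y. [|x \<in> carrier A; y \<in> carrier A|] ==> f (x \<otimes>\<^bsub>A\<^esub> y) = f x \<otimes>\<^bsub>C\<^esub> f y"
    and "f \<one>\<^bsub>A\<^esub> = \<one>\<^bsub>C\<^esub>"
  shows "algebra_hom k A C f"
  using assms by (auto simp: algebra_hom_def ring_hom_def lin_closed lin_add)

lemma hom_D:
  assumes "algebra_hom k A C f"
  shows "linear_map k A C f"
    and "[|x \<in> carrier A; y \<in> carrier A|] ==> f (x \<otimes>\<^bsub>A\<^esub> y) = f x \<otimes>\<^bsub>C\<^esub> f y"
    and "f \<one>\<^bsub>A\<^esub> = \<one>\<^bsub>C\<^esub>"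
    and "x \<in> carrier A ==> f x \<in> carrier C"
  using assms by (auto simp: algebra_hom_def ring_hom_def)

section \<open>Tensor products of modules\<close>

text \<open>
  \<^const>\<open>add_monoid\<close> keeps a junk record extension, so the additive group of a module need not be
  equal to a given monoid record with the same operations.
\<close>

lemma tensor_lift_monoid_cong:
  assumes "carrier G = carrier G'" "monoid.mult G = monoid.mult G'" "\<one>\<^bsub>G\<^esub> = \<one>\<^bsub>G'\<^esub>"
  shows "tensor_lift G F t = tensor_lift G' F t"
proof -
  have "m_inv G = m_inv G'"
    using assms by (intro ext) (simp add: m_inv_def)
  moreover have "x [^]\<^bsub>G\<^esub> (n :: nat) = x [^]\<^bsub>G'\<^esub> n" for x n
    using assms by (simp add: nat_pow_def)
  ultimately have "x [^]\<^bsub>G\<^esub> (n :: int) = x [^]\<^bsub>G'\<^esub> n" for x n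
    using assms by (simp add: int_pow_def Let_def)
  then show ?thesis
    using assms by (simp add: tensor_lift_def finprod_def)
qed

text \<open>
  The assumption \<open>scalar\<close> lets \<open>k\<close> act through \<open>R\<close>, so that the tensor product over \<open>R\<close> carries an
  unambiguous \<open>k\<close>-structure; \<open>P\<close> is this \<open>k\<close>-module.
\<close>

locale tensor_module =
  A: module k A + C: module k C + balanced_pair "add_monoid A" "add_monoid C" R ra la
  for k :: "('k, 'p) ring_scheme" and A :: "('k, 'a, 'm) module_scheme" and C :: "('k, 'c, 'n) module_scheme"
    and R :: "'r set" and ra la and P :: "('k, ('a \<times> 'c \<Rightarrow>\<^sub>0 int) set, 's) module_scheme" +
  assumes ra_smult: "[|a \<in> carrier k; x \<in> carrier A; r \<in> R|] ==> ra (a \<odot>\<^bsub>A\<^esub> x) r = a \<odot>\<^bsub>A\<^esub> ra x r"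
    and scalar: "a \<in> carrier k ==> \<exists>r\<in>R. (\<forall>x\<in>carrier A. ra x r = a \<odot>\<^bsub>A\<^esub> x) \<and> (\<forall>y\<in>carrier C. la r y = a \<odot>\<^bsub>C\<^esub> y)"
    and carrier_P: "carrier P = carrier T"
    and add_P: "ring.add P = monoid.mult T"
    and zero_P: "\<zero>\<^bsub>P\<^esub> = \<one>\<^bsub>T\<^esub>"
    and smult_P: "module.smult P = (%a. tensor_lift T (%x y. pure_tensor T (a \<odot>\<^bsub>A\<^esub> x) y))"
begin

lemma lift_add_monoid_P: "tensor_lift (add_monoid P) = tensor_lift T"
  by (intro ext tensor_lift_monoid_cong) (simp_all add: carrier_P add_P zero_P)

lemma pure_tensor_add_left:
  "[|x \<in> carrier A; x' \<in> carrier A; y \<in> carrier C|]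
    ==> pure_tensor T (x \<oplus>\<^bsub>A\<^esub> x') y = pure_tensor T x y \<oplus>\<^bsub>P\<^esub> pure_tensor T x' y"
  using pure_balanced by (auto simp: balanced_def hom_def add_P)

lemma pure_tensor_add_right:
  "[|x \<in> carrier A; y \<in> carrier C; y' \<in> carrier C|]
    ==> pure_tensor T x (y \<oplus>\<^bsub>C\<^esub> y') = pure_tensor T x y \<oplus>\<^bsub>P\<^esub> pure_tensor T x y'"
  using pure_balanced by (auto simp: balanced_def hom_def add_P)

lemma pure_tensor_balance:
  "[|x \<in> carrier A; r \<in> R; y \<in> carrier C|] ==> pure_tensor T (ra x r) y = pure_tensor T x (la r y)"
  using pure_balanced by (auto simp: balanced_def)

lemma smult_balanced:
  assumes a: "a \<in> carrier k"
  shows "balanced T (%x y. pure_tensor T (a \<odot>\<^bsub>A\<^esub> x) y)"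
  unfolding balanced_def
proof (intro conjI ballI homI)
  fix x r y assume *: "x \<in> carrier (add_monoid A)" "r \<in> R" "y \<in> carrier (add_monoid C)"
  then show "pure_tensor T (a \<odot>\<^bsub>A\<^esub> ra x r) y = pure_tensor T (a \<odot>\<^bsub>A\<^esub> x) (la r y)"
    using a by (simp add: ra_smult[symmetric] pure_tensor_balance)
qed (use a in \<open>auto simp: pure_tensor_add_left pure_tensor_add_right A.smult_r_distr add_P\<close>)

lemma smult_pure:
  assumes "a \<in> carrier k" "x \<in> carrier A" "y \<in> carrier C"
  shows "a \<odot>\<^bsub>P\<^esub> pure_tensor T x y = pure_tensor T (a \<odot>\<^bsub>A\<^esub> x) y"
  using assms lift_pure[OF T.comm_group_axioms smult_balanced[OF assms(1)]] by (simp add: smult_P)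

lemma smult_hom: "a \<in> carrier k ==> (%t. a \<odot>\<^bsub>P\<^esub> t) \<in> hom T T"
  using lift_hom[OF T.comm_group_axioms smult_balanced] by (simp add: smult_P)

lemma P_induct [consumes 1, case_names pure add]:
  assumes "t \<in> carrier P"
    and "!!x y. [|x \<in> carrier A; y \<in> carrier C|] ==> Q (pure_tensor T x y)"
    and "!!s t. [|s \<in> carrier P; t \<in> carrier P; Q s; Q t|] ==> Q (s \<oplus>\<^bsub>P\<^esub> t)"
  shows "Q t"
  using assms(1) unfolding carrier_P
  by (induction rule: T_induct) (use assms(2,3) in \<open>simp_all add: carrier_P add_P\<close>)

lemma pure_tensor_closed [simp]: "[|x \<in> carrier A; y \<in> carrier C|] ==> pure_tensor T x y \<in> carrier P"
  by (simp add: carrier_P)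

lemma abelian_group_P: "abelian_group P"
proof (rule abelian_groupI)
  fix x assume "x \<in> carrier P"
  then show "\<exists>y\<in>carrier P. y \<oplus>\<^bsub>P\<^esub> x = \<zero>\<^bsub>P\<^esub>"
    by (simp add: carrier_P add_P zero_P T.l_inv_ex)
qed (simp_all add: carrier_P add_P zero_P T.m_ac)

sublocale P: abelian_group P
  by (rule abelian_group_P)

lemma smult_P_closed: "[|a \<in> carrier k; t \<in> carrier P|] ==> a \<odot>\<^bsub>P\<^esub> t \<in> carrier P"
  using hom_in_carrier[OF smult_hom] by (simp add: carrier_P)

lemma smult_P_add:
  "[|a \<in> carrier k; s \<in> carrier P; t \<in> carrier P|] ==> a \<odot>\<^bsub>P\<^esub> (s \<oplus>\<^bsub>P\<^esub> t) = a \<odot>\<^bsub>P\<^esub> s \<oplus>\<^bsub>P\<^esub> a \<odot>\<^bsub>P\<^esub> t"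
  using hom_mult[OF smult_hom] by (simp add: carrier_P add_P)

lemma module_P: "module k P"
proof (rule moduleI)
  fix a b t assume ab: "a \<in> carrier k" "b \<in> carrier k" and t: "t \<in> carrier P"
  show "(a \<oplus>\<^bsub>k\<^esub> b) \<odot>\<^bsub>P\<^esub> t = a \<odot>\<^bsub>P\<^esub> t \<oplus>\<^bsub>P\<^esub> b \<odot>\<^bsub>P\<^esub> t"
    using t
  proof (induction rule: P_induct)
    case (pure x y)
    then show ?case using ab by (simp add: smult_pure A.smult_l_distr pure_tensor_add_left)
  next
    case (add s t)
    then show ?case using ab by (simp add: smult_P_add smult_P_closed P.a_ac)
  qed
  show "(a \<otimes>\<^bsub>k\<^esub> b) \<odot>\<^bsub>P\<^esub> t = a \<odot>\<^bsub>P\<^esub> (b \<odot>\<^bsub>P\<^esub> t)"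
    using t
  proof (induction rule: P_induct)
    case (pure x y)
    then show ?case using ab by (simp add: smult_pure A.smult_assoc1)
  next
    case (add s t)
    then show ?case using ab by (simp add: smult_P_add smult_P_closed)
  qed
next
  fix t assume "t \<in> carrier P"
  then show "\<one>\<^bsub>k\<^esub> \<odot>\<^bsub>P\<^esub> t = t"
    by (induction rule: P_induct) (simp_all add: smult_pure smult_P_add)
qed (auto simp: smult_P_closed smult_P_add abelian_group_P A.R.cring_axioms)

sublocale P: module k P
  by (rule module_P)

text \<open>The scalar crosses the tensor sign disguised as the element of \<open>R\<close> that
  \<open>scalar\<close> provides; this is where the two possible k-structures on the tensor product
  are seen to agree.\<close>

lemma pure_tensor_smult_right:
  assumes "a \<in> carrier k" "x \<in> carrier A" "y \<in> carrier C"
  shows "pure_tensor T x (a \<odot>\<^bsub>C\<^esub> y) = a \<odot>\<^bsub>P\<^esub> pure_tensor T x y"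
proof -
  obtain r where r: "r \<in> R" "\<forall>x\<in>carrier A. ra x r = a \<odot>\<^bsub>A\<^esub> x" "\<forall>y\<in>carrier C. la r y = a \<odot>\<^bsub>C\<^esub> y"
    using scalar[OF assms(1)] by blast
  have "pure_tensor T x (a \<odot>\<^bsub>C\<^esub> y) = pure_tensor T (ra x r) y"
    using pure_tensor_balance[OF assms(2) r(1) assms(3)] r(3) assms by simp
  then show ?thesis using r(2) assms by (simp add: smult_pure)
qed

lemma pure_bilinear: "bilinear_map k A C P (pure_tensor T)"
  by (intro bil_I lin_I)
     (simp_all add: pure_tensor_add_left pure_tensor_add_right smult_pure pure_tensor_smult_right)

definition lift_ok :: "('k, 'x, 'y) module_scheme \<Rightarrow> ('a \<Rightarrow> 'c \<Rightarrow> 'x) \<Rightarrow> bool"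
  where "lift_ok M F \<longleftrightarrow> bilinear_map k A C M F \<and>
    (\<forall>x\<in>carrier A. \<forall>r\<in>R. \<forall>y\<in>carrier C. F (ra x r) y = F x (la r y))"

lemma lift_okI:
  assumes "bilinear_map k A C M F"
    and "!!x r y. [|x \<in> carrier A; r \<in> R; y \<in> carrier C|] ==> F (ra x r) y = F x (la r y)"
  shows "lift_ok M F"
  using assms by (simp add: lift_ok_def)

lemma lift_ok_balanced: "lift_ok M F ==> balanced (add_monoid M) F"
  by (auto simp: lift_ok_def balanced_def bilinear_map_def linear_map_def)

lemma tensor_lift_pure:
  assumes "module k M" "lift_ok M F" "x \<in> carrier A" "y \<in> carrier C"
  shows "tensor_lift (add_monoid M) F (pure_tensor T x y) = F x y"
  using lift_pure[OF module.comm_group_add_monoid[OF assms(1)] lift_ok_balanced[OF assms(2)]] assms(3,4)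
  by simp

lemma tensor_lift_linear:
  assumes M: "module k M" and F: "lift_ok M F"
  shows "linear_map k P M (tensor_lift (add_monoid M) F)"
proof -
  interpret M: module k M by fact
  have bil: "bilinear_map k A C M F" using F by (simp add: lift_ok_def)
  have h: "tensor_lift (add_monoid M) F \<in> hom T (add_monoid M)"
    by (rule lift_hom[OF M.comm_group_add_monoid lift_ok_balanced[OF F]])
  show ?thesis
  proof (rule lin_I)
    fix a t assume a: "a \<in> carrier k" and t: "t \<in> carrier P"
    have cl: "tensor_lift (add_monoid M) F t \<in> carrier M" if "t \<in> carrier P" for t
      using hom_in_carrier[OF h] that by (simp add: carrier_P)
    have ad: "tensor_lift (add_monoid M) F (s \<oplus>\<^bsub>P\<^esub> t) = tensor_lift (add_monoid M) F s \<oplus>\<^bsub>M\<^esub> tensor_lift (add_monoid M) F t"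
      if "s \<in> carrier P" "t \<in> carrier P" for s t
      using hom_mult[OF h] that by (simp add: carrier_P add_P)
    show "tensor_lift (add_monoid M) F (a \<odot>\<^bsub>P\<^esub> t) = a \<odot>\<^bsub>M\<^esub> tensor_lift (add_monoid M) F t"
      using t
    proof (induction rule: P_induct)
      case (pure x y)
      then show ?case
        using a lin_smult[OF bil_D(2)[OF bil]] by (simp add: smult_pure tensor_lift_pure[OF M F])
    next
      case (add s t)
      then show ?case using a by (simp add: ad cl smult_P_add smult_P_closed M.smult_r_distr)
    qed
  qed (use hom_in_carrier[OF h] hom_mult[OF h] in \<open>auto simp: carrier_P add_P\<close>)
qed

lemma linear_eqI:
  assumes "linear_map k P M f" "linear_map k P M g"
    and "!!x y. [|x \<in> carrier A; y \<in> carrier C|] ==> f (pure_tensor T x y) = g (pure_tensor T x y)"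
    and "t \<in> carrier P"
  shows "f t = g t"
  using assms(4)
  by (induction rule: P_induct)
     (simp_all add: assms(3) lin_add[OF assms(1)] lin_add[OF assms(2)])

lemma tensor_lift_cong:
  assumes M: "module k M" and F: "lift_ok M F" and t: "t \<in> carrier P"
    and eq: "!!x y. [|x \<in> carrier A; y \<in> carrier C|] ==> F x y = G x y"
  shows "tensor_lift (add_monoid M) F t = tensor_lift (add_monoid M) G t"
proof -
  have G: "lift_ok M G"
  proof (rule lift_okI)
    show "bilinear_map k A C M G"
      by (rule bil_I)
         (use F eq in \<open>auto simp: lift_ok_def bilinear_map_def
            intro: lin_cong[OF A.module_axioms] lin_cong[OF C.module_axioms]\<close>)
    show "G (ra x r) y = G x (la r y)" if "x \<in> carrier A" "r \<in> R" "y \<in> carrier C" for x r y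
      using F that eq[symmetric] ra_closed[of x r] la_closed[of y r] by (simp add: lift_ok_def)
  qed
  show ?thesis
    by (rule linear_eqI[OF tensor_lift_linear[OF M F] tensor_lift_linear[OF M G] _ t])
       (simp add: tensor_lift_pure[OF M F] tensor_lift_pure[OF M G] eq)
qed

text \<open>By induction on t: at a pure tensor the lift is the value of F, and a pointwise sum of
  linear maps is linear. Nested Sweedler sums owe their multilinearity to this lemma.\<close>

lemma tensor_lift_param_linear:
  assumes M: "module k M" and W: "module k W"
    and F: "!!x. x \<in> carrier W ==> lift_ok M (F x)"
    and lin: "!!a c. [|a \<in> carrier A; c \<in> carrier C|] ==> linear_map k W M (%x. F x a c)"
    and t: "t \<in> carrier P"
  shows "linear_map k W M (%x. tensor_lift (add_monoid M) (F x) t)"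
  using t
proof (induction rule: P_induct)
  case (pure a c)
  show ?case
    by (rule lin_cong[OF W lin[OF pure]]) (simp add: tensor_lift_pure[OF M F] pure)
next
  case (add s t)
  show ?case
    by (rule lin_cong[OF W lin_plus[OF M add.IH]])
       (simp add: lin_add[OF tensor_lift_linear[OF M F]] add.hyps)
qed

lemma tensor_lift_post:
  assumes M: "module k M" and N: "module k N" and F: "lift_ok M F" and f: "linear_map k M N f"
    and t: "t \<in> carrier P"
  shows "f (tensor_lift (add_monoid M) F t) = tensor_lift (add_monoid N) (%x y. f (F x y)) t"
proof -
  have G: "lift_ok N (%x y. f (F x y))"
    using F by (auto simp: lift_ok_def intro: bil_post[OF f])
  show ?thesis
    by (rule linear_eqI[OF lin_comp[OF f tensor_lift_linear[OF M F]] tensor_lift_linear[OF N G] _ t])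
       (simp add: tensor_lift_pure[OF M F] tensor_lift_pure[OF N G])
qed

end

section \<open>Tensor products over the ground field\<close>

locale tensor_pair = A: module k A + C: module k C
  for k :: "('k, 'p) ring_scheme" and A :: "('k, 'a, 'm) module_scheme" and C :: "('k, 'c, 'n) module_scheme"
begin

sublocale balanced_pair "add_monoid A" "add_monoid C" "carrier k" "%x a. a \<odot>\<^bsub>A\<^esub> x" "%a y. a \<odot>\<^bsub>C\<^esub> y"
  using A.comm_group_add_monoid C.comm_group_add_monoid
  by (simp add: balanced_pair_def balanced_pair_axioms_def)

lemma T_tensor_over: "T = tensor_over k A C"
  by (simp add: T_def tensor_over_def)

sublocale tensor_module k A C "carrier k" "%x a. a \<odot>\<^bsub>A\<^esub> x" "%a y. a \<odot>\<^bsub>C\<^esub> y" "tensor_algebra k A C"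
  by unfold_locales
     (auto simp: tensor_algebra_def Let_def T_tensor_over A.smult_assoc1[symmetric] A.R.m_comm)

lemma lift_okI_bilinear:
  assumes "bilinear_map k A C M F"
  shows "lift_ok M F"
proof (rule lift_okI[OF assms])
  fix x r y assume "x \<in> carrier A" "r \<in> carrier k" "y \<in> carrier C"
  then show "F (r \<odot>\<^bsub>A\<^esub> x) y = F x (r \<odot>\<^bsub>C\<^esub> y)"
    using lin_smult[OF bil_D(1)[OF assms]] lin_smult[OF bil_D(2)[OF assms]] by simp
qed

end

section \<open>The product on a tensor product of algebras\<close>

locale tensor_algebra_pair = A: unital_algebra k A + C: unital_algebra k C
  for k :: "('k, 'p) ring_scheme" and A :: "('k, 'a, 'm) module_scheme" and C :: "('k, 'c, 'n) module_scheme"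
begin

sublocale tensor_pair k A C
  by unfold_locales

abbreviation "AC \<equiv> tensor_algebra k A C"

lemma inner_bilinear:
  assumes "a \<in> carrier A" "c \<in> carrier C"
  shows "bilinear_map k A C AC (%a' c'. pure_tensor T (a \<otimes>\<^bsub>A\<^esub> a') (c \<otimes>\<^bsub>C\<^esub> c'))"
  by (rule bil_comp[OF pure_bilinear])
     (use assms in \<open>auto intro: A.linear_mult_right C.linear_mult_right lin_id\<close>)

lemma outer_bilinear:
  assumes q: "q \<in> carrier AC"
  shows "bilinear_map k A C AC (%a c. tensor_lift T (%a' c'. pure_tensor T (a \<otimes>\<^bsub>A\<^esub> a') (c \<otimes>\<^bsub>C\<^esub> c')) q)"
proof (rule bil_I)
  fix a assume a: "a \<in> carrier A"
  show "linear_map k C AC (%c. tensor_lift T (%a' c'. pure_tensor T (a \<otimes>\<^bsub>A\<^esub> a') (c \<otimes>\<^bsub>C\<^esub> c')) q)"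
    unfolding lift_add_monoid_P[symmetric]
    by (rule tensor_lift_param_linear[OF module_P C.module_A _ _ q])
       (use a in \<open>auto intro!: lift_okI_bilinear inner_bilinear bil_right[OF pure_bilinear] C.linear_mult_left
          lin_id simp: lift_add_monoid_P\<close>)
next
  fix c assume c: "c \<in> carrier C"
  show "linear_map k A AC (%a. tensor_lift T (%a' c'. pure_tensor T (a \<otimes>\<^bsub>A\<^esub> a') (c \<otimes>\<^bsub>C\<^esub> c')) q)"
    unfolding lift_add_monoid_P[symmetric]
    by (rule tensor_lift_param_linear[OF module_P A.module_A _ _ q])
       (use c in \<open>auto intro!: lift_okI_bilinear inner_bilinear bil_left[OF pure_bilinear] A.linear_mult_left
          lin_id simp: lift_add_monoid_P\<close>)
qed

lemma mult_unfold:
  "p \<otimes>\<^bsub>AC\<^esub> q = tensor_lift T (%a c. tensor_lift T (%a' c'. pure_tensor T (a \<otimes>\<^bsub>A\<^esub> a') (c \<otimes>\<^bsub>C\<^esub> c')) q) p"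
  by (simp add: tensor_algebra_def Let_def T_tensor_over)

lemma mult_pure:
  assumes "a \<in> carrier A" "c \<in> carrier C" "a' \<in> carrier A" "c' \<in> carrier C"
  shows "pure_tensor T a c \<otimes>\<^bsub>AC\<^esub> pure_tensor T a' c' = pure_tensor T (a \<otimes>\<^bsub>A\<^esub> a') (c \<otimes>\<^bsub>C\<^esub> c')"
  unfolding mult_unfold
  using tensor_lift_pure[OF module_P lift_okI_bilinear[OF outer_bilinear], of "pure_tensor T a' c'" a c]
    tensor_lift_pure[OF module_P lift_okI_bilinear[OF inner_bilinear], of a c a' c'] assms
  by (simp add: lift_add_monoid_P)

lemma tensor_mult_bilinear: "bilinear_map k AC AC AC (%p q. p \<otimes>\<^bsub>AC\<^esub> q)"
proof (rule bil_I)
  fix q assume q: "q \<in> carrier AC"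
  show "linear_map k AC AC (%p. p \<otimes>\<^bsub>AC\<^esub> q)"
    unfolding mult_unfold
    using tensor_lift_linear[OF module_P lift_okI_bilinear[OF outer_bilinear[OF q]]] by (simp add: lift_add_monoid_P)
next
  fix p assume p: "p \<in> carrier AC"
  have lin: "linear_map k AC AC (%q. tensor_lift T (%a' c'. pure_tensor T (a \<otimes>\<^bsub>A\<^esub> a') (c \<otimes>\<^bsub>C\<^esub> c')) q)"
    if "a \<in> carrier A" "c \<in> carrier C" for a c
    using tensor_lift_linear[OF module_P lift_okI_bilinear[OF inner_bilinear[OF that]]] by (simp add: lift_add_monoid_P)
  have "linear_map k AC AC (%q. tensor_lift (add_monoid AC)
      (%a c. tensor_lift T (%a' c'. pure_tensor T (a \<otimes>\<^bsub>A\<^esub> a') (c \<otimes>\<^bsub>C\<^esub> c')) q) p)"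
    by (rule tensor_lift_param_linear[OF module_P module_P lift_okI_bilinear[OF outer_bilinear] lin p])
  then show "linear_map k AC AC (%q. p \<otimes>\<^bsub>AC\<^esub> q)"
    by (simp add: mult_unfold lift_add_monoid_P)
qed

lemma one_pure: "\<one>\<^bsub>AC\<^esub> = pure_tensor T \<one>\<^bsub>A\<^esub> \<one>\<^bsub>C\<^esub>"
  by (simp add: tensor_algebra_def Let_def T_tensor_over)

lemma unital_algebra_tensor: "unital_algebra k AC"
proof (rule unital_algebraI[OF A.field_k module_P tensor_mult_bilinear])
  note cl = bil_closed[OF tensor_mult_bilinear]
  note lr = lin_add[OF bil_D(1)[OF tensor_mult_bilinear]]
    lin_add[OF bil_D(2)[OF tensor_mult_bilinear]]
  fix x y z assume x: "x \<in> carrier AC" and y: "y \<in> carrier AC" and z: "z \<in> carrier AC"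
  show "(x \<otimes>\<^bsub>AC\<^esub> y) \<otimes>\<^bsub>AC\<^esub> z = x \<otimes>\<^bsub>AC\<^esub> (y \<otimes>\<^bsub>AC\<^esub> z)"
    using x
  proof (induction rule: P_induct)
    case (pure a c)
    note ac = pure
    show ?case using y
    proof (induction rule: P_induct)
      case (pure a' c')
      note ac' = pure
      show ?case using z
      proof (induction rule: P_induct)
        case (pure a'' c'')
        then show ?case using ac ac' by (simp add: mult_pure A.A.m_assoc C.A.m_assoc)
      next
        case (add s t)
        then show ?case using ac ac' by (simp add: lr cl)
      qed
    next
      case (add s t)
      then show ?case using ac z by (simp add: lr cl)
    qed
  next
    case (add s t)
    then show ?case using y z by (simp add: lr cl)
  qed
next
  note lr = lin_add[OF bil_D(1)[OF tensor_mult_bilinear]]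
    lin_add[OF bil_D(2)[OF tensor_mult_bilinear]]
  have o: "\<one>\<^bsub>AC\<^esub> \<in> carrier AC" by (simp add: one_pure)
  then show "\<one>\<^bsub>AC\<^esub> \<in> carrier AC" .
  fix x assume x: "x \<in> carrier AC"
  show "\<one>\<^bsub>AC\<^esub> \<otimes>\<^bsub>AC\<^esub> x = x"
    using x by (induction rule: P_induct) (simp_all add: lr o, simp_all add: one_pure mult_pure)
  show "x \<otimes>\<^bsub>AC\<^esub> \<one>\<^bsub>AC\<^esub> = x"
    using x by (induction rule: P_induct) (simp_all add: lr o, simp_all add: one_pure mult_pure)
qed

end

section \<open>Sweedler sums\<close>

context hopf_algebra
begin

abbreviation "lin \<equiv> linear_map k"
abbreviation "bil \<equiv> bilinear_map k"
abbreviation "tril \<equiv> trilinear_map k"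
abbreviation "cH \<equiv> carrier H"

sublocale HH: tensor_algebra_pair k H H
  by unfold_locales

sublocale HHH: tensor_pair k H "tensor_algebra k H H"
  by (simp add: tensor_pair_def module_A HH.module_P)

abbreviation sw :: "('k, 'x, 'y) module_scheme \<Rightarrow> ('h \<Rightarrow> 'h \<Rightarrow> 'x) \<Rightarrow> 'h \<Rightarrow> 'x"
  where "sw M F h \<equiv> sweedler2 H (add_monoid M) F h"

abbreviation eps :: "'h \<Rightarrow> 'k" where "eps \<equiv> counit H"
abbreviation S :: "'h \<Rightarrow> 'h" where "S \<equiv> antipode H"

lemma comul_linear: "lin H (tensor_algebra k H H) (comul H)"
  by (rule hom_D(1)[OF comul_hom])

lemma comul_closed [simp]: "h \<in> cH ==> comul H h \<in> carrier (tensor_algebra k H H)"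
  by (rule lin_closed[OF comul_linear])

lemma eps_closed [simp]: "h \<in> cH ==> eps h \<in> carrier k"
  using counit_hom by (auto simp: ring_hom_def)

lemma eps_add: "[|x \<in> cH; y \<in> cH|] ==> eps (x \<oplus>\<^bsub>H\<^esub> y) = eps x \<oplus>\<^bsub>k\<^esub> eps y"
  using counit_hom by (auto simp: ring_hom_def)

lemma eps_mult: "[|x \<in> cH; y \<in> cH|] ==> eps (x \<otimes>\<^bsub>H\<^esub> y) = eps x \<otimes>\<^bsub>k\<^esub> eps y"
  using counit_hom by (auto simp: ring_hom_def)

lemma eps_one [simp]: "eps \<one>\<^bsub>H\<^esub> = \<one>\<^bsub>k\<^esub>"
  using counit_hom by (auto simp: ring_hom_def)

lemma eps_scale_linear:
  assumes M: "module k M" and m: "m \<in> carrier M"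
  shows "lin H M (%x. eps x \<odot>\<^bsub>M\<^esub> m)"
proof -
  interpret M: module k M by fact
  show ?thesis
    by (rule lin_I) (use m in \<open>simp_all add: eps_add M.smult_l_distr counit_smult M.smult_assoc1\<close>)
qed

lemma eps_scale_bilinear:
  assumes M: "module k M" and f: "lin H M f"
  shows "bil H H M (%x y. eps x \<odot>\<^bsub>M\<^esub> f y)"
  by (rule bil_I)
     (auto intro: eps_scale_linear[OF M] lin_closed[OF f] lin_scale[OF M f])

lemma S_linear: "lin H H S"
  by (rule antipode_linear)

lemma S_closed [simp]: "h \<in> cH ==> S h \<in> cH"
  by (rule lin_closed[OF S_linear])

lemma mult_closed_H [simp]: "[|x \<in> cH; y \<in> cH|] ==> x \<otimes>\<^bsub>H\<^esub> y \<in> cH"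
  by (rule A.m_closed)

lemma one_closed_H [simp]: "\<one>\<^bsub>H\<^esub> \<in> cH"
  by (rule A.one_closed)

lemma sw_linear:
  assumes "module k M" "bil H H M F"
  shows "lin H M (%h. sw M F h)"
  unfolding sweedler2_def
  by (rule lin_comp[OF HH.tensor_lift_linear[OF assms(1) HH.lift_okI_bilinear[OF assms(2)]] comul_linear])

lemma sw_cong:
  assumes "module k M" "bil H H M F" "h \<in> cH"
    and "!!x y. [|x \<in> cH; y \<in> cH|] ==> F x y = G x y"
  shows "sw M F h = sw M G h"
  unfolding sweedler2_def
  by (rule HH.tensor_lift_cong[OF assms(1) HH.lift_okI_bilinear[OF assms(2)] _ assms(4)]) (use assms(3) in simp_all)

lemma sw_post:
  assumes "module k M" "module k N" "lin M N f" "bil H H M F" "h \<in> cH"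
  shows "f (sw M F h) = sw N (%x y. f (F x y)) h"
  unfolding sweedler2_def
  by (rule HH.tensor_lift_post[OF assms(1,2) HH.lift_okI_bilinear[OF assms(4)] assms(3)]) (use assms(5) in simp)

lemma sw_map:
  assumes "module k M" "module k N" "lin M N f" "bil H H M F" "h \<in> cH"
    and "!!x y. [|x \<in> cH; y \<in> cH|] ==> f (F x y) = G x y"
  shows "f (sw M F h) = sw N G h"
  unfolding sw_post[OF assms(1-5)]
  by (rule sw_cong[OF assms(2) bil_post[OF assms(3,4)] assms(5,6)])

lemma sw_param_linear:
  assumes "module k M" "module k W"
    and "!!w. w \<in> carrier W ==> bil H H M (F w)"
    and "!!x y. [|x \<in> cH; y \<in> cH|] ==> lin W M (%w. F w x y)"
    and "h \<in> cH"
  shows "lin W M (%w. sw M (F w) h)"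
  unfolding sweedler2_def
  by (rule HH.tensor_lift_param_linear[OF assms(1,2)])
     (use assms(3-5) in \<open>auto intro: HH.lift_okI_bilinear\<close>)

text \<open>Both sides are linear in t, and at a pure tensor x \<otimes> y both reduce to the lift
  of F x y at s. It is the Fubini rule for two independent coproducts.\<close>

lemma tensor_lift_swap:
  assumes M: "module k M"
    and F1: "!!x y. [|x \<in> cH; y \<in> cH|] ==> bil H H M (F x y)"
    and F2: "!!a b. [|a \<in> cH; b \<in> cH|] ==> bil H H M (%x y. F x y a b)"
    and s: "s \<in> carrier (tensor_algebra k H H)" and t: "t \<in> carrier (tensor_algebra k H H)"
  shows "tensor_lift (add_monoid M) (%x y. tensor_lift (add_monoid M) (F x y) s) t =
    tensor_lift (add_monoid M) (%a b. tensor_lift (add_monoid M) (%x y. F x y a b) t) s"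
proof (rule HH.linear_eqI[OF _ _ _ t])
  have b1: "bil H H M (%x y. tensor_lift (add_monoid M) (F x y) s)"
    by (rule bil_I)
       (auto intro!: HH.tensor_lift_param_linear[OF M module_A] HH.lift_okI_bilinear F1 bil_D[OF F2] s)
  then show "lin (tensor_algebra k H H) M
      (%t. tensor_lift (add_monoid M) (%x y. tensor_lift (add_monoid M) (F x y) s) t)"
    by (intro HH.tensor_lift_linear[OF M] HH.lift_okI_bilinear)
  have b2: "bil H H M (%a b. tensor_lift (add_monoid M) (%x y. F x y a b) t)"
    if "t \<in> carrier (tensor_algebra k H H)" for t
    by (rule bil_I)
       (auto intro!: HH.tensor_lift_param_linear[OF M module_A] HH.lift_okI_bilinear F2 bil_D[OF F1] that)
  then show "lin (tensor_algebra k H H) M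
      (%t. tensor_lift (add_monoid M) (%a b. tensor_lift (add_monoid M) (%x y. F x y a b) t) s)"
    by (intro HH.tensor_lift_param_linear[OF M HH.module_P _ _ s] HH.lift_okI_bilinear
         HH.tensor_lift_linear[OF M] F2)
  fix x y assume xy: "x \<in> cH" "y \<in> cH"
  have "tensor_lift (add_monoid M) (%a b. tensor_lift (add_monoid M) (%x y. F x y a b) (pure_tensor HH.T x y)) s =
    tensor_lift (add_monoid M) (F x y) s"
    by (rule HH.tensor_lift_cong[OF M HH.lift_okI_bilinear[OF b2] s])
       (simp_all add: xy HH.tensor_lift_pure[OF M HH.lift_okI_bilinear[OF F2]])
  then show "tensor_lift (add_monoid M) (%x y. tensor_lift (add_monoid M) (F x y) s) (pure_tensor HH.T x y) =
    tensor_lift (add_monoid M) (%a b. tensor_lift (add_monoid M) (%x y. F x y a b) (pure_tensor HH.T x y)) s"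
    by (simp add: HH.tensor_lift_pure[OF M HH.lift_okI_bilinear[OF b1]] xy)
qed

lemma sw_swap:
  assumes "module k M"
    and "!!x y. [|x \<in> cH; y \<in> cH|] ==> bil H H M (F x y)"
    and "!!a b. [|a \<in> cH; b \<in> cH|] ==> bil H H M (%x y. F x y a b)"
    and "h \<in> cH" "g \<in> cH"
  shows "sw M (%x y. sw M (F x y) g) h = sw M (%a b. sw M (%x y. F x y a b) h) g"
  unfolding sweedler2_def
  by (rule tensor_lift_swap) (use assms in auto)

lemma comul_one: "comul H \<one>\<^bsub>H\<^esub> = pure_tensor HH.T \<one>\<^bsub>H\<^esub> \<one>\<^bsub>H\<^esub>"
  using hom_D(3)[OF comul_hom] by (simp add: HH.one_pure)

lemma sw_one:
  assumes "module k M" "bil H H M F"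
  shows "sw M F \<one>\<^bsub>H\<^esub> = F \<one>\<^bsub>H\<^esub> \<one>\<^bsub>H\<^esub>"
  unfolding sweedler2_def comul_one
  by (rule HH.tensor_lift_pure[OF assms(1) HH.lift_okI_bilinear[OF assms(2)]]) simp_all

text \<open>The coproduct is an algebra map, and the product of two tensors is itself a nested lift;
  the lift of F is pushed through both of its layers.\<close>

lemma sw_mult:
  assumes M: "module k M" and F: "bil H H M F" and hg: "h \<in> cH" "g \<in> cH"
  shows "sw M F (h \<otimes>\<^bsub>H\<^esub> g) = sw M (%x y. sw M (%a b. F (x \<otimes>\<^bsub>H\<^esub> a) (y \<otimes>\<^bsub>H\<^esub> b)) g) h"
proof -
  let ?L = "tensor_lift (add_monoid M) F"
  have lin: "lin (tensor_algebra k H H) M ?L"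
    by (rule HH.tensor_lift_linear[OF M HH.lift_okI_bilinear[OF F]])
  have in_b: "bil H H (tensor_algebra k H H) (%a b. pure_tensor HH.T (x \<otimes>\<^bsub>H\<^esub> a) (y \<otimes>\<^bsub>H\<^esub> b))"
    if "x \<in> cH" "y \<in> cH" for x y
    by (rule HH.inner_bilinear[OF that])
  have out_b: "bil H H (tensor_algebra k H H)
      (%x y. tensor_lift HH.T (%a b. pure_tensor HH.T (x \<otimes>\<^bsub>H\<^esub> a) (y \<otimes>\<^bsub>H\<^esub> b)) (comul H g))"
    using HH.outer_bilinear hg by simp
  have "sw M F (h \<otimes>\<^bsub>H\<^esub> g) = ?L (comul H h \<otimes>\<^bsub>tensor_algebra k H H\<^esub> comul H g)"
    using hom_D(2)[OF comul_hom] hg by (simp add: sweedler2_def)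
  also have "... = ?L (tensor_lift (add_monoid (tensor_algebra k H H)) (%x y.
      tensor_lift HH.T (%a b. pure_tensor HH.T (x \<otimes>\<^bsub>H\<^esub> a) (y \<otimes>\<^bsub>H\<^esub> b)) (comul H g)) (comul H h))"
    by (simp add: HH.mult_unfold HH.lift_add_monoid_P)
  also have "... = tensor_lift (add_monoid M) (%x y.
      ?L (tensor_lift HH.T (%a b. pure_tensor HH.T (x \<otimes>\<^bsub>H\<^esub> a) (y \<otimes>\<^bsub>H\<^esub> b)) (comul H g))) (comul H h)"
    by (rule HH.tensor_lift_post[OF HH.module_P M HH.lift_okI_bilinear[OF out_b] lin]) (use hg in simp)
  also have "... = tensor_lift (add_monoid M) (%x y.
      tensor_lift (add_monoid M) (%a b. F (x \<otimes>\<^bsub>H\<^esub> a) (y \<otimes>\<^bsub>H\<^esub> b)) (comul H g)) (comul H h)"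
  proof (rule HH.tensor_lift_cong[OF M HH.lift_okI_bilinear[OF bil_post[OF lin out_b]]])
    fix x y assume xy: "x \<in> cH" "y \<in> cH"
    have "?L (tensor_lift (add_monoid (tensor_algebra k H H)) (%a b. pure_tensor HH.T (x \<otimes>\<^bsub>H\<^esub> a) (y \<otimes>\<^bsub>H\<^esub> b)) (comul H g))
      = tensor_lift (add_monoid M) (%a b. ?L (pure_tensor HH.T (x \<otimes>\<^bsub>H\<^esub> a) (y \<otimes>\<^bsub>H\<^esub> b))) (comul H g)"
      by (rule HH.tensor_lift_post[OF HH.module_P M HH.lift_okI_bilinear[OF in_b[OF xy]] lin]) (use hg in simp)
    also have "... = tensor_lift (add_monoid M) (%a b. F (x \<otimes>\<^bsub>H\<^esub> a) (y \<otimes>\<^bsub>H\<^esub> b)) (comul H g)"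
      by (rule HH.tensor_lift_cong[OF M HH.lift_okI_bilinear[OF bil_post[OF lin in_b[OF xy]]]])
         (use hg xy in \<open>simp_all add: HH.tensor_lift_pure[OF M HH.lift_okI_bilinear[OF F]]\<close>)
    finally show "?L (tensor_lift HH.T (%a b. pure_tensor HH.T (x \<otimes>\<^bsub>H\<^esub> a) (y \<otimes>\<^bsub>H\<^esub> b)) (comul H g))
      = tensor_lift (add_monoid M) (%a b. F (x \<otimes>\<^bsub>H\<^esub> a) (y \<otimes>\<^bsub>H\<^esub> b)) (comul H g)"
      by (simp add: HH.lift_add_monoid_P)
  qed (use hg in simp)
  finally show ?thesis by (simp add: sweedler2_def)
qed

lemma sw_left_bilinear:
  assumes M: "module k M" and F: "tril H H H M F"
  shows "bil H H M (%x c. sw M (%a b. F a b c) x)"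
  by (rule bil_I)
     (auto intro!: sw_linear[OF M] sw_param_linear[OF M module_A] tril_D[OF F])

lemma sw_right_bilinear:
  assumes M: "module k M" and F: "tril H H H M F"
  shows "bil H H M (%a y. sw M (%b c. F a b c) y)"
  by (rule bil_I)
     (auto intro!: sw_linear[OF M] sw_param_linear[OF M module_A] tril_D[OF F])

text \<open>The axiom compares two elements of H \<otimes> (H \<otimes> H). F induces a linear map
  \<open>\<Theta>\<close> on that space, and applying \<open>\<Theta>\<close> to both elements gives
  the two nested sums.\<close>

lemma sw_coassoc:
  assumes M: "module k M" and F: "tril H H H M F" and h: "h \<in> cH"
  shows "sw M (%x c. sw M (%a b. F a b c) x) h = sw M (%a y. sw M (%b c. F a b c) y) h"
proof -
  let ?P3 = "tensor_algebra k H (tensor_algebra k H H)"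
  let ?G = "%a t. tensor_lift (add_monoid M) (F a) t"
  define \<Theta> where "\<Theta> = tensor_lift (add_monoid M) ?G"
  have G: "bil H (tensor_algebra k H H) M ?G"
    by (rule bil_I)
       (auto intro!: HH.tensor_lift_linear[OF M] HH.tensor_lift_param_linear[OF M module_A]
          HH.lift_okI_bilinear tril_D[OF F])
  have lin: "lin ?P3 M \<Theta>"
    unfolding \<Theta>_def by (rule HHH.tensor_lift_linear[OF M HHH.lift_okI_bilinear[OF G]])
  have \<Theta>: "\<Theta> (pure_tensor HHH.T a t) = ?G a t" if "a \<in> cH" "t \<in> carrier (tensor_algebra k H H)" for a t
    unfolding \<Theta>_def by (rule HHH.tensor_lift_pure[OF M HHH.lift_okI_bilinear[OF G] that])
  have \<Theta>2: "\<Theta> (pure_tensor HHH.T a (pure_tensor HH.T b c)) = F a b c"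
    if "a \<in> cH" "b \<in> cH" "c \<in> cH" for a b c
    using that by (simp add: \<Theta> HH.tensor_lift_pure[OF M HH.lift_okI_bilinear[OF tril_D(4)[OF F]]])
  have tri: "tril H H H ?P3 (%a b c. pure_tensor HHH.T a (pure_tensor HH.T b c))"
    by (rule tril_I)
       (auto intro: bil_left[OF HHH.pure_bilinear lin_id] bil_right[OF HHH.pure_bilinear]
          bil_D[OF HH.pure_bilinear])
  have swT: "sweedler2 H HHH.T K = sweedler2 H (add_monoid ?P3) K" for K
    by (intro ext) (simp add: sweedler2_def HHH.lift_add_monoid_P)
  have "sw ?P3 (%x c. sw ?P3 (%a b. pure_tensor HHH.T a (pure_tensor HH.T b c)) x) h
    = sw ?P3 (%a y. pure_tensor HHH.T a (comul H y)) h"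
    using comul_coassoc[OF h] by (simp add: Let_def HHH.T_tensor_over[symmetric] HH.T_tensor_over[symmetric] swT)
  then have eq: "\<Theta> (sw ?P3 (%x c. sw ?P3 (%a b. pure_tensor HHH.T a (pure_tensor HH.T b c)) x) h)
    = \<Theta> (sw ?P3 (%a y. pure_tensor HHH.T a (comul H y)) h)" by simp
  have "\<Theta> (sw ?P3 (%x c. sw ?P3 (%a b. pure_tensor HHH.T a (pure_tensor HH.T b c)) x) h)
    = sw M (%x c. sw M (%a b. F a b c) x) h"
  proof (rule sw_map[OF HHH.module_P M lin sw_left_bilinear[OF HHH.module_P tri] h])
    fix x c assume xc: "x \<in> cH" "c \<in> cH"
    have "\<Theta> (sw ?P3 (%a b. pure_tensor HHH.T a (pure_tensor HH.T b c)) x)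
      = sw M (%a b. F a b c) x"
      by (rule sw_map[OF HHH.module_P M lin tril_D(6)[OF tri xc(2)] xc(1)])
         (simp add: \<Theta>2 xc)
    then show "\<Theta> (sw ?P3 (%a b. pure_tensor HHH.T a (pure_tensor HH.T b c)) x) = sw M (%a b. F a b c) x" .
  qed
  then have l: "\<Theta> (sw ?P3 (%x c. sw ?P3 (%a b. pure_tensor HHH.T a (pure_tensor HH.T b c)) x) h)
    = sw M (%x c. sw M (%a b. F a b c) x) h" .
  have b: "bil H H ?P3 (%a y. pure_tensor HHH.T a (comul H y))"
    by (rule bil_comp[OF HHH.pure_bilinear lin_id comul_linear])
  have "\<Theta> (sw ?P3 (%a y. pure_tensor HHH.T a (comul H y)) h)
    = sw M (%a y. sw M (%b c. F a b c) y) h"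
    by (rule sw_map[OF HHH.module_P M lin b h]) (simp add: \<Theta> sweedler2_def)
  then show ?thesis using eq l by simp
qed

lemma id_scale_bilinear_left: "bil H H H (%x y. eps x \<odot>\<^bsub>H\<^esub> y)"
  by (rule eps_scale_bilinear[OF module_A lin_id])

lemma sw_counit_left:
  assumes M: "module k M" and f: "lin H M f" and h: "h \<in> cH"
  shows "sw M (%x y. eps x \<odot>\<^bsub>M\<^esub> f y) h = f h"
proof -
  have "f h = f (sw H (%x y. eps x \<odot>\<^bsub>H\<^esub> y) h)" using counit_left[OF h] by simp
  also have "... = sw M (%x y. eps x \<odot>\<^bsub>M\<^esub> f y) h"
    by (rule sw_map[OF module_A M f id_scale_bilinear_left h]) (simp add: lin_smult[OF f])
  finally show ?thesis by simp
qed

lemma sw_counit_right: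
  assumes M: "module k M" and f: "lin H M f" and h: "h \<in> cH"
  shows "sw M (%x y. eps y \<odot>\<^bsub>M\<^esub> f x) h = f h"
proof -
  have b: "bil H H H (%x y. eps y \<odot>\<^bsub>H\<^esub> x)"
    by (rule bil_swap[OF id_scale_bilinear_left])
  have "f h = f (sw H (%x y. eps y \<odot>\<^bsub>H\<^esub> x) h)" using counit_right[OF h] by simp
  also have "... = sw M (%x y. eps y \<odot>\<^bsub>M\<^esub> f x) h"
    by (rule sw_map[OF module_A M f b h]) (simp add: lin_smult[OF f])
  finally show ?thesis by simp
qed

lemma sw_antipode_left:
  assumes M: "module k M" and f: "lin H M f" and h: "h \<in> cH"
  shows "sw M (%x y. f (S x \<otimes>\<^bsub>H\<^esub> y)) h = eps h \<odot>\<^bsub>M\<^esub> f \<one>\<^bsub>H\<^esub>"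
proof -
  have "f (sw H (%x y. S x \<otimes>\<^bsub>H\<^esub> y) h) = sw M (%x y. f (S x \<otimes>\<^bsub>H\<^esub> y)) h"
    by (rule sw_post[OF module_A M f bil_comp[OF mult_bilinear S_linear lin_id] h])
  then show ?thesis using antipode_left[OF h] h by (simp add: lin_smult[OF f])
qed

lemma sw_antipode_right:
  assumes M: "module k M" and f: "lin H M f" and h: "h \<in> cH"
  shows "sw M (%x y. f (x \<otimes>\<^bsub>H\<^esub> S y)) h = eps h \<odot>\<^bsub>M\<^esub> f \<one>\<^bsub>H\<^esub>"
proof -
  have "f (sw H (%x y. x \<otimes>\<^bsub>H\<^esub> S y) h) = sw M (%x y. f (x \<otimes>\<^bsub>H\<^esub> S y)) h"
    by (rule sw_post[OF module_A M f bil_comp[OF mult_bilinear lin_id S_linear] h])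
  then show ?thesis using antipode_right[OF h] h by (simp add: lin_smult[OF f])
qed

end

section \<open>Convolution algebras\<close>

text \<open>Members are extensional outside the carrier of H, so that equal linear maps are equal
  functions. The result is again a module record, hence the construction can be iterated:
  \<open>conv k H (conv k H R)\<close> is Hom(H \<otimes> H, R) in curried form, with its
  convolution product.\<close>

definition conv ::
    "('k, 'p) ring_scheme \<Rightarrow> ('k, 'h, 'm) hopf_data_scheme \<Rightarrow> ('k, 'r, 'q) module_scheme
      \<Rightarrow> ('k, 'h \<Rightarrow> 'r) module"
  where "conv k H R =
    \<lparr>carrier = {f \<in> extensional (carrier H). linear_map k H R f},
     monoid.mult = (%f g. \<lambda>h\<in>carrier H. sweedler2 H (add_monoid R) (%x y. f x \<otimes>\<^bsub>R\<^esub> g y) h),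
     one = (\<lambda>h\<in>carrier H. counit H h \<odot>\<^bsub>R\<^esub> \<one>\<^bsub>R\<^esub>),
     ring.zero = (\<lambda>h\<in>carrier H. \<zero>\<^bsub>R\<^esub>),
     ring.add = (%f g. \<lambda>h\<in>carrier H. f h \<oplus>\<^bsub>R\<^esub> g h),
     module.smult = (%a f. \<lambda>h\<in>carrier H. a \<odot>\<^bsub>R\<^esub> f h)\<rparr>"

context hopf_algebra
begin

abbreviation C :: "('k, 'x, 'y) module_scheme \<Rightarrow> ('k, 'h \<Rightarrow> 'x) module"
  where "C R \<equiv> conv k H R"

lemma conv_carrier_iff: "f \<in> carrier (C R) \<longleftrightarrow> f \<in> extensional (cH) \<and> lin H R f"
  by (simp add: conv_def)

lemma conv_apply:
  assumes "h \<in> cH"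
  shows "(f \<otimes>\<^bsub>C R\<^esub> g) h = sw R (%x y. f x \<otimes>\<^bsub>R\<^esub> g y) h"
    and "\<one>\<^bsub>C R\<^esub> h = eps h \<odot>\<^bsub>R\<^esub> \<one>\<^bsub>R\<^esub>"
    and "\<zero>\<^bsub>C R\<^esub> h = \<zero>\<^bsub>R\<^esub>"
    and "(f \<oplus>\<^bsub>C R\<^esub> g) h = f h \<oplus>\<^bsub>R\<^esub> g h"
    and "(a \<odot>\<^bsub>C R\<^esub> f) h = a \<odot>\<^bsub>R\<^esub> f h"
  using assms by (simp_all add: conv_def)

lemma conv_linear: "f \<in> carrier (C R) ==> lin H R f"
  by (simp add: conv_carrier_iff)

lemma conv_closed: "[|f \<in> carrier (C R); h \<in> cH|] ==> f h \<in> carrier R"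
  by (rule lin_closed[OF conv_linear])

lemma conv_memI: "lin H R f ==> (\<lambda>h\<in>cH. f h) \<in> carrier (C R)"
  by (auto simp: conv_carrier_iff intro: lin_cong[OF module_A])

lemma conv_eqI:
  assumes "f \<in> carrier (C R)" "g \<in> carrier (C R)" "!!h. h \<in> cH ==> f h = g h"
  shows "f = g"
  by (rule extensionalityI[of _ "cH"]) (use assms in \<open>auto simp: conv_carrier_iff\<close>)

lemma conv_module:
  assumes R: "module k R"
  shows "module k (C R)"
proof -
  interpret R: module k R by fact
  have z: "\<zero>\<^bsub>C R\<^esub> \<in> carrier (C R)"
    using conv_memI[OF lin_zero_fun[OF R]] by (simp add: conv_def)
  have p: "f \<oplus>\<^bsub>C R\<^esub> g \<in> carrier (C R)" if "f \<in> carrier (C R)" "g \<in> carrier (C R)" for f g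
    using conv_memI[OF lin_plus[OF R conv_linear[OF that(1)] conv_linear[OF that(2)]]] by (simp add: conv_def)
  have s: "a \<odot>\<^bsub>C R\<^esub> f \<in> carrier (C R)" if "a \<in> carrier k" "f \<in> carrier (C R)" for a f
    using conv_memI[OF lin_scale[OF R conv_linear[OF that(2)] that(1)]] by (simp add: conv_def)
  note eqs = conv_apply conv_closed
  have ag: "abelian_group (C R)"
  proof (rule abelian_groupI)
    fix f assume f: "f \<in> carrier (C R)"
    have "\<ominus>\<^bsub>k\<^esub> \<one>\<^bsub>k\<^esub> \<odot>\<^bsub>C R\<^esub> f \<in> carrier (C R)" by (rule s) (use f in auto)
    moreover have "(\<ominus>\<^bsub>k\<^esub> \<one>\<^bsub>k\<^esub> \<odot>\<^bsub>C R\<^esub> f) \<oplus>\<^bsub>C R\<^esub> f = \<zero>\<^bsub>C R\<^esub>"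
      by (rule conv_eqI[where R = R]) (use f in \<open>auto simp: p s z eqs R.smult_l_minus R.l_neg\<close>)
    ultimately show "\<exists>g\<in>carrier (C R). g \<oplus>\<^bsub>C R\<^esub> f = \<zero>\<^bsub>C R\<^esub>" by blast
  qed (auto intro!: conv_eqI p z simp: eqs R.a_ac)
  show ?thesis
    by (rule moduleI)
       (auto intro!: ag s p conv_eqI module.axioms(1)[OF R] simp: eqs R.smult_l_distr R.smult_r_distr R.smult_assoc1)
qed

lemma conv_eval_linear: "h \<in> cH ==> lin (C R) R (%f. f h)"
  by (rule lin_I) (auto simp: conv_apply conv_closed)

lemma lin_into_conv:
  assumes R: "module k R" and f: "bil W H R f" and W: "module k W"
  shows "lin W (C R) (%w. \<lambda>h\<in>cH. f w h)"
proof -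
  interpret W: module k W by fact
  interpret CR: module k "C R" by (rule conv_module[OF R])
  have m: "(\<lambda>h\<in>cH. f w h) \<in> carrier (C R)" if "w \<in> carrier W" for w
    by (rule conv_memI[OF bil_D(1)[OF f that]])
  show ?thesis
  proof (rule lin_I)
    fix x y assume "x \<in> carrier W" "y \<in> carrier W"
    then show "(\<lambda>h\<in>cH. f (x \<oplus>\<^bsub>W\<^esub> y) h) = (\<lambda>h\<in>cH. f x h) \<oplus>\<^bsub>C R\<^esub> (\<lambda>h\<in>cH. f y h)"
      by (intro conv_eqI) (auto simp: m conv_apply lin_add[OF bil_D(2)[OF f]])
  next
    fix a x assume "a \<in> carrier k" "x \<in> carrier W"
    then show "(\<lambda>h\<in>cH. f (a \<odot>\<^bsub>W\<^esub> x) h) = a \<odot>\<^bsub>C R\<^esub> (\<lambda>h\<in>cH. f x h)"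
      by (intro conv_eqI) (auto simp: m conv_apply lin_smult[OF bil_D(2)[OF f]])
  qed (rule m)
qed

lemma conv2_memI:
  assumes "module k R" "bil H H R f"
  shows "(\<lambda>h\<in>cH. \<lambda>g\<in>cH. f h g) \<in> carrier (C (C R))"
  by (rule conv_memI[OF lin_into_conv[OF assms module_A]])

lemma conv2_bilinear:
  assumes "F \<in> carrier (C (C R))"
  shows "bil H H R F"
  by (rule bil_I)
     (auto intro: conv_linear[OF conv_closed[OF assms]] lin_comp[OF conv_eval_linear conv_linear[OF assms]])

lemma conv_mult_bilinear_pre:
  assumes R: "unital_algebra k R" and f: "f \<in> carrier (C R)" and g: "g \<in> carrier (C R)"
  shows "bil H H R (%x y. f x \<otimes>\<^bsub>R\<^esub> g y)"
  by (rule bil_comp[OF unital_algebra.mult_bilinear[OF R] conv_linear[OF f] conv_linear[OF g]])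

text \<open>Associativity combines coassociativity of H with associativity of R, and the unit laws
  are the two counit laws.\<close>

lemma algebra_conv:
  assumes R: "unital_algebra k R"
  shows "unital_algebra k (C R)"
proof -
  interpret R: unital_algebra k R by fact
  note RM = R.module_A
  have CM: "module k (C R)" by (rule conv_module[OF RM])
  interpret CM: module k "C R" by (rule CM)
  note pre = conv_mult_bilinear_pre[OF R]
  have cl: "f \<otimes>\<^bsub>C R\<^esub> g \<in> carrier (C R)" if "f \<in> carrier (C R)" "g \<in> carrier (C R)" for f g
    using conv_memI[OF sw_linear[OF RM pre[OF that]]] by (simp add: conv_def)
  have one: "\<one>\<^bsub>C R\<^esub> \<in> carrier (C R)"
    using conv_memI[OF eps_scale_linear[OF RM R.A.one_closed]] by (simp add: conv_def)
  show ?thesis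
  proof (rule unital_algebraI[OF R.field_k CM _ _ one])
    show "bil (C R) (C R) (C R) (%f g. f \<otimes>\<^bsub>C R\<^esub> g)"
    proof (intro bil_I)
      fix f assume f: "f \<in> carrier (C R)"
      have lin: "lin (C R) R (%g. sw R (%x y. f x \<otimes>\<^bsub>R\<^esub> g y) h)" if h: "h \<in> cH" for h
        by (rule sw_param_linear[OF RM CM pre[OF f] _ h])
           (auto intro!: R.linear_mult_right conv_eval_linear conv_closed[OF f])
      show "lin (C R) (C R) (%g. f \<otimes>\<^bsub>C R\<^esub> g)"
        by (rule lin_I)
           (auto intro!: conv_eqI cl f CM.smult_closed CM.a_closed
             simp: conv_apply[where R = R] lin_add[OF lin] lin_smult[OF lin])
    next
      fix f assume f: "f \<in> carrier (C R)"
      have lin: "lin (C R) R (%g. sw R (%x y. g x \<otimes>\<^bsub>R\<^esub> f y) h)" if h: "h \<in> cH" for h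
        by (rule sw_param_linear[OF RM CM pre[OF _ f] _ h])
           (auto intro!: R.linear_mult_left conv_eval_linear conv_closed[OF f])
      show "lin (C R) (C R) (%g. g \<otimes>\<^bsub>C R\<^esub> f)"
        by (rule lin_I)
           (auto intro!: conv_eqI cl f CM.smult_closed CM.a_closed
             simp: conv_apply[where R = R] lin_add[OF lin] lin_smult[OF lin])
    qed
  next
    fix f g e assume f: "f \<in> carrier (C R)" and g: "g \<in> carrier (C R)" and e: "e \<in> carrier (C R)"
    show "f \<otimes>\<^bsub>C R\<^esub> g \<otimes>\<^bsub>C R\<^esub> e = f \<otimes>\<^bsub>C R\<^esub> (g \<otimes>\<^bsub>C R\<^esub> e)"
    proof (rule conv_eqI)
      fix h assume h: "h \<in> cH"
      let ?t = "%x y z. f x \<otimes>\<^bsub>R\<^esub> g y \<otimes>\<^bsub>R\<^esub> e z"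
      have tri: "tril H H H R ?t"
        by (rule tril_I)
           (auto intro!: R.linear_mult_left R.linear_mult_right conv_linear[OF f] conv_linear[OF g] conv_linear[OF e] conv_closed[OF f] conv_closed[OF g] conv_closed[OF e])
      have "(f \<otimes>\<^bsub>C R\<^esub> g \<otimes>\<^bsub>C R\<^esub> e) h = sw R (%x c. (f \<otimes>\<^bsub>C R\<^esub> g) x \<otimes>\<^bsub>R\<^esub> e c) h"
        using h by (simp add: conv_apply)
      also have "... = sw R (%x c. sw R (%a b. ?t a b c) x) h"
      proof (rule sw_cong[OF RM pre[OF cl[OF f g] e] h])
        fix x c assume xc: "x \<in> cH" "c \<in> cH"
        show "(f \<otimes>\<^bsub>C R\<^esub> g) x \<otimes>\<^bsub>R\<^esub> e c = sw R (%a b. ?t a b c) x"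
          using sw_post[OF RM RM R.linear_mult_left[OF lin_id conv_closed[OF e xc(2)]] pre[OF f g] xc(1)] xc
          by (simp add: conv_apply)
      qed
      also have "... = sw R (%a y. sw R (%b c. ?t a b c) y) h"
        by (rule sw_coassoc[OF RM tri h])
      also have "... = sw R (%a y. f a \<otimes>\<^bsub>R\<^esub> (g \<otimes>\<^bsub>C R\<^esub> e) y) h"
      proof (rule sw_cong[OF RM sw_right_bilinear[OF RM tri] h])
        fix a y assume ay: "a \<in> cH" "y \<in> cH"
        have "f a \<otimes>\<^bsub>R\<^esub> sw R (%b c. g b \<otimes>\<^bsub>R\<^esub> e c) y = sw R (%b c. ?t a b c) y"
          by (rule sw_map[OF RM RM R.linear_mult_right[OF lin_id conv_closed[OF f ay(1)]] pre[OF g e] ay(2)])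
             (simp add: R.A.m_assoc conv_closed[OF f] conv_closed[OF g] conv_closed[OF e] ay)
        then show "sw R (%b c. ?t a b c) y = f a \<otimes>\<^bsub>R\<^esub> (g \<otimes>\<^bsub>C R\<^esub> e) y"
          using ay by (simp add: conv_apply)
      qed
      also have "... = (f \<otimes>\<^bsub>C R\<^esub> (g \<otimes>\<^bsub>C R\<^esub> e)) h"
        using h by (simp add: conv_apply)
      finally show "(f \<otimes>\<^bsub>C R\<^esub> g \<otimes>\<^bsub>C R\<^esub> e) h = (f \<otimes>\<^bsub>C R\<^esub> (g \<otimes>\<^bsub>C R\<^esub> e)) h" .
    qed (auto intro!: cl f g e)
  next
    fix f assume f: "f \<in> carrier (C R)"
    show "\<one>\<^bsub>C R\<^esub> \<otimes>\<^bsub>C R\<^esub> f = f"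
    proof (rule conv_eqI[OF cl[OF one f] f])
      fix h assume h: "h \<in> cH"
      have "(\<one>\<^bsub>C R\<^esub> \<otimes>\<^bsub>C R\<^esub> f) h = sw R (%x y. eps x \<odot>\<^bsub>R\<^esub> f y) h"
        unfolding conv_apply(1)[OF h]
        by (rule sw_cong[OF RM pre[OF one f] h])
           (simp add: conv_apply R.smult_mult_left conv_closed[OF f])
      then show "(\<one>\<^bsub>C R\<^esub> \<otimes>\<^bsub>C R\<^esub> f) h = f h"
        by (simp add: sw_counit_left[OF RM conv_linear[OF f] h])
    qed
    show "f \<otimes>\<^bsub>C R\<^esub> \<one>\<^bsub>C R\<^esub> = f"
    proof (rule conv_eqI[OF cl[OF f one] f])
      fix h assume h: "h \<in> cH"
      have "(f \<otimes>\<^bsub>C R\<^esub> \<one>\<^bsub>C R\<^esub>) h = sw R (%x y. eps y \<odot>\<^bsub>R\<^esub> f x) h"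
        unfolding conv_apply(1)[OF h]
        by (rule sw_cong[OF RM pre[OF f one] h])
           (simp add: conv_apply R.smult_mult_right conv_closed[OF f])
      then show "(f \<otimes>\<^bsub>C R\<^esub> \<one>\<^bsub>C R\<^esub>) h = f h"
        by (simp add: sw_counit_right[OF RM conv_linear[OF f] h])
    qed
  qed
qed

end

lemma (in module) smult_left_commute:
  "[|a \<in> carrier R; b \<in> carrier R; x \<in> carrier M|] ==> a \<odot>\<^bsub>M\<^esub> (b \<odot>\<^bsub>M\<^esub> x) = b \<odot>\<^bsub>M\<^esub> (a \<odot>\<^bsub>M\<^esub> x)"
  by (simp add: smult_assoc1[symmetric] R.m_comm)

context hopf_algebra
begin

lemma S_comp: "lin W H f ==> lin W H (%x. S (f x))"
  by (rule lin_comp[OF S_linear])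

lemma pure_HH_left:
  "[|lin W H f; y \<in> cH|] ==> lin W (tensor_algebra k H H) (%x. pure_tensor HH.T (f x) y)"
  by (rule bil_left[OF HH.pure_bilinear])

lemma pure_HH_right:
  "[|lin W H f; y \<in> cH|] ==> lin W (tensor_algebra k H H) (%x. pure_tensor HH.T y (f x))"
  by (rule bil_right[OF HH.pure_bilinear])

text \<open>Rebrackets (h1 h2)(h3 h4) as h1 ((h2 h3) h4). The two middle legs become the coproduct
  of one element, so that an antipode standing on one of them can cancel the other.\<close>

lemma sw_regroup4:
  assumes M: "module k M" and h: "h \<in> cH"
    and lin: "!!b d c. [|b \<in> cH; d \<in> cH; c \<in> cH|] ==> lin H M (%a. X4 a b d c)"
      "!!a d c. [|a \<in> cH; d \<in> cH; c \<in> cH|] ==> lin H M (%b. X4 a b d c)"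
      "!!a b c. [|a \<in> cH; b \<in> cH; c \<in> cH|] ==> lin H M (%d. X4 a b d c)"
      "!!a b d. [|a \<in> cH; b \<in> cH; d \<in> cH|] ==> lin H M (%c. X4 a b d c)"
  shows "sw M (%x y. sw M (%a b. sw M (%d c. X4 a b d c) y) x) h =
    sw M (%a w. sw M (%z c. sw M (%b d. X4 a b d c) z) w) h"
proof -
  have tri: "tril H H H M (%a b y. sw M (%d c. X4 a b d c) y)"
    by (rule tril_I)
       (auto intro!: sw_param_linear[OF M module_A] sw_linear[OF M] bil_I lin)
  have "sw M (%x y. sw M (%a b. sw M (%d c. X4 a b d c) y) x) h =
    sw M (%a w. sw M (%b y. sw M (%d c. X4 a b d c) y) w) h"
    by (rule sw_coassoc[OF M tri h])
  also have "... = sw M (%a w. sw M (%z c. sw M (%b d. X4 a b d c) z) w) h"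
  proof (rule sw_cong[OF M sw_right_bilinear[OF M tri] h])
    fix a w assume aw: "a \<in> cH" "w \<in> cH"
    have "tril H H H M (%b d c. X4 a b d c)"
      by (rule tril_I) (auto intro!: lin aw)
    then show "sw M (%b y. sw M (%d c. X4 a b d c) y) w = sw M (%z c. sw M (%b d. X4 a b d c) z) w"
      using sw_coassoc[OF M _ aw(2)] by simp
  qed
  finally show ?thesis .
qed

lemma conv2_mult_apply:
  assumes R: "unital_algebra k R" and F: "F \<in> carrier (C (C R))" and G: "G \<in> carrier (C (C R))"
    and hg: "h \<in> cH" "g \<in> cH"
  shows "(F \<otimes>\<^bsub>C (C R)\<^esub> G) h g = sw R (%x y. sw R (%a b. F x a \<otimes>\<^bsub>R\<^esub> G y b) g) h"
proof -
  interpret R: unital_algebra k R by fact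
  have CR: "unital_algebra k (C R)" by (rule algebra_conv[OF R])
  note CM = unital_algebra.module_A[OF CR]
  have b: "bil H H (C R) (%x y. F x \<otimes>\<^bsub>C R\<^esub> G y)"
    by (rule conv_mult_bilinear_pre[OF CR F G])
  have "(F \<otimes>\<^bsub>C (C R)\<^esub> G) h g = (sw (C R) (%x y. F x \<otimes>\<^bsub>C R\<^esub> G y) h) g"
    using hg by (simp add: conv_apply)
  also have "... = sw R (%x y. sw R (%a b. F x a \<otimes>\<^bsub>R\<^esub> G y b) g) h"
    by (rule sw_map[OF CM R.module_A conv_eval_linear[OF hg(2)] b hg(1)])
       (simp add: conv_apply hg)
  finally show ?thesis .
qed

lemma conv2_pre:
  assumes R: "unital_algebra k R" and F: "F \<in> carrier (C (C R))" and G: "G \<in> carrier (C (C R))"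
  shows "[|x \<in> cH; y \<in> cH|] ==> bil H H R (%a b. F x a \<otimes>\<^bsub>R\<^esub> G y b)"
    and "[|a \<in> cH; b \<in> cH|] ==> bil H H R (%x y. F x a \<otimes>\<^bsub>R\<^esub> G y b)"
    and "g \<in> cH ==> bil H H R (%x y. sw R (%a b. F x a \<otimes>\<^bsub>R\<^esub> G y b) g)"
proof -
  interpret R: unital_algebra k R by fact
  note F2 = conv2_bilinear[OF F] and G2 = conv2_bilinear[OF G]
  show 1: "bil H H R (%a b. F x a \<otimes>\<^bsub>R\<^esub> G y b)" if "x \<in> cH" "y \<in> cH" for x y
    by (rule bil_comp[OF R.mult_bilinear bil_D(1)[OF F2 that(1)] bil_D(1)[OF G2 that(2)]])
  show 2: "bil H H R (%x y. F x a \<otimes>\<^bsub>R\<^esub> G y b)" if "a \<in> cH" "b \<in> cH" for a b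
    by (rule bil_comp[OF R.mult_bilinear bil_D(2)[OF F2 that(1)] bil_D(2)[OF G2 that(2)]])
  show "bil H H R (%x y. sw R (%a b. F x a \<otimes>\<^bsub>R\<^esub> G y b) g)" if g: "g \<in> cH"
    by (rule bil_I)
       (auto intro!: sw_param_linear[OF R.module_A module_A _ _ g] 1 bil_D[OF 2])
qed

lemma conv2_eqI:
  assumes "F \<in> carrier (C (C R))" "G \<in> carrier (C (C R))"
    and "!!h g. [|h \<in> cH; g \<in> cH|] ==> F h g = G h g"
  shows "F = G"
  by (intro conv_eqI[OF assms(1,2)] conv_eqI[where R = R] conv_closed[OF assms(1)] conv_closed[OF assms(2)] assms(3))

section \<open>Algebra maps between convolution algebras\<close>

definition cmap :: "('x \<Rightarrow> 'y) \<Rightarrow> ('h \<Rightarrow> 'x) \<Rightarrow> 'h \<Rightarrow> 'y"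
  where "cmap \<phi> f = (\<lambda>h\<in>cH. \<phi> (f h))"

definition mstar :: "('h \<Rightarrow> 'x) \<Rightarrow> 'h \<Rightarrow> 'h \<Rightarrow> 'x"
  where "mstar f = (\<lambda>h\<in>cH. \<lambda>g\<in>cH. f (h \<otimes>\<^bsub>H\<^esub> g))"

text \<open>If \<open>\<alpha> r\<close> is the function h \<mapsto> h \<triangleright> r, the value
  at (h, g) is h \<triangleright> f(g). Storing the action with the acted-on element first makes
  \<alpha> a map into a convolution algebra.\<close>

definition hatm :: "('x \<Rightarrow> 'h \<Rightarrow> 'y) \<Rightarrow> ('h \<Rightarrow> 'x) \<Rightarrow> 'h \<Rightarrow> 'h \<Rightarrow> 'y"
  where "hatm \<alpha> f = (\<lambda>h\<in>cH. \<lambda>g\<in>cH. \<alpha> (f g) h)"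

definition iota :: "('k, 'x, 'y) module_scheme \<Rightarrow> 'x \<Rightarrow> 'h \<Rightarrow> 'x"
  where "iota R r = (\<lambda>h\<in>cH. eps h \<odot>\<^bsub>R\<^esub> r)"

lemma cmap_apply [simp]: "h \<in> cH ==> cmap \<phi> f h = \<phi> (f h)"
  by (simp add: cmap_def)

lemma mstar_apply [simp]: "[|h \<in> cH; g \<in> cH|] ==> mstar f h g = f (h \<otimes>\<^bsub>H\<^esub> g)"
  by (simp add: mstar_def)

lemma hatm_apply [simp]: "[|h \<in> cH; g \<in> cH|] ==> hatm \<alpha> f h g = \<alpha> (f g) h"
  by (simp add: hatm_def)

lemma iota_apply [simp]: "h \<in> cH ==> iota R r h = eps h \<odot>\<^bsub>R\<^esub> r"
  by (simp add: iota_def)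

lemma cmap_closed: "[|lin M N \<phi>; f \<in> carrier (C M)|] ==> cmap \<phi> f \<in> carrier (C N)"
  unfolding cmap_def by (rule conv_memI[OF lin_comp[OF _ conv_linear]])

lemma cmap_linear:
  assumes M: "module k M" and N: "module k N" and \<phi>: "lin M N \<phi>"
  shows "lin (C M) (C N) (cmap \<phi>)"
  unfolding cmap_def
proof (rule lin_into_conv[OF N _ conv_module[OF M]])
  show "bil (C M) H N (%f h. \<phi> (f h))"
    by (rule bil_I)
       (auto intro: lin_comp[OF \<phi> conv_linear] lin_comp[OF \<phi> conv_eval_linear])
qed

lemma cmap_hom:
  assumes R: "unital_algebra k R" and Q: "unital_algebra k Q" and \<phi>: "algebra_hom k R Q \<phi>"
  shows "algebra_hom k (C R) (C Q) (cmap \<phi>)"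
proof -
  interpret R: unital_algebra k R by fact
  interpret Q: unital_algebra k Q by fact
  interpret CR: unital_algebra k "C R" by (rule algebra_conv[OF R])
  interpret CQ: unital_algebra k "C Q" by (rule algebra_conv[OF Q])
  note \<phi>l = hom_D(1)[OF \<phi>]
  show ?thesis
  proof (rule hom_I[OF cmap_linear[OF R.module_A Q.module_A \<phi>l]])
    fix f g assume f: "f \<in> carrier (C R)" and g: "g \<in> carrier (C R)"
    note b = conv_mult_bilinear_pre[OF R f g]
    show "cmap \<phi> (f \<otimes>\<^bsub>C R\<^esub> g) = cmap \<phi> f \<otimes>\<^bsub>C Q\<^esub> cmap \<phi> g"
    proof (rule conv_eqI[where R = Q])
      fix h assume h: "h \<in> cH"
      have "\<phi> (sw R (%x y. f x \<otimes>\<^bsub>R\<^esub> g y) h) = sw Q (%x y. cmap \<phi> f x \<otimes>\<^bsub>Q\<^esub> cmap \<phi> g y) h"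
        by (rule sw_map[OF R.module_A Q.module_A \<phi>l b h])
           (simp add: hom_D(2)[OF \<phi>] conv_closed[OF f] conv_closed[OF g])
      then show "cmap \<phi> (f \<otimes>\<^bsub>C R\<^esub> g) h = (cmap \<phi> f \<otimes>\<^bsub>C Q\<^esub> cmap \<phi> g) h"
        using h by (simp add: conv_apply)
    qed (use f g in \<open>auto intro!: cmap_closed[OF \<phi>l] CR.A.m_closed CQ.A.m_closed\<close>)
  next
    show "cmap \<phi> \<one>\<^bsub>C R\<^esub> = \<one>\<^bsub>C Q\<^esub>"
      by (rule conv_eqI[where R = Q])
         (auto intro!: cmap_closed[OF \<phi>l] simp: conv_apply lin_smult[OF \<phi>l] hom_D(3)[OF \<phi>])
  qed
qed

lemma mstar_closed:
  assumes R: "module k R" and f: "f \<in> carrier (C R)"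
  shows "mstar f \<in> carrier (C (C R))"
  unfolding mstar_def
  by (rule conv2_memI[OF R bil_post[OF conv_linear[OF f] mult_bilinear]])

text \<open>Multiplication H \<otimes> H \<rightarrow> H is a coalgebra map, and pulling back along
  a coalgebra map preserves convolution.\<close>

lemma mstar_hom:
  assumes R: "unital_algebra k R"
  shows "algebra_hom k (C R) (C (C R)) mstar"
proof -
  interpret R: unital_algebra k R by fact
  interpret CR: unital_algebra k "C R" by (rule algebra_conv[OF R])
  interpret CCR: unital_algebra k "C (C R)" by (rule algebra_conv[OF CR.unital_algebra_axioms])
  note cl = mstar_closed[OF R.module_A]
  show ?thesis
  proof (rule hom_I)
    show "lin (C R) (C (C R)) mstar"
      by (rule lin_I)
         (auto intro!: conv2_eqI[where R = R] cl simp: conv_apply)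
  next
    fix f g assume f: "f \<in> carrier (C R)" and g: "g \<in> carrier (C R)"
    show "mstar (f \<otimes>\<^bsub>C R\<^esub> g) = mstar f \<otimes>\<^bsub>C (C R)\<^esub> mstar g"
    proof (rule conv2_eqI[where R = R])
      fix x y assume xy: "x \<in> cH" "y \<in> cH"
      have "mstar (f \<otimes>\<^bsub>C R\<^esub> g) x y = sw R (%a b. sw R (%c d. f (a \<otimes>\<^bsub>H\<^esub> c) \<otimes>\<^bsub>R\<^esub> g (b \<otimes>\<^bsub>H\<^esub> d)) y) x"
        using xy by (simp add: conv_apply sw_mult[OF R.module_A conv_mult_bilinear_pre[OF R f g]])
      also have "... = (mstar f \<otimes>\<^bsub>C (C R)\<^esub> mstar g) x y"
        unfolding conv2_mult_apply[OF R cl[OF f] cl[OF g] xy]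
      proof (rule sw_cong[OF R.module_A _ xy(1), symmetric])
        show "bil H H R (%a b. sw R (%c d. mstar f a c \<otimes>\<^bsub>R\<^esub> mstar g b d) y)"
          by (rule conv2_pre(3)[OF R cl[OF f] cl[OF g] xy(2)])
        fix a b assume ab: "a \<in> cH" "b \<in> cH"
        show "sw R (%c d. mstar f a c \<otimes>\<^bsub>R\<^esub> mstar g b d) y = sw R (%c d. f (a \<otimes>\<^bsub>H\<^esub> c) \<otimes>\<^bsub>R\<^esub> g (b \<otimes>\<^bsub>H\<^esub> d)) y"
          by (rule sw_cong[OF R.module_A conv2_pre(1)[OF R cl[OF f] cl[OF g] ab] xy(2)]) (simp add: ab)
      qed
      finally show "mstar (f \<otimes>\<^bsub>C R\<^esub> g) x y = (mstar f \<otimes>\<^bsub>C (C R)\<^esub> mstar g) x y" .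
    qed (use f g in \<open>auto intro!: cl\<close>)
  next
    show "mstar \<one>\<^bsub>C R\<^esub> = \<one>\<^bsub>C (C R)\<^esub>"
      by (rule conv2_eqI[where R = R]) (auto intro!: cl simp: conv_apply eps_mult R.smult_assoc1)
  qed
qed

lemma hatm_closed:
  assumes R: "module k R" and \<alpha>: "lin R (C R) \<alpha>" and f: "f \<in> carrier (C R)"
  shows "hatm \<alpha> f \<in> carrier (C (C R))"
  unfolding hatm_def
  by (rule conv2_memI[OF R], rule bil_I)
     (auto intro!: conv_linear lin_closed[OF \<alpha>] conv_closed[OF f]
        lin_comp[OF conv_eval_linear lin_comp[OF \<alpha> conv_linear[OF f]]])

text \<open>That \<alpha> is multiplicative into the convolution algebra is the product rule of a
  measuring. The coproducts of h and of g are independent, so their sums may be exchanged.\<close>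

lemma hatm_hom:
  assumes R: "unital_algebra k R" and \<alpha>: "algebra_hom k R (C R) \<alpha>"
  shows "algebra_hom k (C R) (C (C R)) (hatm \<alpha>)"
proof -
  interpret R: unital_algebra k R by fact
  interpret CR: unital_algebra k "C R" by (rule algebra_conv[OF R])
  interpret CCR: unital_algebra k "C (C R)" by (rule algebra_conv[OF CR.unital_algebra_axioms])
  note \<alpha>l = hom_D(1)[OF \<alpha>]
  note cl = hatm_closed[OF R.module_A \<alpha>l]
  show ?thesis
  proof (rule hom_I)
    show "lin (C R) (C (C R)) (hatm \<alpha>)"
      by (rule lin_I)
         (auto intro!: conv2_eqI[where R = R] cl
           simp: conv_apply lin_add[OF \<alpha>l] lin_smult[OF \<alpha>l] conv_closed[where R = R])
  next
    fix f g assume f: "f \<in> carrier (C R)" and g: "g \<in> carrier (C R)"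
    show "hatm \<alpha> (f \<otimes>\<^bsub>C R\<^esub> g) = hatm \<alpha> f \<otimes>\<^bsub>C (C R)\<^esub> hatm \<alpha> g"
    proof (rule conv2_eqI[where R = R])
      fix h y assume hy: "h \<in> cH" "y \<in> cH"
      note b = conv_mult_bilinear_pre[OF R f g]
      have lin: "lin R R (%r. \<alpha> r h)"
        by (rule lin_comp[OF conv_eval_linear[OF hy(1)] \<alpha>l])
      have "hatm \<alpha> (f \<otimes>\<^bsub>C R\<^esub> g) h y = sw R (%a b. \<alpha> (f a \<otimes>\<^bsub>R\<^esub> g b) h) y"
        using hy by (simp add: conv_apply sw_post[OF R.module_A R.module_A lin b hy(2)])
      also have "... = sw R (%a b. sw R (%c d. hatm \<alpha> f c a \<otimes>\<^bsub>R\<^esub> hatm \<alpha> g d b) h) y"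
      proof (rule sw_cong[OF R.module_A bil_post[OF lin b] hy(2)])
        fix a b assume ab: "a \<in> cH" "b \<in> cH"
        have "\<alpha> (f a) \<in> carrier (C R)" "\<alpha> (g b) \<in> carrier (C R)"
          using ab f g by (auto intro!: lin_closed[OF \<alpha>l] conv_closed)
        note pre = conv_mult_bilinear_pre[OF R this]
        have "\<alpha> (f a \<otimes>\<^bsub>R\<^esub> g b) h = sw R (%c d. \<alpha> (f a) c \<otimes>\<^bsub>R\<^esub> \<alpha> (g b) d) h"
          using hy ab by (simp add: hom_D(2)[OF \<alpha>] conv_closed[OF f] conv_closed[OF g] conv_apply)
        also have "... = sw R (%c d. hatm \<alpha> f c a \<otimes>\<^bsub>R\<^esub> hatm \<alpha> g d b) h"
          by (rule sw_cong[OF R.module_A pre hy(1)]) (simp add: ab)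
        finally show "\<alpha> (f a \<otimes>\<^bsub>R\<^esub> g b) h = sw R (%c d. hatm \<alpha> f c a \<otimes>\<^bsub>R\<^esub> hatm \<alpha> g d b) h" .
      qed
      also have "... = sw R (%c d. sw R (%a b. hatm \<alpha> f c a \<otimes>\<^bsub>R\<^esub> hatm \<alpha> g d b) y) h"
        by (rule sw_swap[OF R.module_A conv2_pre(2)[OF R cl[OF f] cl[OF g]] conv2_pre(1)[OF R cl[OF f] cl[OF g]]])
           (use hy in auto)
      also have "... = (hatm \<alpha> f \<otimes>\<^bsub>C (C R)\<^esub> hatm \<alpha> g) h y"
        by (rule conv2_mult_apply[symmetric, OF R cl[OF f] cl[OF g] hy])
      finally show "hatm \<alpha> (f \<otimes>\<^bsub>C R\<^esub> g) h y = (hatm \<alpha> f \<otimes>\<^bsub>C (C R)\<^esub> hatm \<alpha> g) h y" .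
    qed (use f g in \<open>auto intro!: cl\<close>)
  next
    have "a \<odot>\<^bsub>R\<^esub> (b \<odot>\<^bsub>R\<^esub> \<one>\<^bsub>R\<^esub>) = b \<odot>\<^bsub>R\<^esub> (a \<odot>\<^bsub>R\<^esub> \<one>\<^bsub>R\<^esub>)" if "a \<in> carrier k" "b \<in> carrier k" for a b
      using that by (metis R.A.one_closed R.smult_assoc1 F.m_comm)
    then show "hatm \<alpha> \<one>\<^bsub>C R\<^esub> = \<one>\<^bsub>C (C R)\<^esub>"
      by (intro conv2_eqI[where R = R])
         (auto intro!: cl simp: conv_apply lin_smult[OF \<alpha>l] hom_D(3)[OF \<alpha>])
  qed
qed

lemma iota_hom:
  assumes R: "unital_algebra k R"
  shows "algebra_hom k R (C R) (iota R)"
proof -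
  interpret R: unital_algebra k R by fact
  interpret CR: unital_algebra k "C R" by (rule algebra_conv[OF R])
  have cl: "iota R r \<in> carrier (C R)" if "r \<in> carrier R" for r
    unfolding iota_def by (rule conv_memI[OF eps_scale_linear[OF R.module_A that]])
  show ?thesis
  proof (rule hom_I)
    show "lin R (C R) (iota R)"
    proof (rule lin_I)
      fix a x assume "a \<in> carrier k" "x \<in> carrier R"
      then show "iota R (a \<odot>\<^bsub>R\<^esub> x) = a \<odot>\<^bsub>C R\<^esub> iota R x"
        by (intro conv_eqI[where R = R])
           (auto intro!: cl simp: conv_apply R.smult_assoc1[symmetric] F.m_comm)
    qed (auto intro!: cl conv_eqI[where R = R] simp: conv_apply R.smult_r_distr)
  next
    fix r s assume r: "r \<in> carrier R" and s: "s \<in> carrier R"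
    show "iota R (r \<otimes>\<^bsub>R\<^esub> s) = iota R r \<otimes>\<^bsub>C R\<^esub> iota R s"
    proof (rule conv_eqI[where R = R])
      fix h assume h: "h \<in> cH"
      have "(iota R r \<otimes>\<^bsub>C R\<^esub> iota R s) h = sw R (%x y. eps x \<odot>\<^bsub>R\<^esub> (eps y \<odot>\<^bsub>R\<^esub> (r \<otimes>\<^bsub>R\<^esub> s))) h"
        unfolding conv_apply(1)[OF h]
        by (rule sw_cong[OF R.module_A conv_mult_bilinear_pre[OF R cl[OF r] cl[OF s]] h])
           (simp add: R.smult_mult_left R.smult_mult_right r s, rule R.smult_left_commute, simp_all add: r s)
      also have "... = eps h \<odot>\<^bsub>R\<^esub> (r \<otimes>\<^bsub>R\<^esub> s)"
        by (rule sw_counit_left[OF R.module_A eps_scale_linear[OF R.module_A] h]) (simp add: r s)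
      finally show "iota R (r \<otimes>\<^bsub>R\<^esub> s) h = (iota R r \<otimes>\<^bsub>C R\<^esub> iota R s) h" using h by simp
    qed (auto intro!: cl r s CR.A.m_closed)
  next
    show "iota R \<one>\<^bsub>R\<^esub> = \<one>\<^bsub>C R\<^esub>"
      by (rule conv_eqI[where R = R]) (auto intro!: cl simp: conv_apply)
  qed
qed

subsection \<open>The antipode\<close>

lemma id_conv: "(\<lambda>h\<in>cH. h) \<in> carrier (C H)"
  by (rule conv_memI[OF lin_id])

lemma S_conv: "(\<lambda>h\<in>cH. S h) \<in> carrier (C H)"
  by (rule conv_memI[OF S_linear])

lemma CH_algebra: "unital_algebra k (C H)"
  by (rule algebra_conv[OF unital_algebra_axioms])

lemma S_id_conv: "(\<lambda>h\<in>cH. S h) \<otimes>\<^bsub>C H\<^esub> (\<lambda>h\<in>cH. h) = \<one>\<^bsub>C H\<^esub>"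
proof -
  interpret CH: unital_algebra k "C H" by (rule CH_algebra)
  show ?thesis
  proof (rule conv_eqI[where R = H])
    fix h assume h: "h \<in> cH"
    have "((\<lambda>h\<in>cH. S h) \<otimes>\<^bsub>C H\<^esub> (\<lambda>h\<in>cH. h)) h = sw H (%x y. S x \<otimes>\<^bsub>H\<^esub> y) h"
      unfolding conv_apply(1)[OF h]
      by (rule sw_cong[OF module_A conv_mult_bilinear_pre[OF unital_algebra_axioms S_conv id_conv] h]) simp
    then show "((\<lambda>h\<in>cH. S h) \<otimes>\<^bsub>C H\<^esub> (\<lambda>h\<in>cH. h)) h = \<one>\<^bsub>C H\<^esub> h"
      using h by (simp add: antipode_left conv_apply)
  qed (auto intro!: CH.A.m_closed S_conv id_conv)
qed

text \<open>In the convolution algebra Hom(H \<otimes> H, H) the multiplication map has S(hg) as a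
  left inverse and S(g)S(h) as a right inverse, so the two coincide.\<close>

lemma S_mult:
  assumes hg: "h \<in> cH" "g \<in> cH"
  shows "S (h \<otimes>\<^bsub>H\<^esub> g) = S g \<otimes>\<^bsub>H\<^esub> S h"
proof -
  interpret CH: unital_algebra k "C H" by (rule CH_algebra)
  interpret CCH: unital_algebra k "C (C H)" by (rule algebra_conv[OF CH_algebra])
  let ?id = "\<lambda>h\<in>cH. h" and ?S = "\<lambda>h\<in>cH. S h"
  let ?N = "\<lambda>h\<in>cH. \<lambda>g\<in>cH. S g \<otimes>\<^bsub>H\<^esub> S h"
  note mh = mstar_hom[OF unital_algebra_axioms]
  have N: "?N \<in> carrier (C (C H))"
    by (rule conv2_memI[OF module_A], rule bil_I)
       (auto intro!: linear_mult_left linear_mult_right S_linear)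
  have mid: "mstar ?id \<in> carrier (C (C H))" and mS: "mstar ?S \<in> carrier (C (C H))"
    by (rule hom_D(4)[OF mh id_conv], rule hom_D(4)[OF mh S_conv])
  have 1: "mstar ?S \<otimes>\<^bsub>C (C H)\<^esub> mstar ?id = \<one>\<^bsub>C (C H)\<^esub>"
    using hom_D(2)[OF mh S_conv id_conv] by (simp add: S_id_conv hom_D(3)[OF mh])
  have 2: "mstar ?id \<otimes>\<^bsub>C (C H)\<^esub> ?N = \<one>\<^bsub>C (C H)\<^esub>"
  proof (rule conv2_eqI[where R = H])
    fix h g assume hg: "h \<in> cH" "g \<in> cH"
    have "(mstar ?id \<otimes>\<^bsub>C (C H)\<^esub> ?N) h g
        = sw H (%x y. sw H (%a b. mstar ?id x a \<otimes>\<^bsub>H\<^esub> ?N y b) g) h"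
      by (rule conv2_mult_apply[OF unital_algebra_axioms mid N hg])
    also have "... = sw H (%x y. eps g \<odot>\<^bsub>H\<^esub> (x \<otimes>\<^bsub>H\<^esub> S y)) h"
    proof (rule sw_cong[OF module_A conv2_pre(3)[OF unital_algebra_axioms mid N hg(2)] hg(1)])
      fix x y assume xy: "x \<in> cH" "y \<in> cH"
      have "sw H (%a b. mstar ?id x a \<otimes>\<^bsub>H\<^esub> ?N y b) g = sw H (%a b. x \<otimes>\<^bsub>H\<^esub> (a \<otimes>\<^bsub>H\<^esub> S b) \<otimes>\<^bsub>H\<^esub> S y) g"
        by (rule sw_cong[OF module_A conv2_pre(1)[OF unital_algebra_axioms mid N xy] hg(2)])
           (simp add: xy A.m_assoc)
      also have "... = eps g \<odot>\<^bsub>H\<^esub> (x \<otimes>\<^bsub>H\<^esub> \<one>\<^bsub>H\<^esub> \<otimes>\<^bsub>H\<^esub> S y)"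
        by (rule sw_antipode_right[OF module_A _ hg(2)])
           (auto intro!: linear_mult_left linear_mult_right lin_id simp: xy)
      finally show "sw H (%a b. mstar ?id x a \<otimes>\<^bsub>H\<^esub> ?N y b) g = eps g \<odot>\<^bsub>H\<^esub> (x \<otimes>\<^bsub>H\<^esub> S y)"
        using xy by simp
    qed
    also have "... = eps h \<odot>\<^bsub>H\<^esub> (eps g \<odot>\<^bsub>H\<^esub> \<one>\<^bsub>H\<^esub>)"
      by (rule sw_antipode_right[OF module_A lin_scale[OF module_A lin_id] hg(1)]) (simp add: hg)
    finally show "(mstar ?id \<otimes>\<^bsub>C (C H)\<^esub> ?N) h g = \<one>\<^bsub>C (C H)\<^esub> h g"
      using hg by (simp add: conv_apply)
  qed (auto intro!: CCH.A.m_closed mid N)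
  have "mstar ?S = ?N"
    by (rule CCH.A.inv_unique[OF 1 2 mid mS N])
  then have "mstar ?S h g = ?N h g" by simp
  then show ?thesis using hg by simp
qed

lemma S_one [simp]: "S \<one>\<^bsub>H\<^esub> = \<one>\<^bsub>H\<^esub>"
  using antipode_left[OF one_closed_H]
  by (simp add: sw_one[OF module_A bil_comp[OF mult_bilinear S_linear lin_id]])

text \<open>Apply z \<mapsto> \<epsilon>(z)1 to the antipode law for S(h1)h2; the factor
  \<epsilon>(h2) then absorbs the second leg.\<close>

lemma eps_S [simp]:
  assumes h: "h \<in> cH"
  shows "eps (S h) = eps h"
proof -
  let ?f = "%z. eps z \<odot>\<^bsub>H\<^esub> \<one>\<^bsub>H\<^esub>"
  have f: "lin H H ?f" by (rule eps_scale_linear[OF module_A one_closed_H])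
  have "eps h \<odot>\<^bsub>H\<^esub> ?f \<one>\<^bsub>H\<^esub> = sw H (%x y. ?f (S x \<otimes>\<^bsub>H\<^esub> y)) h"
    by (rule sw_antipode_left[symmetric, OF module_A f h])
  also have "... = sw H (%x y. eps y \<odot>\<^bsub>H\<^esub> ?f (S x)) h"
    by (rule sw_cong[OF module_A _ h])
       (auto intro!: bil_post[OF f] bil_comp[OF mult_bilinear S_linear lin_id]
         simp: eps_mult F.m_comm smult_assoc1[symmetric])
  also have "... = ?f (S h)"
    by (rule sw_counit_right[OF module_A lin_comp[OF f S_linear] h])
  finally have "eps (?f (S h)) = eps (?f h)" using h by simp
  then show ?thesis using h by (simp add: counit_smult)
qed

lemma comul_sw:
  assumes "h \<in> cH"
  shows "comul H h = sw (tensor_algebra k H H) (pure_tensor HH.T) h"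
  unfolding sweedler2_def
  by (rule HH.linear_eqI[OF lin_id HH.tensor_lift_linear[OF HH.module_P HH.lift_okI_bilinear[OF HH.pure_bilinear]]])
     (simp_all add: HH.tensor_lift_pure[OF HH.module_P HH.lift_okI_bilinear[OF HH.pure_bilinear]] assms)

text \<open>Uniqueness of inverses once more, now in Hom(H, H \<otimes> H): \<Delta> composed with S
  is a left inverse of \<Delta>, and h \<mapsto> S h2 \<otimes> S h1 is a right inverse.\<close>

lemma comul_S:
  assumes h: "h \<in> cH"
  shows "comul H (S h) = sw (tensor_algebra k H H) (%x y. pure_tensor HH.T (S y) (S x)) h"
proof -
  let ?P = "tensor_algebra k H H"
  let ?id = "\<lambda>h\<in>cH. h" and ?S = "\<lambda>h\<in>cH. S h"
  have PA: "unital_algebra k ?P" by (rule HH.unital_algebra_tensor)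
  interpret PA: unital_algebra k ?P by (rule PA)
  interpret CP: unital_algebra k "C ?P" by (rule algebra_conv[OF PA])
  note PM = HH.module_P
  have ch: "algebra_hom k (C H) (C ?P) (cmap (comul H))"
    by (rule cmap_hom[OF unital_algebra_axioms PA comul_hom])
  let ?n = "%x y. pure_tensor HH.T (S y) (S x)"
  have nb: "bil H H ?P ?n"
    by (rule bil_I) (auto intro!: pure_HH_left pure_HH_right S_linear)
  define N where "N = (\<lambda>h\<in>cH. sw ?P ?n h)"
  have N: "N \<in> carrier (C ?P)"
    unfolding N_def by (rule conv_memI[OF sw_linear[OF PM nb]])
  have cid: "cmap (comul H) ?id \<in> carrier (C ?P)" and cS: "cmap (comul H) ?S \<in> carrier (C ?P)"
    by (rule hom_D(4)[OF ch id_conv], rule hom_D(4)[OF ch S_conv])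
  have 1: "cmap (comul H) ?S \<otimes>\<^bsub>C ?P\<^esub> cmap (comul H) ?id = \<one>\<^bsub>C ?P\<^esub>"
    using hom_D(2)[OF ch S_conv id_conv] by (simp add: S_id_conv hom_D(3)[OF ch])
  have 2: "cmap (comul H) ?id \<otimes>\<^bsub>C ?P\<^esub> N = \<one>\<^bsub>C ?P\<^esub>"
  proof (rule conv_eqI[where R = ?P])
    fix h assume h: "h \<in> cH"
    let ?X = "%a b d c. pure_tensor HH.T (a \<otimes>\<^bsub>H\<^esub> S c) (b \<otimes>\<^bsub>H\<^esub> S d)"
    have Xlin: "lin H ?P (%a. ?X a b d c)" "lin H ?P (%b. ?X a b d c)"
        "lin H ?P (%d. ?X a b d c)" "lin H ?P (%c. ?X a b d c)"
      if "a \<in> cH" "b \<in> cH" "c \<in> cH" "d \<in> cH" for a b c d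
      using that by (auto intro!: pure_HH_left pure_HH_right linear_mult_left linear_mult_right S_linear lin_id)
    have "(cmap (comul H) ?id \<otimes>\<^bsub>C ?P\<^esub> N) h = sw ?P (%x y. sw ?P (%a b. sw ?P (%d c. ?X a b d c) y) x) h"
      unfolding conv_apply(1)[OF h]
    proof (rule sw_cong[OF PM conv_mult_bilinear_pre[OF PA cid N] h])
      fix x y assume xy: "x \<in> cH" "y \<in> cH"
      have Ny: "N y \<in> carrier ?P" by (rule conv_closed[OF N xy(2)])
      have "cmap (comul H) ?id x \<otimes>\<^bsub>?P\<^esub> N y = sw ?P (%a b. pure_tensor HH.T a b) x \<otimes>\<^bsub>?P\<^esub> N y"
        using xy by (simp add: comul_sw)
      also have "... = sw ?P (%a b. sw ?P (%d c. ?X a b d c) y) x"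
      proof (rule sw_map[OF PM PM PA.linear_mult_left[OF lin_id Ny] HH.pure_bilinear xy(1)])
        fix a b assume ab: "a \<in> cH" "b \<in> cH"
        then have p: "pure_tensor HH.T a b \<in> carrier ?P" by simp
        have "pure_tensor HH.T a b \<otimes>\<^bsub>?P\<^esub> N y = sw ?P (%d c. pure_tensor HH.T a b \<otimes>\<^bsub>?P\<^esub> ?n d c) y"
          using sw_post[OF PM PM PA.linear_mult_right[OF lin_id p] nb xy(2)] xy by (simp add: N_def)
        also have "... = sw ?P (%d c. ?X a b d c) y"
          by (rule sw_cong[OF PM bil_post[OF PA.linear_mult_right[OF lin_id p] nb] xy(2)])
             (simp add: ab HH.mult_pure)
        finally show "pure_tensor HH.T a b \<otimes>\<^bsub>?P\<^esub> N y = sw ?P (%d c. ?X a b d c) y" .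
      qed
      finally show "cmap (comul H) ?id x \<otimes>\<^bsub>?P\<^esub> N y = sw ?P (%a b. sw ?P (%d c. ?X a b d c) y) x" .
    qed
    \<comment> \<open>With the middle legs together h2 S(h3) cancels, and after that h1 S(h4) has
      become an adjacent pair and cancels as well.\<close>
    also have "... = sw ?P (%a w. sw ?P (%z c. sw ?P (%b d. ?X a b d c) z) w) h"
      by (rule sw_regroup4[OF PM h]) (auto intro!: Xlin)
    also have "... = sw ?P (%a w. pure_tensor HH.T (a \<otimes>\<^bsub>H\<^esub> S w) \<one>\<^bsub>H\<^esub>) h"
    proof (rule sw_cong[OF PM _ h])
      show "bil H H ?P (%a w. sw ?P (%z c. sw ?P (%b d. ?X a b d c) z) w)"
        by (rule bil_I)
           (auto intro!: sw_linear[OF PM] sw_param_linear[OF PM module_A] bil_I Xlin)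
      fix a w assume aw: "a \<in> cH" "w \<in> cH"
      have "sw ?P (%z c. sw ?P (%b d. ?X a b d c) z) w = sw ?P (%z c. eps z \<odot>\<^bsub>?P\<^esub> pure_tensor HH.T (a \<otimes>\<^bsub>H\<^esub> S c) \<one>\<^bsub>H\<^esub>) w"
      proof (rule sw_cong[OF PM _ aw(2)])
        show "bil H H ?P (%z c. sw ?P (%b d. ?X a b d c) z)"
          by (rule bil_I)
             (auto intro!: sw_linear[OF PM] sw_param_linear[OF PM module_A] bil_I Xlin aw)
        fix z c assume "z \<in> cH" "c \<in> cH"
        then show "sw ?P (%b d. ?X a b d c) z = eps z \<odot>\<^bsub>?P\<^esub> pure_tensor HH.T (a \<otimes>\<^bsub>H\<^esub> S c) \<one>\<^bsub>H\<^esub>"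
          by (intro sw_antipode_right[OF PM pure_HH_right[OF lin_id]]) (auto simp: aw)
      qed
      also have "... = pure_tensor HH.T (a \<otimes>\<^bsub>H\<^esub> S w) \<one>\<^bsub>H\<^esub>"
        by (rule sw_counit_left[OF PM _ aw(2)])
           (auto intro!: pure_HH_left linear_mult_right S_linear aw)
      finally show "sw ?P (%z c. sw ?P (%b d. ?X a b d c) z) w = pure_tensor HH.T (a \<otimes>\<^bsub>H\<^esub> S w) \<one>\<^bsub>H\<^esub>" .
    qed
    also have "... = eps h \<odot>\<^bsub>?P\<^esub> pure_tensor HH.T \<one>\<^bsub>H\<^esub> \<one>\<^bsub>H\<^esub>"
      by (rule sw_antipode_right[OF PM pure_HH_left[OF lin_id one_closed_H] h])
    finally show "(cmap (comul H) ?id \<otimes>\<^bsub>C ?P\<^esub> N) h = \<one>\<^bsub>C ?P\<^esub> h"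
      using h by (simp add: conv_apply HH.one_pure)
  qed (auto intro!: CP.A.m_closed cid N)
  have "cmap (comul H) ?S = N"
    by (rule CP.A.inv_unique[OF 1 2 cid cS N])
  then have "cmap (comul H) ?S h = N h" by simp
  then show ?thesis using h by (simp add: N_def)
qed

lemma sw_S:
  assumes M: "module k M" and F: "bil H H M F" and h: "h \<in> cH"
  shows "sw M F (S h) = sw M (%x y. F (S y) (S x)) h"
proof -
  let ?P = "tensor_algebra k H H"
  let ?n = "%x y. pure_tensor HH.T (S y) (S x)"
  have nb: "bil H H ?P ?n"
    by (rule bil_I) (auto intro!: pure_HH_left pure_HH_right S_linear)
  note ok = HH.lift_okI_bilinear[OF F]
  note lin = HH.tensor_lift_linear[OF M ok]
  have "sw M F (S h) = tensor_lift (add_monoid M) F (sw ?P ?n h)"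
    unfolding comul_S[OF h, symmetric] by (simp add: sweedler2_def)
  also have "... = sw M (%x y. F (S y) (S x)) h"
    by (rule sw_map[OF HH.module_P M lin nb h]) (simp add: HH.tensor_lift_pure[OF M ok])
  finally show ?thesis .
qed

text \<open>Contraction of a function of two arguments along h \<mapsto> h1 \<otimes> S h2. It is
  not multiplicative in general; \<open>con_mult\<close> states what holds instead.\<close>

definition con :: "('k, 'x, 'y) module_scheme \<Rightarrow> ('h \<Rightarrow> 'h \<Rightarrow> 'x) \<Rightarrow> 'h \<Rightarrow> 'x"
  where "con M F h = sw M (%x y. F x (S y)) h"

lemma con_linear:
  assumes M: "module k M" and F: "bil H H M F"
  shows "lin H M (con M F)"
  unfolding con_def by (rule sw_linear[OF M bil_comp[OF F lin_id S_linear]])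

lemma con_linear_arg:
  assumes R: "module k R" and h: "h \<in> cH"
  shows "lin (C (C R)) R (%F. con R F h)"
  unfolding con_def
proof (rule sw_param_linear[OF R conv_module[OF conv_module[OF R]] _ _ h])
  fix F assume "F \<in> carrier (C (C R))"
  then show "bil H H R (%x y. F x (S y))"
    by (intro bil_comp[OF conv2_bilinear lin_id S_linear])
next
  fix x y assume "x \<in> cH" "y \<in> cH"
  then show "lin (C (C R)) R (%F. F x (S y))"
    by (intro lin_comp[OF conv_eval_linear conv_eval_linear]) simp_all
qed

text \<open>S reverses the coproduct, so the product of F and G is taken at F(h1, S h4) G(h2, S h3):
  the arguments of F enclose those of G, and the inner pair is a contraction again.\<close>

lemma con_mult:
  assumes R: "unital_algebra k R" and F: "F \<in> carrier (C (C R))" and G: "G \<in> carrier (C (C R))" and h: "h \<in> cH"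
  shows "con R (F \<otimes>\<^bsub>C (C R)\<^esub> G) h = sw R (%a w. sw R (%z c. F a (S c) \<otimes>\<^bsub>R\<^esub> con R G z) w) h"
proof -
  interpret R: unital_algebra k R by fact
  interpret CR: unital_algebra k "C R" by (rule algebra_conv[OF R])
  interpret CCR: unital_algebra k "C (C R)" by (rule algebra_conv[OF CR.unital_algebra_axioms])
  note RM = R.module_A
  have FG: "F \<otimes>\<^bsub>C (C R)\<^esub> G \<in> carrier (C (C R))" by (rule CCR.A.m_closed[OF F G])
  note F2 = conv2_bilinear[OF F] and G2 = conv2_bilinear[OF G]
  let ?X = "%a b d c. F a (S c) \<otimes>\<^bsub>R\<^esub> G b (S d)"
  have Xlin: "lin H R (%a. ?X a b d c)" "lin H R (%b. ?X a b d c)"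
      "lin H R (%d. ?X a b d c)" "lin H R (%c. ?X a b d c)"
    if "a \<in> cH" "b \<in> cH" "c \<in> cH" "d \<in> cH" for a b c d
    using that by (auto intro!: R.linear_mult_left R.linear_mult_right bil_D(2)[OF F2] bil_D(2)[OF G2]
        lin_comp[OF bil_D(1)[OF F2] S_linear] lin_comp[OF bil_D(1)[OF G2] S_linear]
        bil_closed[OF F2] bil_closed[OF G2])
  have "con R (F \<otimes>\<^bsub>C (C R)\<^esub> G) h = sw R (%x y. sw R (%a b. sw R (%d c. ?X a b d c) y) x) h"
    unfolding con_def
  proof (rule sw_cong[OF RM bil_comp[OF conv2_bilinear[OF FG] lin_id S_linear] h])
    fix x y assume xy: "x \<in> cH" "y \<in> cH"
    have "(F \<otimes>\<^bsub>C (C R)\<^esub> G) x (S y) = sw R (%a b. sw R (%c d. F a c \<otimes>\<^bsub>R\<^esub> G b d) (S y)) x"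
      by (rule conv2_mult_apply[OF R F G]) (simp_all add: xy)
    also have "... = sw R (%a b. sw R (%d c. ?X a b d c) y) x"
      by (rule sw_cong[OF RM conv2_pre(3)[OF R F G] xy(1)])
         (auto intro!: sw_S[OF RM conv2_pre(1)[OF R F G] xy(2)] simp: xy)
    finally show "(F \<otimes>\<^bsub>C (C R)\<^esub> G) x (S y) = sw R (%a b. sw R (%d c. ?X a b d c) y) x" .
  qed
  also have "... = sw R (%a w. sw R (%z c. sw R (%b d. ?X a b d c) z) w) h"
    by (rule sw_regroup4[OF RM h]) (auto intro!: Xlin)
  also have "... = sw R (%a w. sw R (%z c. F a (S c) \<otimes>\<^bsub>R\<^esub> con R G z) w) h"
  proof (rule sw_cong[OF RM _ h])
    show "bil H H R (%a w. sw R (%z c. sw R (%b d. ?X a b d c) z) w)"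
      by (rule bil_I)
         (auto intro!: sw_linear[OF RM] sw_param_linear[OF RM module_A] bil_I Xlin)
    fix a w assume aw: "a \<in> cH" "w \<in> cH"
    show "sw R (%z c. sw R (%b d. ?X a b d c) z) w = sw R (%z c. F a (S c) \<otimes>\<^bsub>R\<^esub> con R G z) w"
    proof (rule sw_cong[OF RM _ aw(2)])
      show "bil H H R (%z c. sw R (%b d. ?X a b d c) z)"
        by (rule bil_I)
           (auto intro!: sw_linear[OF RM] sw_param_linear[OF RM module_A] bil_I Xlin aw)
      fix z c assume zc: "z \<in> cH" "c \<in> cH"
      then have "F a (S c) \<in> carrier R" using aw bil_closed[OF F2] by simp
      then show "sw R (%b d. ?X a b d c) z = F a (S c) \<otimes>\<^bsub>R\<^esub> con R G z"
        unfolding con_def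
        by (intro sw_post[symmetric, OF RM RM R.linear_mult_right[OF lin_id]
              bil_comp[OF G2 lin_id S_linear] zc(1)])
    qed
  qed
  finally show ?thesis .
qed

text \<open>A right factor that sees only the product of its two arguments sees h2 S(h3) and is
  thereby evaluated at the unit. This is the standard way in which an antipode removes a factor
  below.\<close>

lemma con_C0:
  assumes R: "unital_algebra k R" and F: "F \<in> carrier (C (C R))" and G: "G \<in> carrier (C R)" and h: "h \<in> cH"
  shows "con R (F \<otimes>\<^bsub>C (C R)\<^esub> mstar G) h = con R F h \<otimes>\<^bsub>R\<^esub> G \<one>\<^bsub>H\<^esub>"
proof -
  interpret R: unital_algebra k R by fact
  note RM = R.module_A
  have mG: "mstar G \<in> carrier (C (C R))" by (rule mstar_closed[OF RM G])
  note F2 = conv2_bilinear[OF F]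
  have G1: "G \<one>\<^bsub>H\<^esub> \<in> carrier R" by (rule conv_closed[OF G]) simp
  have cG: "con R (mstar G) z = eps z \<odot>\<^bsub>R\<^esub> G \<one>\<^bsub>H\<^esub>" if "z \<in> cH" for z
  proof -
    have "con R (mstar G) z = sw R (%x y. G (x \<otimes>\<^bsub>H\<^esub> S y)) z"
      unfolding con_def
      by (rule sw_cong[OF RM bil_comp[OF conv2_bilinear[OF mG] lin_id S_linear] that]) simp
    then show ?thesis
      using sw_antipode_right[OF RM conv_linear[OF G] that] by simp
  qed
  have cb: "bil H H R (%a w. sw R (%z c. F a (S c) \<otimes>\<^bsub>R\<^esub> con R (mstar G) z) w)"
  proof (rule sw_right_bilinear[OF RM], rule tril_I)
  qed (auto intro!: R.linear_mult_left R.linear_mult_right bil_D(2)[OF F2]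
        lin_comp[OF bil_D(1)[OF F2] S_linear] con_linear[OF RM conv2_bilinear[OF mG]]
        bil_closed[OF F2] lin_closed[OF con_linear[OF RM conv2_bilinear[OF mG]]])
  have "con R (F \<otimes>\<^bsub>C (C R)\<^esub> mstar G) h = sw R (%a w. sw R (%z c. F a (S c) \<otimes>\<^bsub>R\<^esub> con R (mstar G) z) w) h"
    by (rule con_mult[OF R F mG h])
  also have "... = sw R (%a w. F a (S w) \<otimes>\<^bsub>R\<^esub> G \<one>\<^bsub>H\<^esub>) h"
  proof (rule sw_cong[OF RM cb h])
    fix a w assume aw: "a \<in> cH" "w \<in> cH"
    have Fl: "lin H R (%c. F a (S c) \<otimes>\<^bsub>R\<^esub> G \<one>\<^bsub>H\<^esub>)"
      by (rule R.linear_mult_left[OF lin_comp[OF bil_D(1)[OF F2 aw(1)] S_linear] G1])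
    have "sw R (%z c. F a (S c) \<otimes>\<^bsub>R\<^esub> con R (mstar G) z) w = sw R (%z c. eps z \<odot>\<^bsub>R\<^esub> (F a (S c) \<otimes>\<^bsub>R\<^esub> G \<one>\<^bsub>H\<^esub>)) w"
      by (rule sw_cong[symmetric, OF RM eps_scale_bilinear[OF RM Fl] aw(2)])
         (simp add: cG R.smult_mult_right bil_closed[OF F2] aw G1)
    also have "... = F a (S w) \<otimes>\<^bsub>R\<^esub> G \<one>\<^bsub>H\<^esub>"
      by (rule sw_counit_left[OF RM Fl aw(2)])
    finally show "sw R (%z c. F a (S c) \<otimes>\<^bsub>R\<^esub> con R (mstar G) z) w = F a (S w) \<otimes>\<^bsub>R\<^esub> G \<one>\<^bsub>H\<^esub>" .
  qed
  also have "... = con R F h \<otimes>\<^bsub>R\<^esub> G \<one>\<^bsub>H\<^esub>"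
    unfolding con_def
    by (rule sw_post[symmetric, OF RM RM R.linear_mult_left[OF lin_id G1]
          bil_comp[OF F2 lin_id S_linear] h])
  finally show ?thesis .
qed

text \<open>Partial application fixes the outer argument; exchanging the arguments allows the inner
  one to be fixed instead.\<close>

definition flip :: "('h \<Rightarrow> 'h \<Rightarrow> 'x) \<Rightarrow> 'h \<Rightarrow> 'h \<Rightarrow> 'x"
  where "flip F = (\<lambda>h\<in>cH. \<lambda>g\<in>cH. F g h)"

lemma flip_apply [simp]: "[|h \<in> cH; g \<in> cH|] ==> flip F h g = F g h"
  by (simp add: flip_def)

lemma flip_closed:
  assumes "module k R" "F \<in> carrier (C (C R))"
  shows "flip F \<in> carrier (C (C R))"
  unfolding flip_def by (rule conv2_memI[OF assms(1) bil_swap[OF conv2_bilinear[OF assms(2)]]])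

lemma flip_hom:
  assumes R: "unital_algebra k R"
  shows "algebra_hom k (C (C R)) (C (C R)) flip"
proof -
  interpret R: unital_algebra k R by fact
  interpret CR: unital_algebra k "C R" by (rule algebra_conv[OF R])
  interpret CCR: unital_algebra k "C (C R)" by (rule algebra_conv[OF CR.unital_algebra_axioms])
  note cl = flip_closed[OF R.module_A]
  show ?thesis
  proof (rule hom_I)
    show "lin (C (C R)) (C (C R)) flip"
      by (rule lin_I) (auto intro!: conv2_eqI[where R = R] cl simp: conv_apply)
  next
    fix F G assume F: "F \<in> carrier (C (C R))" and G: "G \<in> carrier (C (C R))"
    show "flip (F \<otimes>\<^bsub>C (C R)\<^esub> G) = flip F \<otimes>\<^bsub>C (C R)\<^esub> flip G"
    proof (rule conv2_eqI[where R = R])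
      fix h g assume hg: "h \<in> cH" "g \<in> cH"
      have "flip (F \<otimes>\<^bsub>C (C R)\<^esub> G) h g = sw R (%a b. sw R (%x y. F a x \<otimes>\<^bsub>R\<^esub> G b y) h) g"
        using hg by (simp add: conv2_mult_apply[OF R F G])
      also have "... = sw R (%x y. sw R (%a b. F a x \<otimes>\<^bsub>R\<^esub> G b y) g) h"
        by (rule sw_swap[OF R.module_A conv2_pre(1)[OF R F G] conv2_pre(2)[OF R F G] hg(2,1)])
      also have "... = (flip F \<otimes>\<^bsub>C (C R)\<^esub> flip G) h g"
        unfolding conv2_mult_apply[OF R cl[OF F] cl[OF G] hg]
      proof (rule sw_cong[OF R.module_A _ hg(1), symmetric])
        show "bil H H R (%x y. sw R (%a b. flip F x a \<otimes>\<^bsub>R\<^esub> flip G y b) g)"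
          by (rule conv2_pre(3)[OF R cl[OF F] cl[OF G] hg(2)])
        fix x y assume xy: "x \<in> cH" "y \<in> cH"
        show "sw R (%a b. flip F x a \<otimes>\<^bsub>R\<^esub> flip G y b) g = sw R (%a b. F a x \<otimes>\<^bsub>R\<^esub> G b y) g"
          by (rule sw_cong[OF R.module_A conv2_pre(1)[OF R cl[OF F] cl[OF G] xy] hg(2)]) (simp add: xy)
      qed
      finally show "flip (F \<otimes>\<^bsub>C (C R)\<^esub> G) h g = (flip F \<otimes>\<^bsub>C (C R)\<^esub> flip G) h g" .
    qed (use F G in \<open>auto intro!: cl\<close>)
  next
    show "flip \<one>\<^bsub>C (C R)\<^esub> = \<one>\<^bsub>C (C R)\<^esub>"
      by (rule conv2_eqI[where R = R]) (auto intro!: cl R.smult_left_commute simp: conv_apply)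
  qed
qed

text \<open>The counit inside the constant function absorbs the leg of that factor. In this way an
  equation in Hom(H, R') with a constant factor is read off at a single argument.\<close>

lemma iota_mult_apply:
  assumes R: "unital_algebra k R" and r: "r \<in> carrier R" and f: "f \<in> carrier (C R)" and h: "h \<in> cH"
  shows "(iota R r \<otimes>\<^bsub>C R\<^esub> f) h = r \<otimes>\<^bsub>R\<^esub> f h" "(f \<otimes>\<^bsub>C R\<^esub> iota R r) h = f h \<otimes>\<^bsub>R\<^esub> r"
proof -
  interpret R: unital_algebra k R by fact
  have i: "iota R r \<in> carrier (C R)" by (rule hom_D(4)[OF iota_hom[OF R] r])
  have "(iota R r \<otimes>\<^bsub>C R\<^esub> f) h = sw R (%x y. eps x \<odot>\<^bsub>R\<^esub> (r \<otimes>\<^bsub>R\<^esub> f y)) h"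
    unfolding conv_apply(1)[OF h]
    by (rule sw_cong[OF R.module_A conv_mult_bilinear_pre[OF R i f] h]) (simp add: R.smult_mult_left r conv_closed[OF f])
  then show "(iota R r \<otimes>\<^bsub>C R\<^esub> f) h = r \<otimes>\<^bsub>R\<^esub> f h"
    by (simp add: sw_counit_left[OF R.module_A R.linear_mult_right[OF conv_linear[OF f] r] h])
  have "(f \<otimes>\<^bsub>C R\<^esub> iota R r) h = sw R (%x y. eps y \<odot>\<^bsub>R\<^esub> (f x \<otimes>\<^bsub>R\<^esub> r)) h"
    unfolding conv_apply(1)[OF h]
    by (rule sw_cong[OF R.module_A conv_mult_bilinear_pre[OF R f i] h]) (simp add: R.smult_mult_right r conv_closed[OF f])
  then show "(f \<otimes>\<^bsub>C R\<^esub> iota R r) h = f h \<otimes>\<^bsub>R\<^esub> r"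
    by (simp add: sw_counit_right[OF R.module_A R.linear_mult_left[OF conv_linear[OF f] r] h])
qed

lemma conv2_mult_post:
  assumes R: "unital_algebra k R" and M: "module k M" and \<phi>: "lin R M \<phi>"
    and F: "F \<in> carrier (C (C R))" and G: "G \<in> carrier (C (C R))"
    and hg: "h \<in> cH" "g \<in> cH"
  shows "\<phi> ((F \<otimes>\<^bsub>C (C R)\<^esub> G) h g) = sw M (%x y. sw M (%a b. \<phi> (F x a \<otimes>\<^bsub>R\<^esub> G y b)) g) h"
proof -
  interpret R: unital_algebra k R by fact
  have "\<phi> ((F \<otimes>\<^bsub>C (C R)\<^esub> G) h g) = sw M (%x y. sw M (%a b. \<phi> (F x a \<otimes>\<^bsub>R\<^esub> G y b)) g) h"
    unfolding conv2_mult_apply[OF R F G hg]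
    by (rule sw_map[OF R.module_A M \<phi> conv2_pre(3)[OF R F G hg(2)] hg(1)])
       (rule sw_post[OF R.module_A M \<phi> conv2_pre(1)[OF R F G] hg(2)])
  then show ?thesis .
qed

lemma conv3_eqI:
  assumes "F \<in> carrier (C (C (C R)))" "G \<in> carrier (C (C (C R)))"
    and "!!h g f. [|h \<in> cH; g \<in> cH; f \<in> cH|] ==> F h g f = G h g f"
  shows "F = G"
  by (intro conv_eqI[OF assms(1,2)] conv2_eqI[where R = R] conv_closed[OF assms(1)] conv_closed[OF assms(2)] assms(3))

lemma conv2_mult_eq:
  assumes R: "unital_algebra k R" and F: "F \<in> carrier (C (C R))" and G: "G \<in> carrier (C (C R))"
    and hg: "h \<in> cH" "g \<in> cH"
    and eq: "!!x y. [|x \<in> cH; y \<in> cH|] ==> F x y = F' x y"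
      "!!x y. [|x \<in> cH; y \<in> cH|] ==> G x y = G' x y"
  shows "(F \<otimes>\<^bsub>C (C R)\<^esub> G) h g = sw R (%x y. sw R (%a b. F' x a \<otimes>\<^bsub>R\<^esub> G' y b) g) h"
  unfolding conv2_mult_apply[OF R F G hg]
proof (rule sw_cong[OF _ conv2_pre(3)[OF R F G hg(2)] hg(1)])
  show M: "module k R" by (rule unital_algebra.module_A[OF R])
  fix x y assume xy: "x \<in> cH" "y \<in> cH"
  show "sw R (%a b. F x a \<otimes>\<^bsub>R\<^esub> G y b) g = sw R (%a b. F' x a \<otimes>\<^bsub>R\<^esub> G' y b) g"
    by (rule sw_cong[OF M conv2_pre(1)[OF R F G xy] hg(2)]) (simp add: xy eq)
qed

lemma conv2_post_pre:
  assumes R: "unital_algebra k R" and M: "module k M" and \<phi>: "lin R M \<phi>"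
    and F: "F \<in> carrier (C (C R))" and G: "G \<in> carrier (C (C R))" and g: "g \<in> cH"
  shows "bil H H M (%x y. sw M (%a b. \<phi> (F x a \<otimes>\<^bsub>R\<^esub> G y b)) g)"
proof (rule bil_I)
  note b1 = bil_post[OF \<phi> conv2_pre(1)[OF R F G]] and b2 = bil_post[OF \<phi> conv2_pre(2)[OF R F G]]
  fix x assume x: "x \<in> cH"
  show "lin H M (%y. sw M (%a b. \<phi> (F x a \<otimes>\<^bsub>R\<^esub> G y b)) g)"
    by (rule sw_param_linear[OF M module_A b1[OF x] bil_D(1)[OF b2 x] g])
  show "lin H M (%y. sw M (%a b. \<phi> (F y a \<otimes>\<^bsub>R\<^esub> G x b)) g)"
    by (rule sw_param_linear[OF M module_A b1[OF _ x] bil_D(2)[OF b2 x] g])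
qed

lemma conv_mult_eq:
  assumes R: "unital_algebra k R" and F: "F \<in> carrier (C R)" and G: "G \<in> carrier (C R)"
    and h: "h \<in> cH"
    and eq: "!!x. x \<in> cH ==> F x = F' x" "!!x. x \<in> cH ==> G x = G' x"
  shows "(F \<otimes>\<^bsub>C R\<^esub> G) h = sw R (%x y. F' x \<otimes>\<^bsub>R\<^esub> G' y) h"
  unfolding conv_apply(1)[OF h]
  by (rule sw_cong[OF unital_algebra.module_A[OF R] conv_mult_bilinear_pre[OF R F G] h]) (simp add: eq)

lemma conv_lin: "[|f \<in> carrier (C R); lin W H g|] ==> lin W R (%x. f (g x))"
  by (rule lin_comp[OF conv_linear])

lemma conv2_lin1:
  "[|F \<in> carrier (C (C R)); lin W H g; y \<in> cH|] ==> lin W R (%x. F (g x) y)"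
  by (rule bil_left[OF conv2_bilinear])

lemma conv2_lin2:
  "[|F \<in> carrier (C (C R)); lin W H g; y \<in> cH|] ==> lin W R (%x. F y (g x))"
  by (rule bil_right[OF conv2_bilinear])

lemma conv2_closed: "[|F \<in> carrier (C (C R)); x \<in> cH; y \<in> cH|] ==> F x y \<in> carrier R"
  by (rule bil_closed[OF conv2_bilinear])

text \<open>The bridge from a triple convolution product to the explicit double threefold sum in
  which \<open>act_act\<close> is stated. Convolution interleaves the legs of h and of g, so an
  exchange of sums is required besides associativity.\<close>

lemma conv2_triple:
  assumes R: "unital_algebra k R" and F: "F \<in> carrier (C (C R))" and G: "G \<in> carrier (C (C R))"
    and K: "K \<in> carrier (C (C R))" and hg: "h \<in> cH" "g \<in> cH"
    and eq: "!!x y. [|x \<in> cH; y \<in> cH|] ==> F x y = F' x y"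
      "!!x y. [|x \<in> cH; y \<in> cH|] ==> G x y = G' x y"
      "!!x y. [|x \<in> cH; y \<in> cH|] ==> K x y = K' x y"
  shows "(F \<otimes>\<^bsub>C (C R)\<^esub> (G \<otimes>\<^bsub>C (C R)\<^esub> K)) h g =
    sweedler3 H (add_monoid R) (%h1 h2 h3. sweedler3 H (add_monoid R) (%g1 g2 g3.
      F' h1 g1 \<otimes>\<^bsub>R\<^esub> G' h2 g2 \<otimes>\<^bsub>R\<^esub> K' h3 g3) g) h"
proof -
  interpret R: unital_algebra k R by fact
  interpret CR: unital_algebra k "C R" by (rule algebra_conv[OF R])
  interpret CCR: unital_algebra k "C (C R)" by (rule algebra_conv[OF CR.unital_algebra_axioms])
  let ?t = "%h1 h2 h3 g1 g2 g3. F h1 g1 \<otimes>\<^bsub>R\<^esub> G h2 g2 \<otimes>\<^bsub>R\<^esub> K h3 g3"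
  let ?t' = "%h1 h2 h3 g1 g2 g3. F' h1 g1 \<otimes>\<^bsub>R\<^esub> G' h2 g2 \<otimes>\<^bsub>R\<^esub> K' h3 g3"
  note M = R.module_A
  have Q: "G \<otimes>\<^bsub>C (C R)\<^esub> K \<in> carrier (C (C R))" using G K by simp
  note lin = R.linear_mult_left R.linear_mult_right conv2_lin1[OF F] conv2_lin1[OF G] conv2_lin1[OF K] conv2_lin1[OF Q]
    conv2_lin2[OF F] conv2_lin2[OF G] conv2_lin2[OF K] conv2_lin2[OF Q] lin_id
  note cl = conv2_closed[OF F] conv2_closed[OF G] conv2_closed[OF K] conv2_closed[OF Q]
  note bl = bil_I sw_param_linear[OF M module_A] sw_linear[OF M] lin
  have "(F \<otimes>\<^bsub>C (C R)\<^esub> (G \<otimes>\<^bsub>C (C R)\<^esub> K)) h g =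
    sw R (%h1 x. sw R (%g1 y. F h1 g1 \<otimes>\<^bsub>R\<^esub> (G \<otimes>\<^bsub>C (C R)\<^esub> K) x y) g) h"
    by (rule conv2_mult_apply[OF R F Q hg])
  also have "... = sw R (%h1 x. sw R (%h2 h3. sw R (%g1 y. sw R (%g2 g3. ?t h1 h2 h3 g1 g2 g3) y) g) x) h"
  proof (rule sw_cong[OF M conv2_pre(3)[OF R F Q hg(2)] hg(1)])
    fix h1 x assume hx: "h1 \<in> cH" "x \<in> cH"
    have "sw R (%g1 y. F h1 g1 \<otimes>\<^bsub>R\<^esub> (G \<otimes>\<^bsub>C (C R)\<^esub> K) x y) g =
      sw R (%g1 y. sw R (%h2 h3. sw R (%g2 g3. ?t h1 h2 h3 g1 g2 g3) y) x) g"
    proof (rule sw_cong[OF M conv2_pre(1)[OF R F Q hx] hg(2)])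
      fix g1 y assume gy: "g1 \<in> cH" "y \<in> cH"
      have s: "F h1 g1 \<in> carrier R" by (rule cl(1)[OF hx(1) gy(1)])
      note ml = R.linear_mult_right[OF lin_id s]
      have "F h1 g1 \<otimes>\<^bsub>R\<^esub> (G \<otimes>\<^bsub>C (C R)\<^esub> K) x y =
        sw R (%h2 h3. sw R (%g2 g3. F h1 g1 \<otimes>\<^bsub>R\<^esub> (G h2 g2 \<otimes>\<^bsub>R\<^esub> K h3 g3)) y) x"
        by (rule conv2_mult_post[OF R M ml G K hx(2) gy(2)])
      also have "... = sw R (%h2 h3. sw R (%g2 g3. ?t h1 h2 h3 g1 g2 g3) y) x"
      proof (rule sw_cong[OF M conv2_post_pre[OF R M ml G K gy(2)] hx(2)])
        fix h2 h3 assume h23: "h2 \<in> cH" "h3 \<in> cH"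
        show "sw R (%g2 g3. F h1 g1 \<otimes>\<^bsub>R\<^esub> (G h2 g2 \<otimes>\<^bsub>R\<^esub> K h3 g3)) y = sw R (%g2 g3. ?t h1 h2 h3 g1 g2 g3) y"
          by (rule sw_cong[OF M bil_post[OF ml conv2_pre(1)[OF R G K h23]] gy(2)])
             (simp add: R.A.m_assoc cl s h23)
      qed
      finally show "F h1 g1 \<otimes>\<^bsub>R\<^esub> (G \<otimes>\<^bsub>C (C R)\<^esub> K) x y = sw R (%h2 h3. sw R (%g2 g3. ?t h1 h2 h3 g1 g2 g3) y) x" .
    qed
    also have "... = sw R (%h2 h3. sw R (%g1 y. sw R (%g2 g3. ?t h1 h2 h3 g1 g2 g3) y) g) x"
      by (rule sw_swap[OF M _ _ hg(2) hx(2)]) (auto intro!: bl simp: cl hx)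
    finally show "sw R (%g1 y. F h1 g1 \<otimes>\<^bsub>R\<^esub> (G \<otimes>\<^bsub>C (C R)\<^esub> K) x y) g =
      sw R (%h2 h3. sw R (%g1 y. sw R (%g2 g3. ?t h1 h2 h3 g1 g2 g3) y) g) x" .
  qed
  also have "... = sw R (%h1 x. sw R (%h2 h3. sw R (%g1 y. sw R (%g2 g3. ?t' h1 h2 h3 g1 g2 g3) y) g) x) h"
  proof -
    have cl': "F' x y \<in> carrier R" "G' x y \<in> carrier R" "K' x y \<in> carrier R" if "x \<in> cH" "y \<in> cH" for x y
      using cl(1-3)[OF that] eq(1)[OF that] eq(2)[OF that] eq(3)[OF that] by simp_all
    show ?thesis
      by (intro sw_cong[OF M]) (auto intro!: bl simp: cl cl' hg eq)
  qed
  finally show ?thesis by (simp add: sweedler3_def)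
qed

lemma conv_mult_at_one:
  assumes R: "unital_algebra k R" and F: "F \<in> carrier (C R)" and G: "G \<in> carrier (C R)"
  shows "(F \<otimes>\<^bsub>C R\<^esub> G) \<one>\<^bsub>H\<^esub> = F \<one>\<^bsub>H\<^esub> \<otimes>\<^bsub>R\<^esub> G \<one>\<^bsub>H\<^esub>"
  by (simp add: conv_apply sw_one[OF unital_algebra.module_A[OF R] conv_mult_bilinear_pre[OF R F G]])

end

context unital_algebra
begin

lemma algebra_facts:
  "[|x \<in> carrier A; y \<in> carrier A|] ==> x \<otimes>\<^bsub>A\<^esub> y \<in> carrier A"
  "\<one>\<^bsub>A\<^esub> \<in> carrier A"
  "x \<in> carrier A ==> \<one>\<^bsub>A\<^esub> \<otimes>\<^bsub>A\<^esub> x = x"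
  "x \<in> carrier A ==> x \<otimes>\<^bsub>A\<^esub> \<one>\<^bsub>A\<^esub> = x"
  "[|x \<in> carrier A; y \<in> carrier A; z \<in> carrier A|] ==> (x \<otimes>\<^bsub>A\<^esub> y) \<otimes>\<^bsub>A\<^esub> z = x \<otimes>\<^bsub>A\<^esub> (y \<otimes>\<^bsub>A\<^esub> z)"
  "[|x \<in> carrier A; y \<in> carrier A|] ==> x \<oplus>\<^bsub>A\<^esub> y \<in> carrier A"
  "\<zero>\<^bsub>A\<^esub> \<in> carrier A"
  "x \<in> carrier A ==> \<zero>\<^bsub>A\<^esub> \<oplus>\<^bsub>A\<^esub> x = x"
  "x \<in> carrier A ==> x \<oplus>\<^bsub>A\<^esub> \<zero>\<^bsub>A\<^esub> = x"
  "[|x \<in> carrier A; y \<in> carrier A; z \<in> carrier A|] ==> (x \<oplus>\<^bsub>A\<^esub> y) \<otimes>\<^bsub>A\<^esub> z = x \<otimes>\<^bsub>A\<^esub> z \<oplus>\<^bsub>A\<^esub> y \<otimes>\<^bsub>A\<^esub> z"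
  "[|x \<in> carrier A; y \<in> carrier A; z \<in> carrier A|] ==> z \<otimes>\<^bsub>A\<^esub> (x \<oplus>\<^bsub>A\<^esub> y) = z \<otimes>\<^bsub>A\<^esub> x \<oplus>\<^bsub>A\<^esub> z \<otimes>\<^bsub>A\<^esub> y"
  "[|x \<in> carrier A; y \<in> carrier A; z \<in> carrier A|] ==> (x \<oplus>\<^bsub>A\<^esub> y) \<oplus>\<^bsub>A\<^esub> z = x \<oplus>\<^bsub>A\<^esub> (y \<oplus>\<^bsub>A\<^esub> z)"
  "[|x \<in> carrier A; y \<in> carrier A|] ==> x \<oplus>\<^bsub>A\<^esub> y = y \<oplus>\<^bsub>A\<^esub> x"
  "[|x \<in> carrier A; y \<in> carrier A; z \<in> carrier A|] ==> x \<oplus>\<^bsub>A\<^esub> (y \<oplus>\<^bsub>A\<^esub> z) = y \<oplus>\<^bsub>A\<^esub> (x \<oplus>\<^bsub>A\<^esub> z)"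
  "[|a \<in> carrier k; x \<in> carrier A|] ==> a \<odot>\<^bsub>A\<^esub> x \<in> carrier A"
  "[|x \<in> carrier A; y \<in> carrier A; z \<in> carrier A; y \<otimes>\<^bsub>A\<^esub> x = \<one>\<^bsub>A\<^esub>; x \<otimes>\<^bsub>A\<^esub> z = \<one>\<^bsub>A\<^esub>|] ==> y = z"
  by (simp_all add: A.m_assoc A.l_distr A.r_distr A.a_ac, rule A.inv_unique)

end

text \<open>
  Interpreting \<^locale>\<open>unital_algebra\<close> at each of the many convolution algebras below would
  instantiate the whole ring library every time; this locale carries only what is needed.
\<close>

locale algebra_calculus =
  fixes k :: "('k, 'p) ring_scheme" and A :: "('k, 'a, 'm) module_scheme"
  assumes algebra: "unital_algebra k A"
begin

lemmas m_closed [simp] = unital_algebra.algebra_facts(1)[OF algebra]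
lemmas one_closed [simp] = unital_algebra.algebra_facts(2)[OF algebra]
lemmas one_mult [simp] = unital_algebra.algebra_facts(3,4)[OF algebra]
lemmas m_assoc = unital_algebra.algebra_facts(5)[OF algebra]
lemmas add_closed [simp] = unital_algebra.algebra_facts(6,7)[OF algebra]
lemmas add_zero [simp] = unital_algebra.algebra_facts(8,9)[OF algebra]
lemmas distr = unital_algebra.algebra_facts(10,11)[OF algebra]
lemmas a_ac = unital_algebra.algebra_facts(12-14)[OF algebra]
lemmas smult_closed [simp] = unital_algebra.algebra_facts(15)[OF algebra]
lemmas inv_unique = unital_algebra.algebra_facts(16)[OF algebra]
lemmas module_A = unital_algebra.module_A[OF algebra]
lemmas mult_bilinear = unital_algebra.mult_bilinear[OF algebra]
lemmas linear_mult_left = unital_algebra.linear_mult_left[OF algebra]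
lemmas linear_mult_right = unital_algebra.linear_mult_right[OF algebra]

end

section \<open>Cocycle identities\<close>

context cocycle_cross_product
begin

abbreviation "lin \<equiv> linear_map k"
abbreviation "bil \<equiv> bilinear_map k"
abbreviation "tril \<equiv> trilinear_map k"
abbreviation "cH \<equiv> carrier H"
abbreviation "cB \<equiv> carrier B"
abbreviation "sw \<equiv> hopf.sw"
abbreviation "con \<equiv> hopf.con"
abbreviation "mstar \<equiv> hopf.mstar"
abbreviation "flip \<equiv> hopf.flip"
abbreviation "cmap \<equiv> hopf.cmap"
abbreviation "hatm \<equiv> hopf.hatm"
abbreviation "iota \<equiv> hopf.iota"

lemmas S_linear = hopf.S_linear
lemmas cmap_closed = hopf.cmap_closed
lemmas cmap_hom = hopf.cmap_hom
lemmas con_def = hopf.con_def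
lemmas conv2_bilinear = hopf.conv2_bilinear
lemmas conv2_closed = hopf.conv2_closed
lemmas conv3_eqI = hopf.conv3_eqI
lemmas conv_apply = hopf.conv_apply
lemmas conv_closed = hopf.conv_closed
lemmas conv_eqI = hopf.conv_eqI
lemmas conv_eval_linear = hopf.conv_eval_linear
lemmas conv_linear = hopf.conv_linear
lemmas iota_hom = hopf.iota_hom
lemmas iota_mult_apply = hopf.iota_mult_apply
lemmas sw_coassoc = hopf.sw_coassoc
lemmas sw_cong = hopf.sw_cong
lemmas sw_linear = hopf.sw_linear
lemmas sw_map = hopf.sw_map
lemmas sw_param_linear = hopf.sw_param_linear
lemmas sw_post = hopf.sw_post
lemmas sw_right_bilinear = hopf.sw_right_bilinear

abbreviation mult_B (infixl "\<cdot>" 70) where "a \<cdot> b \<equiv> a \<otimes>\<^bsub>B\<^esub> b"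
abbreviation one_B ("1\<^sub>B") where "1\<^sub>B \<equiv> \<one>\<^bsub>B\<^esub>"
abbreviation one_H ("1\<^sub>H") where "1\<^sub>H \<equiv> \<one>\<^bsub>H\<^esub>"
abbreviation conv1 (infixl "*\<^sub>1" 70) where "F *\<^sub>1 G \<equiv> F \<otimes>\<^bsub>hopf.C B\<^esub> G"
abbreviation conv2 (infixl "*\<^sub>2" 70) where "F *\<^sub>2 G \<equiv> F \<otimes>\<^bsub>hopf.C (hopf.C B)\<^esub> G"
abbreviation conv3 (infixl "*\<^sub>3" 70) where "F *\<^sub>3 G \<equiv> F \<otimes>\<^bsub>hopf.C (hopf.C (hopf.C B))\<^esub> G"

abbreviation "CB \<equiv> hopf.C B"
abbreviation "CCB \<equiv> hopf.C (hopf.C B)"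
abbreviation "CCCB \<equiv> hopf.C (hopf.C (hopf.C B))"

lemma algebra_B: "unital_algebra k B" by (rule base.unital_algebra_axioms)
lemma algebra_CB: "unital_algebra k CB" by (rule hopf.algebra_conv[OF algebra_B])
lemma algebra_CCB: "unital_algebra k CCB" by (rule hopf.algebra_conv[OF algebra_CB])
lemma algebra_CCCB: "unital_algebra k CCCB" by (rule hopf.algebra_conv[OF algebra_CCB])

sublocale CB: algebra_calculus k CB by (rule algebra_calculus.intro[OF algebra_CB])
sublocale CCB: algebra_calculus k CCB by (rule algebra_calculus.intro[OF algebra_CCB])
sublocale CCCB: algebra_calculus k CCCB by (rule algebra_calculus.intro[OF algebra_CCCB])

section \<open>The measuring and the cocycle as elements of convolution algebras\<close>

definition al :: "'b \<Rightarrow> 'h \<Rightarrow> 'b" where "al b = (\<lambda>h\<in>cH. act h b)"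
definition Sg :: "'h \<Rightarrow> 'h \<Rightarrow> 'b" where "Sg = (\<lambda>h\<in>cH. \<lambda>g\<in>cH. \<sigma> h g)"
definition Sg' :: "'h \<Rightarrow> 'h \<Rightarrow> 'b" where "Sg' = (\<lambda>h\<in>cH. \<lambda>g\<in>cH. \<sigma>' h g)"

lemma al_apply [simp]: "h \<in> cH ==> al b h = act h b"
  by (simp add: al_def)

lemma Sg_apply [simp]: "[|h \<in> cH; g \<in> cH|] ==> Sg h g = \<sigma> h g"
  by (simp add: Sg_def)

lemma Sg'_apply [simp]: "[|h \<in> cH; g \<in> cH|] ==> Sg' h g = \<sigma>' h g"
  by (simp add: Sg'_def)

lemma act_closed [simp]: "[|h \<in> cH; b \<in> cB|] ==> act h b \<in> cB"
  by (rule bil_closed[OF act_bilinear])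

lemma sigma_closed [simp]: "[|h \<in> cH; g \<in> cH|] ==> \<sigma> h g \<in> cB"
  by (rule bil_closed[OF sigma_bilinear])

lemma sigma'_closed [simp]: "[|h \<in> cH; g \<in> cH|] ==> \<sigma>' h g \<in> cB"
  by (rule bil_closed[OF sigma_inv_bilinear])

lemma Sg_closed [simp]: "Sg \<in> carrier CCB"
  unfolding Sg_def by (rule hopf.conv2_memI[OF base.module_A sigma_bilinear])

lemma Sg'_closed [simp]: "Sg' \<in> carrier CCB"
  unfolding Sg'_def by (rule hopf.conv2_memI[OF base.module_A sigma_inv_bilinear])

lemma al_closed [simp]: "b \<in> cB ==> al b \<in> carrier CB"
  unfolding al_def by (rule hopf.conv_memI[OF bil_D(2)[OF act_bilinear]])

text \<open>This is \<open>act_mult\<close> and \<open>act_one\<close>, read in Hom(H, B).\<close>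

lemma al_hom: "algebra_hom k B CB al"
proof (rule hom_I)
  show "lin B CB al"
    unfolding al_def
    by (rule hopf.lin_into_conv[OF base.module_A bil_swap[OF act_bilinear] base.module_A])
next
  fix x y assume xy: "x \<in> cB" "y \<in> cB"
  show "al (x \<cdot> y) = al x *\<^sub>1 al y"
  proof (rule conv_eqI[where R = B])
    fix h assume h: "h \<in> cH"
    have "(al x *\<^sub>1 al y) h = sw B (%h1 h2. act h1 x \<cdot> act h2 y) h"
      by (rule hopf.conv_mult_eq[OF algebra_B]) (simp_all add: xy h)
    then show "al (x \<cdot> y) h = (al x *\<^sub>1 al y) h"
      using h xy by (simp add: act_mult)
  qed (use xy in \<open>auto intro!: CB.m_closed\<close>)
next
  show "al 1\<^sub>B = \<one>\<^bsub>CB\<^esub>"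
    by (rule conv_eqI[where R = B]) (auto simp: conv_apply act_one)
qed

lemmas mstar_hom_B = hopf.mstar_hom[OF algebra_B]
lemmas hat_hom = hopf.hatm_hom[OF algebra_B al_hom]

text \<open>The two ways of acting twice on b: one element after the other for \<open>Dm\<close>, by
  the product of both for \<open>Em\<close>.\<close>

definition Dm :: "'b \<Rightarrow> 'h \<Rightarrow> 'h \<Rightarrow> 'b" where "Dm b = hatm al (al b)"
definition Em :: "'b \<Rightarrow> 'h \<Rightarrow> 'h \<Rightarrow> 'b" where "Em b = mstar (al b)"

abbreviation hat :: "('h \<Rightarrow> 'b) \<Rightarrow> 'h \<Rightarrow> 'h \<Rightarrow> 'b" where "hat \<equiv> hatm al"

lemma hat_closed [simp]: "f \<in> carrier CB ==> hat f \<in> carrier CCB"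
  by (rule hom_D(4)[OF hat_hom])

lemma mst_closed [simp]: "f \<in> carrier CB ==> mstar f \<in> carrier CCB"
  by (rule hom_D(4)[OF mstar_hom_B])

lemma Dm_closed [simp]: "b \<in> cB ==> Dm b \<in> carrier CCB"
  by (simp add: Dm_def)

lemma Em_closed [simp]: "b \<in> cB ==> Em b \<in> carrier CCB"
  by (simp add: Em_def)

lemma Sg_inv: "Sg *\<^sub>2 Sg' = \<one>\<^bsub>CCB\<^esub>" "Sg' *\<^sub>2 Sg = \<one>\<^bsub>CCB\<^esub>"
proof -
  have *: "(eps \<otimes>\<^bsub>k\<^esub> eps') \<odot>\<^bsub>B\<^esub> 1\<^sub>B = eps \<odot>\<^bsub>B\<^esub> (eps' \<odot>\<^bsub>B\<^esub> 1\<^sub>B)"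
    if "eps \<in> carrier k" "eps' \<in> carrier k" for eps eps'
    using that by (simp add: base.smult_assoc1)
  show "Sg *\<^sub>2 Sg' = \<one>\<^bsub>CCB\<^esub>"
  proof (rule hopf.conv2_eqI[where R = B])
    fix h g assume hg: "h \<in> cH" "g \<in> cH"
    have "(Sg *\<^sub>2 Sg') h g = sw B (%x y. sw B (%a b. \<sigma> x a \<cdot> \<sigma>' y b) g) h"
      by (rule hopf.conv2_mult_eq[OF algebra_B]) (simp_all add: hg)
    then show "(Sg *\<^sub>2 Sg') h g = \<one>\<^bsub>CCB\<^esub> h g"
      using hg by (simp add: sigma_inv_right conv_apply *)
  qed auto
  show "Sg' *\<^sub>2 Sg = \<one>\<^bsub>CCB\<^esub>"
  proof (rule hopf.conv2_eqI[where R = B])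
    fix h g assume hg: "h \<in> cH" "g \<in> cH"
    have "(Sg' *\<^sub>2 Sg) h g = sw B (%x y. sw B (%a b. \<sigma>' x a \<cdot> \<sigma> y b) g) h"
      by (rule hopf.conv2_mult_eq[OF algebra_B]) (simp_all add: hg)
    then show "(Sg' *\<^sub>2 Sg) h g = \<one>\<^bsub>CCB\<^esub> h g"
      using hg by (simp add: sigma_inv_left conv_apply *)
  qed auto
qed

lemma Dm_eq:
  assumes b: "b \<in> cB"
  shows "Dm b = Sg *\<^sub>2 (Em b *\<^sub>2 Sg')"
proof (rule hopf.conv2_eqI[where R = B])
  fix h g assume hg: "h \<in> cH" "g \<in> cH"
  have "Dm b h g = act h (act g b)"
    using hg by (simp add: Dm_def)
  also have "... = (Sg *\<^sub>2 (Em b *\<^sub>2 Sg')) h g"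
    unfolding act_act[OF hg b]
    by (rule hopf.conv2_triple[symmetric, OF algebra_B]) (simp_all add: b hg Em_def)
  finally show "Dm b h g = (Sg *\<^sub>2 (Em b *\<^sub>2 Sg')) h g" .
qed (use b in auto)

text \<open>The twisted module condition with \<sigma>' cancelled: \<sigma> intertwines the two
  double actions. All later passages of an action across the cocycle take this form or that of
  \<open>Sg'_Dm\<close>.\<close>

lemma Dm_Sg: "b \<in> cB ==> Dm b *\<^sub>2 Sg = Sg *\<^sub>2 Em b"
  by (simp add: Dm_eq CCB.m_assoc Sg_inv)

lemma Sg'_Dm: "b \<in> cB ==> Sg' *\<^sub>2 Dm b = Em b *\<^sub>2 Sg'"
  by (simp add: Dm_eq CCB.m_assoc[symmetric] Sg_inv)

subsection \<open>The cocycle condition in the convolution algebra\<close>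

abbreviation St :: "'h \<Rightarrow> 'h \<Rightarrow> 'b" where "St \<equiv> flip Sg"
abbreviation St' :: "'h \<Rightarrow> 'h \<Rightarrow> 'b" where "St' \<equiv> flip Sg'"

text \<open>A cyclic shift that makes the last argument f the outermost one. For fixed f the cocycle
  condition becomes an equation in Hom(H \<otimes> H, B), where \<open>hat\<close> and
  \<open>mstar\<close> are available as algebra maps.\<close>

definition rot :: "('h \<Rightarrow> 'h \<Rightarrow> 'h \<Rightarrow> 'b) \<Rightarrow> 'h \<Rightarrow> 'h \<Rightarrow> 'h \<Rightarrow> 'b"
  where "rot F = flip (cmap flip F)"

lemma rot_apply: "[|f \<in> cH; h \<in> cH; g \<in> cH|] ==> rot F f h g = F h g f"
  by (simp add: rot_def)

lemma algebra_hom_comp: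
  "[|algebra_hom k P Q f; algebra_hom k Q R' g|] ==> algebra_hom k P R' (%x. g (f x))"
  by (rule hom_I) (auto intro: lin_comp hom_D(1) simp: hom_D)

lemma rot_hom: "algebra_hom k CCCB CCCB rot"
  unfolding rot_def
  by (rule algebra_hom_comp[OF cmap_hom[OF algebra_CCB algebra_CCB hopf.flip_hom[OF algebra_B]] hopf.flip_hom[OF algebra_CB]])

lemmas hat2_hom = hopf.hatm_hom[OF algebra_CB hat_hom]
lemmas cmstar_hom = cmap_hom[OF algebra_CB algebra_CCB mstar_hom_B]
lemmas chat_hom = cmap_hom[OF algebra_CB algebra_CCB hat_hom]
lemmas mstar_hom_CB = hopf.mstar_hom[OF algebra_CB]
lemmas ciota_hom = cmap_hom[OF algebra_CB algebra_CCB cmap_hom[OF algebra_B algebra_CB iota_hom[OF algebra_B]]]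
lemmas flip_hom_B = hopf.flip_hom[OF algebra_B]
lemmas iota_hom_CCB = iota_hom[OF algebra_CCB]

text \<open>The pullback of F along the multiplication in its second argument, (h, g, f) \<mapsto>
  F(h, gf), in rotated form.\<close>

definition A2 :: "('h \<Rightarrow> 'h \<Rightarrow> 'b) \<Rightarrow> 'h \<Rightarrow> 'h \<Rightarrow> 'h \<Rightarrow> 'b"
  where "A2 F = rot (cmap mstar F)"

lemma A2_hom: "algebra_hom k CCB CCCB A2"
  unfolding A2_def by (rule algebra_hom_comp[OF cmstar_hom rot_hom])

lemma A2_apply:
  "[|f \<in> cH; h \<in> cH; g \<in> cH|] ==> A2 F f h g = F h (g \<otimes>\<^bsub>H\<^esub> f)"
  by (simp add: A2_def rot_apply)

lemma St_closed [simp]: "St \<in> carrier CCB" "St' \<in> carrier CCB"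
  by (simp_all add: hom_D(4)[OF flip_hom_B])

lemma col_closed [simp]: "f \<in> cH ==> St f \<in> carrier CB" "f \<in> cH ==> St' f \<in> carrier CB"
  by (auto intro: conv_closed)

text \<open>The four factors h \<triangleright> \<sigma>(g, f), \<sigma>(h, gf), \<sigma>(h, g) and
  \<sigma>(hg, f) are written as elements of Hom(H \<otimes> H \<otimes> H, B). Since \<sigma>(h, g)
  ignores f, it enters with the counit of f, through \<open>iota\<close>.\<close>

lemma cocycle_conv:
  "hatm hat Sg *\<^sub>3 cmap mstar Sg = cmap (cmap (iota B)) Sg *\<^sub>3 mstar Sg"
proof -
  let ?C1 = "hatm hat Sg" and ?C2 = "cmap mstar Sg"
  let ?C3 = "cmap (cmap (iota B)) Sg" and ?C4 = "mstar Sg"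
  have cl: "?C1 \<in> carrier CCCB" "?C2 \<in> carrier CCCB" "?C3 \<in> carrier CCCB" "?C4 \<in> carrier CCCB"
    by (rule hom_D(4)[OF hat2_hom Sg_closed] hom_D(4)[OF cmstar_hom Sg_closed]
        hom_D(4)[OF ciota_hom Sg_closed] hom_D(4)[OF mstar_hom_CB Sg_closed])+
  note M = base.module_A
  show ?thesis
  proof (rule conv3_eqI[where R = B])
    fix h g f assume hgf: "h \<in> cH" "g \<in> cH" "f \<in> cH"
    note ev = conv_eval_linear[OF hgf(3)]
    note cb = hopf.conv2_pre[OF algebra_CB]
    have "(?C1 *\<^sub>3 ?C2) h g f = sw B (%x y. sw B (%a b. (?C1 x a *\<^sub>1 ?C2 y b) f) g) h"
      by (rule hopf.conv2_mult_post[OF algebra_CB M ev cl(1,2) hgf(1,2)])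
    also have "... = sw B (%h1 h2. sw B (%g1 g2. sw B (%f1 f2.
          act h1 (\<sigma> g1 f1) \<cdot> \<sigma> h2 (g2 \<otimes>\<^bsub>H\<^esub> f2)) f) g) h"
    proof (rule sw_cong[OF M _ hgf(1)])
      show "bil H H B (%x y. sw B (%a b. (?C1 x a *\<^sub>1 ?C2 y b) f) g)"
        by (rule hopf.conv2_post_pre[OF algebra_CB M ev cl(1,2) hgf(2)])
      fix x y assume xy: "x \<in> cH" "y \<in> cH"
      show "sw B (%a b. (?C1 x a *\<^sub>1 ?C2 y b) f) g = sw B (%g1 g2. sw B (%f1 f2.
          act x (\<sigma> g1 f1) \<cdot> \<sigma> y (g2 \<otimes>\<^bsub>H\<^esub> f2)) f) g"
      proof (rule sw_cong[OF M bil_post[OF ev cb(1)[OF cl(1,2) xy]] hgf(2)])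
        fix a b assume ab: "a \<in> cH" "b \<in> cH"
        have "?C1 x a \<in> carrier CB" "?C2 y b \<in> carrier CB"
          using conv_closed[OF conv_closed[OF cl(1) xy(1)] ab(1)]
            conv_closed[OF conv_closed[OF cl(2) xy(2)] ab(2)] by simp_all
        then show "(?C1 x a *\<^sub>1 ?C2 y b) f = sw B (%f1 f2. act x (\<sigma> a f1) \<cdot> \<sigma> y (b \<otimes>\<^bsub>H\<^esub> f2)) f"
          by (rule hopf.conv_mult_eq[OF algebra_B _ _ hgf(3)]) (simp_all add: xy ab)
      qed
    qed
    also have "... = sw B (%h1 h2. sw B (%g1 g2. \<sigma> h1 g1 \<cdot> \<sigma> (h2 \<otimes>\<^bsub>H\<^esub> g2) f) g) h"
      by (rule sigma_cocycle[OF hgf])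
    also have "... = sw B (%x y. sw B (%a b. (?C3 x a *\<^sub>1 ?C4 y b) f) g) h"
    proof (rule sw_cong[symmetric, OF M _ hgf(1)])
      show "bil H H B (%x y. sw B (%a b. (?C3 x a *\<^sub>1 ?C4 y b) f) g)"
        by (rule hopf.conv2_post_pre[OF algebra_CB M ev cl(3,4) hgf(2)])
      fix x y assume xy: "x \<in> cH" "y \<in> cH"
      show "sw B (%a b. (?C3 x a *\<^sub>1 ?C4 y b) f) g = sw B (%g1 g2. \<sigma> x g1 \<cdot> \<sigma> (y \<otimes>\<^bsub>H\<^esub> g2) f) g"
      proof (rule sw_cong[OF M bil_post[OF ev cb(1)[OF cl(3,4) xy]] hgf(2)])
        fix a b assume ab: "a \<in> cH" "b \<in> cH"
        have "Sg (y \<otimes>\<^bsub>H\<^esub> b) \<in> carrier CB" using xy ab by (auto intro: conv_closed)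
        then show "(?C3 x a *\<^sub>1 ?C4 y b) f = \<sigma> x a \<cdot> \<sigma> (y \<otimes>\<^bsub>H\<^esub> b) f"
          using xy ab hgf by (simp add: iota_mult_apply[OF algebra_B])
      qed
    qed
    also have "... = (?C3 *\<^sub>3 ?C4) h g f"
      by (rule hopf.conv2_mult_post[symmetric, OF algebra_CB M ev cl(3,4) hgf(1,2)])
    finally show "(?C1 *\<^sub>3 ?C2) h g f = (?C3 *\<^sub>3 ?C4) h g f" .
  qed (auto intro!: cl CCCB.m_closed)
qed

lemma rot_images:
  assumes F: "F \<in> carrier CCB"
  shows "rot (hatm hat F) = cmap hat (flip F)"
    and "rot (cmap (cmap (iota B)) F) = iota CCB F"
    and "rot (mstar F) = cmap mstar (flip F)"
proof -
  note r = hom_D(4)[OF rot_hom]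
  have fF: "flip F \<in> carrier CCB" by (rule hom_D(4)[OF flip_hom_B F])
  show "rot (hatm hat F) = cmap hat (flip F)"
  proof (rule conv3_eqI[where R = B])
    fix f h g assume *: "f \<in> cH" "h \<in> cH" "g \<in> cH"
    have "flip F f g = F g f" using * by simp
    then show "rot (hatm hat F) f h g = cmap hat (flip F) f h g"
      using * by (simp add: rot_apply)
  qed (auto intro!: r hom_D(4)[OF hat2_hom] hom_D(4)[OF chat_hom] F fF)
  show "rot (cmap (cmap (iota B)) F) = iota CCB F"
    by (rule conv3_eqI[where R = B])
       (auto intro!: r hom_D(4)[OF ciota_hom] hom_D(4)[OF iota_hom_CCB] F simp: rot_apply conv_apply)
  show "rot (mstar F) = cmap mstar (flip F)"
    by (rule conv3_eqI[where R = B])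
       (auto intro!: r hom_D(4)[OF mstar_hom_CB] hom_D(4)[OF cmstar_hom] F fF simp: rot_apply)
qed

lemma cocycle_rot:
  "cmap hat St *\<^sub>3 A2 Sg = iota CCB Sg *\<^sub>3 cmap mstar St"
proof -
  have "rot (hatm hat Sg *\<^sub>3 cmap mstar Sg)
    = rot (cmap (cmap (iota B)) Sg *\<^sub>3 mstar Sg)"
    by (simp add: cocycle_conv)
  then show ?thesis
    by (simp add: hom_D(2)[OF rot_hom] hom_D(4)[OF hat2_hom] hom_D(4)[OF cmstar_hom]
        hom_D(4)[OF ciota_hom] hom_D(4)[OF mstar_hom_CB] rot_images A2_def)
qed

lemma St_inv: "St *\<^sub>2 St' = \<one>\<^bsub>CCB\<^esub>" "St' *\<^sub>2 St = \<one>\<^bsub>CCB\<^esub>"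
  by (simp_all add: hom_D(2)[OF flip_hom_B, symmetric] Sg_inv hom_D(3)[OF flip_hom_B])

lemma hom_inv:
  assumes "algebra_hom k P Q f" "x \<in> carrier P" "y \<in> carrier P" "x \<otimes>\<^bsub>P\<^esub> y = \<one>\<^bsub>P\<^esub>"
  shows "f x \<otimes>\<^bsub>Q\<^esub> f y = \<one>\<^bsub>Q\<^esub>"
  by (simp add: hom_D(2)[OF assms(1-3), symmetric] assms(4) hom_D(3)[OF assms(1)])

lemma cocycle_rot_closed:
  "cmap hat St \<in> carrier CCCB" "cmap hat St' \<in> carrier CCCB"
  "A2 Sg \<in> carrier CCCB" "A2 Sg' \<in> carrier CCCB"
  "iota CCB Sg \<in> carrier CCCB" "iota CCB Sg' \<in> carrier CCCB"
  "cmap mstar St \<in> carrier CCCB" "cmap mstar St' \<in> carrier CCCB"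
  by (auto intro!: hom_D(4)[OF chat_hom] hom_D(4)[OF A2_hom] hom_D(4)[OF iota_hom_CCB]
      hom_D(4)[OF cmstar_hom])

text \<open>All four factors are convolution invertible. Cancelling the outer ones leaves the
  relation between h \<triangleright> \<sigma>'(g, f) . \<sigma>(h, g) and \<sigma>(h, gf) .
  \<sigma>'(hg, f), Sweedler legs understood, which is needed to undo \<open>qq\<close>.\<close>

lemma cocycle_rot_inv1:
  "cmap hat St' *\<^sub>3 iota CCB Sg = A2 Sg *\<^sub>3 cmap mstar St'"
proof -
  let ?c1 = "cmap hat St" and ?c1' = "cmap hat St'" and ?c2 = "A2 Sg"
    and ?c3 = "iota CCB Sg" and ?c4 = "cmap mstar St" and ?c4' = "cmap mstar St'"
  note cl = cocycle_rot_closed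
  have i1: "?c1' *\<^sub>3 ?c1 = \<one>\<^bsub>CCCB\<^esub>" by (rule hom_inv[OF chat_hom]) (simp_all add: St_inv)
  have i4: "?c4 *\<^sub>3 ?c4' = \<one>\<^bsub>CCCB\<^esub>" by (rule hom_inv[OF cmstar_hom]) (simp_all add: St_inv)
  have "?c1' *\<^sub>3 ?c3 = ?c1' *\<^sub>3 (?c3 *\<^sub>3 ?c4) *\<^sub>3 ?c4'"
    using cl i4 by (simp add: CCCB.m_assoc)
  also have "... = (?c1' *\<^sub>3 ?c1) *\<^sub>3 ?c2 *\<^sub>3 ?c4'"
    using cl by (simp add: CCCB.m_assoc cocycle_rot[symmetric])
  also have "... = ?c2 *\<^sub>3 ?c4'"
    using cl i1 by simp
  finally show ?thesis .
qed

text \<open>The other rearrangement, relating \<sigma>'(h, g) . (h \<triangleright> \<sigma>(g, f))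
  to \<sigma>(hg, f) . \<sigma>'(h, gf). It governs expressions in which \<sigma>' stands to the
  left of an action on \<open>Tau\<close>.\<close>

lemma cocycle_rot_inv2:
  "iota CCB Sg' *\<^sub>3 cmap hat St = cmap mstar St *\<^sub>3 A2 Sg'"
proof -
  let ?c1 = "cmap hat St" and ?c2 = "A2 Sg" and ?c2' = "A2 Sg'" and ?c3 = "iota CCB Sg"
    and ?c3' = "iota CCB Sg'" and ?c4 = "cmap mstar St"
  note cl = cocycle_rot_closed
  have i3: "?c3' *\<^sub>3 ?c3 = \<one>\<^bsub>CCCB\<^esub>" by (rule hom_inv[OF iota_hom_CCB]) (simp_all add: Sg_inv)
  have i2: "?c2 *\<^sub>3 ?c2' = \<one>\<^bsub>CCCB\<^esub>" by (rule hom_inv[OF A2_hom]) (simp_all add: Sg_inv)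
  have "?c3' *\<^sub>3 ?c1 = ?c3' *\<^sub>3 (?c1 *\<^sub>3 ?c2) *\<^sub>3 ?c2'"
    using cl i2 by (simp add: CCCB.m_assoc)
  also have "... = (?c3' *\<^sub>3 ?c3) *\<^sub>3 ?c4 *\<^sub>3 ?c2'"
    using cl by (simp add: CCCB.m_assoc cocycle_rot)
  also have "... = ?c4 *\<^sub>3 ?c2'"
    using cl i3 by simp
  finally show ?thesis .
qed

lemma cocycle_at:
  assumes f: "f \<in> cH"
  shows "sw CCB (%x y. hat (St x) *\<^sub>2 A2 Sg y) f = Sg *\<^sub>2 mstar (St f)"
proof -
  have "(cmap hat St *\<^sub>3 A2 Sg) f = sw CCB (%x y. hat (St x) *\<^sub>2 A2 Sg y) f"
    by (rule hopf.conv_mult_eq[OF algebra_CCB]) (use cocycle_rot_closed f in auto)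
  moreover have "(iota CCB Sg *\<^sub>3 cmap mstar St) f = Sg *\<^sub>2 mstar (St f)"
    using iota_mult_apply(1)[OF algebra_CCB Sg_closed cocycle_rot_closed(7) f] f by simp
  ultimately show ?thesis by (simp add: cocycle_rot)
qed

lemma cocycle_inv1_at:
  assumes f: "f \<in> cH"
  shows "hat (St' f) *\<^sub>2 Sg = sw CCB (%x y. A2 Sg x *\<^sub>2 mstar (St' y)) f"
proof -
  have "(A2 Sg *\<^sub>3 cmap mstar St') f = sw CCB (%x y. A2 Sg x *\<^sub>2 mstar (St' y)) f"
    by (rule hopf.conv_mult_eq[OF algebra_CCB]) (use cocycle_rot_closed f in auto)
  moreover have "(cmap hat St' *\<^sub>3 iota CCB Sg) f = hat (St' f) *\<^sub>2 Sg"
    using iota_mult_apply(2)[OF algebra_CCB Sg_closed cocycle_rot_closed(2) f] f by simp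
  ultimately show ?thesis by (simp add: cocycle_rot_inv1)
qed

text \<open>Evaluate the convolution product of \<sigma>' and \<sigma>, which is the unit, at (h,
  1): the normalisation of \<sigma> reduces the second factor to a counit.\<close>

lemma sigma'_one_right: "h \<in> cH ==> \<sigma>' h 1\<^sub>H = counit H h \<odot>\<^bsub>B\<^esub> 1\<^sub>B"
proof -
  assume h: "h \<in> cH"
  note M = base.module_A
  have s1: "lin H B (%x. \<sigma>' x 1\<^sub>H)" by (rule bil_D(2)[OF sigma_inv_bilinear]) simp
  have "\<one>\<^bsub>CCB\<^esub> h 1\<^sub>H = (Sg' *\<^sub>2 Sg) h 1\<^sub>H" by (simp add: Sg_inv)
  also have "... = sw B (%x y. sw B (%a b. Sg' x a \<cdot> Sg y b) 1\<^sub>H) h"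
    by (rule hopf.conv2_mult_apply[OF algebra_B]) (simp_all add: h)
  also have "... = sw B (%x y. counit H y \<odot>\<^bsub>B\<^esub> \<sigma>' x 1\<^sub>H) h"
    by (rule sw_cong[OF M hopf.conv2_pre(3)[OF algebra_B] h])
       (simp_all add: hopf.sw_one[OF M hopf.conv2_pre(1)[OF algebra_B]] sigma_one_right base.smult_mult_right)
  also have "... = \<sigma>' h 1\<^sub>H"
    by (rule hopf.sw_counit_right[OF M s1 h])
  finally show ?thesis using h by (simp add: conv_apply)
qed

lemma sigma'_one_left: "h \<in> cH ==> \<sigma>' 1\<^sub>H h = counit H h \<odot>\<^bsub>B\<^esub> 1\<^sub>B"
proof -
  assume h: "h \<in> cH"
  note M = base.module_A
  have s1: "lin H B (%x. \<sigma>' 1\<^sub>H x)" by (rule bil_D(1)[OF sigma_inv_bilinear]) simp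
  have "\<one>\<^bsub>CCB\<^esub> 1\<^sub>H h = (Sg' *\<^sub>2 Sg) 1\<^sub>H h" by (simp add: Sg_inv)
  also have "... = sw B (%x y. sw B (%a b. Sg' x a \<cdot> Sg y b) h) 1\<^sub>H"
    by (rule hopf.conv2_mult_apply[OF algebra_B]) (simp_all add: h)
  also have "... = sw B (%a b. Sg' 1\<^sub>H a \<cdot> Sg 1\<^sub>H b) h"
    by (rule hopf.sw_one[OF M hopf.conv2_pre(3)[OF algebra_B]]) (simp_all add: h)
  also have "... = sw B (%x y. counit H y \<odot>\<^bsub>B\<^esub> \<sigma>' 1\<^sub>H x) h"
    by (rule sw_cong[OF M hopf.conv2_pre(1)[OF algebra_B] h])
       (simp_all add: sigma_one_left base.smult_mult_right)
  also have "... = \<sigma>' 1\<^sub>H h"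
    by (rule hopf.sw_counit_right[OF M s1 h])
  finally show ?thesis using h by (simp add: conv_apply)
qed

end

context hopf_algebra
begin

lemma mstar_at:
  assumes R: "unital_algebra k R" and F: "F \<in> carrier (C R)" and G: "G \<in> carrier (C R)"
  shows "mstar (F \<otimes>\<^bsub>C R\<^esub> G) = mstar F \<otimes>\<^bsub>C (C R)\<^esub> mstar G"
  by (rule hom_D(2)[OF mstar_hom[OF R] F G])

lemma sw_absorb_left:
  assumes M: "module k M" and F: "bil H H M F" and f: "lin H M f" and h: "h \<in> cH"
    and eq: "!!x y. [|x \<in> cH; y \<in> cH|] ==> F x y = eps x \<odot>\<^bsub>M\<^esub> f y"
  shows "sw M F h = f h"
  using sw_cong[OF M F h eq] sw_counit_left[OF M f h] by simp

lemma sw_absorb_right: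
  assumes M: "module k M" and F: "bil H H M F" and f: "lin H M f" and h: "h \<in> cH"
    and eq: "!!x y. [|x \<in> cH; y \<in> cH|] ==> F x y = eps y \<odot>\<^bsub>M\<^esub> f x"
  shows "sw M F h = f h"
  using sw_cong[OF M F h eq] sw_counit_right[OF M f h] by simp

end

section \<open>The change of the second coefficient between the two bases\<close>

context cocycle_cross_product
begin

text \<open>In Sweedler notation \<open>Tau h\<close> is \<sigma>(h1, S h2), \<open>pp b h\<close>
  is (h1 \<triangleright> b)\<sigma>(h2, S h3) and \<open>qq c h\<close> is \<sigma>'(S h2, h3)(S h1
  \<triangleright> c). The first two are the prescribed counits of 1 \<otimes> 1 # h and 1 \<otimes>
  b # h.\<close>

definition Tau :: "'h \<Rightarrow> 'b" where "Tau = (\<lambda>h\<in>cH. con B Sg h)"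
definition pp :: "'b \<Rightarrow> 'h \<Rightarrow> 'b" where "pp b h = (al b *\<^sub>1 Tau) h"
definition qq :: "'b \<Rightarrow> 'h \<Rightarrow> 'b" where "qq c h = sw B (%x y. (St' y *\<^sub>1 al c) (antipode H x)) h"

abbreviation S :: "'h \<Rightarrow> 'h" where "S \<equiv> antipode H"
abbreviation eps :: "'h \<Rightarrow> 'k" where "eps \<equiv> counit H"

lemma Tau_closed [simp]: "Tau \<in> carrier CB"
  unfolding Tau_def by (rule hopf.conv_memI[OF hopf.con_linear[OF base.module_A conv2_bilinear[OF Sg_closed]]])

lemma Tau_apply: "h \<in> cH ==> Tau h = con B Sg h"
  by (simp add: Tau_def)

lemma Tau_sw: "h \<in> cH ==> Tau h = sw B (%x y. \<sigma> x (S y)) h"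
  unfolding Tau_apply con_def
  by (rule sw_cong[OF base.module_A bil_comp[OF conv2_bilinear[OF Sg_closed] lin_id S_linear]]) simp_all

lemma Tau_h_closed [simp]: "h \<in> cH ==> Tau h \<in> cB"
  by (rule conv_closed[OF Tau_closed])

lemma pp_conv: "b \<in> cB ==> al b *\<^sub>1 Tau \<in> carrier CB"
  by (simp add: CB.m_closed)

lemma pp_bilinear: "bil B H B pp"
proof (rule bil_I)
  fix b assume "b \<in> cB"
  then show "lin H B (pp b)"
    unfolding pp_def by (rule conv_linear[OF pp_conv])
next
  fix h assume h: "h \<in> cH"
  show "lin B B (%b. pp b h)"
    unfolding pp_def
    by (rule lin_comp[OF conv_eval_linear[OF h]])
       (auto intro!: CB.linear_mult_left hom_D(1)[OF al_hom])
qed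

lemma pp_closed [simp]: "[|b \<in> cB; h \<in> cH|] ==> pp b h \<in> cB"
  by (rule bil_closed[OF pp_bilinear])

lemma pp_sw:
  assumes "b \<in> cB" "h \<in> cH"
  shows "pp b h = sw B (%x y. act x b \<cdot> Tau y) h"
  unfolding pp_def by (rule hopf.conv_mult_eq[OF algebra_B]) (simp_all add: assms)

lemma St'_linear: "lin H CB St'"
  by (rule conv_linear) simp

lemma St_linear: "lin H CB St"
  by (rule conv_linear) simp

lemma qq_inner_linear:
  assumes c: "c \<in> cB"
  shows "lin H CB (%y. St' y *\<^sub>1 al c)"
  by (rule CB.linear_mult_left[OF St'_linear]) (simp add: c)

lemma qq_inner_bilinear:
  assumes c: "c \<in> cB"
  shows "bil H H B (%x y. (St' y *\<^sub>1 al c) (S x))"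
  by (rule bil_I)
     (auto intro!: lin_comp[OF conv_eval_linear qq_inner_linear[OF c]] hopf.conv_lin S_linear
        lin_closed[OF qq_inner_linear[OF c]])

lemma qq_bilinear: "bil B H B qq"
proof (rule bil_I)
  fix b assume "b \<in> cB"
  then show "lin H B (qq b)"
    unfolding qq_def by (rule sw_linear[OF base.module_A qq_inner_bilinear])
next
  fix h assume h: "h \<in> cH"
  show "lin B B (%b. qq b h)"
    unfolding qq_def
  proof (rule sw_param_linear[OF base.module_A base.module_A qq_inner_bilinear _ h])
    fix x y assume xy: "x \<in> cH" "y \<in> cH"
    have "lin B CB (%w. St' y *\<^sub>1 al w)"
      by (rule CB.linear_mult_right[OF hom_D(1)[OF al_hom]]) (simp add: xy)
    from lin_comp[OF conv_eval_linear this, of "S x"]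
    show "lin B B (%w. (St' y *\<^sub>1 al w) (S x))"
      using xy by simp
  qed
qed

lemma qq_closed [simp]: "[|b \<in> cB; h \<in> cH|] ==> qq b h \<in> cB"
  by (rule bil_closed[OF qq_bilinear])

lemma act_linear_right: "[|lin W B f; h \<in> cH|] ==> lin W B (%x. act h (f x))"
  by (rule bil_right[OF act_bilinear])

lemma act_linear_left: "[|lin W H f; b \<in> cB|] ==> lin W B (%x. act (f x) b)"
  by (rule bil_left[OF act_bilinear])

lemma sigma_linear_right: "[|lin W H f; h \<in> cH|] ==> lin W B (%x. \<sigma> h (f x))"
  by (rule bil_right[OF sigma_bilinear])

lemma sigma_linear_left: "[|lin W H f; h \<in> cH|] ==> lin W B (%x. \<sigma> (f x) h)"
  by (rule bil_left[OF sigma_bilinear])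

lemma Tau_linear: "lin W H f ==> lin W B (%x. Tau (f x))"
  by (rule hopf.conv_lin[OF Tau_closed])

lemma pp_leg:
  assumes f: "lin H B f" and h: "h \<in> cH"
  shows "sw B (%x y. pp (f y) x) h = sw B (%a w. sw B (%z y. act a (f y) \<cdot> Tau z) w) h"
proof -
  note M = base.module_A
  have fc: "f y \<in> cB" if "y \<in> cH" for y by (rule lin_closed[OF f that])
  have tri: "tril H H H B (%a z y. act a (f y) \<cdot> Tau z)"
    by (rule tril_I)
       (auto intro!: base.linear_mult_left base.linear_mult_right act_linear_left act_linear_right Tau_linear lin_id f simp: fc)
  have "sw B (%x y. pp (f y) x) h = sw B (%x y. sw B (%a z. act a (f y) \<cdot> Tau z) x) h"
    by (rule sw_cong[OF M _ h])
       (auto intro!: bil_swap[OF bil_comp[OF pp_bilinear f lin_id]] simp: pp_sw fc)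
  also have "... = sw B (%a w. sw B (%z y. act a (f y) \<cdot> Tau z) w) h"
    by (rule sw_coassoc[OF M tri h])
  finally show ?thesis .
qed

text \<open>Written out, the sum is h1 \<triangleright> (S h4 \<triangleright> c) . \<sigma>(h2, S
  h3), the contraction of \<open>Dm c\<close> times the cocycle. The twisted module condition brings
  \<sigma> to the left, and the remaining action is by a product that contracts to the unit.\<close>

lemma pp_act_S:
  assumes c: "c \<in> cB" and h: "h \<in> cH"
  shows "sw B (%x y. pp (act (S y) c) x) h = Tau h \<cdot> c"
proof -
  note M = base.module_A
  have f: "lin H B (%y. act (S y) c)"
    by (rule act_linear_left[OF S_linear c])
  have "sw B (%x y. pp (act (S y) c) x) h
    = sw B (%a w. sw B (%z y. act a (act (S y) c) \<cdot> Tau z) w) h"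
    by (rule pp_leg[OF f h])
  also have "... = sw B (%a w. sw B (%z y. Dm c a (S y) \<cdot> con B Sg z) w) h"
  proof (rule sw_cong[OF M _ h])
    show "bil H H B (%a w. sw B (%z y. act a (act (S y) c) \<cdot> Tau z) w)"
      by (rule sw_right_bilinear[OF M], rule tril_I)
         (auto intro!: base.linear_mult_left base.linear_mult_right act_linear_left act_linear_right Tau_linear lin_id S_linear simp: c)
    fix a w assume aw: "a \<in> cH" "w \<in> cH"
    show "sw B (%z y. act a (act (S y) c) \<cdot> Tau z) w = sw B (%z y. Dm c a (S y) \<cdot> con B Sg z) w"
      by (rule sw_cong[OF M _ aw(2)])
         (auto intro!: bil_I base.linear_mult_left base.linear_mult_right act_linear_left act_linear_right Tau_linear lin_id S_linear
            simp: c aw Dm_def simp flip: Tau_apply)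
  qed
  also have "... = con B (Dm c *\<^sub>2 Sg) h"
    by (rule hopf.con_mult[symmetric, OF algebra_B _ _ h]) (simp_all add: c)
  also have "... = con B (Sg *\<^sub>2 mstar (al c)) h"
    by (simp add: Dm_Sg c Em_def)
  also have "... = Tau h \<cdot> c"
    using hopf.con_C0[OF algebra_B Sg_closed al_closed[OF c] h] by (simp add: Tau_apply h one_act c)
  finally show ?thesis .
qed

text \<open>After the twisted module condition and the rearranged cocycle identity, the factor
  \<sigma>'(hg, f2) and the action on c depend on the contracted arguments only through their
  product. \<open>con_C0\<close> evaluates them at the unit, where \<sigma>'(1, f2) is a
  counit.\<close>

lemma con_inv1:
  assumes c: "c \<in> cB" and f: "f \<in> cH" and z: "z \<in> cH"
  shows "con B (hat (St' f *\<^sub>1 al c) *\<^sub>2 Sg) z = con B (A2 Sg f) z \<cdot> c"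
proof -
  note M = base.module_A
  have A2c: "A2 Sg x \<in> carrier CCB" if "x \<in> cH" for x
    by (rule conv_closed[OF cocycle_rot_closed(3) that])
  have b: "bil H H CCB (%x y. A2 Sg x *\<^sub>2 mstar (St' y))"
  proof (rule bil_comp[OF CCB.mult_bilinear])
    show "lin H CCB (A2 Sg)" by (rule conv_linear[OF cocycle_rot_closed(3)])
    show "lin H CCB (%y. mstar (St' y))"
      by (rule lin_comp[OF hom_D(1)[OF mstar_hom_B] St'_linear])
  qed
  have "hat (St' f *\<^sub>1 al c) *\<^sub>2 Sg = hat (St' f) *\<^sub>2 (Dm c *\<^sub>2 Sg)"
    by (simp add: hom_D(2)[OF hat_hom] f c CCB.m_assoc Dm_def)
  also have "... = (hat (St' f) *\<^sub>2 Sg) *\<^sub>2 Em c"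
    by (simp add: Dm_Sg c f CCB.m_assoc)
  also have "... = sw CCB (%x y. (A2 Sg x *\<^sub>2 mstar (St' y)) *\<^sub>2 Em c) f"
    unfolding cocycle_inv1_at[OF f]
    by (rule sw_post[OF CCB.module_A CCB.module_A _ b f]) (auto intro!: CCB.linear_mult_left lin_id simp: c)
  finally have eq: "hat (St' f *\<^sub>1 al c) *\<^sub>2 Sg
    = sw CCB (%x y. (A2 Sg x *\<^sub>2 mstar (St' y)) *\<^sub>2 Em c) f" .
  have b2: "bil H H CCB (%x y. (A2 Sg x *\<^sub>2 mstar (St' y)) *\<^sub>2 Em c)"
    by (rule bil_post[OF _ b]) (auto intro!: CCB.linear_mult_left lin_id simp: c)
  note cl = hopf.con_linear_arg[OF M z]
  have fl: "lin H B (%x. con B (A2 Sg x) z \<cdot> c)"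
    by (rule base.linear_mult_left[OF lin_comp[OF cl conv_linear[OF cocycle_rot_closed(3)]] c])
  have "con B (hat (St' f *\<^sub>1 al c) *\<^sub>2 Sg) z
    = sw B (%x y. con B ((A2 Sg x *\<^sub>2 mstar (St' y)) *\<^sub>2 Em c) z) f"
    unfolding eq by (rule sw_post[OF CCB.module_A M cl b2 f])
  also have "... = con B (A2 Sg f) z \<cdot> c"
  proof (rule hopf.sw_absorb_right[OF M bil_post[OF cl b2] fl f])
    fix x y assume xy: "x \<in> cH" "y \<in> cH"
    have m: "St' y *\<^sub>1 al c \<in> carrier CB" using xy c by (auto intro!: CB.m_closed)
    have "(A2 Sg x *\<^sub>2 mstar (St' y)) *\<^sub>2 Em c = A2 Sg x *\<^sub>2 mstar (St' y *\<^sub>1 al c)"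
      by (simp add: Em_def hopf.mstar_at[OF algebra_B] CCB.m_assoc A2c xy c)
    then have "con B ((A2 Sg x *\<^sub>2 mstar (St' y)) *\<^sub>2 Em c) z
      = con B (A2 Sg x) z \<cdot> (St' y *\<^sub>1 al c) 1\<^sub>H"
      using hopf.con_C0[OF algebra_B A2c[OF xy(1)] m z] by simp
    moreover have "(St' y *\<^sub>1 al c) 1\<^sub>H = eps y \<odot>\<^bsub>B\<^esub> c"
      using hopf.conv_mult_at_one[OF algebra_B, of "St' y" "al c"] xy c
      by (simp add: sigma'_one_left one_act base.smult_mult_left)
    moreover have "con B (A2 Sg x) z \<in> cB"
      by (rule lin_closed[OF cl A2c[OF xy(1)]])
    ultimately show "con B ((A2 Sg x *\<^sub>2 mstar (St' y)) *\<^sub>2 Em c) z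
      = eps y \<odot>\<^bsub>B\<^esub> (con B (A2 Sg x) z \<cdot> c)"
      using xy c by (simp add: base.smult_mult_right)
  qed
  finally show ?thesis .
qed

text \<open>The first three legs of h form the contraction of \<open>con_inv1\<close>, with the last
  leg f as a parameter. What remains is \<sigma>(h1, S(h2)h3) c, and the antipode cancels h2 against
  h3.\<close>

lemma pp_qq:
  assumes c: "c \<in> cB" and h: "h \<in> cH"
  shows "sw B (%x y. pp (qq c y) x) h = eps h \<odot>\<^bsub>B\<^esub> c"
proof -
  note M = base.module_A
  define Lf where "Lf f = hat (St' f *\<^sub>1 al c)" for f
  have Lf_lin: "lin H CCB Lf"
    unfolding Lf_def by (rule lin_comp[OF hom_D(1)[OF hat_hom] qq_inner_linear[OF c]])
  have Lf: "Lf f \<in> carrier CCB" if "f \<in> cH" for f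
    by (rule lin_closed[OF Lf_lin that])
  have Lf3: "lin H B (%f. Lf f x y)" if "x \<in> cH" "y \<in> cH" for x y
    by (rule lin_comp[OF lin_comp[OF conv_eval_linear[OF that(2)] conv_eval_linear[OF that(1)]] Lf_lin])
  let ?X = "%a b d f. Lf f a (S d) \<cdot> Tau b"
  have Xlin: "lin H B (%a. ?X a b d f)" "lin H B (%b. ?X a b d f)"
      "lin H B (%d. ?X a b d f)" "lin H B (%f. ?X a b d f)"
    if "a \<in> cH" "b \<in> cH" "d \<in> cH" "f \<in> cH" for a b d f
    using that by (auto intro!: base.linear_mult_left base.linear_mult_right Lf3 Tau_linear lin_id
        hopf.conv2_lin1[OF Lf] hopf.conv2_lin2[OF Lf] S_linear conv2_closed[OF Lf])
  have "sw B (%x y. pp (qq c y) x) h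
    = sw B (%x y. sw B (%a b. sw B (%d f. ?X a b d f) y) x) h"
  proof (rule sw_cong[OF M _ h])
    show "bil H H B (%x y. pp (qq c y) x)"
      by (rule bil_swap[OF bil_comp[OF pp_bilinear bil_D(1)[OF qq_bilinear c] lin_id]])
    fix x y assume xy: "x \<in> cH" "y \<in> cH"
    have q: "qq c y \<in> cB" using c xy by simp
    have "pp (qq c y) x = sw B (%a b. act a (qq c y) \<cdot> Tau b) x"
      by (rule pp_sw[OF q xy(1)])
    also have "... = sw B (%a b. sw B (%d f. ?X a b d f) y) x"
    proof (rule sw_cong[OF M _ xy(1)])
      show "bil H H B (%a b. act a (qq c y) \<cdot> Tau b)"
        by (rule bil_comp[OF base.mult_bilinear act_linear_left[OF lin_id q] Tau_linear[OF lin_id]])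
      fix a b assume ab: "a \<in> cH" "b \<in> cH"
      have lin: "lin B B (%r. act a r \<cdot> Tau b)"
        by (rule base.linear_mult_left[OF act_linear_right[OF lin_id]]) (simp_all add: ab)
      have "act a (qq c y) \<cdot> Tau b = sw B (%d f. ?X a b d f) y"
        unfolding qq_def by (rule sw_map[OF M M lin qq_inner_bilinear[OF c] xy(2)]) (simp add: Lf_def ab)
      then show "act a (qq c y) \<cdot> Tau b = sw B (%d f. ?X a b d f) y" .
    qed
    finally show "pp (qq c y) x = sw B (%a b. sw B (%d f. ?X a b d f) y) x" .
  qed
  \<comment> \<open>Two rebracketings split off the last leg f, so that the legs a, b, d become
    those of one element z.\<close>
  also have "... = sw B (%a w. sw B (%z f. sw B (%b d. ?X a b d f) z) w) h"
    by (rule hopf.sw_regroup4[OF M h]) (auto intro!: Xlin)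
  also have "... = sw B (%z f. sw B (%a w. sw B (%b d. ?X a b d f) w) z) h"
    by (rule sw_coassoc[symmetric, OF M _ h], rule tril_I)
       (auto intro!: sw_linear[OF M] sw_param_linear[OF M hopf.module_A] bil_I Xlin)
  finally have lhs: "sw B (%x y. pp (qq c y) x) h
    = sw B (%z f. sw B (%a w. sw B (%b d. ?X a b d f) w) z) h" .
  have step: "sw B (%a w. sw B (%b d. ?X a b d f) w) z = sw B (%x y. \<sigma> x (S y \<otimes>\<^bsub>H\<^esub> f) \<cdot> c) z"
    if zf: "z \<in> cH" "f \<in> cH" for z f
  proof -
    have A2c: "A2 Sg f \<in> carrier CCB" by (rule conv_closed[OF cocycle_rot_closed(3) zf(2)])
    have bA: "bil H H B (%x y. A2 Sg f x (S y))"
      by (rule bil_comp[OF conv2_bilinear[OF A2c] lin_id S_linear])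
    have "sw B (%a w. sw B (%b d. ?X a b d f) w) z = sw B (%a w. sw B (%b d. Lf f a (S d) \<cdot> con B Sg b) w) z"
    proof (rule sw_cong[OF M _ zf(1)])
      show "bil H H B (%a w. sw B (%b d. ?X a b d f) w)"
        by (rule sw_right_bilinear[OF M], rule tril_I) (auto intro!: Xlin zf)
      fix a w assume aw: "a \<in> cH" "w \<in> cH"
      show "sw B (%b d. ?X a b d f) w = sw B (%b d. Lf f a (S d) \<cdot> con B Sg b) w"
        by (rule sw_cong[OF M bil_I aw(2)]) (auto intro!: Xlin aw zf simp flip: Tau_apply)
    qed
    also have "... = con B (Lf f *\<^sub>2 Sg) z"
      by (rule hopf.con_mult[symmetric, OF algebra_B Lf[OF zf(2)] Sg_closed zf(1)])
    also have "... = con B (A2 Sg f) z \<cdot> c"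
      unfolding Lf_def by (rule con_inv1[OF c zf(2,1)])
    also have "... = sw B (%x y. \<sigma> x (S y \<otimes>\<^bsub>H\<^esub> f) \<cdot> c) z"
      unfolding con_def
      by (rule sw_map[OF M M base.linear_mult_left[OF lin_id c] bA zf(1)])
         (simp add: A2_apply zf)
    finally show ?thesis .
  qed
  have tri: "tril H H H B (%x y f. \<sigma> x (S y \<otimes>\<^bsub>H\<^esub> f) \<cdot> c)"
    by (rule tril_I)
       (auto intro!: base.linear_mult_left sigma_linear_left sigma_linear_right hopf.linear_mult_left hopf.linear_mult_right
          S_linear lin_id c)
  have "sw B (%z f. sw B (%a w. sw B (%b d. ?X a b d f) w) z) h
    = sw B (%z f. sw B (%x y. \<sigma> x (S y \<otimes>\<^bsub>H\<^esub> f) \<cdot> c) z) h"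
    by (rule sw_cong[symmetric, OF M hopf.sw_left_bilinear[OF M tri] h]) (simp add: step)
  also have "... = sw B (%x w. sw B (%y f. \<sigma> x (S y \<otimes>\<^bsub>H\<^esub> f) \<cdot> c) w) h"
    by (rule sw_coassoc[OF M tri h])
  also have "... = eps h \<odot>\<^bsub>B\<^esub> c"
  proof (rule hopf.sw_absorb_left[OF M sw_right_bilinear[OF M tri] hopf.eps_scale_linear[OF M c] h])
    fix x w assume xw: "x \<in> cH" "w \<in> cH"
    have "sw B (%y f. \<sigma> x (S y \<otimes>\<^bsub>H\<^esub> f) \<cdot> c) w = eps w \<odot>\<^bsub>B\<^esub> (\<sigma> x 1\<^sub>H \<cdot> c)"
      by (rule hopf.sw_antipode_left[OF M base.linear_mult_left[OF sigma_linear_right[OF lin_id xw(1)] c] xw(2)])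
    then show "sw B (%y f. \<sigma> x (S y \<otimes>\<^bsub>H\<^esub> f) \<cdot> c) w = eps x \<odot>\<^bsub>B\<^esub> (eps w \<odot>\<^bsub>B\<^esub> c)"
      using xw c by (simp add: sigma_one_right base.smult_mult_left base.smult_left_commute[of "eps w" "eps x"])
  qed
  finally show ?thesis
    using lhs by simp
qed

text \<open>\<open>Tau\<close> is a sum of terms \<sigma>(f, S y). Taking the leg y out of the
  convolution turns S y into a fixed parameter, as the rotated cocycle identities require.\<close>

lemma hat_Tau:
  assumes Y: "Y \<in> carrier CCB" and g: "g \<in> cH" and w: "w \<in> cH"
  shows "(Y *\<^sub>2 hat Tau) g w = sw B (%z y. (Y *\<^sub>2 hat (St (S y))) g z) w"
proof -
  note M = base.module_A
  let ?X = "%a b p f y. Y a p \<cdot> act b (\<sigma> f (S y))"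
  have Xlin: "lin H B (%a. ?X a b p f y)" "lin H B (%b. ?X a b p f y)"
      "lin H B (%p. ?X a b p f y)" "lin H B (%f. ?X a b p f y)" "lin H B (%y. ?X a b p f y)"
    if "a \<in> cH" "b \<in> cH" "p \<in> cH" "f \<in> cH" "y \<in> cH" for a b p f y
    using that by (auto intro!: base.linear_mult_left base.linear_mult_right act_linear_left act_linear_right
        sigma_linear_left sigma_linear_right lin_id S_linear
        hopf.conv2_lin1[OF Y] hopf.conv2_lin2[OF Y] conv2_closed[OF Y])
  have tri: "tril H H H B (%p f y. ?X a b p f y)" if "a \<in> cH" "b \<in> cH" for a b
    by (rule tril_I) (auto intro!: Xlin that)
  note bl = bil_I sw_linear[OF M] sw_param_linear[OF M hopf.module_A] Xlin
  have "(Y *\<^sub>2 hat Tau) g w = sw B (%a b. sw B (%p q. Y a p \<cdot> act b (Tau q)) w) g"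
    by (rule hopf.conv2_mult_eq[OF algebra_B Y _ g w]) simp_all
  also have "... = sw B (%a b. sw B (%z y. sw B (%p f. ?X a b p f y) z) w) g"
  proof (rule sw_cong[symmetric, OF M _ g])
    show "bil H H B (%a b. sw B (%z y. sw B (%p f. ?X a b p f y) z) w)"
      by (auto intro!: bl w)
    fix a b assume ab: "a \<in> cH" "b \<in> cH"
    have "sw B (%z y. sw B (%p f. ?X a b p f y) z) w = sw B (%p q. sw B (%f y. ?X a b p f y) q) w"
      by (rule sw_coassoc[OF M tri[OF ab] w])
    also have "... = sw B (%p q. Y a p \<cdot> act b (Tau q)) w"
    proof (rule sw_cong[OF M sw_right_bilinear[OF M tri[OF ab]] w])
      fix p q assume pq: "p \<in> cH" "q \<in> cH"
      have lin: "lin B B (%r. Y a p \<cdot> act b r)"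
        by (rule base.linear_mult_right[OF act_linear_right[OF lin_id ab(2)] conv2_closed[OF Y ab(1) pq(1)]])
      have "bil H H B (%f y. \<sigma> f (S y))"
        by (rule bil_comp[OF sigma_bilinear lin_id S_linear])
      from sw_post[OF M M lin this pq(2)]
      show "sw B (%f y. ?X a b p f y) q = Y a p \<cdot> act b (Tau q)"
        by (simp add: Tau_sw pq)
    qed
    finally show "sw B (%z y. sw B (%p f. ?X a b p f y) z) w = sw B (%p q. Y a p \<cdot> act b (Tau q)) w" .
  qed
  also have "... = sw B (%z y. sw B (%a b. sw B (%p f. ?X a b p f y) z) g) w"
    by (rule hopf.sw_swap[OF M _ _ g w]) (auto intro!: bl g w)
  also have "... = sw B (%z y. (Y *\<^sub>2 hat (St (S y))) g z) w"
  proof (rule sw_cong[OF M _ w])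
    show "bil H H B (%z y. sw B (%a b. sw B (%p f. ?X a b p f y) z) g)"
      by (auto intro!: bl g)
    fix z y assume zy: "z \<in> cH" "y \<in> cH"
    show "sw B (%a b. sw B (%p f. ?X a b p f y) z) g = (Y *\<^sub>2 hat (St (S y))) g z"
      by (rule hopf.conv2_mult_eq[symmetric, OF algebra_B Y _ g zy(1)]) (simp_all add: zy)
  qed
  finally show ?thesis .
qed

text \<open>By \<open>cocycle_rot_inv2\<close> a factor \<sigma>'(g2, fy) appears at the right end.
  The arguments f and y are the ones being contracted, so it becomes \<sigma>'(g2, 1) and
  disappears. The free left factor G lets the lemma serve both with G the unit and with G an action
  on an element of B.\<close>

lemma sigma'_hat_Tau:
  assumes G: "G \<in> carrier CB" and g: "g \<in> cH" and w: "w \<in> cH"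
  shows "(mstar G *\<^sub>2 (Sg' *\<^sub>2 hat Tau)) g w = sw B (%f y. (G *\<^sub>1 St (S y)) (g \<otimes>\<^bsub>H\<^esub> f)) w"
proof -
  note M = base.module_A
  \<comment> \<open>\<open>Z\<close>, defined below, has the contraction in its last two arguments f
    and y that is wanted. \<open>P\<close> collects G(gf) . \<sigma>(gf, y), and \<open>Q\<close> is
    the factor \<sigma>'(g, fy) that will vanish.\<close>
  define Gs where "Gs = cmap (cmap (iota B)) (mstar G)"
  define P where "P = Gs *\<^sub>3 mstar Sg"
  define Q where "Q = cmap mstar Sg'"
  have mG: "mstar G \<in> carrier CCB" using G by simp
  have Gs: "Gs \<in> carrier CCCB" unfolding Gs_def by (rule hom_D(4)[OF ciota_hom mG])
  have mS: "mstar Sg \<in> carrier CCCB" by (rule hom_D(4)[OF mstar_hom_CB Sg_closed])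
  have P: "P \<in> carrier CCCB" unfolding P_def by (rule CCCB.m_closed[OF Gs mS])
  have Q: "Q \<in> carrier CCCB" unfolding Q_def by (rule hom_D(4)[OF cmstar_hom Sg'_closed])
  define Z where "Z = P *\<^sub>3 Q"
  have Z: "Z \<in> carrier CCCB" unfolding Z_def by (rule CCCB.m_closed[OF P Q])
  have rotP: "rot P = iota CCB (mstar G) *\<^sub>3 cmap mstar St"
    unfolding P_def Gs_def
    by (simp add: hom_D(2)[OF rot_hom Gs[unfolded Gs_def] mS] rot_images mG)
  have Pev: "P g f y = (G *\<^sub>1 St y) (g \<otimes>\<^bsub>H\<^esub> f)" if "g \<in> cH" "f \<in> cH" "y \<in> cH" for g f y
  proof -
    have "P g f y = rot P y g f" using that by (simp add: rot_apply)
    also have "... = (mstar G *\<^sub>2 mstar (St y)) g f"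
      unfolding rotP using iota_mult_apply(1)[OF algebra_CCB mG cocycle_rot_closed(7) that(3)] that by simp
    also have "... = (G *\<^sub>1 St y) (g \<otimes>\<^bsub>H\<^esub> f)"
      using that G by (simp add: hopf.mstar_at[OF algebra_B, symmetric])
    finally show ?thesis .
  qed
  have rotZ: "rot Z = iota CCB (mstar G) *\<^sub>3 (iota CCB Sg' *\<^sub>3 cmap hat St)"
  proof -
    have "rot Z = rot P *\<^sub>3 A2 Sg'"
      unfolding Z_def hom_D(2)[OF rot_hom P Q] by (simp add: A2_def Q_def)
    also have "... = iota CCB (mstar G) *\<^sub>3 (cmap mstar St *\<^sub>3 A2 Sg')"
      unfolding rotP using cocycle_rot_closed hom_D(4)[OF iota_hom_CCB mG] by (simp add: CCCB.m_assoc)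
    finally show ?thesis by (simp add: cocycle_rot_inv2)
  qed
  have Zev: "Z g f y = (mstar G *\<^sub>2 (Sg' *\<^sub>2 hat (St y))) g f"
    if "g \<in> cH" "f \<in> cH" "y \<in> cH" for g f y
  proof -
    have cl: "iota CCB Sg' *\<^sub>3 cmap hat St \<in> carrier CCCB"
      using cocycle_rot_closed by (simp add: CCCB.m_closed)
    have "Z g f y = rot Z y g f" using that by (simp add: rot_apply)
    also have "... = (mstar G *\<^sub>2 (Sg' *\<^sub>2 hat (St y))) g f"
      unfolding rotZ
      using iota_mult_apply(1)[OF algebra_CCB mG cl that(3)]
        iota_mult_apply(1)[OF algebra_CCB Sg'_closed cocycle_rot_closed(1) that(3)] that by simp
    finally show ?thesis .
  qed
  note cl = hopf.con_linear_arg[OF M w]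
  have Pc: "P a \<in> carrier CCB" if "a \<in> cH" for a by (rule conv_closed[OF P that])
  have Zg: "Z g = sw CCB (%a b. P a *\<^sub>2 mstar (Sg' b)) g"
    unfolding Z_def by (rule hopf.conv_mult_eq[OF algebra_CCB P Q g]) (simp_all add: Q_def)
  have s'c: "Sg' b \<in> carrier CB" if "b \<in> cH" for b by (rule conv_closed[OF Sg'_closed that])
  have bb: "bil H H CCB (%a b. P a *\<^sub>2 mstar (Sg' b))"
    by (rule bil_comp[OF CCB.mult_bilinear conv_linear[OF P]
          lin_comp[OF hom_D(1)[OF mstar_hom_B] conv_linear[OF Sg'_closed]]])
  have con_eq: "con B (Z g) w = con B (P g) w"
  proof -
    have "con B (Z g) w = sw B (%a b. con B (P a *\<^sub>2 mstar (Sg' b)) w) g"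
      unfolding Zg by (rule sw_post[OF CCB.module_A M cl bb g])
    also have "... = con B (P g) w"
    proof (rule hopf.sw_absorb_right[OF M bil_post[OF cl bb] lin_comp[OF cl conv_linear[OF P]] g])
      fix a b assume ab: "a \<in> cH" "b \<in> cH"
      have "con B (P a) w \<in> cB" by (rule lin_closed[OF cl Pc[OF ab(1)]])
      then show "con B (P a *\<^sub>2 mstar (Sg' b)) w = eps b \<odot>\<^bsub>B\<^esub> con B (P a) w"
        using ab by (simp add: hopf.con_C0[OF algebra_B Pc s'c w] sigma'_one_right base.smult_mult_right)
    qed
    finally show ?thesis .
  qed
  have Y: "mstar G *\<^sub>2 Sg' \<in> carrier CCB" using mG by simp
  have "(mstar G *\<^sub>2 (Sg' *\<^sub>2 hat Tau)) g w = ((mstar G *\<^sub>2 Sg') *\<^sub>2 hat Tau) g w"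
    using mG by (simp add: CCB.m_assoc)
  also have "... = sw B (%z y. ((mstar G *\<^sub>2 Sg') *\<^sub>2 hat (St (S y))) g z) w"
    by (rule hat_Tau[OF Y g w])
  also have "... = con B (Z g) w"
    unfolding con_def
    by (rule sw_cong[symmetric, OF M bil_comp[OF conv2_bilinear[OF conv_closed[OF Z g]] lin_id S_linear] w])
       (simp add: Zev g CCB.m_assoc mG)
  also have "... = sw B (%f y. (G *\<^sub>1 St (S y)) (g \<otimes>\<^bsub>H\<^esub> f)) w"
    unfolding con_eq unfolding con_def
    by (rule sw_cong[OF M bil_comp[OF conv2_bilinear[OF Pc[OF g]] lin_id S_linear] w])
       (simp add: Pev g)
  finally show ?thesis .
qed

text \<open>The case in which G is the unit; the right-hand side is the sum of the terms \<sigma>(g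
  w1, S w2).\<close>

lemma sigma'_act_Tau:
  assumes g: "g \<in> cH" and w: "w \<in> cH"
  shows "(Sg' *\<^sub>2 hat Tau) g w = con B (mstar Sg g) w"
proof -
  have mS: "mstar Sg g \<in> carrier CCB"
    by (rule conv_closed[OF hom_D(4)[OF mstar_hom_CB Sg_closed] g])
  have "(Sg' *\<^sub>2 hat Tau) g w = (mstar \<one>\<^bsub>CB\<^esub> *\<^sub>2 (Sg' *\<^sub>2 hat Tau)) g w"
    by (simp add: hom_D(3)[OF mstar_hom_B])
  also have "... = sw B (%f y. (\<one>\<^bsub>CB\<^esub> *\<^sub>1 St (S y)) (g \<otimes>\<^bsub>H\<^esub> f)) w"
    by (rule sigma'_hat_Tau[OF _ g w]) simp
  also have "... = con B (mstar Sg g) w"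
    unfolding con_def
    by (rule sw_cong[symmetric, OF base.module_A bil_comp[OF conv2_bilinear[OF mS] lin_id S_linear] w])
       (simp add: g)
  finally show ?thesis .
qed

text \<open>At a first argument S d the previous result is a function of the product S(d)f, which
  the antipode evaluates at the unit; the factor \<sigma>(1, S y) left over is a counit.\<close>

lemma sigma'_hat_Tau_S:
  assumes G: "G \<in> carrier CB" and h: "h \<in> cH"
  shows "sw B (%d w. (mstar G *\<^sub>2 (Sg' *\<^sub>2 hat Tau)) (S d) w) h = eps h \<odot>\<^bsub>B\<^esub> G 1\<^sub>H"
proof -
  note M = base.module_A
  let ?N = "mstar G *\<^sub>2 (Sg' *\<^sub>2 hat Tau)"
  have N: "?N \<in> carrier CCB" using G by simp
  have GS: "lin H CB (%y. G *\<^sub>1 St (S y))"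
    by (rule CB.linear_mult_right[OF lin_comp[OF St_linear S_linear] G])
  have GSc: "G *\<^sub>1 St (S y) \<in> carrier CB" if "y \<in> cH" for y
    by (rule lin_closed[OF GS that])
  have GSe: "lin H B (%y. (G *\<^sub>1 St (S y)) x)" if "x \<in> cH" for x
    by (rule lin_comp[OF conv_eval_linear[OF that] GS])
  have tri: "tril H H H B (%d f y. (G *\<^sub>1 St (S y)) (S d \<otimes>\<^bsub>H\<^esub> f))"
    by (rule tril_I)
       (auto intro!: GSe hopf.conv_lin[OF GSc] hopf.linear_mult_left hopf.linear_mult_right S_linear lin_id)
  have G1: "G 1\<^sub>H \<in> cB" by (rule conv_closed[OF G]) simp
  have "sw B (%d w. ?N (S d) w) h = sw B (%d w. sw B (%f y. (G *\<^sub>1 St (S y)) (S d \<otimes>\<^bsub>H\<^esub> f)) w) h"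
    by (rule sw_cong[OF M bil_comp[OF conv2_bilinear[OF N] S_linear lin_id] h])
       (simp add: sigma'_hat_Tau[OF G])
  also have "... = sw B (%z y. sw B (%d f. (G *\<^sub>1 St (S y)) (S d \<otimes>\<^bsub>H\<^esub> f)) z) h"
    by (rule sw_coassoc[symmetric, OF M tri h])
  also have "... = eps h \<odot>\<^bsub>B\<^esub> G 1\<^sub>H"
  proof (rule hopf.sw_absorb_left[OF M hopf.sw_left_bilinear[OF M tri] hopf.eps_scale_linear[OF M G1] h])
    fix z y assume zy: "z \<in> cH" "y \<in> cH"
    have "sw B (%d f. (G *\<^sub>1 St (S y)) (S d \<otimes>\<^bsub>H\<^esub> f)) z = eps z \<odot>\<^bsub>B\<^esub> (G *\<^sub>1 St (S y)) 1\<^sub>H"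
      by (rule hopf.sw_antipode_left[OF M conv_linear[OF GSc[OF zy(2)]] zy(1)])
    then show "sw B (%d f. (G *\<^sub>1 St (S y)) (S d \<otimes>\<^bsub>H\<^esub> f)) z = eps z \<odot>\<^bsub>B\<^esub> (eps y \<odot>\<^bsub>B\<^esub> G 1\<^sub>H)"
      using hopf.conv_mult_at_one[OF algebra_B G, of "St (S y)"] zy G1
      by (simp add: sigma_one_left base.smult_mult_right)
  qed
  finally show ?thesis .
qed

text \<open>S reverses the coproduct, so the arguments S h2 and S h1 in \<open>qq\<close> are the
  two legs of one element S d. The sum is therefore a convolution product evaluated at S d and the
  remaining leg.\<close>

lemma qq_leg:
  assumes W: "W \<in> carrier CB" and h: "h \<in> cH"
  shows "sw B (%x y. qq (W y) x) h = sw B (%d w. (Sg' *\<^sub>2 hat W) (S d) w) h"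
proof -
  note M = base.module_A
  have Wc: "W y \<in> cB" if "y \<in> cH" for y by (rule conv_closed[OF W that])
  let ?Q = "%g f y. (St' f *\<^sub>1 al (W y)) g"
  have Qlin: "lin H B (%g. ?Q g f y)" "lin H B (%f. ?Q g f y)" "lin H B (%y. ?Q g f y)"
    if "g \<in> cH" "f \<in> cH" "y \<in> cH" for g f y
  proof -
    show "lin H B (%g. ?Q g f y)"
      by (rule conv_linear) (simp add: that Wc)
    show "lin H B (%f. ?Q g f y)"
      by (rule lin_comp[OF conv_eval_linear[OF that(1)] qq_inner_linear[OF Wc[OF that(3)]]])
    have "lin H CB (%y. St' f *\<^sub>1 al (W y))"
      by (rule CB.linear_mult_right[OF lin_comp[OF hom_D(1)[OF al_hom] conv_linear[OF W]]]) (simp add: that)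
    then show "lin H B (%y. ?Q g f y)"
      by (rule lin_comp[OF conv_eval_linear[OF that(1)]])
  qed
  have QS: "lin H B (%g. ?Q (S g) f y)" if "f \<in> cH" "y \<in> cH" for f y
    by (rule lin_comp[OF Qlin(1)[OF hopf.one_closed_H that] S_linear])
  have tri: "tril H H H B (%d f y. ?Q (S d) f y)"
    by (rule tril_I) (auto intro!: Qlin QS)
  have "sw B (%x y. qq (W y) x) h = sw B (%x y. sw B (%d f. ?Q (S d) f y) x) h"
    by (simp add: qq_def)
  also have "... = sw B (%d w. sw B (%f y. ?Q (S d) f y) w) h"
    by (rule sw_coassoc[OF M tri h])
  also have "... = sw B (%d w. (Sg' *\<^sub>2 hat W) (S d) w) h"
  proof (rule sw_cong[OF M sw_right_bilinear[OF M tri] h])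
    fix d w assume dw: "d \<in> cH" "w \<in> cH"
    let ?q = "%a b f y. \<sigma>' a f \<cdot> act b (W y)"
    have ql: "lin H B (%a. ?q a b f y)" "lin H B (%b. ?q a b f y)"
        "lin H B (%f. ?q a b f y)" "lin H B (%y. ?q a b f y)"
      if "a \<in> cH" "b \<in> cH" "f \<in> cH" "y \<in> cH" for a b f y
      using that by (auto intro!: base.linear_mult_left base.linear_mult_right act_linear_left act_linear_right
         bil_D[OF sigma_inv_bilinear] conv_linear[OF W] lin_id simp: Wc)
    have Sd: "S d \<in> cH" using dw by simp
    have "sw B (%f y. ?Q (S d) f y) w = sw B (%f y. sw B (%a b. ?q a b f y) (S d)) w"
    proof (rule sw_cong[OF M _ dw(2)])
      show "bil H H B (%f y. ?Q (S d) f y)" by (rule bil_I) (auto intro!: Qlin Sd)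
      fix f y assume fy: "f \<in> cH" "y \<in> cH"
      show "?Q (S d) f y = sw B (%a b. ?q a b f y) (S d)"
        by (rule hopf.conv_mult_eq[OF algebra_B]) (use fy dw Wc in auto)
    qed
    also have "... = sw B (%a b. sw B (%f y. ?q a b f y) w) (S d)"
      by (rule hopf.sw_swap[OF M _ _ dw(2) Sd]) (auto intro!: bil_I ql)
    also have "... = (Sg' *\<^sub>2 hat W) (S d) w"
      by (rule hopf.conv2_mult_eq[symmetric, OF algebra_B _ _ Sd dw(2)]) (simp_all add: W)
    finally show "sw B (%f y. ?Q (S d) f y) w = (Sg' *\<^sub>2 hat W) (S d) w" .
  qed
  finally show ?thesis .
qed

text \<open>For W the convolution of \<open>al b\<close> and \<open>Tau\<close>, the twisted module
  condition carries the double action on b across \<sigma>' to the left, where it is an action by a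
  product. \<open>sigma'_hat_Tau_S\<close> then leaves only 1 \<triangleright> b.\<close>

lemma qq_pp:
  assumes b: "b \<in> cB" and h: "h \<in> cH"
  shows "sw B (%x y. qq (pp b y) x) h = eps h \<odot>\<^bsub>B\<^esub> b"
proof -
  let ?W = "al b *\<^sub>1 Tau"
  have W: "?W \<in> carrier CB" by (rule pp_conv[OF b])
  have "sw B (%x y. qq (pp b y) x) h = sw B (%d w. (Sg' *\<^sub>2 hat ?W) (S d) w) h"
    using qq_leg[OF W h] by (simp add: pp_def)
  also have "Sg' *\<^sub>2 hat ?W = (Sg' *\<^sub>2 Dm b) *\<^sub>2 hat Tau"
    by (simp add: hom_D(2)[OF hat_hom] b Dm_def CCB.m_assoc)
  also have "... = mstar (al b) *\<^sub>2 (Sg' *\<^sub>2 hat Tau)"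
    unfolding Sg'_Dm[OF b] by (simp add: b Em_def CCB.m_assoc)
  finally show ?thesis
    using sigma'_hat_Tau_S[OF al_closed[OF b] h] by (simp add: one_act b)
qed

lemma mstar_mstar:
  assumes f: "f \<in> carrier CB" and b: "b \<in> cH"
  shows "mstar (mstar f) b = mstar (mstar f b)"
proof (rule hopf.conv2_eqI[where R = B])
  have mf: "mstar f \<in> carrier CCB" using f by simp
  show "mstar (mstar f) b \<in> carrier CCB"
    by (rule conv_closed[OF hom_D(4)[OF mstar_hom_CB mf] b])
  show "mstar (mstar f b) \<in> carrier CCB"
    by (rule mst_closed[OF conv_closed[OF mf b]])
qed (use b in \<open>simp add: hopf.A.m_assoc\<close>)

text \<open>Multiplying 1 \<otimes> 1 # h by 1 \<otimes> 1 # g in the free bimodule produces the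
  right coefficient \<sigma>'(h1, g1)(h2 \<triangleright> Tau g2) Tau h3. The lemma recognises it as
  the transformed coefficient \<sigma>(S g, S h) of the product formula. Because S(hg) = S(g)S(h),
  the cocycle condition applies at the three arguments h1 g1, S g2, S h2.\<close>

lemma Tau_product:
  assumes h: "h \<in> cH" and g: "g \<in> cH"
  shows "sw B (%h1 h2. sw B (%g1 g2. pp (\<sigma> (S g2) (S h2)) (h1 \<otimes>\<^bsub>H\<^esub> g1)) g) h
    = sw B (%h1 h2. (Sg' *\<^sub>2 hat Tau) h1 g \<cdot> Tau h2) h"
proof -
  note M = base.module_A
  let ?j = "%c x p q. act x c \<cdot> \<sigma> p (S q)"
  define J where "J x y1 z1 y2 z2 = sw B (%x1 p. act x1 (\<sigma> y1 z1) \<cdot> \<sigma> p (y2 \<otimes>\<^bsub>H\<^esub> z2)) x" for x y1 z1 y2 z2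
  let ?W = "%h' h'' h2 g' g'' g2. J (h' \<otimes>\<^bsub>H\<^esub> g') (S g2) (S h2) (S g'') (S h'')"
  note ll = base.linear_mult_left base.linear_mult_right act_linear_left act_linear_right sigma_linear_left sigma_linear_right
    hopf.linear_mult_left hopf.linear_mult_right lin_id S_linear
  have jl: "lin H B (%x1. act x1 (\<sigma> y1 z1) \<cdot> \<sigma> p (y2 \<otimes>\<^bsub>H\<^esub> z2))"
    "lin H B (%p. act x1 (\<sigma> y1 z1) \<cdot> \<sigma> p (y2 \<otimes>\<^bsub>H\<^esub> z2))"
    "lin H B (%y1. act x1 (\<sigma> y1 z1) \<cdot> \<sigma> p (y2 \<otimes>\<^bsub>H\<^esub> z2))"
    "lin H B (%z1. act x1 (\<sigma> y1 z1) \<cdot> \<sigma> p (y2 \<otimes>\<^bsub>H\<^esub> z2))"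
    "lin H B (%y2. act x1 (\<sigma> y1 z1) \<cdot> \<sigma> p (y2 \<otimes>\<^bsub>H\<^esub> z2))"
    "lin H B (%z2. act x1 (\<sigma> y1 z1) \<cdot> \<sigma> p (y2 \<otimes>\<^bsub>H\<^esub> z2))"
    if "x1 \<in> cH" "y1 \<in> cH" "z1 \<in> cH" "p \<in> cH" "y2 \<in> cH" "z2 \<in> cH"
    for x1 y1 z1 p y2 z2
    using that by (auto intro!: ll)
  have Jl: "lin H B (%x. J x y1 z1 y2 z2)" "lin H B (%y1. J x y1 z1 y2 z2)"
    "lin H B (%z1. J x y1 z1 y2 z2)" "lin H B (%y2. J x y1 z1 y2 z2)" "lin H B (%z2. J x y1 z1 y2 z2)"
    if "x \<in> cH" "y1 \<in> cH" "z1 \<in> cH" "y2 \<in> cH" "z2 \<in> cH" for x y1 z1 y2 z2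
    using that unfolding J_def by (auto intro!: sw_linear[OF M] sw_param_linear[OF M hopf.module_A] bil_I jl)
  have Wl: "lin H B (%h'. ?W h' h'' h2 g' g'' g2)" "lin H B (%h''. ?W h' h'' h2 g' g'' g2)"
    "lin H B (%h2. ?W h' h'' h2 g' g'' g2)" "lin H B (%g'. ?W h' h'' h2 g' g'' g2)"
    "lin H B (%g''. ?W h' h'' h2 g' g'' g2)" "lin H B (%g2. ?W h' h'' h2 g' g'' g2)"
    if "h' \<in> cH" "h'' \<in> cH" "h2 \<in> cH" "g' \<in> cH" "g'' \<in> cH" "g2 \<in> cH"
    for h' h'' h2 g' g'' g2
    using that
    by (auto intro!: lin_comp[OF Jl(1)] lin_comp[OF Jl(2) S_linear] lin_comp[OF Jl(3) S_linear]
        lin_comp[OF Jl(4) S_linear] lin_comp[OF Jl(5) S_linear] hopf.linear_mult_left hopf.linear_mult_right lin_id)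
  note bl = bil_I sw_linear[OF M] sw_param_linear[OF M hopf.module_A] Wl
  have pp_expand: "pp c (x \<otimes>\<^bsub>H\<^esub> y) = sw B (%h' h''. sw B (%g' g''. sw B (%a p. ?j c a p (h'' \<otimes>\<^bsub>H\<^esub> g'')) (h' \<otimes>\<^bsub>H\<^esub> g')) y) x"
    if c: "c \<in> cB" and xy: "x \<in> cH" "y \<in> cH" for c x y
  proof -
    have tri: "tril H H H B (%a p q. ?j c a p q)"
      by (rule tril_I) (auto intro!: ll simp: c)
    have "pp c z = sw B (%y q. sw B (%a p. ?j c a p q) y) z" if z: "z \<in> cH" for z
    proof -
      have "pp c z = sw B (%a w. act a c \<cdot> Tau w) z" by (rule pp_sw[OF c z])
      also have "... = sw B (%a w. sw B (%p q. ?j c a p q) w) z"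
      proof (rule sw_cong[symmetric, OF M sw_right_bilinear[OF M tri] z])
        fix a w assume aw: "a \<in> cH" "w \<in> cH"
        have "bil H H B (%p q. \<sigma> p (S q))"
          by (rule bil_comp[OF sigma_bilinear lin_id S_linear])
        from sw_post[OF M M base.linear_mult_right[OF lin_id act_closed[OF aw(1) c]] this aw(2)]
        show "sw B (%p q. ?j c a p q) w = act a c \<cdot> Tau w" by (simp add: Tau_sw aw)
      qed
      also have "... = sw B (%y q. sw B (%a p. ?j c a p q) y) z"
        by (rule sw_coassoc[symmetric, OF M tri z])
      finally show ?thesis .
    qed
    then show ?thesis
      using hopf.sw_mult[OF M hopf.sw_left_bilinear[OF M tri] xy] xy by simp
  qed
  have "sw B (%h1 h2. sw B (%g1 g2. pp (\<sigma> (S g2) (S h2)) (h1 \<otimes>\<^bsub>H\<^esub> g1)) g) h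
    = sw B (%h1 h2. sw B (%g1 g2. sw B (%h' h''. sw B (%g' g''. ?W h' h'' h2 g' g'' g2) g1) h1) g) h"
  proof (rule sw_cong[symmetric, OF M _ h])
    show "bil H H B (%h1 h2. sw B (%g1 g2. sw B (%h' h''. sw B (%g' g''. ?W h' h'' h2 g' g'' g2) g1) h1) g)"
      by (auto intro!: bl g)
    fix h1 h2 assume h12: "h1 \<in> cH" "h2 \<in> cH"
    show "sw B (%g1 g2. sw B (%h' h''. sw B (%g' g''. ?W h' h'' h2 g' g'' g2) g1) h1) g
      = sw B (%g1 g2. pp (\<sigma> (S g2) (S h2)) (h1 \<otimes>\<^bsub>H\<^esub> g1)) g"
    proof (rule sw_cong[OF M _ g])
      show "bil H H B (%g1 g2. sw B (%h' h''. sw B (%g' g''. ?W h' h'' h2 g' g'' g2) g1) h1)"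
        by (auto intro!: bl h12)
      fix g1 g2 assume g12: "g1 \<in> cH" "g2 \<in> cH"
      have c: "\<sigma> (S g2) (S h2) \<in> cB" using h12 g12 by simp
      show "sw B (%h' h''. sw B (%g' g''. ?W h' h'' h2 g' g'' g2) g1) h1 = pp (\<sigma> (S g2) (S h2)) (h1 \<otimes>\<^bsub>H\<^esub> g1)"
        unfolding pp_expand[OF c h12(1) g12(1)]
      proof (rule sw_cong[OF M _ h12(1)])
        show "bil H H B (%h' h''. sw B (%g' g''. ?W h' h'' h2 g' g'' g2) g1)"
          by (auto intro!: bl h12 g12)
        fix h' h'' assume hh: "h' \<in> cH" "h'' \<in> cH"
        show "sw B (%g' g''. ?W h' h'' h2 g' g'' g2) g1
          = sw B (%g' g''. sw B (%a p. ?j (\<sigma> (S g2) (S h2)) a p (h'' \<otimes>\<^bsub>H\<^esub> g'')) (h' \<otimes>\<^bsub>H\<^esub> g')) g1"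
        proof (rule sw_cong[OF M _ g12(1)])
          show "bil H H B (%g' g''. ?W h' h'' h2 g' g'' g2)"
            by (auto intro!: bl h12 g12 hh)
        qed (simp add: hopf.S_mult hh J_def)
      qed
    qed
  qed
  \<comment> \<open>The next four rearrangements make the last two legs of h, and likewise those of
    g, the coproduct of single elements w and v. Then S v and S w can play the second and third
    argument of the cocycle condition.\<close>
  also have "... = sw B (%h1 h2. sw B (%h' h''. sw B (%g1 g2. sw B (%g' g''. ?W h' h'' h2 g' g'' g2) g1) g) h1) h"
    by (rule sw_cong[OF M _ h]) (auto intro!: bl g hopf.sw_swap[OF M])
  also have "... = sw B (%h1 h2. sw B (%h' h''. sw B (%g' v. sw B (%g'' g2. ?W h' h'' h2 g' g'' g2) v) g) h1) h"
    by (intro sw_cong[OF M] sw_coassoc[OF M _ g] tril_I) (auto intro!: bl g h)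
  also have "... = sw B (%h' w. sw B (%h'' h2. sw B (%g' v. sw B (%g'' g2. ?W h' h'' h2 g' g'' g2) v) g) w) h"
    by (rule sw_coassoc[OF M tril_I h]) (auto intro!: bl g)
  also have "... = sw B (%h' w. sw B (%g' v. sw B (%h'' h2. sw B (%g'' g2. ?W h' h'' h2 g' g'' g2) v) w) g) h"
    by (rule sw_cong[OF M _ h]) (auto intro!: bl g hopf.sw_swap[OF M])
  also have "... = sw B (%h' w. sw B (%a b. con B (mstar Sg a) g \<cdot> \<sigma> b (S w)) h') h"
  proof (rule sw_cong[OF M _ h])
    show "bil H H B (%h' w. sw B (%g' v. sw B (%h'' h2. sw B (%g'' g2. ?W h' h'' h2 g' g'' g2) v) w) g)"
      by (auto intro!: bl g)
    fix h' w assume hw: "h' \<in> cH" "w \<in> cH"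
    define z where "z = S w"
    have z: "z \<in> cH" using hw by (simp add: z_def)
    let ?Th = "mstar (Sg *\<^sub>2 mstar (St z))"
    have SS: "Sg *\<^sub>2 mstar (St z) \<in> carrier CCB" using z by simp
    have Th: "?Th \<in> carrier CCCB" by (rule hom_D(4)[OF mstar_hom_CB SS])
    have mS: "mstar Sg \<in> carrier CCCB" by (rule hom_D(4)[OF mstar_hom_CB Sg_closed])
    have mm: "mstar (St z) \<in> carrier CCB" using z by simp
    have "sw B (%g' v. sw B (%h'' h2. sw B (%g'' g2. ?W h' h'' h2 g' g'' g2) v) w) g
      = con B (?Th h') g"
      unfolding con_def
    proof (rule sw_cong[OF M _ g])
      show "bil H H B (%g' v. sw B (%h'' h2. sw B (%g'' g2. ?W h' h'' h2 g' g'' g2) v) w)"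
        by (auto intro!: bl hw)
      fix g' v assume gv: "g' \<in> cH" "v \<in> cH"
      have x: "h' \<otimes>\<^bsub>H\<^esub> g' \<in> cH" and y: "S v \<in> cH" using hw gv by simp_all
      let ?x = "h' \<otimes>\<^bsub>H\<^esub> g'" and ?y = "S v"
      have "sw B (%h'' h2. sw B (%g'' g2. ?W h' h'' h2 g' g'' g2) v) w
        = sw B (%h'' h2. sw B (%y1 y2. J ?x y1 (S h2) y2 (S h'')) ?y) w"
      proof (rule sw_cong[OF M _ hw(2)])
        show "bil H H B (%h'' h2. sw B (%g'' g2. ?W h' h'' h2 g' g'' g2) v)"
          by (auto intro!: bl hw gv)
        fix h'' h2 assume "h'' \<in> cH" "h2 \<in> cH"
        then show "sw B (%g'' g2. ?W h' h'' h2 g' g'' g2) v = sw B (%y1 y2. J ?x y1 (S h2) y2 (S h'')) ?y"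
          using x by (intro hopf.sw_S[symmetric, OF M _ gv(2)]) (auto intro!: bil_I Jl)
      qed
      also have "... = sw B (%z1 z2. sw B (%y1 y2. J ?x y1 z1 y2 z2) ?y) z"
        unfolding z_def using x y
        by (intro hopf.sw_S[symmetric, OF M _ hw(2)])
           (auto intro!: bil_I sw_param_linear[OF M hopf.module_A] Jl)
      also have "... = sw B (%z1 z2. (hat (St z1) *\<^sub>2 A2 Sg z2) ?x ?y) z"
      proof (rule sw_cong[OF M _ z])
        show "bil H H B (%z1 z2. sw B (%y1 y2. J ?x y1 z1 y2 z2) ?y)"
          using x y by (auto intro!: bil_I sw_param_linear[OF M hopf.module_A] Jl)
        fix z1 z2 assume zz: "z1 \<in> cH" "z2 \<in> cH"
        have "sw B (%y1 y2. J ?x y1 z1 y2 z2) ?y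
          = sw B (%x1 p. sw B (%y1 y2. act x1 (\<sigma> y1 z1) \<cdot> \<sigma> p (y2 \<otimes>\<^bsub>H\<^esub> z2)) ?y) ?x"
          unfolding J_def by (rule hopf.sw_swap[OF M _ _ y x]) (auto intro!: bil_I jl zz)
        also have "... = (hat (St z1) *\<^sub>2 A2 Sg z2) ?x ?y"
          by (rule hopf.conv2_mult_eq[symmetric, OF algebra_B _ _ x y])
             (use zz conv_closed[OF cocycle_rot_closed(3) zz(2)] in \<open>simp_all add: A2_apply\<close>)
        finally show "sw B (%y1 y2. J ?x y1 z1 y2 z2) ?y = (hat (St z1) *\<^sub>2 A2 Sg z2) ?x ?y" .
      qed
      also have "... = (sw CCB (%z1 z2. hat (St z1) *\<^sub>2 A2 Sg z2) z) ?x ?y"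
      proof -
        have "bil H H CCB (%z1 z2. hat (St z1) *\<^sub>2 A2 Sg z2)"
          by (rule bil_comp[OF CCB.mult_bilinear lin_comp[OF hom_D(1)[OF hat_hom] St_linear]
                conv_linear[OF cocycle_rot_closed(3)]])
        from sw_post[OF CCB.module_A M lin_comp[OF conv_eval_linear[OF y] conv_eval_linear[OF x]] this z]
        show ?thesis by simp
      qed
      also have "... = ?Th h' g' ?y"
        unfolding cocycle_at[OF z] using hw gv by simp
      finally show "sw B (%h'' h2. sw B (%g'' g2. ?W h' h'' h2 g' g'' g2) v) w = ?Th h' g' (S v)" .
    qed
    \<comment> \<open>The function c \<mapsto> \<sigma>(bc, z) is applied to a product of the two
      contracted arguments, so \<open>con_C0\<close> evaluates it at c = 1 and leaves \<sigma>(b, S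
      w).\<close>
    also have "... = sw B (%a b. con B (mstar Sg a) g \<cdot> \<sigma> b (S w)) h'"
    proof -
      note cl = hopf.con_linear_arg[OF M g]
      have mmS: "mstar (mstar (St z)) \<in> carrier CCCB" by (rule hom_D(4)[OF mstar_hom_CB mm])
      note b = hopf.conv_mult_bilinear_pre[OF algebra_CCB mS mmS]
      have "?Th h' = sw CCB (%a b. mstar Sg a *\<^sub>2 mstar (mstar (St z)) b) h'"
        unfolding hopf.mstar_at[OF algebra_CB Sg_closed mm] using hw by (simp add: conv_apply)
      then have "con B (?Th h') g = sw B (%a b. con B (mstar Sg a *\<^sub>2 mstar (mstar (St z)) b) g) h'"
        using sw_post[OF CCB.module_A M cl b hw(1)] by simp
      also have "... = sw B (%a b. con B (mstar Sg a) g \<cdot> \<sigma> b (S w)) h'"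
      proof (rule sw_cong[OF M bil_post[OF cl b] hw(1)])
        fix a b assume ab: "a \<in> cH" "b \<in> cH"
        have mb: "mstar (St z) b \<in> carrier CB" by (rule conv_closed[OF mm ab(2)])
        show "con B (mstar Sg a *\<^sub>2 mstar (mstar (St z)) b) g = con B (mstar Sg a) g \<cdot> \<sigma> b (S w)"
          using hopf.con_C0[OF algebra_B conv_closed[OF mS ab(1)] mb g] ab z hw
          by (simp add: mstar_mstar z_def)
      qed
      finally show ?thesis .
    qed
    finally show "sw B (%g' v. sw B (%h'' h2. sw B (%g'' g2. ?W h' h'' h2 g' g'' g2) v) w) g
      = sw B (%a b. con B (mstar Sg a) g \<cdot> \<sigma> b (S w)) h'" .
  qed
  also have "... = sw B (%h1 h2. (Sg' *\<^sub>2 hat Tau) h1 g \<cdot> Tau h2) h"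
  proof -
    have mS: "mstar Sg \<in> carrier CCCB" by (rule hom_D(4)[OF mstar_hom_CB Sg_closed])
    have l: "lin H B (%a. con B (mstar Sg a) g)"
      by (rule lin_comp[OF hopf.con_linear_arg[OF M g] conv_linear[OF mS]])
    have lc: "con B (mstar Sg a) g \<in> cB" if "a \<in> cH" for a
      by (rule lin_closed[OF l that])
    have tri: "tril H H H B (%a b w. con B (mstar Sg a) g \<cdot> \<sigma> b (S w))"
      by (rule tril_I) (auto intro!: ll l lc)
    have "sw B (%h' w. sw B (%a b. con B (mstar Sg a) g \<cdot> \<sigma> b (S w)) h') h
      = sw B (%a y. sw B (%b w. con B (mstar Sg a) g \<cdot> \<sigma> b (S w)) y) h"
      by (rule sw_coassoc[OF M tri h])
    also have "... = sw B (%h1 h2. (Sg' *\<^sub>2 hat Tau) h1 g \<cdot> Tau h2) h"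
    proof (rule sw_cong[OF M sw_right_bilinear[OF M tri] h])
      fix a y assume ay: "a \<in> cH" "y \<in> cH"
      have "bil H H B (%p q. \<sigma> p (S q))"
        by (rule bil_comp[OF sigma_bilinear lin_id S_linear])
      from sw_post[OF M M base.linear_mult_right[OF lin_id lc[OF ay(1)]] this ay(2)]
      show "sw B (%b w. con B (mstar Sg a) g \<cdot> \<sigma> b (S w)) y = (Sg' *\<^sub>2 hat Tau) a g \<cdot> Tau y"
        by (simp add: Tau_sw ay sigma'_act_Tau g)
    qed
    finally show ?thesis .
  qed
  finally show ?thesis .
qed

end

section \<open>The enveloping tensor product and its second basis\<close>

lemma lin_opposite [simp]:
  "linear_map k (opposite A) M f \<longleftrightarrow> linear_map k A M f"
  by (simp add: linear_map_def hom_def opposite_def)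

lemma lin_into_opposite [simp]:
  "linear_map k M (opposite A) f \<longleftrightarrow> linear_map k M A f"
  by (simp add: linear_map_def hom_def opposite_def)

lemma carrier_opposite: "carrier (opposite A) = carrier A"
  by (simp add: opposite_def)

lemma opposite_ops:
  "x \<otimes>\<^bsub>opposite A\<^esub> y = y \<otimes>\<^bsub>A\<^esub> x" "\<one>\<^bsub>opposite A\<^esub> = \<one>\<^bsub>A\<^esub>" "\<zero>\<^bsub>opposite A\<^esub> = \<zero>\<^bsub>A\<^esub>"
  "x \<oplus>\<^bsub>opposite A\<^esub> y = x \<oplus>\<^bsub>A\<^esub> y" "a \<odot>\<^bsub>opposite A\<^esub> x = a \<odot>\<^bsub>A\<^esub> x"
  "carrier (opposite A) = carrier A"
  by (simp_all add: opposite_def)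

lemma (in unital_algebra) unital_algebra_opposite: "unital_algebra k (opposite A)"
proof (rule unital_algebraI[OF field_k])
  have ag: "abelian_group (opposite A)"
  proof (rule abelian_groupI)
    fix x assume "x \<in> carrier (opposite A)"
    then show "\<exists>y\<in>carrier (opposite A). y \<oplus>\<^bsub>opposite A\<^esub> x = \<zero>\<^bsub>opposite A\<^esub>"
      by (intro bexI[of _ "\<ominus>\<^bsub>A\<^esub> x"]) (simp_all add: opposite_ops A.l_neg)
  qed (simp_all add: opposite_ops A.a_ac)
  show "module k (opposite A)"
    by (rule moduleI[OF module.axioms(1)[OF module_axioms] ag])
       (simp_all add: opposite_ops smult_l_distr smult_r_distr smult_assoc1)
  show "bilinear_map k (opposite A) (opposite A) (opposite A) (%x y. x \<otimes>\<^bsub>opposite A\<^esub> y)"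
    by (rule bil_I) (auto intro!: linear_mult_left linear_mult_right lin_id simp: opposite_ops)
qed (auto simp: opposite_ops A.m_assoc)

locale enveloping_cross_product = cocycle_cross_product k B H act \<sigma> \<sigma>'
  for k :: "('k, 'p) ring_scheme" and B :: "('k, 'b, 'n) module_scheme" and H :: "('k, 'h, 'm) hopf_data_scheme"
    and act :: "'h \<Rightarrow> 'b \<Rightarrow> 'b" and \<sigma> \<sigma>' :: "'h \<Rightarrow> 'h \<Rightarrow> 'b"
begin

lemma algebra_op: "unital_algebra k (opposite B)"
  by (rule base.unital_algebra_opposite)

sublocale BB: tensor_algebra_pair k B "opposite B"
  by (simp add: tensor_algebra_pair_def algebra_B algebra_op)

sublocale VV: tensor_pair k "tensor_algebra k B (opposite B)" H
  by (simp add: tensor_pair_def BB.module_P hopf.module_A)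

abbreviation V where "V \<equiv> tensor_algebra k (tensor_algebra k B (opposite B)) H"
abbreviation cV where "cV \<equiv> carrier V"

definition e :: "'b \<Rightarrow> 'b \<Rightarrow> 'h \<Rightarrow> (('b \<times> 'b \<Rightarrow>\<^sub>0 int) set \<times> 'h \<Rightarrow>\<^sub>0 int) set"
  where "e b b' h = pure_tensor VV.T (pure_tensor BB.T b b') h"

lemma pure_BB_closed: "[|b \<in> cB; b' \<in> cB|] ==> pure_tensor BB.T b b' \<in> carrier BB.AC"
  by (rule BB.pure_tensor_closed) (simp_all only: carrier_opposite)

lemma env_elem_e: "env_elem k B H b b' h = e b b' h"
  by (simp add: env_elem_def e_def enveloping_algebra_def VV.T_tensor_over BB.T_tensor_over)

lemma V_enveloping: "tensor_algebra k (enveloping_algebra k B) H = V"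
  by (simp add: enveloping_algebra_def)

lemma V_module: "module k V" by (rule VV.module_P)

sublocale V: module k V by (rule V_module)

lemma e_trilinear: "tril B B H V e"
proof (rule tril_I)
  note p = BB.pure_bilinear
  fix y z assume yz: "y \<in> cB" "z \<in> cH"
  show "lin B V (%x. e x y z)"
    unfolding e_def
    by (rule bil_left[OF VV.pure_bilinear bil_D(2)[OF p] yz(2)]) (use yz in \<open>simp only: carrier_opposite\<close>)
  show "lin B V (%x. e y x z)"
    unfolding e_def by (rule bil_left[OF VV.pure_bilinear _ yz(2)]) (use bil_D(1)[OF p yz(1)] in simp)
next
  fix x y assume "x \<in> cB" "y \<in> cB"
  then show "lin H V (%z. e x y z)"
    unfolding e_def by (intro bil_D(1)[OF VV.pure_bilinear] pure_BB_closed)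
qed

lemma e_closed [simp]: "[|b \<in> cB; b' \<in> cB; h \<in> cH|] ==> e b b' h \<in> cV"
  by (rule tril_closed[OF e_trilinear])

lemma e_induct [consumes 1, case_names e add]:
  assumes v: "v \<in> cV"
    and "!!b b' h. [|b \<in> cB; b' \<in> cB; h \<in> cH|] ==> P (e b b' h)"
    and add: "!!x y. [|x \<in> cV; y \<in> cV; P x; P y|] ==> P (x \<oplus>\<^bsub>V\<^esub> y)"
  shows "P v"
  using v
proof (induction rule: VV.P_induct)
  case (pure t h)
  show ?case using pure(1)
  proof (induction rule: BB.P_induct)
    case (pure b b')
    then have "b \<in> cB" "b' \<in> cB" by (simp_all only: carrier_opposite)
    then show ?case using assms(2)[of b b' h] \<open>h \<in> cH\<close> by (simp only: e_def)
  next
    case (add s t)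
    then show ?case
      using assms(3)[of "pure_tensor VV.T s h" "pure_tensor VV.T t h"] \<open>h \<in> cH\<close>
      by (simp add: VV.pure_tensor_add_left)
  qed
next
  case (add x y)
  then show ?case by (rule assms(3))
qed

text \<open>The linear map on \<open>V\<close> induced by a trilinear map, with one lift for each of
  the two nested tensor products.\<close>

definition elift :: "('k, 'x, 'y) module_scheme \<Rightarrow> ('b \<Rightarrow> 'b \<Rightarrow> 'h \<Rightarrow> 'x) \<Rightarrow> (('b \<times> 'b \<Rightarrow>\<^sub>0 int) set \<times> 'h \<Rightarrow>\<^sub>0 int) set \<Rightarrow> 'x"
  where "elift M F = tensor_lift (add_monoid M) (%t h. tensor_lift (add_monoid M) (%b b'. F b b' h) t)"

lemma elift_inner:
  assumes "tril B B H M F" "h \<in> cH"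
  shows "BB.lift_ok M (%b b'. F b b' h)"
  by (rule BB.lift_okI_bilinear) (use tril_D(6)[OF assms] in \<open>simp add: bilinear_map_def carrier_opposite\<close>)

lemma elift_outer:
  assumes M: "module k M" and F: "tril B B H M F"
  shows "VV.lift_ok M (%t h. tensor_lift (add_monoid M) (%b b'. F b b' h) t)"
proof (rule VV.lift_okI_bilinear, rule bil_I)
  fix t assume t: "t \<in> carrier (tensor_algebra k B (opposite B))"
  show "lin H M (%h. tensor_lift (add_monoid M) (%b b'. F b b' h) t)"
    by (rule BB.tensor_lift_param_linear[OF M hopf.module_A elift_inner[OF F] _ t])
       (use tril_D(3)[OF F] in \<open>simp_all add: carrier_opposite\<close>)
next
  fix h assume "h \<in> cH"
  then show "lin (tensor_algebra k B (opposite B)) M (%t. tensor_lift (add_monoid M) (%b b'. F b b' h) t)"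
    by (intro BB.tensor_lift_linear[OF M elift_inner[OF F]])
qed

lemma elift_linear:
  assumes M: "module k M" and F: "tril B B H M F"
  shows "lin V M (elift M F)"
  unfolding elift_def by (rule VV.tensor_lift_linear[OF M elift_outer[OF M F]])

lemma elift_e:
  assumes M: "module k M" and F: "tril B B H M F"
    and "b \<in> cB" "b' \<in> cB" "h \<in> cH"
  shows "elift M F (e b b' h) = F b b' h"
proof -
  have b': "b' \<in> carrier (opposite B)" using assms(4) by (simp only: carrier_opposite)
  show ?thesis
    unfolding elift_def e_def VV.tensor_lift_pure[OF M elift_outer[OF M F] pure_BB_closed[OF assms(3,4)] assms(5)]
    by (rule BB.tensor_lift_pure[OF M elift_inner[OF F assms(5)] assms(3) b'])
qed

lemma e_linear_eqI:
  assumes "lin V M f" "lin V M g"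
    and "!!b b' h. [|b \<in> cB; b' \<in> cB; h \<in> cH|] ==> f (e b b' h) = g (e b b' h)"
    and "v \<in> cV"
  shows "f v = g v"
  using assms(4)
  by (induction rule: e_induct) (simp_all add: assms(3) lin_add[OF assms(1)] lin_add[OF assms(2)])

lemma elift_param_linear:
  assumes M: "module k M" and W: "module k W"
    and F: "!!w. w \<in> carrier W ==> tril B B H M (F w)"
    and lin: "!!b b' h. [|b \<in> cB; b' \<in> cB; h \<in> cH|] ==> lin W M (%w. F w b b' h)"
    and v: "v \<in> cV"
  shows "lin W M (%w. elift M (F w) v)"
  using v
proof (induction rule: e_induct)
  case (e b b' h)
  show ?case
    by (rule lin_cong[OF W lin[OF e]]) (simp add: elift_e[OF M F] e)
next
  case (add x y)
  show ?case
    by (rule lin_cong[OF W lin_plus[OF M add.IH]])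
       (simp add: lin_add[OF elift_linear[OF M F]] add.hyps)
qed

text \<open>
  \<open>E b c h\<close> is the element \<open>b\<cdot>u(h)\<cdot>c\<close> of the free \<open>B\<close>-bimodule on \<open>H\<close>; the antipode occurs only
  in this change of basis, not in the bialgebroid structure expressed through \<open>E\<close>.
\<close>

definition E :: "'b \<Rightarrow> 'b \<Rightarrow> 'h \<Rightarrow> (('b \<times> 'b \<Rightarrow>\<^sub>0 int) set \<times> 'h \<Rightarrow>\<^sub>0 int) set"
  where "E b c h = sw V (%x y. e b (qq c y) x) h"

lemma E_bilinear:
  assumes "b \<in> cB" "c \<in> cB"
  shows "bil H H V (%x y. e b (qq c y) x)"
  by (rule bil_I)
     (auto intro!: lin_comp[OF tril_D(2)[OF e_trilinear]] tril_D(3)[OF e_trilinear]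
        bil_D(1)[OF qq_bilinear] simp: assms)

lemma E_trilinear: "tril B B H V E"
proof (rule tril_I)
  fix y z assume yz: "y \<in> cB" "z \<in> cH"
  show "lin B V (%x. E x y z)"
    unfolding E_def
    by (rule sw_param_linear[OF V_module base.module_A E_bilinear _ yz(2)])
       (auto intro!: tril_D(1)[OF e_trilinear] simp: yz)
  show "lin B V (%x. E y x z)"
    unfolding E_def
    by (rule sw_param_linear[OF V_module base.module_A E_bilinear _ yz(2)])
       (auto intro!: lin_comp[OF tril_D(2)[OF e_trilinear]] bil_D(2)[OF qq_bilinear] simp: yz)
next
  fix x y assume "x \<in> cB" "y \<in> cB"
  then show "lin H V (%z. E x y z)"
    unfolding E_def by (intro sw_linear[OF V_module E_bilinear])
qed

lemma E_closed [simp]: "[|b \<in> cB; c \<in> cB; h \<in> cH|] ==> E b c h \<in> cV"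
  by (rule tril_closed[OF E_trilinear])

lemma E_pp_bilinear:
  assumes M: "module k M" and F: "tril B B H M F" and b: "b \<in> cB" "b' \<in> cB"
  shows "bil H H M (%x y. F b (pp b' y) x)"
  by (rule bil_I)
     (auto intro!: lin_comp[OF tril_D(2)[OF F]] tril_D(3)[OF F]
        bil_D(1)[OF pp_bilinear] simp: b)

text \<open>Coassociativity puts two successive changes of the coefficient on adjacent legs, where
  the hypothesis makes their composite a counit. Used with \<open>pp\<close> and \<open>qq\<close>
  in either order, it shows that the change of basis is invertible.\<close>

lemma E_qq_leg:
  assumes M: "module k M" and F: "tril B B H M F" and b: "b \<in> cB"
    and G: "bil H H B G" and h: "h \<in> cH" and c: "c \<in> cB"
    and eq: "!!w. w \<in> cH ==> sw B (%v y. G v y) w = eps w \<odot>\<^bsub>B\<^esub> c"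
  shows "sw M (%x y. sw M (%u v. F b (G v y) u) x) h = F b c h"
proof -
  note l2 = lin_comp[OF tril_D(2)[OF F]]
  have tri: "tril H H H M (%u v y. F b (G v y) u)"
    by (rule tril_I)
       (auto intro!: l2 tril_D(3)[OF F] bil_D[OF G] bil_closed[OF G] b)
  have "sw M (%x y. sw M (%u v. F b (G v y) u) x) h = sw M (%u w. sw M (%v y. F b (G v y) u) w) h"
    by (rule sw_coassoc[OF M tri h])
  also have "... = F b c h"
  proof (rule hopf.sw_absorb_right[OF M sw_right_bilinear[OF M tri] tril_D(3)[OF F b c] h])
    fix u w assume uw: "u \<in> cH" "w \<in> cH"
    have "sw M (%v y. F b (G v y) u) w = F b (sw B (%v y. G v y) w) u"
      by (rule sw_post[symmetric, OF base.module_A M tril_D(2)[OF F b uw(1)] G uw(2)])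
    then show "sw M (%v y. F b (G v y) u) w = eps w \<odot>\<^bsub>M\<^esub> F b c u"
      using uw by (simp add: eq lin_smult[OF tril_D(2)[OF F b uw(1)]] c)
  qed
  finally show ?thesis .
qed

lemma e_E:
  assumes b: "b \<in> cB" "b' \<in> cB" and h: "h \<in> cH"
  shows "e b b' h = sw V (%x y. E b (pp b' y) x) h"
  unfolding E_def
  by (rule E_qq_leg[symmetric, OF V_module e_trilinear b(1) _ h b(2)])
     (auto intro!: bil_swap[OF bil_comp[OF qq_bilinear bil_D(1)[OF pp_bilinear b(2)] lin_id]]
        simp: qq_pp b)

text \<open>The universal property of the free bimodule. It is built in the original coordinates,
  where linear maps can be defined by lifting, and F is precomposed with the change of
  coefficient.\<close>

definition Elift :: "('k, 'x, 'y) module_scheme \<Rightarrow> ('b \<Rightarrow> 'b \<Rightarrow> 'h \<Rightarrow> 'x) \<Rightarrow> (('b \<times> 'b \<Rightarrow>\<^sub>0 int) set \<times> 'h \<Rightarrow>\<^sub>0 int) set \<Rightarrow> 'x"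
  where "Elift M F = elift M (%b b' h. sw M (%x y. F b (pp b' y) x) h)"

lemma Elift_trilinear:
  assumes M: "module k M" and F: "tril B B H M F"
  shows "tril B B H M (%b b' h. sw M (%x y. F b (pp b' y) x) h)"
proof (rule tril_I)
  note bb = E_pp_bilinear[OF M F]
  fix y z assume yz: "y \<in> cB" "z \<in> cH"
  show "lin B M (%b. sw M (%u v. F b (pp y v) u) z)"
    by (rule sw_param_linear[OF M base.module_A bb _ yz(2)]) (auto intro!: tril_D(1)[OF F] simp: yz)
  show "lin B M (%b'. sw M (%u v. F y (pp b' v) u) z)"
    by (rule sw_param_linear[OF M base.module_A bb _ yz(2)])
       (auto intro!: lin_comp[OF tril_D(2)[OF F]] bil_D(2)[OF pp_bilinear] simp: yz)
next
  fix x y assume "x \<in> cB" "y \<in> cB"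
  then show "lin H M (%h. sw M (%u v. F x (pp y v) u) h)"
    by (intro sw_linear[OF M E_pp_bilinear[OF M F]])
qed

lemma Elift_linear:
  assumes "module k M" "tril B B H M F"
  shows "lin V M (Elift M F)"
  unfolding Elift_def by (rule elift_linear[OF assms(1) Elift_trilinear[OF assms]])

lemma Elift_e:
  assumes M: "module k M" and F: "tril B B H M F"
    and b: "b \<in> cB" "b' \<in> cB" "h \<in> cH"
  shows "Elift M F (e b b' h) = sw M (%x y. F b (pp b' y) x) h"
  unfolding Elift_def by (rule elift_e[OF M Elift_trilinear[OF M F] b])

lemma Elift_E:
  assumes M: "module k M" and F: "tril B B H M F"
    and b: "b \<in> cB" "c \<in> cB" and h: "h \<in> cH"
  shows "Elift M F (E b c h) = F b c h"
proof -
  note lin = Elift_linear[OF M F]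
  have "Elift M F (E b c h) = sw M (%x y. sw M (%u v. F b (pp (qq c y) v) u) x) h"
    unfolding E_def by (rule sw_map[OF V_module M lin E_bilinear[OF b] h]) (simp add: Elift_e[OF M F] b)
  also have "... = F b c h"
    by (rule E_qq_leg[OF M F b(1) _ h b(2)])
       (auto intro!: bil_swap[OF bil_comp[OF pp_bilinear bil_D(1)[OF qq_bilinear b(2)] lin_id]]
          simp: pp_qq b)
  finally show ?thesis .
qed

lemma E_linear_eqI:
  assumes M: "module k M" and f: "lin V M f" and g: "lin V M g"
    and eq: "!!b c h. [|b \<in> cB; c \<in> cB; h \<in> cH|] ==> f (E b c h) = g (E b c h)"
    and v: "v \<in> cV"
  shows "f v = g v"
proof (rule e_linear_eqI[OF f g _ v])
  fix b b' h assume b: "b \<in> cB" "b' \<in> cB" and h: "h \<in> cH"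
  note bb = E_pp_bilinear[OF V_module E_trilinear b]
  have "f (e b b' h) = sw M (%x y. g (E b (pp b' y) x)) h"
    unfolding e_E[OF b h] by (rule sw_map[OF V_module M f bb h]) (simp add: eq b)
  also have "... = g (e b b' h)"
    unfolding e_E[OF b h] by (rule sw_post[symmetric, OF V_module M g bb h])
  finally show "f (e b b' h) = g (e b b' h)" .
qed

lemma Elift_param_linear:
  assumes M: "module k M" and W: "module k W"
    and F: "!!w. w \<in> carrier W ==> tril B B H M (F w)"
    and lin: "!!b c h. [|b \<in> cB; c \<in> cB; h \<in> cH|] ==> lin W M (%w. F w b c h)"
    and v: "v \<in> cV"
  shows "lin W M (%w. Elift M (F w) v)"
  unfolding Elift_def
  by (rule elift_param_linear[OF M W Elift_trilinear[OF M F] _ v])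
     (auto intro!: sw_param_linear[OF M W E_pp_bilinear[OF M F]] lin)

end

text \<open>The product and unit of the record have no meaning for a balanced tensor product; only
  its group structure and its scalars are read.\<close>

definition tensor_space ::
    "('k, 'a, 'm) module_scheme \<Rightarrow> ('a \<times> 'c \<Rightarrow>\<^sub>0 int) set monoid \<Rightarrow> ('k, ('a \<times> 'c \<Rightarrow>\<^sub>0 int) set) module"
  where "tensor_space A T = \<lparr>carrier = carrier T, monoid.mult = undefined, one = undefined, ring.zero = \<one>\<^bsub>T\<^esub>,
    ring.add = monoid.mult T, module.smult = (%a. tensor_lift T (%x y. pure_tensor T (a \<odot>\<^bsub>A\<^esub> x) y))\<rparr>"

section \<open>Truncated tensor rings\<close>

text \<open>
  Products of degree above two are discarded; for \<open>W = V \<otimes>\<^sub>B V\<close> this is the tensor ring of the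
  bimodule \<open>V\<close> truncated in degree two.
\<close>

locale truncated_ring = B: unital_algebra k B + V: module k V + W: module k W
  for k :: "('k, 'p) ring_scheme" and B :: "('k, 'b, 'm) module_scheme"
    and V :: "('k, 'v, 'n) module_scheme" and W :: "('k, 'w, 'q) module_scheme" +
  fixes lV :: "'b \<Rightarrow> 'v \<Rightarrow> 'v" and rV :: "'v \<Rightarrow> 'b \<Rightarrow> 'v" and lW :: "'b \<Rightarrow> 'w \<Rightarrow> 'w" and rW :: "'w \<Rightarrow> 'b \<Rightarrow> 'w"
    and pr :: "'v \<Rightarrow> 'v \<Rightarrow> 'w"
  assumes bilin: "bilinear_map k B V V lV" "bilinear_map k V B V rV" "bilinear_map k B W W lW" "bilinear_map k W B W rW"
      "bilinear_map k V V W pr"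
    and bimodule_V: "[|a \<in> carrier B; b \<in> carrier B; x \<in> carrier V|] ==> lV (a \<otimes>\<^bsub>B\<^esub> b) x = lV a (lV b x)"
      "x \<in> carrier V ==> lV \<one>\<^bsub>B\<^esub> x = x"
      "[|a \<in> carrier B; b \<in> carrier B; x \<in> carrier V|] ==> rV x (a \<otimes>\<^bsub>B\<^esub> b) = rV (rV x a) b"
      "x \<in> carrier V ==> rV x \<one>\<^bsub>B\<^esub> = x"
      "[|a \<in> carrier B; b \<in> carrier B; x \<in> carrier V|] ==> rV (lV a x) b = lV a (rV x b)"
    and bimodule_W: "[|a \<in> carrier B; b \<in> carrier B; p \<in> carrier W|] ==> lW (a \<otimes>\<^bsub>B\<^esub> b) p = lW a (lW b p)"
      "p \<in> carrier W ==> lW \<one>\<^bsub>B\<^esub> p = p"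
      "[|a \<in> carrier B; b \<in> carrier B; p \<in> carrier W|] ==> rW p (a \<otimes>\<^bsub>B\<^esub> b) = rW (rW p a) b"
      "p \<in> carrier W ==> rW p \<one>\<^bsub>B\<^esub> = p"
      "[|a \<in> carrier B; b \<in> carrier B; p \<in> carrier W|] ==> rW (lW a p) b = lW a (rW p b)"
    and pairing: "[|a \<in> carrier B; x \<in> carrier V; y \<in> carrier V|] ==> pr (lV a x) y = lW a (pr x y)"
      "[|a \<in> carrier B; x \<in> carrier V; y \<in> carrier V|] ==> pr x (rV y a) = rW (pr x y) a"
      "[|a \<in> carrier B; x \<in> carrier V; y \<in> carrier V|] ==> pr (rV x a) y = pr x (lV a y)"
begin

definition TR :: "('k, 'b \<times> 'v \<times> 'w) module"
  where "TR = \<lparr>carrier = carrier B \<times> carrier V \<times> carrier W,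
    monoid.mult = (%(b, x, p) (b', x', p').
      (b \<otimes>\<^bsub>B\<^esub> b', lV b x' \<oplus>\<^bsub>V\<^esub> rV x b', (lW b p' \<oplus>\<^bsub>W\<^esub> pr x x') \<oplus>\<^bsub>W\<^esub> rW p b')),
    one = (\<one>\<^bsub>B\<^esub>, \<zero>\<^bsub>V\<^esub>, \<zero>\<^bsub>W\<^esub>),
    ring.zero = (\<zero>\<^bsub>B\<^esub>, \<zero>\<^bsub>V\<^esub>, \<zero>\<^bsub>W\<^esub>),
    ring.add = (%(b, x, p) (b', x', p'). (b \<oplus>\<^bsub>B\<^esub> b', x \<oplus>\<^bsub>V\<^esub> x', p \<oplus>\<^bsub>W\<^esub> p')),
    module.smult = (%a (b, x, p). (a \<odot>\<^bsub>B\<^esub> b, a \<odot>\<^bsub>V\<^esub> x, a \<odot>\<^bsub>W\<^esub> p))\<rparr>"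

lemma TR_simps:
  "carrier TR = carrier B \<times> carrier V \<times> carrier W"
  "(b, x, p) \<otimes>\<^bsub>TR\<^esub> (b', x', p') = (b \<otimes>\<^bsub>B\<^esub> b', lV b x' \<oplus>\<^bsub>V\<^esub> rV x b', (lW b p' \<oplus>\<^bsub>W\<^esub> pr x x') \<oplus>\<^bsub>W\<^esub> rW p b')"
  "\<one>\<^bsub>TR\<^esub> = (\<one>\<^bsub>B\<^esub>, \<zero>\<^bsub>V\<^esub>, \<zero>\<^bsub>W\<^esub>)"
  "\<zero>\<^bsub>TR\<^esub> = (\<zero>\<^bsub>B\<^esub>, \<zero>\<^bsub>V\<^esub>, \<zero>\<^bsub>W\<^esub>)"
  "(b, x, p) \<oplus>\<^bsub>TR\<^esub> (b', x', p') = (b \<oplus>\<^bsub>B\<^esub> b', x \<oplus>\<^bsub>V\<^esub> x', p \<oplus>\<^bsub>W\<^esub> p')"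
  "a \<odot>\<^bsub>TR\<^esub> (b, x, p) = (a \<odot>\<^bsub>B\<^esub> b, a \<odot>\<^bsub>V\<^esub> x, a \<odot>\<^bsub>W\<^esub> p)"
  by (simp_all add: TR_def)

lemmas cl [simp] = bilin[THEN bil_closed]
lemmas addr = bilin[THEN bil_D(1), THEN lin_add]
lemmas addl = bilin[THEN bil_D(2), THEN lin_add]
lemmas smr = bilin[THEN bil_D(1), THEN lin_smult]
lemmas sml = bilin[THEN bil_D(2), THEN lin_smult]

lemma zr [simp]:
  "a \<in> carrier B ==> lV a \<zero>\<^bsub>V\<^esub> = \<zero>\<^bsub>V\<^esub>" "x \<in> carrier V ==> rV x \<zero>\<^bsub>B\<^esub> = \<zero>\<^bsub>V\<^esub>"
  "a \<in> carrier B ==> lW a \<zero>\<^bsub>W\<^esub> = \<zero>\<^bsub>W\<^esub>" "p \<in> carrier W ==> rW p \<zero>\<^bsub>B\<^esub> = \<zero>\<^bsub>W\<^esub>"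
  "x \<in> carrier V ==> pr x \<zero>\<^bsub>V\<^esub> = \<zero>\<^bsub>W\<^esub>"
  using bilin[THEN bil_D(1), THEN lin_zero[rotated 2]] B.module_A V.module_axioms W.module_axioms
  by auto

lemma zl [simp]:
  "x \<in> carrier V ==> lV \<zero>\<^bsub>B\<^esub> x = \<zero>\<^bsub>V\<^esub>" "a \<in> carrier B ==> rV \<zero>\<^bsub>V\<^esub> a = \<zero>\<^bsub>V\<^esub>"
  "p \<in> carrier W ==> lW \<zero>\<^bsub>B\<^esub> p = \<zero>\<^bsub>W\<^esub>" "a \<in> carrier B ==> rW \<zero>\<^bsub>W\<^esub> a = \<zero>\<^bsub>W\<^esub>"
  "x \<in> carrier V ==> pr \<zero>\<^bsub>V\<^esub> x = \<zero>\<^bsub>W\<^esub>"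
  using bilin[THEN bil_D(2), THEN lin_zero[rotated 2]] B.module_A V.module_axioms W.module_axioms
  by auto

lemma TR_module: "module k TR"
proof (rule moduleI)
  show "abelian_group TR"
  proof (rule abelian_groupI)
    fix x assume "x \<in> carrier TR"
    then obtain b v w where x: "x = (b, v, w)" "b \<in> carrier B" "v \<in> carrier V" "w \<in> carrier W"
      by (auto simp: TR_simps)
    then have "(\<ominus>\<^bsub>B\<^esub> b, \<ominus>\<^bsub>V\<^esub> v, \<ominus>\<^bsub>W\<^esub> w) \<oplus>\<^bsub>TR\<^esub> x = \<zero>\<^bsub>TR\<^esub>"
      by (simp add: TR_simps B.A.l_neg V.l_neg W.l_neg)
    then show "\<exists>y\<in>carrier TR. y \<oplus>\<^bsub>TR\<^esub> x = \<zero>\<^bsub>TR\<^esub>"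
      using x by (auto simp: TR_simps intro!: bexI[of _ "(\<ominus>\<^bsub>B\<^esub> b, \<ominus>\<^bsub>V\<^esub> v, \<ominus>\<^bsub>W\<^esub> w)"])
  qed (auto simp: TR_simps B.A.a_ac V.a_ac W.a_ac)
qed (auto simp: TR_simps B.smult_l_distr V.smult_l_distr W.smult_l_distr B.smult_r_distr V.smult_r_distr W.smult_r_distr
      B.smult_assoc1 V.smult_assoc1 W.smult_assoc1 intro: module.axioms(1)[OF B.module_A])

text \<open>A surviving component of a triple product contains at most two factors from
  \<open>V\<close>, so the bimodule laws and the balancedness of the pairing account for
  associativity.\<close>

lemma TR_algebra: "unital_algebra k TR"
proof (rule unital_algebraI[OF B.field_k TR_module])
  show "bilinear_map k TR TR TR (%x y. x \<otimes>\<^bsub>TR\<^esub> y)"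
    by (intro bil_I lin_I)
       (auto simp: TR_simps addl addr sml smr B.A.l_distr B.A.r_distr B.smult_mult_left B.smult_mult_right
          V.smult_r_distr W.smult_r_distr V.a_ac W.a_ac)
qed (auto simp: TR_simps addl addr B.A.m_assoc bimodule_V bimodule_W pairing V.a_ac W.a_ac)

end

lemma tril_pre:
  assumes F: "trilinear_map k A B C M F" and f: "linear_map k A' A f" "linear_map k B' B g" "linear_map k C' C i"
  shows "trilinear_map k A' B' C' M (%x y z. F (f x) (g y) (i z))"
  by (rule tril_I)
     (auto intro: lin_comp[OF tril_D(1)[OF F] f(1)] lin_comp[OF tril_D(2)[OF F] f(2)]
        lin_comp[OF tril_D(3)[OF F] f(3)]
        lin_closed[OF f(1)] lin_closed[OF f(2)] lin_closed[OF f(3)])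

section \<open>Homogeneous components of the truncated ring\<close>

context truncated_ring
begin

definition iB :: "'b \<Rightarrow> 'b \<times> 'v \<times> 'w" where "iB b = (b, \<zero>\<^bsub>V\<^esub>, \<zero>\<^bsub>W\<^esub>)"
definition iV :: "'v \<Rightarrow> 'b \<times> 'v \<times> 'w" where "iV x = (\<zero>\<^bsub>B\<^esub>, x, \<zero>\<^bsub>W\<^esub>)"
definition iW :: "'w \<Rightarrow> 'b \<times> 'v \<times> 'w" where "iW p = (\<zero>\<^bsub>B\<^esub>, \<zero>\<^bsub>V\<^esub>, p)"

lemma iB_closed [simp]: "b \<in> carrier B ==> iB b \<in> carrier TR"
  and iV_closed [simp]: "x \<in> carrier V ==> iV x \<in> carrier TR"
  and iW_closed [simp]: "p \<in> carrier W ==> iW p \<in> carrier TR"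
  by (simp_all add: iB_def iV_def iW_def TR_simps)

lemma i_mult:
  "[|a \<in> carrier B; b \<in> carrier B|] ==> iB a \<otimes>\<^bsub>TR\<^esub> iB b = iB (a \<otimes>\<^bsub>B\<^esub> b)"
  "[|a \<in> carrier B; x \<in> carrier V|] ==> iB a \<otimes>\<^bsub>TR\<^esub> iV x = iV (lV a x)"
  "[|a \<in> carrier B; x \<in> carrier V|] ==> iV x \<otimes>\<^bsub>TR\<^esub> iB a = iV (rV x a)"
  "[|a \<in> carrier B; p \<in> carrier W|] ==> iB a \<otimes>\<^bsub>TR\<^esub> iW p = iW (lW a p)"
  "[|a \<in> carrier B; p \<in> carrier W|] ==> iW p \<otimes>\<^bsub>TR\<^esub> iB a = iW (rW p a)"
  "[|x \<in> carrier V; y \<in> carrier V|] ==> iV x \<otimes>\<^bsub>TR\<^esub> iV y = iW (pr x y)"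
  "[|x \<in> carrier V; p \<in> carrier W|] ==> iV x \<otimes>\<^bsub>TR\<^esub> iW p = \<zero>\<^bsub>TR\<^esub>"
  "[|x \<in> carrier V; p \<in> carrier W|] ==> iW p \<otimes>\<^bsub>TR\<^esub> iV x = \<zero>\<^bsub>TR\<^esub>"
  "[|p \<in> carrier W; q \<in> carrier W|] ==> iW p \<otimes>\<^bsub>TR\<^esub> iW q = \<zero>\<^bsub>TR\<^esub>"
  by (simp_all add: iB_def iV_def iW_def TR_simps)

lemma iB_linear: "linear_map k B TR iB"
  by (rule lin_I) (auto simp: iB_def TR_simps V.smult_r_null W.smult_r_null)

lemma iV_linear: "linear_map k V TR iV"
  by (rule lin_I) (auto simp: iV_def TR_simps B.smult_r_null W.smult_r_null)

lemma iW_linear: "linear_map k W TR iW"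
  by (rule lin_I) (auto simp: iW_def TR_simps B.smult_r_null V.smult_r_null)

lemma iB_hom: "algebra_hom k B TR iB"
  by (rule hom_I[OF iB_linear]) (simp_all add: i_mult, simp add: iB_def TR_simps)

definition pB :: "'b \<times> 'v \<times> 'w \<Rightarrow> 'b" where "pB r = fst r"
definition pV :: "'b \<times> 'v \<times> 'w \<Rightarrow> 'v" where "pV r = fst (snd r)"
definition pW :: "'b \<times> 'v \<times> 'w \<Rightarrow> 'w" where "pW r = snd (snd r)"

lemma p_i [simp]:
  "pB (iB b) = b" "pV (iB b) = \<zero>\<^bsub>V\<^esub>" "pW (iB b) = \<zero>\<^bsub>W\<^esub>"
  "pB (iV x) = \<zero>\<^bsub>B\<^esub>" "pV (iV x) = x" "pW (iV x) = \<zero>\<^bsub>W\<^esub>"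
  "pB (iW p) = \<zero>\<^bsub>B\<^esub>" "pV (iW p) = \<zero>\<^bsub>V\<^esub>" "pW (iW p) = p"
  by (simp_all add: pB_def pV_def pW_def iB_def iV_def iW_def)

lemma p_linear: "linear_map k TR B pB" "linear_map k TR V pV" "linear_map k TR W pW"
  by (rule lin_I; auto simp: pB_def pV_def pW_def TR_simps)+

lemma p_closed [simp]:
  "r \<in> carrier TR ==> pB r \<in> carrier B" "r \<in> carrier TR ==> pV r \<in> carrier V" "r \<in> carrier TR ==> pW r \<in> carrier W"
  by (rule lin_closed[OF p_linear(1)] lin_closed[OF p_linear(2)] lin_closed[OF p_linear(3)]; assumption)+

lemma TR_decomp: "r \<in> carrier TR ==> r = iB (pB r) \<oplus>\<^bsub>TR\<^esub> iV (pV r) \<oplus>\<^bsub>TR\<^esub> iW (pW r)"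
  by (auto simp: pB_def pV_def pW_def iB_def iV_def iW_def TR_simps)

lemma TR_mult_decomp:
  assumes "r \<in> carrier TR" "s \<in> carrier TR"
  shows "pB (r \<otimes>\<^bsub>TR\<^esub> s) = pB r \<otimes>\<^bsub>B\<^esub> pB s"
    and "pV (r \<otimes>\<^bsub>TR\<^esub> s) = lV (pB r) (pV s) \<oplus>\<^bsub>V\<^esub> rV (pV r) (pB s)"
    and "pW (r \<otimes>\<^bsub>TR\<^esub> s) = lW (pB r) (pW s) \<oplus>\<^bsub>W\<^esub> pr (pV r) (pV s) \<oplus>\<^bsub>W\<^esub> rW (pW r) (pB s)"
  using assms by (auto simp: pB_def pV_def pW_def TR_simps)

definition degV :: "('b \<times> 'v \<times> 'w) set" where "degV = iV ` carrier V"
definition degW :: "('b \<times> 'v \<times> 'w) set" where "degW = iW ` carrier W"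

text \<open>Homogeneity is expressed by the vanishing of linear projections, a condition that passes
  through Sweedler sums term by term.\<close>

lemma degV_iff: "r \<in> degV \<longleftrightarrow> r \<in> carrier TR \<and> pB r = \<zero>\<^bsub>B\<^esub> \<and> pW r = \<zero>\<^bsub>W\<^esub>"
  by (auto simp: degV_def iV_def pB_def pW_def TR_simps)

lemma degW_iff: "r \<in> degW \<longleftrightarrow> r \<in> carrier TR \<and> pB r = \<zero>\<^bsub>B\<^esub> \<and> pV r = \<zero>\<^bsub>V\<^esub>"
  by (auto simp: degW_def iW_def pB_def pV_def TR_simps)

lemma degV_mult: "[|b \<in> carrier B; r \<in> degV|] ==> iB b \<otimes>\<^bsub>TR\<^esub> r \<in> degV" "[|b \<in> carrier B; r \<in> degV|] ==> r \<otimes>\<^bsub>TR\<^esub> iB b \<in> degV"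
  by (auto simp: degV_def i_mult)

lemma degV_mult_degV: "[|r \<in> degV; s \<in> degV|] ==> r \<otimes>\<^bsub>TR\<^esub> s \<in> degW"
  by (auto simp: degV_def degW_def i_mult)

lemma deg_mult_zero:
  "[|r \<in> degV; s \<in> degW|] ==> r \<otimes>\<^bsub>TR\<^esub> s = \<zero>\<^bsub>TR\<^esub>" "[|r \<in> degW; s \<in> degV|] ==> r \<otimes>\<^bsub>TR\<^esub> s = \<zero>\<^bsub>TR\<^esub>"
  "[|r \<in> degW; s \<in> degW|] ==> r \<otimes>\<^bsub>TR\<^esub> s = \<zero>\<^bsub>TR\<^esub>"
  by (auto simp: degV_def degW_def i_mult)

end

context hopf_algebra
begin

lemma sw_zero:
  assumes M: "module k M" and F: "bil H H M F" and h: "h \<in> cH"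
    and z: "!!x y. [|x \<in> cH; y \<in> cH|] ==> F x y = \<zero>\<^bsub>M\<^esub>"
  shows "sw M F h = \<zero>\<^bsub>M\<^esub>"
  using sw_cong[OF M F h z] sw_post[OF M M lin_zero_fun[OF M] F h] by simp

lemma conv_mult_zero:
  assumes R: "unital_algebra k R" and F: "F \<in> carrier (C R)" and G: "G \<in> carrier (C R)"
    and z: "!!x y. [|x \<in> cH; y \<in> cH|] ==> F x \<otimes>\<^bsub>R\<^esub> G y = \<zero>\<^bsub>R\<^esub>"
  shows "F \<otimes>\<^bsub>C R\<^esub> G = \<zero>\<^bsub>C R\<^esub>"
proof -
  interpret CR: unital_algebra k "C R" by (rule algebra_conv[OF R])
  show ?thesis
    by (rule conv_eqI[where R = R])
       (auto intro!: sw_zero[OF unital_algebra.module_A[OF R] conv_mult_bilinear_pre[OF R F G]] z F G simp: conv_apply)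
qed

lemma conv_mult_kernel:
  assumes R: "unital_algebra k R" and M: "module k M" and p: "lin R M p"
    and F: "F \<in> carrier (C R)" and G: "G \<in> carrier (C R)" and h: "h \<in> cH"
    and z: "!!x y. [|x \<in> cH; y \<in> cH|] ==> p (F x \<otimes>\<^bsub>R\<^esub> G y) = \<zero>\<^bsub>M\<^esub>"
  shows "p ((F \<otimes>\<^bsub>C R\<^esub> G) h) = \<zero>\<^bsub>M\<^esub>"
proof -
  note b = conv_mult_bilinear_pre[OF R F G]
  have "p ((F \<otimes>\<^bsub>C R\<^esub> G) h) = sw M (%x y. p (F x \<otimes>\<^bsub>R\<^esub> G y)) h"
    unfolding conv_apply(1)[OF h] by (rule sw_post[OF unital_algebra.module_A[OF R] M p b h])
  then show ?thesis using sw_zero[OF M bil_post[OF p b] h z] by simp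
qed

end

section \<open>The free bimodule on H and its balanced square\<close>

context enveloping_cross_product
begin

definition lb where "lb b = Elift V (%b' c h. E (b \<cdot> b') c h)"
definition rb where "rb v d = Elift V (%b c h. E b (c \<cdot> d) h) v"
definition u where "u h = E 1\<^sub>B 1\<^sub>B h"

lemma lb_tri: "b \<in> cB ==> tril B B H V (%b' c h. E (b \<cdot> b') c h)"
  by (rule tril_pre[OF E_trilinear base.linear_mult_right lin_id lin_id]) (auto intro: lin_id)

lemma rb_tri: "d \<in> cB ==> tril B B H V (%b c h. E b (c \<cdot> d) h)"
  by (rule tril_pre[OF E_trilinear lin_id base.linear_mult_left lin_id]) (auto intro: lin_id)

lemma lb_E [simp]: "[|b \<in> cB; b' \<in> cB; c \<in> cB; h \<in> cH|] ==> lb b (E b' c h) = E (b \<cdot> b') c h"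
  unfolding lb_def by (rule Elift_E[OF V_module lb_tri])

lemma rb_E [simp]: "[|d \<in> cB; b \<in> cB; c \<in> cB; h \<in> cH|] ==> rb (E b c h) d = E b (c \<cdot> d) h"
  unfolding rb_def by (rule Elift_E[OF V_module rb_tri])

lemma lb_bilinear: "bil B V V lb"
proof (rule bil_I)
  fix b assume "b \<in> cB"
  then show "lin V V (lb b)" unfolding lb_def by (intro Elift_linear[OF V_module lb_tri])
next
  fix v assume v: "v \<in> cV"
  show "lin B V (%b. lb b v)"
    unfolding lb_def
    by (rule Elift_param_linear[OF V_module base.module_A lb_tri _ v])
       (auto intro!: lin_comp[OF tril_D(1)[OF E_trilinear]] base.linear_mult_left lin_id)
qed

lemma rb_bilinear: "bil V B V rb"
proof (rule bil_I)
  fix b assume "b \<in> cB"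
  then show "lin V V (%v. rb v b)" unfolding rb_def by (intro Elift_linear[OF V_module rb_tri])
next
  fix v assume v: "v \<in> cV"
  show "lin B V (rb v)"
    unfolding rb_def
    by (rule Elift_param_linear[OF V_module base.module_A rb_tri _ v])
       (auto intro!: lin_comp[OF tril_D(2)[OF E_trilinear]] base.linear_mult_right lin_id)
qed

lemma lb_closed [simp]: "[|b \<in> cB; v \<in> cV|] ==> lb b v \<in> cV"
  by (rule bil_closed[OF lb_bilinear])

lemma rb_closed [simp]: "[|v \<in> cV; b \<in> cB|] ==> rb v b \<in> cV"
  by (rule bil_closed[OF rb_bilinear])

lemma lb_linear: "[|lin W V f; b \<in> cB|] ==> lin W V (%x. lb b (f x))"
  by (rule bil_right[OF lb_bilinear])

lemma rb_linear: "[|lin W V f; b \<in> cB|] ==> lin W V (%x. rb (f x) b)"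
  by (rule bil_left[OF rb_bilinear])

lemma V_eqI:
  assumes "lin V V f" "lin V V g"
    and "!!b c h. [|b \<in> cB; c \<in> cB; h \<in> cH|] ==> f (E b c h) = g (E b c h)" "v \<in> cV"
  shows "f v = g v"
  by (rule E_linear_eqI[OF V_module assms])

lemma V_bimodule:
  "[|a \<in> cB; b \<in> cB; x \<in> cV|] ==> lb (a \<cdot> b) x = lb a (lb b x)"
  "x \<in> cV ==> lb 1\<^sub>B x = x"
  "[|a \<in> cB; b \<in> cB; x \<in> cV|] ==> rb x (a \<cdot> b) = rb (rb x a) b"
  "x \<in> cV ==> rb x 1\<^sub>B = x"
  "[|a \<in> cB; b \<in> cB; x \<in> cV|] ==> rb (lb a x) b = lb a (rb x b)"
  by (rule V_eqI[where v = x]; auto intro!: lb_linear rb_linear lin_id simp: base.A.m_assoc)+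

lemma u_linear: "lin H V u"
  unfolding u_def[abs_def] by (rule tril_D(3)[OF E_trilinear]) simp_all

lemma u_closed [simp]: "h \<in> cH ==> u h \<in> cV"
  by (rule lin_closed[OF u_linear])

lemma E_u: "[|b \<in> cB; c \<in> cB; h \<in> cH|] ==> E b c h = lb b (rb (u h) c)"
  by (simp add: u_def)

definition T0 where "T0 = tensor_group (cB) rb lb (add_monoid V) (add_monoid V)"

definition TM where "TM = tensor_space V T0"

text \<open>The field acts through the multiples of the unit of B, which is what
  \<open>tensor_module\<close> asks of the balancing set.\<close>

lemma scalar_V:
  "[|a \<in> carrier k; x \<in> cV|] ==> rb x (a \<odot>\<^bsub>B\<^esub> 1\<^sub>B) = a \<odot>\<^bsub>V\<^esub> x"
  "[|a \<in> carrier k; x \<in> cV|] ==> lb (a \<odot>\<^bsub>B\<^esub> 1\<^sub>B) x = a \<odot>\<^bsub>V\<^esub> x"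
  using lin_smult[OF bil_D(1)[OF rb_bilinear], of x a "1\<^sub>B"]
    lin_smult[OF bil_D(2)[OF lb_bilinear], of x a "1\<^sub>B"]
  by (simp_all add: V_bimodule)

lemma VT_pair: "balanced_pair (add_monoid V) (add_monoid V) (cB) rb lb"
  using module.comm_group_add_monoid[OF V_module] by (simp add: balanced_pair_def balanced_pair_axioms_def)

lemma VT_T: "balanced_pair.T (add_monoid V) (add_monoid V) (cB) rb lb = T0"
  by (simp add: balanced_pair.T_def[OF VT_pair] T0_def)

sublocale VT: tensor_module k V V "cB" rb lb TM
proof (intro tensor_module.intro tensor_module_axioms.intro V_module VT_pair)
  fix a assume a: "a \<in> carrier k"
  show "\<exists>r\<in>cB. (\<forall>x\<in>cV. rb x r = a \<odot>\<^bsub>V\<^esub> x) \<and> (\<forall>y\<in>cV. lb r y = a \<odot>\<^bsub>V\<^esub> y)"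
    by (rule bexI[of _ "a \<odot>\<^bsub>B\<^esub> 1\<^sub>B"]) (use a in \<open>simp_all add: scalar_V\<close>)
qed (simp_all add: VT_T TM_def tensor_space_def lin_smult[OF bil_D(2)[OF rb_bilinear]])

abbreviation cT where "cT \<equiv> carrier TM"

lemma TM_module: "module k TM" by (rule VT.module_P)

abbreviation pt where "pt \<equiv> pure_tensor VT.T"

lemma pt_closed [simp]: "[|x \<in> cV; y \<in> cV|] ==> pt x y \<in> cT"
  by (rule VT.pure_tensor_closed)

definition lT where "lT b = tensor_lift (add_monoid TM) (%x y. pt (lb b x) y)"
definition rT where "rT t b = tensor_lift (add_monoid TM) (%x y. pt x (rb y b)) t"

lemma lT_ok: "b \<in> cB ==> VT.lift_ok TM (%x y. pt (lb b x) y)"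
  by (rule VT.lift_okI, rule bil_comp[OF VT.pure_bilinear])
     (auto intro!: lb_linear lin_id simp: V_bimodule(5)[symmetric] VT.pure_tensor_balance)

lemma rT_ok: "b \<in> cB ==> VT.lift_ok TM (%x y. pt x (rb y b))"
  by (rule VT.lift_okI, rule bil_comp[OF VT.pure_bilinear])
     (auto intro!: rb_linear lin_id simp: V_bimodule(5) VT.pure_tensor_balance)

lemma lT_pt [simp]: "[|b \<in> cB; x \<in> cV; y \<in> cV|] ==> lT b (pt x y) = pt (lb b x) y"
  unfolding lT_def by (rule VT.tensor_lift_pure[OF TM_module lT_ok])

lemma rT_pt [simp]: "[|b \<in> cB; x \<in> cV; y \<in> cV|] ==> rT (pt x y) b = pt x (rb y b)"
  unfolding rT_def by (rule VT.tensor_lift_pure[OF TM_module rT_ok])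

lemma lT_bilinear: "bil B TM TM lT"
  unfolding lT_def
  by (rule bil_I)
     (auto intro!: VT.tensor_lift_linear[OF TM_module] VT.tensor_lift_param_linear[OF TM_module base.module_A] lT_ok
        bil_left[OF VT.pure_bilinear bil_D(2)[OF lb_bilinear]])

lemma rT_bilinear: "bil TM B TM rT"
  unfolding rT_def
  by (rule bil_I)
     (auto intro!: VT.tensor_lift_linear[OF TM_module] VT.tensor_lift_param_linear[OF TM_module base.module_A] rT_ok
        bil_right[OF VT.pure_bilinear bil_D(1)[OF rb_bilinear]])

lemma T_eqI:
  assumes "lin TM M f" "lin TM M g"
    and "!!x y. [|x \<in> cV; y \<in> cV|] ==> f (pt x y) = g (pt x y)" "t \<in> cT"
  shows "f t = g t"
  by (rule VT.linear_eqI[OF assms])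

lemma lT_linear: "[|lin W TM f; b \<in> cB|] ==> lin W TM (%x. lT b (f x))"
  by (rule bil_right[OF lT_bilinear])

lemma rT_linear: "[|lin W TM f; b \<in> cB|] ==> lin W TM (%x. rT (f x) b)"
  by (rule bil_left[OF rT_bilinear])

sublocale tr: truncated_ring k B V TM lb rb lT rT pt
proof (intro truncated_ring.intro truncated_ring_axioms.intro algebra_B V_module TM_module
    lb_bilinear rb_bilinear lT_bilinear rT_bilinear VT.pure_bilinear V_bimodule)
  note eq = T_eqI[where M = TM]
  note li = lT_linear rT_linear lin_id
  show "[|a \<in> cB; b \<in> cB; p \<in> cT|] ==> lT (a \<cdot> b) p = lT a (lT b p)" for a b p
    by (rule eq[where t = p]) (auto intro!: li simp: V_bimodule)
  show "p \<in> cT ==> lT 1\<^sub>B p = p" for p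
    by (rule eq[where t = p]) (auto intro!: li simp: V_bimodule)
  show "[|a \<in> cB; b \<in> cB; p \<in> cT|] ==> rT p (a \<cdot> b) = rT (rT p a) b" for a b p
    by (rule eq[where t = p]) (auto intro!: li simp: V_bimodule)
  show "p \<in> cT ==> rT p 1\<^sub>B = p" for p
    by (rule eq[where t = p]) (auto intro!: li simp: V_bimodule)
  show "[|a \<in> cB; b \<in> cB; p \<in> cT|] ==> rT (lT a p) b = lT a (rT p b)" for a b p
    by (rule eq[where t = p]) (auto intro!: li simp: V_bimodule)
qed (auto simp: VT.pure_tensor_balance)

abbreviation RR where "RR \<equiv> tr.TR"
abbreviation mult_R (infixl "\<star>\<^sub>0" 70) where "a \<star>\<^sub>0 b \<equiv> a \<otimes>\<^bsub>RR\<^esub> b"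
abbreviation convR1 (infixl "\<star>\<^sub>1" 70) where "F \<star>\<^sub>1 G \<equiv> F \<otimes>\<^bsub>hopf.C RR\<^esub> G"
abbreviation convR2 (infixl "\<star>\<^sub>2" 70) where "F \<star>\<^sub>2 G \<equiv> F \<otimes>\<^bsub>hopf.C (hopf.C RR)\<^esub> G"
abbreviation convR3 (infixl "\<star>\<^sub>3" 70) where "F \<star>\<^sub>3 G \<equiv> F \<otimes>\<^bsub>hopf.C (hopf.C (hopf.C RR))\<^esub> G"

lemma algebra_RR: "unital_algebra k RR" by (rule tr.TR_algebra)

end

context hopf_algebra
begin

lemma conv2_mult_kernel:
  assumes R: "unital_algebra k R" and M: "module k M" and p: "lin R M p"
    and F: "F \<in> carrier (C (C R))" and G: "G \<in> carrier (C (C R))" and hg: "h \<in> cH" "g \<in> cH"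
    and z: "!!x y a b. [|x \<in> cH; y \<in> cH; a \<in> cH; b \<in> cH|] ==> p (F x a \<otimes>\<^bsub>R\<^esub> G y b) = \<zero>\<^bsub>M\<^esub>"
  shows "p ((F \<otimes>\<^bsub>C (C R)\<^esub> G) h g) = \<zero>\<^bsub>M\<^esub>"
  unfolding conv2_mult_post[OF R M p F G hg]
  by (rule sw_zero[OF M conv2_post_pre[OF R M p F G hg(2)] hg(1)],
      rule sw_zero[OF M bil_post[OF p conv2_pre(1)[OF R F G]] hg(2)])
     (simp_all add: z)

end

section \<open>Extending the measuring to the truncated tensor ring\<close>

context enveloping_cross_product
begin

abbreviation "CR \<equiv> hopf.C RR"
abbreviation "CCR \<equiv> hopf.C (hopf.C RR)"
abbreviation "CCCR \<equiv> hopf.C (hopf.C (hopf.C RR))"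

lemma algebra_CR: "unital_algebra k CR" by (rule hopf.algebra_conv[OF algebra_RR])
lemma algebra_CCR: "unital_algebra k CCR" by (rule hopf.algebra_conv[OF algebra_CR])
lemma algebra_CCCR: "unital_algebra k CCCR" by (rule hopf.algebra_conv[OF algebra_CCR])

sublocale RR: algebra_calculus k RR by (rule algebra_calculus.intro[OF algebra_RR])
sublocale CR: algebra_calculus k CR by (rule algebra_calculus.intro[OF algebra_CR])
sublocale CCR: algebra_calculus k CCR by (rule algebra_calculus.intro[OF algebra_CCR])
sublocale CCCR: algebra_calculus k CCCR by (rule algebra_calculus.intro[OF algebra_CCCR])

abbreviation iB where "iB \<equiv> tr.iB"
abbreviation iV where "iV \<equiv> tr.iV"
abbreviation iW where "iW \<equiv> tr.iW"

lemmas iB1_hom = cmap_hom[OF algebra_B algebra_RR tr.iB_hom]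
lemmas iB2_hom = cmap_hom[OF algebra_CB algebra_CR iB1_hom]
lemmas iB3_hom = cmap_hom[OF algebra_CCB algebra_CCR iB2_hom]

abbreviation "iB2 \<equiv> cmap (cmap iB)"
abbreviation "iB3 \<equiv> cmap (cmap (cmap iB))"

definition alB where "alB b = cmap iB (al b)"
definition uR where "uR = (\<lambda>h\<in>cH. iV (u h))"
definition SR where "SR = iB2 Sg"
definition SR' where "SR' = iB2 Sg'"
text \<open>The value of h \<triangleright> u(g). It is forced: u(1) is to be the unit, hence u(g)
  should equal g \<triangleright> u(1), and a twisted action must take h \<triangleright> (g
  \<triangleright> u(1)) to the conjugate by \<sigma> of (hg) \<triangleright> u(1) = u(hg).\<close>

definition KR where "KR = SR \<star>\<^sub>2 (mstar uR \<star>\<^sub>2 SR')"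
definition Kt where "Kt = flip KR"

lemma alB_hom: "algebra_hom k B CR alB"
  unfolding alB_def by (rule algebra_hom_comp[OF al_hom iB1_hom])

lemma alB_closed [simp]: "b \<in> cB ==> alB b \<in> carrier CR"
  by (rule hom_D(4)[OF alB_hom])

lemma alB_apply: "h \<in> cH ==> alB b h = iB (act h b)"
  by (simp add: alB_def)

lemma uR_closed [simp]: "uR \<in> carrier CR"
  unfolding uR_def by (rule hopf.conv_memI[OF lin_comp[OF tr.iV_linear u_linear]])

lemma uR_apply [simp]: "h \<in> cH ==> uR h = iV (u h)"
  by (simp add: uR_def)

lemma SR_closed [simp]: "SR \<in> carrier CCR" "SR' \<in> carrier CCR"
  unfolding SR_def SR'_def by (simp_all add: hom_D(4)[OF iB2_hom])

lemma SR_apply [simp]: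
  "[|h \<in> cH; g \<in> cH|] ==> SR h g = iB (\<sigma> h g)"
  "[|h \<in> cH; g \<in> cH|] ==> SR' h g = iB (\<sigma>' h g)"
  by (simp_all add: SR_def SR'_def)

lemma SR_inv: "SR \<star>\<^sub>2 SR' = \<one>\<^bsub>CCR\<^esub>" "SR' \<star>\<^sub>2 SR = \<one>\<^bsub>CCR\<^esub>"
  unfolding SR_def SR'_def by (rule hom_inv[OF iB2_hom]; simp add: Sg_inv)+

lemma mu_closed [simp]: "mstar uR \<in> carrier CCR"
  by (rule hom_D(4)[OF hopf.mstar_hom[OF algebra_RR] uR_closed])

lemma KR_closed [simp]: "KR \<in> carrier CCR"
  unfolding KR_def by (simp add: CCR.m_closed)

lemmas flip_hom_R = hopf.flip_hom[OF algebra_RR]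
lemmas mstar_hom_R = hopf.mstar_hom[OF algebra_RR]

lemma Kt_closed [simp]: "Kt \<in> carrier CCR"
  unfolding Kt_def by (rule hom_D(4)[OF flip_hom_R KR_closed])

lemma Kt_apply: "[|g \<in> cH; h \<in> cH|] ==> Kt g h = KR h g"
  by (simp add: Kt_def)

lemma Kt_linear: "lin H CR Kt"
  by (rule conv_linear[OF Kt_closed])

lemma Kt_g_closed [simp]: "g \<in> cH ==> Kt g \<in> carrier CR"
  by (rule conv_closed[OF Kt_closed])

lemma conv_degV:
  assumes F: "F \<in> carrier CR" and G: "G \<in> carrier CR" and h: "h \<in> cH"
    and z: "!!x y. [|x \<in> cH; y \<in> cH|] ==> F x \<star>\<^sub>0 G y \<in> tr.degV"
  shows "(F \<star>\<^sub>1 G) h \<in> tr.degV"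
  unfolding tr.degV_iff
proof (intro conjI)
  show "(F \<star>\<^sub>1 G) h \<in> carrier RR" by (rule conv_closed[OF CR.m_closed[OF F G] h])
  show "tr.pB ((F \<star>\<^sub>1 G) h) = \<zero>\<^bsub>B\<^esub>"
    by (rule hopf.conv_mult_kernel[OF algebra_RR base.module_A tr.p_linear(1) F G h])
       (drule (1) z, simp only: tr.degV_iff)
  show "tr.pW ((F \<star>\<^sub>1 G) h) = \<zero>\<^bsub>TM\<^esub>"
    by (rule hopf.conv_mult_kernel[OF algebra_RR TM_module tr.p_linear(3) F G h])
       (drule (1) z, simp only: tr.degV_iff)
qed

lemma conv_degW:
  assumes F: "F \<in> carrier CR" and G: "G \<in> carrier CR" and h: "h \<in> cH"
    and z: "!!x y. [|x \<in> cH; y \<in> cH|] ==> F x \<star>\<^sub>0 G y \<in> tr.degW"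
  shows "(F \<star>\<^sub>1 G) h \<in> tr.degW"
  unfolding tr.degW_iff
proof (intro conjI)
  show "(F \<star>\<^sub>1 G) h \<in> carrier RR" by (rule conv_closed[OF CR.m_closed[OF F G] h])
  show "tr.pB ((F \<star>\<^sub>1 G) h) = \<zero>\<^bsub>B\<^esub>"
    by (rule hopf.conv_mult_kernel[OF algebra_RR base.module_A tr.p_linear(1) F G h])
       (drule (1) z, simp only: tr.degW_iff)
  show "tr.pV ((F \<star>\<^sub>1 G) h) = \<zero>\<^bsub>V\<^esub>"
    by (rule hopf.conv_mult_kernel[OF algebra_RR V_module tr.p_linear(2) F G h])
       (drule (1) z, simp only: tr.degW_iff)
qed

lemma conv2_degV:
  assumes F: "F \<in> carrier CCR" and G: "G \<in> carrier CCR" and h: "h \<in> cH" and g: "g \<in> cH"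
    and z: "!!x y a b. [|x \<in> cH; y \<in> cH; a \<in> cH; b \<in> cH|] ==> F x a \<star>\<^sub>0 G y b \<in> tr.degV"
  shows "(F \<star>\<^sub>2 G) h g \<in> tr.degV"
  unfolding tr.degV_iff
proof (intro conjI)
  show "(F \<star>\<^sub>2 G) h g \<in> carrier RR" by (rule conv2_closed[OF CCR.m_closed[OF F G] h g])
  show "tr.pB ((F \<star>\<^sub>2 G) h g) = \<zero>\<^bsub>B\<^esub>"
  proof (rule hopf.conv2_mult_kernel[OF algebra_RR base.module_A tr.p_linear(1) F G h g])
    fix x y a b assume "x \<in> cH" "y \<in> cH" "a \<in> cH" "b \<in> cH"
    from z[OF this] show "tr.pB (F x a \<star>\<^sub>0 G y b) = \<zero>\<^bsub>B\<^esub>" by (simp only: tr.degV_iff)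
  qed
  show "tr.pW ((F \<star>\<^sub>2 G) h g) = \<zero>\<^bsub>TM\<^esub>"
  proof (rule hopf.conv2_mult_kernel[OF algebra_RR TM_module tr.p_linear(3) F G h g])
    fix x y a b assume "x \<in> cH" "y \<in> cH" "a \<in> cH" "b \<in> cH"
    from z[OF this] show "tr.pW (F x a \<star>\<^sub>0 G y b) = \<zero>\<^bsub>TM\<^esub>" by (simp only: tr.degV_iff)
  qed
qed

lemma iV_degV: "x \<in> cV ==> iV x \<in> tr.degV"
  by (simp add: tr.degV_def)

lemma KR_degV: "[|h \<in> cH; g \<in> cH|] ==> KR h g \<in> tr.degV"
proof -
  assume hg: "h \<in> cH" "g \<in> cH"
  have 1: "(mstar uR \<star>\<^sub>2 SR') x y \<in> tr.degV" if "x \<in> cH" "y \<in> cH" for x y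
    by (rule conv2_degV[OF mu_closed SR_closed(2) that]) (simp add: tr.degV_mult iV_degV)
  show ?thesis
    unfolding KR_def
    by (rule conv2_degV[OF SR_closed(1) CCR.m_closed[OF mu_closed SR_closed(2)] hg])
       (simp add: tr.degV_mult 1)
qed

text \<open>The product rule of a measuring, applied to b.u(g).c.\<close>

definition aV where "aV = Elift CR (%b c g. alB b \<star>\<^sub>1 (Kt g \<star>\<^sub>1 alB c))"

lemma aV_tri: "tril B B H CR (%b c g. alB b \<star>\<^sub>1 (Kt g \<star>\<^sub>1 alB c))"
  by (rule tril_I)
     (auto intro!: CR.linear_mult_left CR.linear_mult_right hom_D(1)[OF alB_hom] Kt_linear CR.m_closed)

lemma aV_linear: "lin V CR aV"
  unfolding aV_def by (rule Elift_linear[OF CR.module_A aV_tri])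

lemma aV_closed [simp]: "x \<in> cV ==> aV x \<in> carrier CR"
  by (rule lin_closed[OF aV_linear])

lemma aV_E: "[|b \<in> cB; c \<in> cB; g \<in> cH|] ==> aV (E b c g) = alB b \<star>\<^sub>1 (Kt g \<star>\<^sub>1 alB c)"
  unfolding aV_def by (rule Elift_E[OF CR.module_A aV_tri])

lemma aV_u: "g \<in> cH ==> aV (u g) = Kt g"
  by (simp add: u_def aV_E hom_D(3)[OF alB_hom])

lemma aV_lb: "[|b \<in> cB; x \<in> cV|] ==> aV (lb b x) = alB b \<star>\<^sub>1 aV x"
  by (rule E_linear_eqI[OF CR.module_A, where v = x])
     (auto intro!: lin_comp[OF aV_linear] lb_linear lin_id CR.linear_mult_right aV_linear
        simp: aV_E hom_D(2)[OF alB_hom] CR.m_assoc)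

lemma aV_rb: "[|b \<in> cB; x \<in> cV|] ==> aV (rb x b) = aV x \<star>\<^sub>1 alB b"
  by (rule E_linear_eqI[OF CR.module_A, where v = x])
     (auto intro!: lin_comp[OF aV_linear] rb_linear lin_id CR.linear_mult_left aV_linear
        simp: aV_E hom_D(2)[OF alB_hom] CR.m_assoc)

lemma aV_degV:
  assumes x: "x \<in> cV" and h: "h \<in> cH"
  shows "aV x h \<in> tr.degV"
proof -
  have E: "aV (E b c g) h \<in> tr.degV" if "b \<in> cB" "c \<in> cB" "g \<in> cH" for b c g
  proof -
    have 1: "(Kt g \<star>\<^sub>1 alB c) x \<in> tr.degV" if x: "x \<in> cH" for x
      by (rule conv_degV[OF Kt_g_closed alB_closed x])
         (use \<open>c \<in> cB\<close> \<open>g \<in> cH\<close> in \<open>simp_all add: tr.degV_mult alB_apply Kt_apply KR_degV\<close>)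
    show ?thesis
      unfolding aV_E[OF that]
      by (rule conv_degV[OF alB_closed CR.m_closed[OF Kt_g_closed alB_closed] h])
         (use that in \<open>simp_all add: tr.degV_mult alB_apply 1\<close>)
  qed
  note l = lin_comp[OF conv_eval_linear[OF h] aV_linear]
  have "tr.pB (aV x h) = \<zero>\<^bsub>B\<^esub>"
    by (rule E_linear_eqI[OF base.module_A lin_comp[OF tr.p_linear(1) l] lin_zero_fun[OF base.module_A] _ x])
       (use E in \<open>simp add: tr.degV_iff\<close>)
  moreover have "tr.pW (aV x h) = \<zero>\<^bsub>TM\<^esub>"
    by (rule E_linear_eqI[OF TM_module lin_comp[OF tr.p_linear(3) l] lin_zero_fun[OF TM_module] _ x])
       (use E in \<open>simp add: tr.degV_iff\<close>)
  ultimately show ?thesis using conv_closed[OF aV_closed[OF x] h] by (simp add: tr.degV_iff)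
qed

definition aW where "aW = tensor_lift (add_monoid CR) (%x y. aV x \<star>\<^sub>1 aV y)"

text \<open>Acting on x.b and then on y, or on x and then on b.y, yields in both cases the three
  convolution factors for x, b and y.\<close>

lemma aW_ok: "VT.lift_ok CR (%x y. aV x \<star>\<^sub>1 aV y)"
  by (rule VT.lift_okI, rule bil_comp[OF CR.mult_bilinear aV_linear aV_linear])
     (simp add: aV_lb aV_rb CR.m_assoc)

lemma aW_linear: "lin TM CR aW"
  unfolding aW_def by (rule VT.tensor_lift_linear[OF CR.module_A aW_ok])

lemma aW_closed [simp]: "t \<in> cT ==> aW t \<in> carrier CR"
  by (rule lin_closed[OF aW_linear])

lemma aW_pt: "[|x \<in> cV; y \<in> cV|] ==> aW (pt x y) = aV x \<star>\<^sub>1 aV y"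
  unfolding aW_def by (rule VT.tensor_lift_pure[OF CR.module_A aW_ok])

lemma aW_lT: "[|b \<in> cB; t \<in> cT|] ==> aW (lT b t) = alB b \<star>\<^sub>1 aW t"
  by (rule T_eqI[where t = t])
     (auto intro!: lin_comp[OF aW_linear] lT_linear lin_id CR.linear_mult_right aW_linear
        simp: aW_pt aV_lb CR.m_assoc)

lemma aW_rT: "[|b \<in> cB; t \<in> cT|] ==> aW (rT t b) = aW t \<star>\<^sub>1 alB b"
  by (rule T_eqI[where t = t])
     (auto intro!: lin_comp[OF aW_linear] rT_linear lin_id CR.linear_mult_left aW_linear
        simp: aW_pt aV_rb CR.m_assoc)

lemma aW_degW:
  assumes t: "t \<in> cT" and h: "h \<in> cH"
  shows "aW t h \<in> tr.degW"
proof -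
  have p: "aW (pt x y) h \<in> tr.degW" if "x \<in> cV" "y \<in> cV" for x y
    unfolding aW_pt[OF that]
    by (rule conv_degW[OF aV_closed aV_closed h]) (use that in \<open>simp_all add: tr.degV_mult_degV aV_degV\<close>)
  note l = lin_comp[OF conv_eval_linear[OF h] aW_linear]
  have "tr.pB (aW t h) = \<zero>\<^bsub>B\<^esub>"
    by (rule T_eqI[OF lin_comp[OF tr.p_linear(1) l] lin_zero_fun[OF base.module_A] _ t])
       (use p in \<open>simp add: tr.degW_iff\<close>)
  moreover have "tr.pV (aW t h) = \<zero>\<^bsub>V\<^esub>"
    by (rule T_eqI[OF lin_comp[OF tr.p_linear(2) l] lin_zero_fun[OF V_module] _ t])
       (use p in \<open>simp add: tr.degW_iff\<close>)
  ultimately show ?thesis using conv_closed[OF aW_closed[OF t] h] by (simp add: tr.degW_iff)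
qed

definition alR where "alR r = (alB (tr.pB r) \<oplus>\<^bsub>CR\<^esub> aV (tr.pV r)) \<oplus>\<^bsub>CR\<^esub> aW (tr.pW r)"

lemma alR_linear: "lin RR CR alR"
  unfolding alR_def
  by (intro lin_plus[OF CR.module_A] lin_comp[OF hom_D(1)[OF alB_hom] tr.p_linear(1)]
      lin_comp[OF aV_linear tr.p_linear(2)] lin_comp[OF aW_linear tr.p_linear(3)])

lemma a_zero [simp]: "alB \<zero>\<^bsub>B\<^esub> = \<zero>\<^bsub>CR\<^esub>" "aV \<zero>\<^bsub>V\<^esub> = \<zero>\<^bsub>CR\<^esub>" "aW \<zero>\<^bsub>TM\<^esub> = \<zero>\<^bsub>CR\<^esub>"
  by (rule lin_zero[OF base.module_A CR.module_A hom_D(1)[OF alB_hom]]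
      lin_zero[OF V_module CR.module_A aV_linear] lin_zero[OF TM_module CR.module_A aW_linear])+

lemma alR_i:
  "b \<in> cB ==> alR (iB b) = alB b" "x \<in> cV ==> alR (iV x) = aV x" "t \<in> cT ==> alR (iW t) = aW t"
  by (simp_all add: alR_def)

text \<open>Acting preserves the degree, so products that the truncation discards are still
  discarded after the action; the surviving ones follow the product rules by which the action was
  defined.\<close>

lemma alR_hom: "algebra_hom k RR CR alR"
proof (rule hom_I[OF alR_linear])
  fix r s assume r: "r \<in> carrier RR" and s: "s \<in> carrier RR"
  have z1: "aV x \<star>\<^sub>1 aW t = \<zero>\<^bsub>CR\<^esub>" "aW t \<star>\<^sub>1 aV x = \<zero>\<^bsub>CR\<^esub>" if "x \<in> cV" "t \<in> cT" for x t
    by (rule hopf.conv_mult_zero[OF algebra_RR]; use that in \<open>simp add: tr.deg_mult_zero aV_degV aW_degW\<close>)+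
  have z2: "aW t \<star>\<^sub>1 aW t' = \<zero>\<^bsub>CR\<^esub>" if "t \<in> cT" "t' \<in> cT" for t t'
    by (rule hopf.conv_mult_zero[OF algebra_RR]; use that in \<open>simp add: tr.deg_mult_zero aV_degV aW_degW\<close>)
  show "alR (r \<star>\<^sub>0 s) = alR r \<star>\<^sub>1 alR s"
    using r s
    by (simp add: alR_def tr.TR_mult_decomp hom_D(2)[OF alB_hom] lin_add[OF aV_linear]
        lin_add[OF aW_linear] aV_lb aV_rb aW_lT aW_rT aW_pt CR.distr z1 z2
        CR.a_ac CR.m_closed)
next
  have "\<one>\<^bsub>RR\<^esub> = iB 1\<^sub>B" by (rule hom_D(3)[OF tr.iB_hom, symmetric])
  then show "alR \<one>\<^bsub>RR\<^esub> = \<one>\<^bsub>CR\<^esub>"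
    by (simp add: alR_i hom_D(3)[OF alB_hom])
qed

lemma alR_closed [simp]: "r \<in> carrier RR ==> alR r \<in> carrier CR"
  by (rule hom_D(4)[OF alR_hom])

subsection \<open>The twisted module condition\<close>

text \<open>The counterparts of \<open>Dm\<close> and \<open>Em\<close> for the extended
  measuring.\<close>

definition DR where "DR r = hatm alR (alR r)"
definition ER where "ER r = mstar (alR r)"

lemmas hatR_hom = hopf.hatm_hom[OF algebra_RR alR_hom]

lemma DR_hom: "algebra_hom k RR CCR DR"
  unfolding DR_def by (rule algebra_hom_comp[OF alR_hom hatR_hom])

lemma ER_hom: "algebra_hom k RR CCR ER"
  unfolding ER_def by (rule algebra_hom_comp[OF alR_hom mstar_hom_R])

lemma DE_closed [simp]: "r \<in> carrier RR ==> DR r \<in> carrier CCR" "r \<in> carrier RR ==> ER r \<in> carrier CCR"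
  by (rule hom_D(4)[OF DR_hom] hom_D(4)[OF ER_hom]; assumption)+

text \<open>The twisted module condition of B is transported along the algebra map that
  \<open>iB\<close> induces on convolution algebras.\<close>

lemma intertwine_B: "b \<in> cB ==> DR (iB b) \<star>\<^sub>2 SR = SR \<star>\<^sub>2 ER (iB b)"
proof -
  assume b: "b \<in> cB"
  have "DR (iB b) = iB2 (Dm b)"
    by (rule hopf.conv2_eqI[where R = RR])
       (auto intro!: hom_D(4)[OF iB2_hom] hom_D(4)[OF hatR_hom] simp: b DR_def alR_i alB_apply Dm_def)
  moreover have "ER (iB b) = iB2 (Em b)"
    by (rule hopf.conv2_eqI[where R = RR])
       (auto intro!: hom_D(4)[OF iB2_hom] hom_D(4)[OF mstar_hom_R] simp: b ER_def alR_i alB_apply Em_def)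
  ultimately show ?thesis
    using arg_cong[OF Dm_Sg[OF b], of iB2] b by (simp add: SR_def hom_D(2)[OF iB2_hom])
qed

definition A2R where "A2R F = flip (cmap flip (cmap mstar F))"

lemma A2R_hom: "algebra_hom k CCR CCCR A2R"
  unfolding A2R_def
  by (rule algebra_hom_comp[OF cmap_hom[OF algebra_CR algebra_CCR mstar_hom_R]
        algebra_hom_comp[OF cmap_hom[OF algebra_CCR algebra_CCR flip_hom_R] hopf.flip_hom[OF algebra_CR]]])

lemma A2R_apply:
  "[|f \<in> cH; h \<in> cH; g \<in> cH|] ==> A2R F f h g = F h (g \<otimes>\<^bsub>H\<^esub> f)"
  by (simp add: A2R_def)

lemmas chatR_hom = cmap_hom[OF algebra_CR algebra_CCR hatR_hom]
lemmas cmstarR_hom = cmap_hom[OF algebra_CR algebra_CCR mstar_hom_R]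
lemmas iotaR_hom = iota_hom[OF algebra_CCR]

lemma flipSR_closed [simp]: "flip SR \<in> carrier CCR" "flip SR' \<in> carrier CCR" "flip (mstar uR) \<in> carrier CCR"
  by (simp_all add: hom_D(4)[OF flip_hom_R])

lemma cocycle_rot_R:
  "cmap (hatm alR) (flip SR) \<star>\<^sub>3 A2R SR = iota CCR SR \<star>\<^sub>3 cmap mstar (flip SR)"
proof -
  note cl = cocycle_rot_closed
  have 1: "iB3 (cmap hat St) = cmap (hatm alR) (flip SR)"
  proof (rule conv3_eqI[where R = RR])
    fix f h g assume "f \<in> cH" "h \<in> cH" "g \<in> cH"
    then show "iB3 (cmap hat St) f h g = cmap (hatm alR) (flip SR) f h g"
      by (simp add: alR_i alB_apply)
  qed (auto intro!: hom_D(4)[OF iB3_hom] hom_D(4)[OF chatR_hom] cl)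
  have 2: "iB3 (A2 Sg) = A2R SR"
    by (rule conv3_eqI[where R = RR])
       (auto intro!: hom_D(4)[OF iB3_hom] hom_D(4)[OF A2R_hom] cl simp: A2R_apply A2_apply)
  have 3: "iB3 (iota CCB Sg) = iota CCR SR"
    by (rule conv3_eqI[where R = RR])
       (auto intro!: hom_D(4)[OF iB3_hom] hom_D(4)[OF iotaR_hom] cl
          simp: conv_apply lin_smult[OF tr.iB_linear])
  have 4: "iB3 (cmap mstar St) = cmap mstar (flip SR)"
    by (rule conv3_eqI[where R = RR])
       (auto intro!: hom_D(4)[OF iB3_hom] hom_D(4)[OF cmstarR_hom] cl)
  show ?thesis
    using arg_cong[OF cocycle_rot, of iB3] cl by (simp add: hom_D(2)[OF iB3_hom] 1 2 3 4)
qed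

text \<open>\<open>Kt\<close> is the function u(hg) conjugated by the cocycle. Acting once more
  conjugates u((hg)f) = u(h(gf)) by an element \<open>Q\<close>, the left side of the cocycle
  condition. The right side factors the same \<open>Q\<close> into \<sigma>(h, g) and \<sigma>(hg,
  f): conjugation by the second factor alone gives (hg) \<triangleright> u(f), and conjugation by
  the first is the twist.\<close>

lemma DR_u:
  assumes f: "f \<in> cH"
  shows "DR (iV (u f)) = SR \<star>\<^sub>2 (ER (iV (u f)) \<star>\<^sub>2 SR')"
proof -
  let ?h = "cmap (hatm alR)" and ?m = "cmap mstar" and ?i = "iota CCR"
  let ?fS = "flip SR" and ?fS' = "flip SR'" and ?fm = "flip (mstar uR)"
  have fSi: "?fS \<star>\<^sub>2 ?fS' = \<one>\<^bsub>CCR\<^esub>" "?fS' \<star>\<^sub>2 ?fS = \<one>\<^bsub>CCR\<^esub>"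
    by (rule hom_inv[OF flip_hom_R]; simp add: SR_inv)+
  have cl: "?h F \<in> carrier CCCR" "?m F \<in> carrier CCCR" "?i F \<in> carrier CCCR" "A2R F \<in> carrier CCCR" if "F \<in> carrier CCR" for F
    using that hom_D(4)[OF chatR_hom] hom_D(4)[OF cmstarR_hom] hom_D(4)[OF iotaR_hom] hom_D(4)[OF A2R_hom]
    by auto
  have Kt: "Kt = ?fS \<star>\<^sub>2 (?fm \<star>\<^sub>2 ?fS')"
    unfolding Kt_def KR_def by (simp add: hom_D(2)[OF flip_hom_R])
  have hm: "?h ?fm = A2R KR"
  proof (rule conv3_eqI[where R = RR])
    fix f h g assume "f \<in> cH" "h \<in> cH" "g \<in> cH"
    then show "?h ?fm f h g = A2R KR f h g"
      by (simp add: A2R_apply alR_i aV_u Kt_apply)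
  qed (auto intro!: cl)
  have A2m: "A2R (mstar uR) = ?m ?fm"
  proof (rule conv3_eqI[where R = RR])
    fix f h g assume "f \<in> cH" "h \<in> cH" "g \<in> cH"
    then show "A2R (mstar uR) f h g = ?m ?fm f h g"
      by (simp add: A2R_apply hopf.A.m_assoc)
  qed (auto intro!: cl)
  define Q where "Q = ?h ?fS \<star>\<^sub>3 A2R SR"
  have Q: "Q = ?i SR \<star>\<^sub>3 ?m ?fS" by (simp add: Q_def cocycle_rot_R)
  \<comment> \<open>Each factorisation of \<open>Q\<close> supplies an inverse, \<open>Q1\<close> a
    left and \<open>Q2\<close> a right one, so they agree.\<close>
  define Q1 where "Q1 = A2R SR' \<star>\<^sub>3 ?h ?fS'"
  define Q2 where "Q2 = ?m ?fS' \<star>\<^sub>3 ?i SR'"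
  have Qc: "Q \<in> carrier CCCR" "Q1 \<in> carrier CCCR" "Q2 \<in> carrier CCCR"
    by (simp_all add: Q_def Q1_def Q2_def cl CCCR.m_closed)
  have i1: "A2R SR' \<star>\<^sub>3 A2R SR = \<one>\<^bsub>CCCR\<^esub>" by (rule hom_inv[OF A2R_hom]) (simp_all add: SR_inv)
  have i2: "?h ?fS' \<star>\<^sub>3 ?h ?fS = \<one>\<^bsub>CCCR\<^esub>" by (rule hom_inv[OF chatR_hom]) (simp_all add: fSi)
  have i3: "?m ?fS \<star>\<^sub>3 ?m ?fS' = \<one>\<^bsub>CCCR\<^esub>" by (rule hom_inv[OF cmstarR_hom]) (simp_all add: fSi)
  have i4: "?i SR \<star>\<^sub>3 ?i SR' = \<one>\<^bsub>CCCR\<^esub>" by (rule hom_inv[OF iotaR_hom]) (simp_all add: SR_inv)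
  have "Q1 \<star>\<^sub>3 Q = A2R SR' \<star>\<^sub>3 (?h ?fS' \<star>\<^sub>3 ?h ?fS) \<star>\<^sub>3 A2R SR"
    by (simp add: Q1_def Q_def CCCR.m_assoc cl)
  then have q1: "Q1 \<star>\<^sub>3 Q = \<one>\<^bsub>CCCR\<^esub>" by (simp add: i1 i2 cl)
  have "Q \<star>\<^sub>3 Q2 = ?i SR \<star>\<^sub>3 (?m ?fS \<star>\<^sub>3 ?m ?fS') \<star>\<^sub>3 ?i SR'"
    by (simp add: Q Q2_def CCCR.m_assoc cl)
  then have q2: "Q \<star>\<^sub>3 Q2 = \<one>\<^bsub>CCCR\<^esub>" by (simp add: i3 i4 cl)
  have Q12: "Q1 = Q2" by (rule CCCR.inv_unique[OF Qc(1,2,3) q1 q2])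
  have "?h Kt = ?h ?fS \<star>\<^sub>3 (A2R KR \<star>\<^sub>3 ?h ?fS')"
    unfolding Kt by (simp add: hom_D(2)[OF chatR_hom] hm)
  also have "A2R KR = A2R SR \<star>\<^sub>3 (?m ?fm \<star>\<^sub>3 A2R SR')"
    unfolding KR_def by (simp add: hom_D(2)[OF A2R_hom] A2m)
  also have "?h ?fS \<star>\<^sub>3 ((A2R SR \<star>\<^sub>3 (?m ?fm \<star>\<^sub>3 A2R SR')) \<star>\<^sub>3 ?h ?fS')
    = Q \<star>\<^sub>3 (?m ?fm \<star>\<^sub>3 Q1)"
    by (simp add: Q_def Q1_def CCCR.m_assoc cl)
  also have "... = ?i SR \<star>\<^sub>3 ((?m ?fS \<star>\<^sub>3 (?m ?fm \<star>\<^sub>3 ?m ?fS')) \<star>\<^sub>3 ?i SR')"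
    unfolding Q12 Q Q2_def by (simp add: CCCR.m_assoc cl)
  also have "?m ?fS \<star>\<^sub>3 (?m ?fm \<star>\<^sub>3 ?m ?fS') = ?m Kt"
    unfolding Kt by (simp add: hom_D(2)[OF cmstarR_hom])
  finally have eq: "?h Kt = ?i SR \<star>\<^sub>3 (?m Kt \<star>\<^sub>3 ?i SR')" .
  have "?h Kt f = (?i SR \<star>\<^sub>3 (?m Kt \<star>\<^sub>3 ?i SR')) f" by (simp only: eq)
  also have "... = SR \<star>\<^sub>2 (?m Kt f \<star>\<^sub>2 SR')"
    using iota_mult_apply(1)[OF algebra_CCR SR_closed(1) CCCR.m_closed[OF cl(2)[OF Kt_closed] cl(3)[OF SR_closed(2)]] f]
      iota_mult_apply(2)[OF algebra_CCR SR_closed(2) cl(2)[OF Kt_closed] f] by simp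
  finally show ?thesis
    using f by (simp add: DR_def ER_def alR_i aV_u)
qed

lemma intertwine_u: "f \<in> cH ==> DR (iV (u f)) \<star>\<^sub>2 SR = SR \<star>\<^sub>2 ER (iV (u f))"
  by (simp add: DR_u CCR.m_assoc SR_inv)

text \<open>\<open>DR\<close> and \<open>ER\<close> are algebra maps and the condition says that one
  fixed element intertwines them, so it is inherited by products.\<close>

lemma intertwine_mult:
  assumes "r \<in> carrier RR" "s \<in> carrier RR"
    and r: "DR r \<star>\<^sub>2 SR = SR \<star>\<^sub>2 ER r" and s: "DR s \<star>\<^sub>2 SR = SR \<star>\<^sub>2 ER s"
  shows "DR (r \<star>\<^sub>0 s) \<star>\<^sub>2 SR = SR \<star>\<^sub>2 ER (r \<star>\<^sub>0 s)"
proof -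
  have "DR (r \<star>\<^sub>0 s) \<star>\<^sub>2 SR = DR r \<star>\<^sub>2 (DR s \<star>\<^sub>2 SR)"
    using assms(1,2) by (simp add: hom_D(2)[OF DR_hom] CCR.m_assoc)
  also have "... = (DR r \<star>\<^sub>2 SR) \<star>\<^sub>2 ER s"
    using assms(1,2) by (simp add: s CCR.m_assoc)
  also have "... = SR \<star>\<^sub>2 ER (r \<star>\<^sub>0 s)"
    using assms(1,2) by (simp add: r hom_D(2)[OF ER_hom] CCR.m_assoc)
  finally show ?thesis .
qed

lemma iV_E: "[|b \<in> cB; c \<in> cB; h \<in> cH|] ==> iV (E b c h) = iB b \<star>\<^sub>0 (iV (u h) \<star>\<^sub>0 iB c)"
  by (simp add: tr.i_mult E_u)

text \<open>The ring is generated by the b and the u(h), for which the condition is known. Degree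
  one consists of sums of products b u(h) c, and degree two of sums of products from degree
  one.\<close>

lemma intertwine:
  assumes r: "r \<in> carrier RR"
  shows "DR r \<star>\<^sub>2 SR = SR \<star>\<^sub>2 ER r"
proof -
  have l: "lin RR CCR (%r. DR r \<star>\<^sub>2 SR)" "lin RR CCR (%r. SR \<star>\<^sub>2 ER r)"
    by (auto intro!: CCR.linear_mult_left CCR.linear_mult_right hom_D(1)[OF DR_hom] hom_D(1)[OF ER_hom])
  have V: "DR (iV x) \<star>\<^sub>2 SR = SR \<star>\<^sub>2 ER (iV x)" if x: "x \<in> cV" for x
  proof (rule E_linear_eqI[OF CCR.module_A lin_comp[OF l(1) tr.iV_linear] lin_comp[OF l(2) tr.iV_linear] _ x])
    fix b c h assume a: "b \<in> cB" "c \<in> cB" "h \<in> cH"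
    show "DR (iV (E b c h)) \<star>\<^sub>2 SR = SR \<star>\<^sub>2 ER (iV (E b c h))"
      unfolding iV_E[OF a] by (intro intertwine_mult intertwine_B intertwine_u RR.m_closed) (simp_all add: a)
  qed
  have W: "DR (iW t) \<star>\<^sub>2 SR = SR \<star>\<^sub>2 ER (iW t)" if t: "t \<in> cT" for t
  proof (rule T_eqI[OF lin_comp[OF l(1) tr.iW_linear] lin_comp[OF l(2) tr.iW_linear] _ t])
    fix x y assume "x \<in> cV" "y \<in> cV"
    then show "DR (iW (pt x y)) \<star>\<^sub>2 SR = SR \<star>\<^sub>2 ER (iW (pt x y))"
      using intertwine_mult[OF _ _ V V, of x y] by (simp add: tr.i_mult)
  qed
  have "DR (iB b \<oplus>\<^bsub>RR\<^esub> iV x \<oplus>\<^bsub>RR\<^esub> iW t) \<star>\<^sub>2 SR = SR \<star>\<^sub>2 ER (iB b \<oplus>\<^bsub>RR\<^esub> iV x \<oplus>\<^bsub>RR\<^esub> iW t)"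
    if "b \<in> cB" "x \<in> cV" "t \<in> cT" for b x t
    using that by (simp add: lin_add[OF l(1)] lin_add[OF l(2)] intertwine_B V W)
  from this[of "tr.pB r" "tr.pV r" "tr.pW r"] show ?thesis
    using r tr.TR_decomp[OF r] by simp
qed

lemma DR_eq: "r \<in> carrier RR ==> DR r = SR \<star>\<^sub>2 (ER r \<star>\<^sub>2 SR')"
proof -
  assume r: "r \<in> carrier RR"
  have "DR r = (DR r \<star>\<^sub>2 SR) \<star>\<^sub>2 SR'" using r by (simp add: CCR.m_assoc SR_inv)
  then show ?thesis using r by (simp add: intertwine CCR.m_assoc)
qed

end

context hopf_algebra
begin

lemma cmap_mult_left:
  assumes R: "unital_algebra k R" and \<phi>: "lin R R \<phi>" and F: "F \<in> carrier (C R)" and G: "G \<in> carrier (C R)"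
    and eq: "!!x r. [|x \<in> cH; r \<in> carrier R|] ==> \<phi> (F x \<otimes>\<^bsub>R\<^esub> r) = F x \<otimes>\<^bsub>R\<^esub> \<phi> r"
  shows "cmap \<phi> (F \<otimes>\<^bsub>C R\<^esub> G) = F \<otimes>\<^bsub>C R\<^esub> cmap \<phi> G"
proof -
  interpret CR: unital_algebra k "C R" by (rule algebra_conv[OF R])
  note M = unital_algebra.module_A[OF R] and G' = cmap_closed[OF \<phi> G]
  show ?thesis
  proof (rule conv_eqI[where R = R])
    fix h assume h: "h \<in> cH"
    have "\<phi> (sw R (%x y. F x \<otimes>\<^bsub>R\<^esub> G y) h) = sw R (%x y. F x \<otimes>\<^bsub>R\<^esub> cmap \<phi> G y) h"
      by (rule sw_map[OF M M \<phi> conv_mult_bilinear_pre[OF R F G] h])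
         (simp add: eq conv_closed[OF G])
    then show "cmap \<phi> (F \<otimes>\<^bsub>C R\<^esub> G) h = (F \<otimes>\<^bsub>C R\<^esub> cmap \<phi> G) h"
      using h by (simp add: conv_apply)
  qed (simp_all add: cmap_closed[OF \<phi>] F G CR.A.m_closed)
qed

lemma cmap_mult_right:
  assumes R: "unital_algebra k R" and \<phi>: "lin R R \<phi>" and F: "F \<in> carrier (C R)" and G: "G \<in> carrier (C R)"
    and eq: "!!x r. [|x \<in> cH; r \<in> carrier R|] ==> \<phi> (r \<otimes>\<^bsub>R\<^esub> G x) = \<phi> r \<otimes>\<^bsub>R\<^esub> G x"
  shows "cmap \<phi> (F \<otimes>\<^bsub>C R\<^esub> G) = cmap \<phi> F \<otimes>\<^bsub>C R\<^esub> G"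
proof -
  interpret CR: unital_algebra k "C R" by (rule algebra_conv[OF R])
  note M = unital_algebra.module_A[OF R] and F' = cmap_closed[OF \<phi> F]
  show ?thesis
  proof (rule conv_eqI[where R = R])
    fix h assume h: "h \<in> cH"
    have "\<phi> (sw R (%x y. F x \<otimes>\<^bsub>R\<^esub> G y) h) = sw R (%x y. cmap \<phi> F x \<otimes>\<^bsub>R\<^esub> G y) h"
      by (rule sw_map[OF M M \<phi> conv_mult_bilinear_pre[OF R F G] h])
         (simp add: eq conv_closed[OF F])
    then show "cmap \<phi> (F \<otimes>\<^bsub>C R\<^esub> G) h = (cmap \<phi> F \<otimes>\<^bsub>C R\<^esub> G) h"
      using h by (simp add: conv_apply)
  qed (simp_all add: cmap_closed[OF \<phi>] F G CR.A.m_closed)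
qed

end

context enveloping_cross_product
begin

text \<open>In the expansion of h \<triangleright> (b u(g) c) every factor except the u in the
  middle lies in B, so a bimodule map may be moved onto that u. Taking \<phi> as an endomorphism of
  the whole ring lets it change degree; right multiplication, the coproduct and the counit, with
  values in degrees one, two and zero, are all instances.\<close>

lemma bimodule_map_aV:
  assumes \<phi>: "lin RR RR \<phi>"
    and l: "!!b r. [|b \<in> cB; r \<in> carrier RR|] ==> \<phi> (iB b \<star>\<^sub>0 r) = iB b \<star>\<^sub>0 \<phi> r"
    and r: "!!b r. [|b \<in> cB; r \<in> carrier RR|] ==> \<phi> (r \<star>\<^sub>0 iB b) = \<phi> r \<star>\<^sub>0 iB b"
    and b: "b \<in> cB" and c: "c \<in> cB" and g: "g \<in> cH" and h: "h \<in> cH"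
  shows "\<phi> (aV (E b c g) h) = (alB b \<star>\<^sub>1
    (flip (SR \<star>\<^sub>2 (mstar (cmap \<phi> uR) \<star>\<^sub>2 SR')) g \<star>\<^sub>1 alB c)) h"
proof -
  note cl = cmap_closed[OF \<phi>]
  have \<phi>2: "lin CR CR (cmap \<phi>)" by (rule hopf.cmap_linear[OF RR.module_A RR.module_A \<phi>])
  have muc: "mstar (cmap \<phi> uR) \<in> carrier CCR"
    by (rule hom_D(4)[OF mstar_hom_R]) (simp add: cl)
  have l2: "cmap \<phi> (SR x \<star>\<^sub>1 F) = SR x \<star>\<^sub>1 cmap \<phi> F" if "x \<in> cH" "F \<in> carrier CR" for x F
    by (rule hopf.cmap_mult_left[OF algebra_RR \<phi> conv_closed[OF SR_closed(1)]]) (use that in \<open>simp_all add: l\<close>)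
  have r2: "cmap \<phi> (F \<star>\<^sub>1 SR' x) = cmap \<phi> F \<star>\<^sub>1 SR' x" if "x \<in> cH" "F \<in> carrier CR" for x F
    by (rule hopf.cmap_mult_right[OF algebra_RR \<phi> _ conv_closed[OF SR_closed(2)]]) (use that in \<open>simp_all add: r\<close>)
  have ms: "cmap (cmap \<phi>) (mstar uR) = mstar (cmap \<phi> uR)"
    by (rule hopf.conv2_eqI[where R = RR])
       (auto intro!: cmap_closed[OF \<phi>2] muc)
  have K: "cmap (cmap \<phi>) KR = SR \<star>\<^sub>2 (mstar (cmap \<phi> uR) \<star>\<^sub>2 SR')"
    unfolding KR_def
    by (simp add: hopf.cmap_mult_left[OF algebra_CR \<phi>2 _ _ l2] hopf.cmap_mult_right[OF algebra_CR \<phi>2 _ _ r2] ms)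
  have Kg: "cmap \<phi> (Kt g) = flip (SR \<star>\<^sub>2 (mstar (cmap \<phi> uR) \<star>\<^sub>2 SR')) g"
    unfolding K[symmetric]
  proof (rule conv_eqI[where R = RR])
    show "flip (cmap (cmap \<phi>) KR) g \<in> carrier CR"
      by (rule conv_closed[OF hom_D(4)[OF flip_hom_R cmap_closed[OF \<phi>2 KR_closed]] g])
  qed (use g in \<open>auto intro!: cl simp: Kt_apply\<close>)
  have "\<phi> (aV (E b c g) h) = cmap \<phi> (alB b \<star>\<^sub>1 (Kt g \<star>\<^sub>1 alB c)) h"
    using h by (simp add: aV_E[OF b c g])
  also have "cmap \<phi> (alB b \<star>\<^sub>1 (Kt g \<star>\<^sub>1 alB c)) = alB b \<star>\<^sub>1 cmap \<phi> (Kt g \<star>\<^sub>1 alB c)"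
    by (rule hopf.cmap_mult_left[OF algebra_RR \<phi>]) (use b c g in \<open>simp_all add: alB_apply l CR.m_closed\<close>)
  also have "cmap \<phi> (Kt g \<star>\<^sub>1 alB c) = cmap \<phi> (Kt g) \<star>\<^sub>1 alB c"
    by (rule hopf.cmap_mult_right[OF algebra_RR \<phi>]) (use b c g in \<open>simp_all add: alB_apply r\<close>)
  finally show ?thesis by (simp only: Kg)
qed

lemma pV_iB_mult:
  "[|b \<in> cB; r \<in> carrier RR|] ==> tr.pV (iB b \<star>\<^sub>0 r) = lb b (tr.pV r)"
  "[|b \<in> cB; r \<in> carrier RR|] ==> tr.pV (r \<star>\<^sub>0 iB b) = rb (tr.pV r) b"
  by (simp_all add: tr.TR_mult_decomp tr.zl tr.zr)

subsection \<open>The product\<close>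

definition U where "U h x = tr.pV (aV x h)"

lemma U_linear: "h \<in> cH ==> lin V V (U h)"
  unfolding U_def[abs_def] by (rule lin_comp[OF tr.p_linear(2) lin_comp[OF conv_eval_linear aV_linear]])

lemma U_bilinear: "bil H V V U"
  by (rule bil_I)
     (auto intro!: U_linear lin_comp[OF tr.p_linear(2) conv_linear] simp: U_def)

lemma U_closed [simp]: "[|h \<in> cH; x \<in> cV|] ==> U h x \<in> cV"
  by (rule bil_closed[OF U_bilinear])

lemma iV_U: "[|h \<in> cH; x \<in> cV|] ==> iV (U h x) = aV x h"
  using aV_degV[of x h] by (auto simp: U_def tr.degV_def)

text \<open>Left multiplication by b.u(h).c is z \<mapsto> b.(h \<triangleright> z).c. The
  coefficient c ends up on the far right because left multiplication by the target t(c) is to be the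
  right bimodule action.\<close>

definition mu where "mu x z = Elift V (%b c h. lb b (rb (U h z) c)) x"

lemma mu_tri:
  assumes z: "z \<in> cV"
  shows "tril B B H V (%b c h. lb b (rb (U h z) c))"
  by (rule tril_I)
     (auto intro!: lb_linear rb_linear bil_D(2)[OF lb_bilinear] bil_D(1)[OF rb_bilinear]
        bil_D(2)[OF U_bilinear] simp: z)

lemma mu_bilinear: "bil V V V mu"
proof (rule bil_I)
  fix z assume "z \<in> cV"
  then show "lin V V (%x. mu x z)" unfolding mu_def by (intro Elift_linear[OF V_module mu_tri])
next
  fix x assume x: "x \<in> cV"
  show "lin V V (mu x)"
    unfolding mu_def
    by (rule Elift_param_linear[OF V_module V_module mu_tri _ x]) (auto intro!: lb_linear rb_linear U_linear)
qed

lemma mu_closed' [simp]: "[|x \<in> cV; z \<in> cV|] ==> mu x z \<in> cV"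
  by (rule bil_closed[OF mu_bilinear])

lemma mu_E: "[|b \<in> cB; c \<in> cB; h \<in> cH; z \<in> cV|] ==> mu (E b c h) z = lb b (rb (U h z) c)"
  unfolding mu_def by (rule Elift_E[OF V_module mu_tri])

lemma mu_linear_left: "[|lin W V f; z \<in> cV|] ==> lin W V (%x. mu (f x) z)"
  by (rule bil_left[OF mu_bilinear])

lemma mu_linear_right: "[|lin W V f; z \<in> cV|] ==> lin W V (%x. mu z (f x))"
  by (rule bil_right[OF mu_bilinear])

lemma mu_u: "[|h \<in> cH; z \<in> cV|] ==> mu (u h) z = U h z"
  by (simp add: u_def mu_E V_bimodule)

lemma mu_lb: "[|b \<in> cB; x \<in> cV; z \<in> cV|] ==> mu (lb b x) z = lb b (mu x z)"
  by (rule V_eqI[where v = x])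
     (auto intro!: mu_linear_left lb_linear lin_id simp: mu_E V_bimodule)

lemma mu_rb: "[|b \<in> cB; x \<in> cV; z \<in> cV|] ==> mu (rb x b) z = rb (mu x z) b"
  by (rule V_eqI[where v = x])
     (auto intro!: mu_linear_left rb_linear lin_id simp: mu_E V_bimodule)

text \<open>The twisted action property \<open>DR_eq\<close>, read at a fixed second argument
  g.\<close>

lemma flip_DR:
  assumes x: "x \<in> cV" and g: "g \<in> cH"
  shows "flip (SR \<star>\<^sub>2 (mstar (aV x) \<star>\<^sub>2 SR')) g = aV (U g x)"
proof (rule conv_eqI[where R = RR])
  have eq: "SR \<star>\<^sub>2 (mstar (aV x) \<star>\<^sub>2 SR') = DR (iV x)"
    using DR_eq[of "iV x"] x by (simp add: ER_def alR_i)
  show "flip (SR \<star>\<^sub>2 (mstar (aV x) \<star>\<^sub>2 SR')) g \<in> carrier CR"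
    unfolding eq by (rule conv_closed[OF hom_D(4)[OF flip_hom_R] g]) (use x in simp)
  fix h assume h: "h \<in> cH"
  show "flip (SR \<star>\<^sub>2 (mstar (aV x) \<star>\<^sub>2 SR')) g h = aV (U g x) h"
    unfolding eq using x g h by (simp add: DR_def alR_i iV_U[symmetric])
qed (use x g in simp)

text \<open>Right multiplication by z is a bimodule map sending u(h) to h \<triangleright> z. By
  \<open>bimodule_map_aV\<close> it is equivariant once the conjugate by \<sigma> of (hg)
  \<triangleright> z is h \<triangleright> (g \<triangleright> z), and that is the twisted action
  property.\<close>

lemma mu_U:
  assumes h: "h \<in> cH" and y: "y \<in> cV" and z: "z \<in> cV"
  shows "mu (U h y) z = U h (mu y z)"
proof (rule V_eqI[OF _ _ _ y])
  fix b c g assume a: "b \<in> cB" "c \<in> cB" "g \<in> cH"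
  let ?\<phi> = "%r. iV (mu (tr.pV r) z)"
  have \<phi>: "lin RR RR ?\<phi>"
    by (intro lin_comp[OF tr.iV_linear] mu_linear_left tr.p_linear z)
  have u: "cmap ?\<phi> uR = aV z"
    by (rule conv_eqI[where R = RR]) (use z in \<open>auto simp: cmap_closed[OF \<phi>] mu_u iV_U\<close>)
  have "?\<phi> (aV (E b c g) h) = (alB b \<star>\<^sub>1 (aV (U g z) \<star>\<^sub>1 alB c)) h"
    using bimodule_map_aV[OF \<phi> _ _ a h] z a
    by (simp add: pV_iB_mult mu_lb mu_rb tr.i_mult u flip_DR)
  also have "... = aV (mu (E b c g) z) h"
    using a z by (simp add: mu_E aV_lb aV_rb)
  finally show "mu (U h (E b c g)) z = U h (mu (E b c g) z)"
    by (metis (no_types, lifting) U_def tr.p_i(5))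
qed (use h z in \<open>auto intro!: mu_linear_left U_linear lin_comp[OF U_linear]  lin_id\<close>)

text \<open>On b.u(h).c in the first place, associativity is the equivariance \<open>mu_U\<close>;
  the coefficients b and c stay outside on both sides.\<close>

lemma mu_assoc:
  "[|x \<in> cV; y \<in> cV; z \<in> cV|] ==> mu (mu x y) z = mu x (mu y z)"
  by (rule V_eqI[where v = x])
     (auto intro!: mu_linear_left lin_id simp: mu_E mu_lb mu_rb mu_U)

text \<open>By the normalisation of \<sigma> and \<sigma>', conjugation is trivial as soon as one of
  the arguments is the unit. The two unit laws of the product follow from the two equations.\<close>

lemma KR_one:
  "KR 1\<^sub>H = uR" "Kt 1\<^sub>H = uR"
proof -
  have s1: "SR 1\<^sub>H = \<one>\<^bsub>CR\<^esub>" "SR' 1\<^sub>H = \<one>\<^bsub>CR\<^esub>" "flip SR 1\<^sub>H = \<one>\<^bsub>CR\<^esub>" "flip SR' 1\<^sub>H = \<one>\<^bsub>CR\<^esub>"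
    by (rule conv_eqI[where R = RR];
        auto simp: conv_closed[OF SR_closed(1)] conv_closed[OF SR_closed(2)] conv_closed[OF flipSR_closed(1)]
          conv_closed[OF flipSR_closed(2)] conv_apply sigma_one_left sigma'_one_left sigma_one_right sigma'_one_right
          lin_smult[OF tr.iB_linear] hom_D(3)[OF tr.iB_hom])+
  have m1: "mstar uR 1\<^sub>H = uR" "flip (mstar uR) 1\<^sub>H = uR"
    by (rule conv_eqI[where R = RR]; auto simp: conv_closed[OF mu_closed] conv_closed[OF flipSR_closed(3)])+
  show "KR 1\<^sub>H = uR"
    unfolding KR_def by (simp add: hopf.conv_mult_at_one[OF algebra_CR] CCR.m_closed s1 m1)
  show "Kt 1\<^sub>H = uR"
    unfolding Kt_def KR_def
    by (simp add: hom_D(2)[OF flip_hom_R] hopf.conv_mult_at_one[OF algebra_CR] CCR.m_closed s1 m1)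
qed

lemma U_one: "x \<in> cV ==> U 1\<^sub>H x = x"
proof (rule V_eqI[where v = x])
  fix b c g assume a: "b \<in> cB" "c \<in> cB" "g \<in> cH"
  have "aV (E b c g) 1\<^sub>H = iB b \<star>\<^sub>0 (iV (u g) \<star>\<^sub>0 iB c)"
    using a by (simp add: aV_E hopf.conv_mult_at_one[OF algebra_RR] alB_apply one_act Kt_apply KR_one)
  then show "U 1\<^sub>H (E b c g) = E b c g"
    using a by (simp add: U_def iV_E[symmetric])
qed (auto intro!: U_linear lin_id)

lemma U_unit: "h \<in> cH ==> U h (u 1\<^sub>H) = u h"
  by (simp add: U_def aV_u KR_one)

lemma mu_one: "x \<in> cV ==> mu (u 1\<^sub>H) x = x" "x \<in> cV ==> mu x (u 1\<^sub>H) = x"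
proof -
  assume x: "x \<in> cV"
  show "mu (u 1\<^sub>H) x = x" using x by (simp add: mu_u U_one)
  show "mu x (u 1\<^sub>H) = x"
    by (rule V_eqI[OF _ _ _ x]) (auto intro!: mu_linear_left lin_id simp: E_u mu_lb mu_rb mu_u U_unit)
qed

subsection \<open>The coproduct and the counit\<close>

definition D0 where "D0 h = sw TM (%x y. pt (u x) (u y)) h"

lemma D0_bilinear: "bil H H TM (%x y. pt (u x) (u y))"
  by (rule bil_comp[OF VT.pure_bilinear u_linear u_linear])

lemma D0_linear: "lin H TM D0"
  unfolding D0_def[abs_def] by (rule sw_linear[OF TM_module D0_bilinear])

lemma D0_closed [simp]: "h \<in> cH ==> D0 h \<in> cT"
  by (rule lin_closed[OF D0_linear])

definition Dl where "Dl x = Elift TM (%b c h. lT b (rT (D0 h) c)) x"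

lemma lT_closed [simp]: "[|b \<in> cB; t \<in> cT|] ==> lT b t \<in> cT"
  by (rule bil_closed[OF lT_bilinear])

lemma rT_closed [simp]: "[|t \<in> cT; b \<in> cB|] ==> rT t b \<in> cT"
  by (rule bil_closed[OF rT_bilinear])

lemma TM_tri:
  assumes f: "lin H TM f"
  shows "tril B B H TM (%b c h. lT b (rT (f h) c))"
  by (rule tril_I)
     (auto intro!: lT_linear rT_linear bil_D(2)[OF lT_bilinear] bil_D(1)[OF rT_bilinear] f
        simp: lin_closed[OF f])

lemma Dl_linear: "lin V TM Dl"
  unfolding Dl_def[abs_def] by (rule Elift_linear[OF TM_module TM_tri[OF D0_linear]])

lemma Dl_closed [simp]: "x \<in> cV ==> Dl x \<in> cT"
  by (rule lin_closed[OF Dl_linear])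

lemma Dl_E: "[|b \<in> cB; c \<in> cB; h \<in> cH|] ==> Dl (E b c h) = lT b (rT (D0 h) c)"
  unfolding Dl_def by (rule Elift_E[OF TM_module TM_tri[OF D0_linear]])

lemma Dl_u: "h \<in> cH ==> Dl (u h) = D0 h"
  by (simp add: u_def Dl_E tr.bimodule_W)

lemma Dl_lb: "[|b \<in> cB; x \<in> cV|] ==> Dl (lb b x) = lT b (Dl x)"
  by (rule E_linear_eqI[OF TM_module, where v = x])
     (auto intro!: lin_comp[OF Dl_linear] lb_linear lin_id lT_linear Dl_linear simp: Dl_E tr.bimodule_W)

lemma Dl_rb: "[|b \<in> cB; x \<in> cV|] ==> Dl (rb x b) = rT (Dl x) b"
  by (rule E_linear_eqI[OF TM_module, where v = x])
     (auto intro!: lin_comp[OF Dl_linear] rb_linear lin_id rT_linear Dl_linear simp: Dl_E tr.bimodule_W)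

text \<open>Between two adjacent conjugates \<sigma>' and \<sigma> cancel, so the conjugate of a
  square is the square of the conjugate.\<close>

lemma KR_square: "SR \<star>\<^sub>2 (mstar (uR \<star>\<^sub>1 uR) \<star>\<^sub>2 SR') = KR \<star>\<^sub>2 KR"
proof -
  have c: "SR' \<star>\<^sub>2 (SR \<star>\<^sub>2 F) = F" if "F \<in> carrier CCR" for F
    using that by (simp add: CCR.m_assoc[symmetric] SR_inv)
  show ?thesis
    by (simp add: KR_def hom_D(2)[OF mstar_hom_R] CCR.m_assoc c)
qed

text \<open>The coproduct is a bimodule map whose value on u is the convolution square of u, formed
  in degree two. \<open>KR_square\<close> then says that h \<triangleright> u(g) goes to the action
  of h on the coproduct of u(g).\<close>

lemma Dl_U:
  assumes h: "h \<in> cH" and x: "x \<in> cV"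
  shows "Dl (U h x) = tr.pW (aW (Dl x) h)"
proof (rule E_linear_eqI[OF TM_module _ _ _ x])
  fix b c g assume a: "b \<in> cB" "c \<in> cB" "g \<in> cH"
  let ?\<phi> = "%r. iW (Dl (tr.pV r))"
  have \<phi>: "lin RR RR ?\<phi>"
    by (intro lin_comp[OF tr.iW_linear] lin_comp[OF Dl_linear] tr.p_linear)
  have u: "cmap ?\<phi> uR = uR \<star>\<^sub>1 uR"
  proof (rule conv_eqI[where R = RR])
    fix w assume w: "w \<in> cH"
    have "iW (D0 w) = sw RR (%x y. uR x \<star>\<^sub>0 uR y) w"
      unfolding D0_def by (rule sw_map[OF TM_module RR.module_A tr.iW_linear D0_bilinear w]) (simp add: tr.i_mult)
    then show "cmap ?\<phi> uR w = (uR \<star>\<^sub>1 uR) w"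
      using w by (simp add: Dl_u conv_apply)
  qed (simp_all add: cmap_closed[OF \<phi>])
  have "flip (KR \<star>\<^sub>2 KR) g = (Kt \<star>\<^sub>2 Kt) g"
    by (simp add: hom_D(2)[OF flip_hom_R] Kt_def)
  also have "... = sw CR (%x y. Kt x \<star>\<^sub>1 Kt y) g"
    using a by (simp add: conv_apply)
  also have "... = sw CR (%x y. aW (pt (u x) (u y))) g"
    by (rule sw_cong[OF CR.module_A hopf.conv_mult_bilinear_pre[OF algebra_CR Kt_closed Kt_closed] a(3)])
       (simp add: aW_pt aV_u)
  also have "... = aW (D0 g)"
    unfolding D0_def by (rule sw_post[symmetric, OF TM_module CR.module_A aW_linear D0_bilinear a(3)])
  finally have K: "flip (KR \<star>\<^sub>2 KR) g = aW (D0 g)" .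
  have "?\<phi> (aV (E b c g) h) = (alB b \<star>\<^sub>1 (aW (D0 g) \<star>\<^sub>1 alB c)) h"
    using bimodule_map_aV[OF \<phi> _ _ a h] a
    by (simp add: pV_iB_mult Dl_lb Dl_rb tr.i_mult u KR_square K)
  also have "... = aW (Dl (E b c g)) h"
    using a by (simp add: Dl_E aW_lT aW_rT)
  finally show "Dl (U h (E b c g)) = tr.pW (aW (Dl (E b c g)) h)"
    by (metis (no_types, lifting) U_def tr.p_i(9))
qed (use h in \<open>auto intro!: lin_comp[OF Dl_linear] U_linear lin_comp[OF tr.p_linear(3)]
      lin_comp[OF conv_eval_linear] lin_comp[OF aW_linear] Dl_linear\<close>)

definition epsL where "epsL x = Elift B (%b c h. eps h \<odot>\<^bsub>B\<^esub> (b \<cdot> c)) x"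

lemma epsL_tri: "tril B B H B (%b c h. eps h \<odot>\<^bsub>B\<^esub> (b \<cdot> c))"
  by (rule tril_I)
     (auto intro!: lin_scale[OF base.module_A] base.linear_mult_left base.linear_mult_right lin_id
        hopf.eps_scale_linear[OF base.module_A])

lemma epsL_linear: "lin V B epsL"
  unfolding epsL_def[abs_def] by (rule Elift_linear[OF base.module_A epsL_tri])

lemma epsL_closed [simp]: "x \<in> cV ==> epsL x \<in> cB"
  by (rule lin_closed[OF epsL_linear])

lemma epsL_E: "[|b \<in> cB; c \<in> cB; h \<in> cH|] ==> epsL (E b c h) = eps h \<odot>\<^bsub>B\<^esub> (b \<cdot> c)"
  unfolding epsL_def by (rule Elift_E[OF base.module_A epsL_tri])

lemma epsL_u: "h \<in> cH ==> epsL (u h) = eps h \<odot>\<^bsub>B\<^esub> 1\<^sub>B"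
  by (simp add: u_def epsL_E)

lemma epsL_lb: "[|b \<in> cB; x \<in> cV|] ==> epsL (lb b x) = b \<cdot> epsL x"
  by (rule E_linear_eqI[OF base.module_A, where v = x])
     (auto intro!: lin_comp[OF epsL_linear] lb_linear lin_id base.linear_mult_right epsL_linear
       simp: epsL_E base.smult_mult_right base.A.m_assoc)

lemma epsL_rb: "[|b \<in> cB; x \<in> cV|] ==> epsL (rb x b) = epsL x \<cdot> b"
  by (rule E_linear_eqI[OF base.module_A, where v = x])
     (auto intro!: lin_comp[OF epsL_linear] rb_linear lin_id base.linear_mult_left epsL_linear
       simp: epsL_E base.smult_mult_left base.A.m_assoc)

text \<open>The counit turns u into the unit of the convolution algebra, and the conjugate of the
  unit is the unit.\<close>

lemma epsL_U:
  assumes h: "h \<in> cH" and x: "x \<in> cV"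
  shows "epsL (U h x) = act h (epsL x)"
proof (rule E_linear_eqI[OF base.module_A _ _ _ x])
  fix b c g assume a: "b \<in> cB" "c \<in> cB" "g \<in> cH"
  let ?\<phi> = "%r. iB (epsL (tr.pV r))"
  have \<phi>: "lin RR RR ?\<phi>"
    by (intro lin_comp[OF tr.iB_linear] lin_comp[OF epsL_linear] tr.p_linear)
  have u: "cmap ?\<phi> uR = \<one>\<^bsub>CR\<^esub>"
    by (rule conv_eqI[where R = RR])
       (simp_all add: cmap_closed[OF \<phi>] epsL_u conv_apply lin_smult[OF tr.iB_linear]
          hom_D(3)[OF tr.iB_hom])
  have K: "flip (SR \<star>\<^sub>2 (mstar \<one>\<^bsub>CR\<^esub> \<star>\<^sub>2 SR')) g = alB (eps g \<odot>\<^bsub>B\<^esub> 1\<^sub>B)"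
    using a by (simp add: hom_D(3)[OF mstar_hom_R] hom_D(3)[OF flip_hom_R] SR_inv conv_apply
        lin_smult[OF hom_D(1)[OF alB_hom]] hom_D(3)[OF alB_hom])
  have "?\<phi> (aV (E b c g) h) = (alB b \<star>\<^sub>1 (alB (eps g \<odot>\<^bsub>B\<^esub> 1\<^sub>B) \<star>\<^sub>1 alB c)) h"
    using bimodule_map_aV[OF \<phi> _ _ a h] a
    by (simp add: pV_iB_mult epsL_lb epsL_rb tr.i_mult u K)
  also have "... = iB (act h (epsL (E b c g)))"
    using a h by (simp add: hom_D(2)[OF alB_hom, symmetric] epsL_E base.smult_mult_left base.smult_mult_right alB_apply)
  finally show "epsL (U h (E b c g)) = act h (epsL (E b c g))"
    by (metis (no_types, lifting) U_def tr.p_i(1))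
qed (use h in \<open>auto intro!: lin_comp[OF epsL_linear] U_linear act_linear_right epsL_linear\<close>)

text \<open>Left multiplication on \<open>V \<otimes>\<^sub>B V\<close>, obtained from the extended
  measuring in degree two. It is defined on all tensors at once, whereas a factorwise product is
  well defined only for a left factor from the Takeuchi product.\<close>

definition actT where "actT x q = Elift TM (%b c h. lT b (rT (tr.pW (aW q h)) c)) x"

lemma aW_eval_linear: "q \<in> cT ==> lin H TM (%h. tr.pW (aW q h))"
  by (intro lin_comp[OF tr.p_linear(3)] conv_linear aW_closed)

lemma actT_E:
  "[|b \<in> cB; c \<in> cB; h \<in> cH; q \<in> cT|] ==> actT (E b c h) q = lT b (rT (tr.pW (aW q h)) c)"
  unfolding actT_def by (rule Elift_E[OF TM_module TM_tri[OF aW_eval_linear]])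

lemma actT_linear_left: "q \<in> cT ==> lin V TM (%x. actT x q)"
  unfolding actT_def by (rule Elift_linear[OF TM_module TM_tri[OF aW_eval_linear]])

lemma actT_linear_right: "x \<in> cV ==> lin TM TM (actT x)"
  unfolding actT_def
  by (rule Elift_param_linear[OF TM_module TM_module TM_tri[OF aW_eval_linear]])
     (auto intro!: lT_linear rT_linear lin_comp[OF tr.p_linear(3) lin_comp[OF conv_eval_linear aW_linear]])

lemma Dl_mu:
  assumes x: "x \<in> cV" and y: "y \<in> cV"
  shows "Dl (mu x y) = actT x (Dl y)"
  by (rule E_linear_eqI[OF TM_module _ _ _ x])
     (auto intro!: lin_comp[OF Dl_linear] mu_linear_left lin_id actT_linear_left
       simp: y mu_E Dl_lb Dl_rb Dl_U actT_E)

text \<open>By equivariance the counit of xy involves y only through its counit. The two laws for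
  products with s(\<epsilon>(y)) and t(\<epsilon>(y)) are the instances in which z is one of these
  elements.\<close>

lemma epsL_mu:
  assumes x: "x \<in> cV" and y: "y \<in> cV" and z: "z \<in> cV" and eq: "epsL y = epsL z"
  shows "epsL (mu x y) = epsL (mu x z)"
  by (rule E_linear_eqI[OF base.module_A _ _ _ x])
     (auto intro!: lin_comp[OF epsL_linear] mu_linear_left lin_id
       simp: y z mu_E epsL_lb epsL_rb epsL_U eq)

lemma mu_pair_ok: "[|x \<in> cV; y \<in> cV|] ==> VT.lift_ok TM (%a b. pt (mu a x) (mu b y))"
  by (rule VT.lift_okI, rule bil_comp[OF VT.pure_bilinear])
     (auto intro!: mu_linear_left lin_id simp: mu_lb mu_rb VT.pure_tensor_balance)

text \<open>In degree two the product rule reads h \<triangleright> (x \<otimes> y) = (h1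
  \<triangleright> x) \<otimes> (h2 \<triangleright> y), and u(h1) \<otimes> u(h2) is the coproduct
  of u(h). The Takeuchi condition and multiplicativity of the coproduct both rest on this
  identity.\<close>

lemma factor_mult_Dl:
  assumes w: "w \<in> cV" and x: "x \<in> cV" and y: "y \<in> cV"
  shows "tensor_lift (add_monoid TM) (%a b. pt (mu a x) (mu b y)) (Dl w) = actT w (pt x y)"
proof (rule E_linear_eqI[OF TM_module _ _ _ w])
  let ?L = "tensor_lift (add_monoid TM) (%a b. pt (mu a x) (mu b y))"
  note lin = VT.tensor_lift_linear[OF TM_module mu_pair_ok[OF x y]]
    and pure = VT.tensor_lift_pure[OF TM_module mu_pair_ok[OF x y]]
  show "lin V TM (%w. ?L (Dl w))" by (rule lin_comp[OF lin Dl_linear])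
  show "lin V TM (%w. actT w (pt x y))" by (rule actT_linear_left) (simp add: x y)
  fix b c h assume a: "b \<in> cB" "c \<in> cB" "h \<in> cH"
  have bim: "?L (lT b (rT t c)) = lT b (rT (?L t) c)" if t: "t \<in> cT" for t
    by (rule T_eqI[OF _ _ _ t])
       (use a x y in \<open>auto intro!: lin_comp[OF lin] lT_linear rT_linear lin_id lin simp: pure mu_lb mu_rb\<close>)
  have bb: "bil H H TM (%p q. pt (U p x) (U q y))"
    by (rule bil_comp[OF VT.pure_bilinear bil_D(2)[OF U_bilinear x] bil_D(2)[OF U_bilinear y]])
  have "?L (D0 h) = sw TM (%p q. pt (U p x) (U q y)) h"
    unfolding D0_def by (rule sw_map[OF TM_module TM_module lin D0_bilinear a(3)]) (simp add: pure mu_u x y)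
  also have "... = tr.pW (aW (pt x y) h)"
  proof -
    have xy: "aV x \<in> carrier CR" "aV y \<in> carrier CR" using x y by simp_all
    have "tr.pW (aW (pt x y) h) = tr.pW (sw RR (%p q. aV x p \<star>\<^sub>0 aV y q) h)"
      using a x y by (simp add: aW_pt conv_apply)
    also have "... = sw TM (%p q. pt (U p x) (U q y)) h"
      by (rule sw_map[OF RR.module_A TM_module tr.p_linear(3) hopf.conv_mult_bilinear_pre[OF algebra_RR xy] a(3)])
         (simp add: iV_U[symmetric] x y tr.i_mult)
    finally show ?thesis by simp
  qed
  finally show "?L (Dl (E b c h)) = actT (E b c h) (pt x y)"
    using a x y by (simp add: Dl_E bim actT_E)
qed

end

section \<open>Transport of tensor products and modules between records\<close>

lemma tensor_group_cong:
  assumes M: "carrier M = carrier M'" "monoid.mult M = monoid.mult M'"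
    and N: "carrier N = carrier N'" "monoid.mult N = monoid.mult N'"
    and ra: "!!x r. [|x \<in> carrier M; r \<in> R|] ==> ra x r = ra' x r"
    and la: "!!y r. [|y \<in> carrier N; r \<in> R|] ==> la r y = la' r y"
  shows "tensor_group R ra la M N = tensor_group R ra' la' M' N'"
proof -
  have "{frag_of (ra x r, y) - frag_of (x, la r y) | x r y. x \<in> carrier M \<and> r \<in> R \<and> y \<in> carrier N}
    = {frag_of (ra' x r, y) - frag_of (x, la' r y) | x r y. x \<in> carrier M \<and> r \<in> R \<and> y \<in> carrier N}"
    using ra la by (intro Collect_cong) metis
  then have "tensor_relators R ra la M N = tensor_relators R ra' la' M' N'"
    by (simp add: tensor_relators_def M[symmetric] N[symmetric])
  then show ?thesis by (simp add: tensor_group_def M[symmetric] N[symmetric])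
qed

lemma module_transfer:
  assumes M: "module k M" and eq: "carrier N = carrier M" "\<zero>\<^bsub>N\<^esub> = \<zero>\<^bsub>M\<^esub>" "ring.add N = ring.add M" "module.smult N = module.smult M"
  shows "module k N"
proof -
  interpret M: module k M by fact
  show ?thesis
  proof (rule moduleI[OF module.axioms(1)[OF M]])
    show "abelian_group N"
    proof (rule abelian_groupI)
      fix x assume "x \<in> carrier N"
      then show "\<exists>y\<in>carrier N. y \<oplus>\<^bsub>N\<^esub> x = \<zero>\<^bsub>N\<^esub>"
        by (intro bexI[of _ "\<ominus>\<^bsub>M\<^esub> x"]) (simp_all add: eq M.l_neg)
    qed (simp_all add: eq M.a_ac)
  qed (simp_all add: eq M.smult_l_distr M.smult_r_distr M.smult_assoc1)
qed

context enveloping_cross_product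
begin

section \<open>The bialgebroid\<close>

definition L :: "('k, 'b, (('b \<times> 'b \<Rightarrow>\<^sub>0 int) set \<times> 'h \<Rightarrow>\<^sub>0 int) set) bialgebroid_data"
  where "L = \<lparr>carrier = cV, monoid.mult = mu, one = u 1\<^sub>H, ring.zero = \<zero>\<^bsub>V\<^esub>, ring.add = ring.add V,
    module.smult = module.smult V, source = (%b. lb b (u 1\<^sub>H)), target = (%b. rb (u 1\<^sub>H) b),
    coprod = Dl, bcounit = epsL\<rparr>"

lemma L_simps [simp]:
  "carrier L = cV" "monoid.mult L = mu" "\<one>\<^bsub>L\<^esub> = u 1\<^sub>H" "\<zero>\<^bsub>L\<^esub> = \<zero>\<^bsub>V\<^esub>" "ring.add L = ring.add V"
  "module.smult L = module.smult V" "source L = (%b. lb b (u 1\<^sub>H))" "target L = (%b. rb (u 1\<^sub>H) b)"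
  "coprod L = Dl" "bcounit L = epsL"
  by (simp_all add: L_def)

lemma lin_L [simp]: "lin L M f \<longleftrightarrow> lin V M f" "lin N L g \<longleftrightarrow> lin N V g"
  by (simp_all add: linear_map_def hom_def)

lemma mu_source: "[|b \<in> cB; x \<in> cV|] ==> mu (lb b (u 1\<^sub>H)) x = lb b x"
  by (simp add: mu_lb mu_one)

lemma mu_target: "[|b \<in> cB; x \<in> cV|] ==> mu (rb (u 1\<^sub>H) b) x = rb x b"
  by (simp add: mu_rb mu_one)

lemma unital_algebra_L: "unital_algebra k L"
proof (rule unital_algebraI[OF base.field_k])
  show "module k L" by (rule module_transfer[OF V_module]) simp_all
  show "bil L L L (%x y. x \<otimes>\<^bsub>L\<^esub> y)"
    using mu_bilinear by (simp add: bilinear_map_def)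
qed (simp_all add: mu_assoc mu_one)

lemma tensor_base_L: "tensor_base B L = VT.T"
  unfolding tensor_base_def VT_T T0_def
  by (rule tensor_group_cong) (simp_all add: mu_source mu_target)

lemma tensor_lift_VT: "tensor_lift VT.T = tensor_lift (add_monoid TM)"
  by (rule VT.lift_add_monoid_P[symmetric])

lemma pair_ok:
  assumes "lin V V f" "lin V V g"
    and "!!x b. [|x \<in> cV; b \<in> cB|] ==> f (rb x b) = rb (f x) b"
    and "!!x b. [|x \<in> cV; b \<in> cB|] ==> g (lb b x) = lb b (g x)"
  shows "VT.lift_ok TM (%x y. pt (f x) (g y))"
  by (rule VT.lift_okI, rule bil_comp[OF VT.pure_bilinear assms(1,2)])
     (simp add: assms(3,4) VT.pure_tensor_balance lin_closed[OF assms(1)] lin_closed[OF assms(2)])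

lemma bimodule_lift:
  assumes "b \<in> cB" "c \<in> cB" and t: "t \<in> cT"
  shows "tensor_lift (add_monoid TM) (%x y. pt (mu (lb b (u 1\<^sub>H)) x) (mu (rb (u 1\<^sub>H) c) y)) t = lT b (rT t c)"
proof -
  have ok: "VT.lift_ok TM (%x y. pt (mu (lb b (u 1\<^sub>H)) x) (mu (rb (u 1\<^sub>H) c) y))"
    by (rule pair_ok) (use assms(1,2) in \<open>auto intro!: mu_linear_right lin_id simp: mu_source mu_target V_bimodule\<close>)
  show ?thesis
    by (rule T_eqI[OF _ _ _ t])
       (use assms(1,2) in \<open>auto intro!: VT.tensor_lift_linear[OF TM_module ok] lT_linear rT_linear lin_id
          simp: VT.tensor_lift_pure[OF TM_module ok] mu_source mu_target\<close>)
qed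

text \<open>On b.u(h).c both sides are the sum of the b.u(h1) \<otimes> (u(h2) \<otimes> u(h3).c),
  so coassociativity of H decides. The effort goes into making the triple tensor product a k-module,
  \<open>M3\<close>, and into the balancedness of the nested lifts.\<close>

lemma Dl_coassoc:
  assumes w: "w \<in> cV"
  shows "let T = tensor_base B L; T3 = tensor_base3 B L
    in tensor_lift T3 (%y x3. tensor_lift T3 (%x1 x2.
          pure_tensor T3 x1 (pure_tensor T x2 x3)) (Dl y)) (Dl w)
      = tensor_lift T3 (%x1 y. pure_tensor T3 x1 (Dl y)) (Dl w)"
proof -
  define G3 where "G3 = tensor_group (cB) rb lT (add_monoid V) (add_monoid TM)"
  define M3 where "M3 = tensor_space V G3"
  have pair: "balanced_pair (add_monoid V) (add_monoid TM) (cB) rb lT"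
    using module.comm_group_add_monoid[OF V_module] module.comm_group_add_monoid[OF TM_module]
    by (simp add: balanced_pair_def balanced_pair_axioms_def)
  have T: "balanced_pair.T (add_monoid V) (add_monoid TM) (cB) rb lT = G3"
    by (simp add: balanced_pair.T_def[OF pair] G3_def)
  have scal: "lT (a \<odot>\<^bsub>B\<^esub> 1\<^sub>B) t = a \<odot>\<^bsub>TM\<^esub> t" if "a \<in> carrier k" "t \<in> cT" for a t
    using lin_smult[OF bil_D(2)[OF lT_bilinear], of t a "1\<^sub>B"] that by (simp add: tr.bimodule_W)
  interpret TT: tensor_module k V TM "cB" rb lT M3
  proof (intro tensor_module.intro tensor_module_axioms.intro V_module TM_module pair)
    fix a assume a: "a \<in> carrier k"
    show "\<exists>r\<in>cB. (\<forall>x\<in>cV. rb x r = a \<odot>\<^bsub>V\<^esub> x) \<and> (\<forall>y\<in>cT. lT r y = a \<odot>\<^bsub>TM\<^esub> y)"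
      by (rule bexI[of _ "a \<odot>\<^bsub>B\<^esub> 1\<^sub>B"]) (use a in \<open>simp_all add: scalar_V scal\<close>)
  qed (simp_all add: T M3_def tensor_space_def lin_smult[OF bil_D(2)[OF rb_bilinear]])
  let ?p = "pure_tensor TT.T" and ?lift = "tensor_lift (add_monoid M3)"
  note M3 = TT.module_P
  have T3: "tensor_base3 B L = TT.T"
    unfolding tensor_base3_def Let_def tensor_base_L T G3_def tensor_lift_VT
  proof (rule tensor_group_cong)
    fix y r assume yr: "y \<in> carrier VT.T" "r \<in> cB"
    then have y: "y \<in> cT" by (simp add: VT.carrier_P)
    show "tensor_lift (add_monoid TM) (%x y. pt (source L r \<otimes>\<^bsub>L\<^esub> x) y) y = lT r y"
      unfolding lT_def by (rule VT.tensor_lift_cong[symmetric, OF TM_module lT_ok[OF yr(2)] y]) (simp add: yr mu_source)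
  qed (simp_all add: VT.carrier_P VT.add_P mu_target)
  have in_ok: "VT.lift_ok M3 (%x1 x2. ?p x1 (pt x2 x3))" if x3: "x3 \<in> cV" for x3
  proof (rule VT.lift_okI)
    show "bil V V M3 (%x1 x2. ?p x1 (pt x2 x3))"
      by (rule bil_comp[OF TT.pure_bilinear lin_id bil_D(2)[OF VT.pure_bilinear x3]])
    fix x r y assume a: "x \<in> cV" "r \<in> cB" "y \<in> cV"
    then show "?p (rb x r) (pt y x3) = ?p x (pt (lb r y) x3)"
      using TT.pure_tensor_balance[of x r "pt y x3"] x3 by simp
  qed
  let ?F = "%t x3. ?lift (%x1 x2. ?p x1 (pt x2 x3)) t"
  note F_lin = VT.tensor_lift_linear[OF M3 in_ok] and F_pure = VT.tensor_lift_pure[OF M3 in_ok]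
  have F_r: "?F (rT t d) x3 = ?F t (lb d x3)" if "t \<in> cT" "d \<in> cB" "x3 \<in> cV" for t d x3
    by (rule T_eqI[OF _ _ _ that(1)])
       (use that in \<open>auto intro!: lin_comp[OF F_lin] rT_linear lin_id F_lin simp: F_pure VT.pure_tensor_balance\<close>)
  have out_ok: "VT.lift_ok M3 (%y x3. ?F (Dl y) x3)"
  proof (rule VT.lift_okI)
    show "bil V V M3 (%y x3. ?F (Dl y) x3)"
    proof (rule bil_I)
      fix y assume y: "y \<in> cV"
      show "lin V M3 (?F (Dl y))"
        by (rule VT.tensor_lift_param_linear[OF M3 V_module in_ok])
           (auto intro!: bil_right[OF TT.pure_bilinear bil_D(1)[OF VT.pure_bilinear]] simp: y)
    qed (rule lin_comp[OF F_lin Dl_linear])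
  qed (simp add: Dl_rb F_r)
  have rhs_ok: "VT.lift_ok M3 (%x1 y. ?p x1 (Dl y))"
    by (rule VT.lift_okI, rule bil_comp[OF TT.pure_bilinear lin_id Dl_linear])
       (simp add: Dl_lb TT.pure_tensor_balance)
  note l1 = VT.tensor_lift_linear[OF M3 out_ok] and p1 = VT.tensor_lift_pure[OF M3 out_ok]
  note l2 = VT.tensor_lift_linear[OF M3 rhs_ok] and p2 = VT.tensor_lift_pure[OF M3 rhs_ok]
  have main: "?lift (%y x3. ?F (Dl y) x3) (Dl w) = ?lift (%x1 y. ?p x1 (Dl y)) (Dl w)"
  proof (rule E_linear_eqI[OF M3 lin_comp[OF l1 Dl_linear] lin_comp[OF l2 Dl_linear] _ w])
    fix b c h assume a: "b \<in> cB" "c \<in> cB" "h \<in> cH"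
    let ?D = "%b c x y. pt (lb b (u x)) (rb (u y) c)"
    have Db: "bil H H TM (?D b c)" if "b \<in> cB" "c \<in> cB" for b c
      by (rule bil_comp[OF VT.pure_bilinear]) (use that in \<open>auto intro!: lb_linear rb_linear u_linear\<close>)
    have lrT: "lin TM TM (%t. lT b (rT t c))" if "b \<in> cB" "c \<in> cB" for b c
      by (intro lT_linear rT_linear lin_id that)
    have D: "lT b (rT (D0 h) c) = sw TM (?D b c) h" if "b \<in> cB" "c \<in> cB" "h \<in> cH" for b c h
    proof -
      have "lT b (rT (D0 h) c) = sw TM (?D b c) h"
        unfolding D0_def by (rule sw_map[OF TM_module TM_module lrT[OF that(1,2)] D0_bilinear that(3)]) (simp add: that)
      then show ?thesis .
    qed
    have D1: "lT 1\<^sub>B t = t" "rT t 1\<^sub>B = t" if "t \<in> cT" for t using that by (simp_all add: tr.bimodule_W)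
    let ?Q = "%p q r. ?p (lb b (u p)) (pt (u q) (rb (u r) c))"
    have Q: "tril H H H M3 ?Q"
      by (rule tril_I)
         (use a in \<open>auto intro!: bil_left[OF TT.pure_bilinear] bil_right[OF TT.pure_bilinear]
            bil_left[OF VT.pure_bilinear] bil_right[OF VT.pure_bilinear] lb_linear rb_linear u_linear\<close>)
    have "?lift (%y x3. ?F (Dl y) x3) (Dl (E b c h)) = sw M3 (%x y. ?F (lT b (D0 x)) (rb (u y) c)) h"
    proof -
      have "?lift (%y x3. ?F (Dl y) x3) (sw TM (?D b c) h) = sw M3 (%x y. ?F (lT b (D0 x)) (rb (u y) c)) h"
        by (rule sw_map[OF TM_module M3 l1 Db[OF a(1,2)] a(3)]) (simp add: p1 a Dl_lb Dl_u)
      then show ?thesis using a by (simp add: Dl_E D)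
    qed
    also have "... = sw M3 (%x r. sw M3 (%p q. ?Q p q r) x) h"
    proof (rule sw_cong[symmetric, OF M3 hopf.sw_left_bilinear[OF M3 Q] a(3)])
      fix x r assume x: "x \<in> cH" and r: "r \<in> cH"
      have z: "rb (u r) c \<in> cV" using r a by simp
      have "?F (lT b (D0 x)) (rb (u r) c) = ?F (lT b (rT (D0 x) 1\<^sub>B)) (rb (u r) c)" using x by (simp add: D1)
      also have "... = ?F (sw TM (?D b 1\<^sub>B) x) (rb (u r) c)" using a x by (simp add: D)
      also have "... = sw M3 (%p q. ?Q p q r) x"
        by (rule sw_map[OF TM_module M3 F_lin[OF z] Db[OF a(1) base.A.one_closed] x])
           (simp add: F_pure[OF z] a V_bimodule)
      finally show "sw M3 (%p q. ?Q p q r) x = ?F (lT b (D0 x)) (rb (u r) c)" by simp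
    qed
    also have "... = sw M3 (%p y. sw M3 (%q r. ?Q p q r) y) h"
      by (rule sw_coassoc[OF M3 Q a(3)])
    also have "... = sw M3 (%p y. ?p (lb b (u p)) (rT (D0 y) c)) h"
    proof (rule sw_cong[OF M3 sw_right_bilinear[OF M3 Q] a(3)])
      fix p y assume p: "p \<in> cH" and y: "y \<in> cH"
      have z: "lb b (u p) \<in> cV" using p a by simp
      note lp = bil_D(1)[OF TT.pure_bilinear z]
      have "?p (lb b (u p)) (rT (D0 y) c) = ?p (lb b (u p)) (lT 1\<^sub>B (rT (D0 y) c))" using y a by (simp add: D1)
      also have "... = ?p (lb b (u p)) (sw TM (?D 1\<^sub>B c) y)" using a y by (simp add: D)
      also have "... = sw M3 (%q r. ?Q p q r) y"
        by (rule sw_map[OF TM_module M3 lp Db[OF base.A.one_closed a(2)] y]) (simp add: V_bimodule)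
      finally show "sw M3 (%q r. ?Q p q r) y = ?p (lb b (u p)) (rT (D0 y) c)" by simp
    qed
    also have "... = ?lift (%x1 y. ?p x1 (Dl y)) (Dl (E b c h))"
    proof -
      have bb: "bil H H M3 (%x y. ?p (lb b (u x)) (rT (D0 y) c))"
        by (rule bil_comp[OF TT.pure_bilinear]) (use a in \<open>auto intro!: lb_linear u_linear rT_linear D0_linear\<close>)
      have "?lift (%x1 y. ?p x1 (Dl y)) (sw TM (?D b c) h) = sw M3 (%x y. ?lift (%x1 y. ?p x1 (Dl y)) (?D b c x y)) h"
        by (rule sw_post[OF TM_module M3 l2 Db[OF a(1,2)] a(3)])
      also have "... = sw M3 (%x y. ?p (lb b (u x)) (rT (D0 y) c)) h"
        by (rule sw_cong[symmetric, OF M3 bb a(3)]) (simp add: p2 a Dl_rb Dl_u)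
      finally show ?thesis using a by (simp add: Dl_E D)
    qed
    finally show "?lift (%y x3. ?F (Dl y) x3) (Dl (E b c h)) = ?lift (%x1 y. ?p x1 (Dl y)) (Dl (E b c h))" .
  qed
  show ?thesis
    using main by (simp add: T3 tensor_base_L TT.lift_add_monoid_P)
qed

text \<open>Both lifts are bimodule maps, so u(h) is the case that matters; there one factor has a
  scalar as its counit and the counit law of H absorbs the leg.\<close>

lemma epsL_unit_left:
  assumes w: "w \<in> cV"
  shows "tensor_lift (add_monoid V) (%x y. lb (epsL x) y) (Dl w) = w"
    and "tensor_lift (add_monoid V) (%x y. rb x (epsL y)) (Dl w) = w"
proof -
  have ok: "VT.lift_ok V (%x y. lb (epsL x) y)" "VT.lift_ok V (%x y. rb x (epsL y))"
    by (rule VT.lift_okI, rule bil_comp[OF lb_bilinear epsL_linear lin_id], simp add: epsL_rb V_bimodule,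
        rule VT.lift_okI, rule bil_comp[OF rb_bilinear lin_id epsL_linear], simp add: epsL_lb V_bimodule)
  have u1: "lb (eps x \<odot>\<^bsub>B\<^esub> 1\<^sub>B) y = eps x \<odot>\<^bsub>V\<^esub> y" "rb y (eps x \<odot>\<^bsub>B\<^esub> 1\<^sub>B) = eps x \<odot>\<^bsub>V\<^esub> y"
    if "x \<in> cH" "y \<in> cV" for x y
    using that by (simp_all add: scalar_V)
  have D: "tensor_lift (add_monoid V) F (D0 h) = sw V (%x y. F (u x) (u y)) h"
    "bil H H V (%x y. F (u x) (u y))"
    if F: "VT.lift_ok V F" and h: "h \<in> cH" for F h
  proof -
    note l = VT.tensor_lift_linear[OF V_module F] and p = VT.tensor_lift_pure[OF V_module F]
    show "bil H H V (%x y. F (u x) (u y))"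
      by (rule bil_comp[OF _ u_linear u_linear]) (use F in \<open>simp add: VT.lift_ok_def\<close>)
    have "tensor_lift (add_monoid V) F (D0 h) = sw V (%x y. F (u x) (u y)) h"
      unfolding D0_def by (rule sw_map[OF TM_module V_module l D0_bilinear h]) (simp add: p)
    then show "tensor_lift (add_monoid V) F (D0 h) = sw V (%x y. F (u x) (u y)) h" .
  qed
  have bim: "tensor_lift (add_monoid V) F (lT b (rT t c)) = lb b (rb (tensor_lift (add_monoid V) F t) c)"
    if F: "VT.lift_ok V F" and t: "t \<in> cT" and bc: "b \<in> cB" "c \<in> cB"
      and Fb: "!!x y. [|x \<in> cV; y \<in> cV|] ==> F (lb b x) (rb y c) = lb b (rb (F x y) c)" for F t b c
  proof -
    note l = VT.tensor_lift_linear[OF V_module F] and p = VT.tensor_lift_pure[OF V_module F]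
    show ?thesis
      by (rule T_eqI[OF _ _ _ t])
         (use bc in \<open>auto intro!: lin_comp[OF l] lT_linear rT_linear lb_linear rb_linear lin_id l simp: p Fb\<close>)
  qed
  show "tensor_lift (add_monoid V) (%x y. lb (epsL x) y) (Dl w) = w"
  proof (rule V_eqI[OF lin_comp[OF VT.tensor_lift_linear[OF V_module ok(1)] Dl_linear] lin_id _ w])
    fix b c h assume a: "b \<in> cB" "c \<in> cB" "h \<in> cH"
    have "sw V (%x y. lb (epsL (u x)) (u y)) h = u h"
      by (rule hopf.sw_absorb_left[OF V_module D(2)[OF ok(1) a(3)] u_linear a(3)]) (simp add: epsL_u u1)
    then show "tensor_lift (add_monoid V) (%x y. lb (epsL x) y) (Dl (E b c h)) = E b c h"
      using a by (simp add: Dl_lb Dl_rb Dl_u bim[OF ok(1)] epsL_lb V_bimodule D(1)[OF ok(1)] E_u)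
  qed
  show "tensor_lift (add_monoid V) (%x y. rb x (epsL y)) (Dl w) = w"
  proof (rule V_eqI[OF lin_comp[OF VT.tensor_lift_linear[OF V_module ok(2)] Dl_linear] lin_id _ w])
    fix b c h assume a: "b \<in> cB" "c \<in> cB" "h \<in> cH"
    have "sw V (%x y. rb (u x) (epsL (u y))) h = u h"
      by (rule hopf.sw_absorb_right[OF V_module D(2)[OF ok(2) a(3)] u_linear a(3)]) (simp add: epsL_u u1)
    then show "tensor_lift (add_monoid V) (%x y. rb x (epsL y)) (Dl (E b c h)) = E b c h"
      using a by (simp add: Dl_lb Dl_rb Dl_u bim[OF ok(2)] epsL_rb V_bimodule D(1)[OF ok(2)] E_u)
  qed
qed

lemma source_linear: "lin B V (%b. lb b (u 1\<^sub>H))"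
  by (rule bil_D(2)[OF lb_bilinear]) simp

lemma target_linear: "lin B V (%b. rb (u 1\<^sub>H) b)"
  by (rule bil_D(1)[OF rb_bilinear]) simp

lemma epsL_one: "epsL (u 1\<^sub>H) = 1\<^sub>B"
  by (simp add: epsL_u)

text \<open>Both sides are w acting on one and the same tensor, since t(b) \<otimes> 1 = 1 \<otimes>
  s(b) by the balancing relation.\<close>

lemma Dl_takeuchi:
  assumes w: "w \<in> cV" and b: "b \<in> cB"
  shows "tensor_lift (add_monoid TM) (%x y. pt (mu x (rb (u 1\<^sub>H) b)) y) (Dl w)
    = tensor_lift (add_monoid TM) (%x y. pt x (mu y (lb b (u 1\<^sub>H)))) (Dl w)"
proof -
  let ?o = "u 1\<^sub>H"
  have "tensor_lift (add_monoid TM) (%x y. pt (mu x (rb ?o b)) y) (Dl w)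
    = tensor_lift (add_monoid TM) (%x y. pt (mu x (rb ?o b)) (mu y ?o)) (Dl w)"
    by (rule VT.tensor_lift_cong[symmetric, OF TM_module mu_pair_ok]) (simp_all add: w b mu_one)
  also have "... = tensor_lift (add_monoid TM) (%x y. pt (mu x ?o) (mu y (lb b ?o))) (Dl w)"
    by (simp add: factor_mult_Dl w b VT.pure_tensor_balance)
  also have "... = tensor_lift (add_monoid TM) (%x y. pt x (mu y (lb b ?o))) (Dl w)"
    by (rule VT.tensor_lift_cong[OF TM_module mu_pair_ok]) (simp_all add: w b mu_one)
  finally show ?thesis .
qed

lemma left_bialgebroid_L: "left_bialgebroid k B L"
proof (intro left_bialgebroid.intro left_bialgebroid_axioms.intro unital_algebra_L algebra_B)
  note sm = tensor_base_L tensor_lift_VT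
  show "algebra_hom k B L (source L)"
    by (rule hom_I) (simp_all add: source_linear mu_source V_bimodule)
  show "algebra_hom k (opposite B) L (target L)"
    by (rule hom_I) (simp_all add: target_linear mu_target V_bimodule opposite_ops)
  show "source L b \<otimes>\<^bsub>L\<^esub> target L c = target L c \<otimes>\<^bsub>L\<^esub> source L b" if "b \<in> cB" "c \<in> cB" for b c
    using that by (simp add: mu_source mu_target V_bimodule)
  show "coprod L \<in> hom (add_monoid L) (tensor_base B L)"
    using lin_hom[OF Dl_linear] by (simp add: sm hom_def VT.carrier_P VT.add_P)
  show "coprod L (source L b \<otimes>\<^bsub>L\<^esub> target L c \<otimes>\<^bsub>L\<^esub> x) =
      tensor_lift (tensor_base B L) (%x1 x2. pure_tensor (tensor_base B L) (source L b \<otimes>\<^bsub>L\<^esub> x1) (target L c \<otimes>\<^bsub>L\<^esub> x2)) (coprod L x)"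
    if "b \<in> cB" "c \<in> cB" "x \<in> carrier L" for b c x
    using that by (simp add: sm bimodule_lift mu_source mu_target mu_lb mu_rb mu_one Dl_lb Dl_rb)
  show "x \<in> carrier L ==> let T = tensor_base B L; T3 = tensor_base3 B L
       in tensor_lift T3 (%y x3. tensor_lift T3 (%x1 x2. pure_tensor T3 x1 (pure_tensor T x2 x3)) (coprod L y)) (coprod L x)
        = tensor_lift T3 (%x1 y. pure_tensor T3 x1 (coprod L y)) (coprod L x)" for x
    using Dl_coassoc[of x] by simp
  show "bcounit L \<in> hom (add_monoid L) (add_monoid B)"
    using lin_hom[OF epsL_linear] by (simp add: hom_def)
  show "bcounit L (source L b \<otimes>\<^bsub>L\<^esub> target L c \<otimes>\<^bsub>L\<^esub> x) = b \<cdot> bcounit L x \<cdot> c"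
    if "b \<in> cB" "c \<in> cB" "x \<in> carrier L" for b c x
    using that by (simp add: mu_source mu_target mu_lb mu_rb mu_one epsL_lb epsL_rb base.A.m_assoc)
  have lift_L: "tensor_lift (add_monoid L) F t = tensor_lift (add_monoid V) F t" for F t
    by (rule tensor_lift_monoid_cong) simp_all
  show "tensor_lift (add_monoid L) (%x1 x2. source L (bcounit L x1) \<otimes>\<^bsub>L\<^esub> x2) (coprod L x) = x"
    if x: "x \<in> carrier L" for x
  proof -
    have ok: "VT.lift_ok V (%x y. lb (epsL x) y)"
      by (rule VT.lift_okI, rule bil_comp[OF lb_bilinear epsL_linear lin_id], simp add: epsL_rb V_bimodule)
    have "tensor_lift (add_monoid V) (%x1 x2. mu (lb (epsL x1) (u 1\<^sub>H)) x2) (Dl x) = tensor_lift (add_monoid V) (%x y. lb (epsL x) y) (Dl x)"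
      by (rule VT.tensor_lift_cong[symmetric, OF V_module ok]) (use x in \<open>simp_all add: mu_source\<close>)
    then show ?thesis unfolding lift_L using x by (simp add: epsL_unit_left)
  qed
  show "tensor_lift (add_monoid L) (%x1 x2. target L (bcounit L x2) \<otimes>\<^bsub>L\<^esub> x1) (coprod L x) = x"
    if x: "x \<in> carrier L" for x
  proof -
    have ok: "VT.lift_ok V (%x y. rb x (epsL y))"
      by (rule VT.lift_okI, rule bil_comp[OF rb_bilinear lin_id epsL_linear], simp add: epsL_lb V_bimodule)
    have "tensor_lift (add_monoid V) (%x1 x2. mu (rb (u 1\<^sub>H) (epsL x2)) x1) (Dl x) = tensor_lift (add_monoid V) (%x y. rb x (epsL y)) (Dl x)"
      by (rule VT.tensor_lift_cong[symmetric, OF V_module ok]) (use x in \<open>simp_all add: mu_target\<close>)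
    then show ?thesis unfolding lift_L using x by (simp add: epsL_unit_left)
  qed
  show "x \<in> carrier L ==> coprod L x \<in> takeuchi B L" for x
    by (simp add: takeuchi_def Let_def sm Dl_takeuchi VT.carrier_P[symmetric])
  show "coprod L \<one>\<^bsub>L\<^esub> = pure_tensor (tensor_base B L) \<one>\<^bsub>L\<^esub> \<one>\<^bsub>L\<^esub>"
    by (simp add: sm Dl_u D0_def hopf.sw_one[OF TM_module D0_bilinear])
  show "coprod L (x \<otimes>\<^bsub>L\<^esub> y) = factorwise_mult B L (coprod L x) (coprod L y)"
    if "x \<in> carrier L" "y \<in> carrier L" for x y
  proof -
    have x: "x \<in> cV" and y: "y \<in> cV" using that by simp_all
    have ok: "VT.lift_ok TM (%a b. actT x (pt a b))"
      by (rule VT.lift_okI, rule bil_post[OF actT_linear_right[OF x] VT.pure_bilinear])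
         (simp add: VT.pure_tensor_balance)
    \<comment> \<open>The inner lift is the action of x on a pure tensor, so the outer lift merely
      reassembles the coproduct of y inside the linear map \<open>actT x\<close>.\<close>
    have "tensor_lift (add_monoid TM) (%a' b'. tensor_lift (add_monoid TM) (%a b. pt (mu a a') (mu b b')) (Dl x)) (Dl y)
      = tensor_lift (add_monoid TM) (%a b. actT x (pt a b)) (Dl y)"
      by (rule VT.tensor_lift_cong[symmetric, OF TM_module ok]) (simp_all add: y factor_mult_Dl x)
    also have "... = actT x (Dl y)"
      by (rule T_eqI[OF VT.tensor_lift_linear[OF TM_module ok] actT_linear_right[OF x]])
         (simp_all add: VT.tensor_lift_pure[OF TM_module ok] y)
    finally show ?thesis by (simp add: factorwise_mult_def Let_def sm Dl_mu x y)
  qed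
  show "bcounit L \<one>\<^bsub>L\<^esub> = 1\<^sub>B" by (simp add: epsL_one)
  show "bcounit L (source L b \<otimes>\<^bsub>L\<^esub> x) = b \<cdot> bcounit L x" if "b \<in> cB" "x \<in> carrier L" for b x
    using that by (simp add: mu_source epsL_lb)
  show "bcounit L (x \<otimes>\<^bsub>L\<^esub> source L (bcounit L y)) = bcounit L (x \<otimes>\<^bsub>L\<^esub> y)" if "x \<in> carrier L" "y \<in> carrier L" for x y
    using that epsL_mu[of x "lb (epsL y) (u 1\<^sub>H)" y] by (simp add: epsL_lb epsL_one)
  show "bcounit L (x \<otimes>\<^bsub>L\<^esub> y) = bcounit L (x \<otimes>\<^bsub>L\<^esub> target L (bcounit L y))" if "x \<in> carrier L" "y \<in> carrier L" for x y
    using that epsL_mu[of x "rb (u 1\<^sub>H) (epsL y)" y] by (simp add: epsL_rb epsL_one)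
qed

end

section \<open>Rearrangement of longer Sweedler sums and left contraction\<close>

context hopf_algebra
begin

text \<open>Brings legs bracketed as (h1 (h2 h3)) h4 into the right-nested form of
  \<open>sweedler4\<close>.\<close>

lemma sw_coassoc4:
  assumes M: "module k M" and h: "h \<in> cH"
    and lin: "!!b c d. [|b \<in> cH; c \<in> cH; d \<in> cH|] ==> lin H M (%a. K a b c d)"
      "!!a c d. [|a \<in> cH; c \<in> cH; d \<in> cH|] ==> lin H M (%b. K a b c d)"
      "!!a b d. [|a \<in> cH; b \<in> cH; d \<in> cH|] ==> lin H M (%c. K a b c d)"
      "!!a b c. [|a \<in> cH; b \<in> cH; c \<in> cH|] ==> lin H M (%d. K a b c d)"
  shows "sw M (%p d. sw M (%a q. sw M (%b c. K a b c d) q) p) h = sw M (%a z. sw M (%b y. sw M (%c d. K a b c d) y) z) h"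
proof -
  have t: "tril H H H M (%a q d. sw M (%b c. K a b c d) q)"
    by (rule tril_I) (auto intro!: sw_linear[OF M] sw_param_linear[OF M module_A] bil_I lin)
  have ti: "tril H H H M (%b c d. K a b c d)" if "a \<in> cH" for a
    by (rule tril_I) (auto intro!: lin that)
  have "sw M (%p d. sw M (%a q. sw M (%b c. K a b c d) q) p) h = sw M (%a z. sw M (%q d. sw M (%b c. K a b c d) q) z) h"
    by (rule sw_coassoc[OF M t h])
  also have "... = sw M (%a z. sw M (%b y. sw M (%c d. K a b c d) y) z) h"
    by (rule sw_cong[OF M sw_right_bilinear[OF M t] h]) (rule sw_coassoc[OF M ti])
  finally show ?thesis .
qed

lemma sw_swap3:
  assumes M: "module k M" and h: "h \<in> cH" and g: "g \<in> cH"
    and lin: "!!b c d p r. [|b \<in> cH; c \<in> cH; d \<in> cH; p \<in> cH; r \<in> cH|] ==> lin H M (%a. K a b c d p r)"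
      "!!a c d p r. [|a \<in> cH; c \<in> cH; d \<in> cH; p \<in> cH; r \<in> cH|] ==> lin H M (%b. K a b c d p r)"
      "!!a b d p r. [|a \<in> cH; b \<in> cH; d \<in> cH; p \<in> cH; r \<in> cH|] ==> lin H M (%c. K a b c d p r)"
      "!!a b c p r. [|a \<in> cH; b \<in> cH; c \<in> cH; p \<in> cH; r \<in> cH|] ==> lin H M (%d. K a b c d p r)"
      "!!a b c d r. [|a \<in> cH; b \<in> cH; c \<in> cH; d \<in> cH; r \<in> cH|] ==> lin H M (%p. K a b c d p r)"
      "!!a b c d p. [|a \<in> cH; b \<in> cH; c \<in> cH; d \<in> cH; p \<in> cH|] ==> lin H M (%r. K a b c d p r)"
  shows "sw M (%p r. sw M (%a x. sw M (%b y. sw M (%c d. K a b c d p r) y) x) h) g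
    = sw M (%a x. sw M (%b y. sw M (%c d. sw M (%p r. K a b c d p r) g) y) x) h"
proof -
  note li = sw_linear[OF M] sw_param_linear[OF M module_A] bil_I lin
  have b3: "bil H H M (%a x. sw M (%b y. sw M (%c d. sw M (%p r. K a b c d p r) g) y) x)"
    by (auto intro!: li g)
  have "sw M (%p r. sw M (%a x. sw M (%b y. sw M (%c d. K a b c d p r) y) x) h) g
      = sw M (%a x. sw M (%p r. sw M (%b y. sw M (%c d. K a b c d p r) y) x) g) h"
    by (rule sw_swap[OF M _ _ g h]) (auto intro!: li)
  also have "... = sw M (%a x. sw M (%b y. sw M (%c d. sw M (%p r. K a b c d p r) g) y) x) h"
  proof (rule sw_cong[symmetric, OF M b3 h])
    fix a x assume a: "a \<in> cH" and x: "x \<in> cH"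
    have b2: "bil H H M (%b y. sw M (%c d. sw M (%p r. K a b c d p r) g) y)"
      by (auto intro!: li g a)
    have "sw M (%p r. sw M (%b y. sw M (%c d. K a b c d p r) y) x) g = sw M (%b y. sw M (%p r. sw M (%c d. K a b c d p r) y) g) x"
      by (rule sw_swap[OF M _ _ g x]) (auto intro!: li a)
    also have "... = sw M (%b y. sw M (%c d. sw M (%p r. K a b c d p r) g) y) x"
      by (rule sw_cong[symmetric, OF M b2 x], rule sw_swap[OF M]) (auto intro!: li a g)
    finally show "sw M (%b y. sw M (%c d. sw M (%p r. K a b c d p r) g) y) x
      = sw M (%p r. sw M (%b y. sw M (%c d. K a b c d p r) y) x) g" by simp
  qed
  finally show ?thesis .
qed

text \<open>Rebrackets a threefold coproduct of h and one of g at the same time. Each is hidden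
  behind the sums of the other, hence the exchanges before and after.\<close>

lemma sw2_coassoc:
  assumes M: "module k M" and h: "h \<in> cH" and g: "g \<in> cH"
    and lin: "!!b c d p r. [|b \<in> cH; c \<in> cH; d \<in> cH; p \<in> cH; r \<in> cH|] ==> lin H M (%a. K a b c d p r)"
      "!!a c d p r. [|a \<in> cH; c \<in> cH; d \<in> cH; p \<in> cH; r \<in> cH|] ==> lin H M (%b. K a b c d p r)"
      "!!a b d p r. [|a \<in> cH; b \<in> cH; d \<in> cH; p \<in> cH; r \<in> cH|] ==> lin H M (%c. K a b c d p r)"
      "!!a b c p r. [|a \<in> cH; b \<in> cH; c \<in> cH; p \<in> cH; r \<in> cH|] ==> lin H M (%d. K a b c d p r)"
      "!!a b c d r. [|a \<in> cH; b \<in> cH; c \<in> cH; d \<in> cH; r \<in> cH|] ==> lin H M (%p. K a b c d p r)"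
      "!!a b c d p. [|a \<in> cH; b \<in> cH; c \<in> cH; d \<in> cH; p \<in> cH|] ==> lin H M (%r. K a b c d p r)"
  shows "sw M (%x c. sw M (%y r. sw M (%a b. sw M (%d p. K a b c d p r) y) x) g) h
    = sw M (%a x. sw M (%d y. sw M (%b c. sw M (%p r. K a b c d p r) y) x) g) h"
proof -
  note li = sw_linear[OF M] sw_param_linear[OF M module_A] bil_I lin
  let ?G = "%a b c. sw M (%d y. sw M (%p r. K a b c d p r) y) g"
  have tg: "tril H H H M (%d p r. K a b c d p r)" if "a \<in> cH" "b \<in> cH" "c \<in> cH" for a b c
    by (rule tril_I) (auto intro!: lin that)
  have tG: "tril H H H M ?G"
    by (rule tril_I) (auto intro!: li g)
  have "sw M (%x c. sw M (%y r. sw M (%a b. sw M (%d p. K a b c d p r) y) x) g) h = sw M (%x c. sw M (%a b. ?G a b c) x) h"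
  proof (rule sw_cong[symmetric, OF M sw_left_bilinear[OF M tG] h])
    fix x c assume x: "x \<in> cH" and c: "c \<in> cH"
    have "sw M (%y r. sw M (%a b. sw M (%d p. K a b c d p r) y) x) g = sw M (%a b. sw M (%y r. sw M (%d p. K a b c d p r) y) g) x"
      by (rule sw_swap[OF M _ _ g x]) (auto intro!: li c)
    also have "... = sw M (%a b. ?G a b c) x"
      by (rule sw_cong[symmetric, OF M tril_D(6)[OF tG c] x]) (rule sw_coassoc[symmetric, OF M tg[OF _ _ c] g])
    finally show "sw M (%a b. ?G a b c) x = sw M (%y r. sw M (%a b. sw M (%d p. K a b c d p r) y) x) g" by simp
  qed
  also have "... = sw M (%a x. sw M (%b c. ?G a b c) x) h"
    by (rule sw_coassoc[OF M tG h])
  also have "... = sw M (%a x. sw M (%d y. sw M (%b c. sw M (%p r. K a b c d p r) y) x) g) h"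
    by (rule sw_cong[OF M sw_right_bilinear[OF M tG] h], rule sw_swap[OF M]) (auto intro!: li g)
  finally show ?thesis .
qed

definition lcon :: "('k, 'x, 'y) module_scheme \<Rightarrow> ('h \<Rightarrow> 'h \<Rightarrow> 'x) \<Rightarrow> 'h \<Rightarrow> 'x"
  where "lcon M F h = sw M (%x y. F (S x) y) h"

text \<open>Here S reverses the coproduct of the first argument, so F is taken at (S h2, h3) and G
  at (S h1, h4): the arguments of G enclose those of F, while F still multiplies from the
  left.\<close>

lemma lcon_mult:
  assumes R: "unital_algebra k R" and F: "F \<in> carrier (C (C R))" and G: "G \<in> carrier (C (C R))" and h: "h \<in> cH"
  shows "lcon R (F \<otimes>\<^bsub>C (C R)\<^esub> G) h = sw R (%a w. sw R (%z c. lcon R F z \<otimes>\<^bsub>R\<^esub> G (S a) c) w) h"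
proof -
  interpret R: unital_algebra k R by fact
  have RC: "unital_algebra k (C R)" by (rule algebra_conv[OF R])
  note RM = R.module_A
  have FG: "F \<otimes>\<^bsub>C (C R)\<^esub> G \<in> carrier (C (C R))"
    by (rule unital_algebra.algebra_facts(1)[OF algebra_conv[OF RC] F G])
  note F2 = conv2_bilinear[OF F] and G2 = conv2_bilinear[OF G]
  let ?X = "%a b d c. F (S b) d \<otimes>\<^bsub>R\<^esub> G (S a) c"
  have Xlin: "lin H R (%a. ?X a b d c)" "lin H R (%b. ?X a b d c)"
      "lin H R (%d. ?X a b d c)" "lin H R (%c. ?X a b d c)"
    if "a \<in> cH" "b \<in> cH" "c \<in> cH" "d \<in> cH" for a b c d
    using that by (auto intro!: R.linear_mult_left R.linear_mult_right bil_D(1)[OF F2] bil_D(1)[OF G2]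
        lin_comp[OF bil_D(2)[OF F2] S_linear] lin_comp[OF bil_D(2)[OF G2] S_linear]
        bil_closed[OF F2] bil_closed[OF G2])
  note li = sw_linear[OF RM] sw_param_linear[OF RM module_A] bil_I Xlin
  have "lcon R (F \<otimes>\<^bsub>C (C R)\<^esub> G) h = sw R (%x y. sw R (%a b. sw R (%d c. ?X a b d c) y) x) h"
    unfolding lcon_def
  proof (rule sw_cong[OF RM bil_comp[OF conv2_bilinear[OF FG] S_linear lin_id] h])
    fix x y assume xy: "x \<in> cH" "y \<in> cH"
    have "(F \<otimes>\<^bsub>C (C R)\<^esub> G) (S x) y = sw R (%a b. sw R (%d c. F a d \<otimes>\<^bsub>R\<^esub> G b c) y) (S x)"
      by (rule conv2_mult_apply[OF R F G]) (simp_all add: xy)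
    also have "... = sw R (%a b. sw R (%d c. ?X a b d c) y) x"
      by (rule sw_S[OF RM conv2_pre(3)[OF R F G xy(2)] xy(1)])
    finally show "(F \<otimes>\<^bsub>C (C R)\<^esub> G) (S x) y = sw R (%a b. sw R (%d c. ?X a b d c) y) x" .
  qed
  also have "... = sw R (%a w. sw R (%z c. sw R (%b d. ?X a b d c) z) w) h"
    by (rule sw_regroup4[OF RM h]) (auto intro!: Xlin)
  also have "... = sw R (%a w. sw R (%z c. lcon R F z \<otimes>\<^bsub>R\<^esub> G (S a) c) w) h"
  proof (rule sw_cong[OF RM _ h])
    show "bil H H R (%a w. sw R (%z c. sw R (%b d. ?X a b d c) z) w)"
      by (rule bil_I) (auto intro!: li)
    fix a w assume aw: "a \<in> cH" "w \<in> cH"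
    show "sw R (%z c. sw R (%b d. ?X a b d c) z) w = sw R (%z c. lcon R F z \<otimes>\<^bsub>R\<^esub> G (S a) c) w"
    proof (rule sw_cong[OF RM _ aw(2)])
      show "bil H H R (%z c. sw R (%b d. ?X a b d c) z)"
        by (rule bil_I) (auto intro!: li aw)
      fix z c assume zc: "z \<in> cH" "c \<in> cH"
      then have "G (S a) c \<in> carrier R" using aw bil_closed[OF G2] by simp
      then show "sw R (%b d. ?X a b d c) z = lcon R F z \<otimes>\<^bsub>R\<^esub> G (S a) c"
        unfolding lcon_def
        by (intro sw_post[symmetric, OF RM RM R.linear_mult_left[OF lin_id]
              bil_comp[OF F2 S_linear lin_id] zc(1)])
    qed
  qed
  finally show ?thesis .
qed

end

context enveloping_cross_product
begin

section \<open>The cross product structure in the original coordinates\<close>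

lemma U_conv:
  assumes h: "h \<in> cH" and F: "F \<in> carrier CR" and G: "G \<in> carrier CR" and z: "aV z = F \<star>\<^sub>1 G"
    and f: "!!x y. [|x \<in> cH; y \<in> cH|] ==> F x \<star>\<^sub>0 G y = iV (f x y)"
  shows "U h z = sw V f h" "bil H H V f"
proof -
  note b = hopf.conv_mult_bilinear_pre[OF algebra_RR F G]
  have "U h z = sw V f h"
    unfolding U_def z conv_apply(1)[OF h] by (rule sw_map[OF RR.module_A V_module tr.p_linear(2) b h]) (simp add: f)
  then show "U h z = sw V f h" .
  show "bil H H V f"
    using bil_post[OF tr.p_linear(2) b] f
    by (auto simp: bilinear_map_def intro: lin_cong[OF hopf.module_A])
qed

lemma U_lb:
  "[|h \<in> cH; d \<in> cB; z \<in> cV|] ==> U h (lb d z) = sw V (%x y. lb (act x d) (U y z)) h"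
  by (rule U_conv(1)[where F = "alB d" and G = "aV z"]) (simp_all add: aV_lb alB_apply iV_U[symmetric] tr.i_mult)

lemma U_rb:
  "[|h \<in> cH; d \<in> cB; z \<in> cV|] ==> U h (rb z d) = sw V (%x y. rb (U x z) (act y d)) h"
  by (rule U_conv(1)[where F = "aV z" and G = "alB d"]) (simp_all add: aV_rb alB_apply iV_U[symmetric] tr.i_mult)

lemma U_compose:
  assumes "lin W V f" "h \<in> cH"
  shows "lin W V (%x. U h (f x))"
  by (rule lin_comp[OF U_linear[OF assms(2)] assms(1)])

lemmas sw_linears = sw_linear[OF V_module] sw_param_linear[OF V_module hopf.module_A] bil_I

lemma lb_linear_scalar: "[|lin W B f; x \<in> cV|] ==> lin W V (%w. lb (f w) x)"
  by (rule bil_left[OF lb_bilinear])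

lemma rb_linear_scalar: "[|lin W B f; x \<in> cV|] ==> lin W V (%w. rb x (f w))"
  by (rule bil_right[OF rb_bilinear])

lemma U_linear_scalar: "[|lin W H f; x \<in> cV|] ==> lin W V (%w. U (f w) x)"
  by (rule bil_left[OF U_bilinear])

lemma u_compose: "lin W H f ==> lin W V (%w. u (f w))"
  by (rule lin_comp[OF u_linear])

lemma e_linear1: "[|lin W B f; c \<in> cB; h \<in> cH|] ==> lin W V (%w. e (f w) c h)"
  by (rule lin_comp[OF tril_D(1)[OF e_trilinear]])

lemma e_linear2: "[|lin W B f; c \<in> cB; h \<in> cH|] ==> lin W V (%w. e c (f w) h)"
  by (rule lin_comp[OF tril_D(2)[OF e_trilinear]])

lemma e_linear3: "[|lin W H f; b \<in> cB; c \<in> cB|] ==> lin W V (%w. e b c (f w))"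
  by (rule lin_comp[OF tril_D(3)[OF e_trilinear]])

lemma pp_linear1: "[|lin W B f; h \<in> cH|] ==> lin W B (%w. pp (f w) h)"
  by (rule bil_left[OF pp_bilinear])

lemma pp_linear2: "[|lin W H f; b \<in> cB|] ==> lin W B (%w. pp b (f w))"
  by (rule bil_right[OF pp_bilinear])

lemmas V_linears = lb_linear rb_linear lb_linear_scalar rb_linear_scalar U_compose U_linear_scalar u_compose
  e_linear1 e_linear2 e_linear3 mu_linear_left mu_linear_right
lemmas B_linears = pp_linear1 pp_linear2 act_linear_left act_linear_right sigma_linear_left sigma_linear_right Tau_linear
  base.linear_mult_left base.linear_mult_right
lemmas H_linears = lin_id hopf.S_comp hopf.linear_mult_left hopf.linear_mult_right

text \<open>The elements 1 \<otimes> 1 # h, through which the original basis is reached: b \<otimes>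
  b' # h is the product of s(b), \<open>w h\<close> and t(b').\<close>

definition w where "w h = e 1\<^sub>B 1\<^sub>B h"

lemma w_closed [simp]: "h \<in> cH ==> w h \<in> cV"
  by (simp add: w_def)

lemma w_linear: "lin W H f ==> lin W V (%x. w (f x))"
  unfolding w_def by (rule e_linear3) simp_all

lemma pp_one: "h \<in> cH ==> pp 1\<^sub>B h = Tau h"
  by (simp add: pp_def hom_D(3)[OF al_hom])

lemma e_sw: "[|b \<in> cB; c \<in> cB; h \<in> cH|] ==> e b c h = sw V (%x y. lb b (rb (u x) (pp c y))) h"
  by (subst e_E; assumption?) (rule sw_cong[OF V_module E_pp_bilinear[OF V_module E_trilinear]]; simp add: E_u)

lemma w_sw: "h \<in> cH ==> w h = sw V (%x y. rb (u x) (Tau y)) h"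
  unfolding w_def e_sw[OF base.A.one_closed base.A.one_closed]
  by (rule sw_cong[OF V_module]) (auto intro!: bil_I V_linears B_linears H_linears simp: V_bimodule pp_one)

lemma lb_e: "[|a \<in> cB; b \<in> cB; c \<in> cB; h \<in> cH|] ==> lb a (e b c h) = e (a \<cdot> b) c h"
proof -
  assume a: "a \<in> cB" "b \<in> cB" "c \<in> cB" "h \<in> cH"
  note bb = E_pp_bilinear[OF V_module E_trilinear a(2,3)]
  have "lb a (e b c h) = sw V (%x y. lb a (E b (pp c y) x)) h"
    unfolding e_E[OF a(2-4)] by (rule sw_post[OF V_module V_module lb_linear[OF lin_id a(1)] bb a(4)])
  also have "... = e (a \<cdot> b) c h"
    unfolding e_E[OF base.A.m_closed[OF a(1,2)] a(3,4)]
    by (rule sw_cong[OF V_module bil_post[OF lb_linear[OF lin_id a(1)] bb] a(4)]) (simp add: a)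
  finally show ?thesis .
qed

text \<open>The product rule splits off the action on b as the leftmost factor, and
  \<open>pp_act_S\<close> treats the rest.\<close>

lemma pp_mult_act_S:
  assumes b: "b \<in> cB" and d: "d \<in> cB" and z: "z \<in> cH"
  shows "sw B (%q y. pp (b \<cdot> act (S y) d) q) z = pp b z \<cdot> d"
proof -
  note M = base.module_A
  have pm: "pp (b \<cdot> c) q = sw B (%x y. act x b \<cdot> pp c y) q" if c: "c \<in> cB" and q: "q \<in> cH" for c q
  proof -
    have "pp (b \<cdot> c) q = (al b *\<^sub>1 (al c *\<^sub>1 Tau)) q"
      using b c by (simp add: pp_def hom_D(2)[OF al_hom] CB.m_assoc)
    also have "... = sw B (%x y. act x b \<cdot> pp c y) q"
      by (rule hopf.conv_mult_eq[OF algebra_B _ pp_conv[OF c] q]) (simp_all add: b pp_def)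
    finally show ?thesis .
  qed
  note li = sw_linear[OF M] sw_param_linear[OF M hopf.module_A] bil_I B_linears H_linears
  have t: "tril H H H B (%x q y. act x b \<cdot> pp (act (S y) d) q)"
    by (rule tril_I) (auto intro!: li simp: b d)
  have "sw B (%q y. pp (b \<cdot> act (S y) d) q) z = sw B (%p y. sw B (%x q. act x b \<cdot> pp (act (S y) d) q) p) z"
    by (rule sw_cong[OF M _ z]) (auto intro!: li simp: b d pm)
  also have "... = sw B (%x p. sw B (%q y. act x b \<cdot> pp (act (S y) d) q) p) z"
    by (rule sw_coassoc[OF M t z])
  also have "... = sw B (%x p. (act x b \<cdot> Tau p) \<cdot> d) z"
  proof (rule sw_cong[OF M sw_right_bilinear[OF M t] z])
    fix x p assume x: "x \<in> cH" and p: "p \<in> cH"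
    have "sw B (%q y. act x b \<cdot> pp (act (S y) d) q) p = act x b \<cdot> sw B (%q y. pp (act (S y) d) q) p"
      by (rule sw_post[symmetric, OF M M base.linear_mult_right[OF lin_id]]) (use b d x p in \<open>auto intro!: li\<close>)
    then show "sw B (%q y. act x b \<cdot> pp (act (S y) d) q) p = (act x b \<cdot> Tau p) \<cdot> d"
      using x p b d by (simp add: pp_act_S base.A.m_assoc)
  qed
  also have "... = pp b z \<cdot> d"
    unfolding pp_sw[OF b z]
    by (rule sw_post[symmetric, OF M M base.linear_mult_left[OF lin_id]]) (use b d z in \<open>auto intro!: li\<close>)
  finally show ?thesis .
qed

text \<open>Expanded in the free basis, right multiplication by d only multiplies the coefficient
  \<open>pp b'\<close> by d. By \<open>pp_mult_act_S\<close> this is the coefficient to which b'(S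
  h2 \<triangleright> d) transforms.\<close>

lemma rb_e:
  assumes b: "b \<in> cB" "b' \<in> cB" and d: "d \<in> cB" and h: "h \<in> cH"
  shows "rb (e b b' h) d = sw V (%x y. e b (b' \<cdot> act (S y) d) x) h"
proof -
  note li = sw_linears V_linears B_linears H_linears
  let ?F = "%p q y. lb b (rb (u p) (pp (b' \<cdot> act (S y) d) q))"
  have t: "tril H H H V ?F"
    by (rule tril_I) (auto intro!: li simp: b d)
  have "sw V (%x y. e b (b' \<cdot> act (S y) d) x) h = sw V (%x y. sw V (%p q. ?F p q y) x) h"
    by (rule sw_cong[OF V_module _ h]) (auto intro!: li simp: b d e_sw)
  also have "... = sw V (%p z. sw V (%q y. ?F p q y) z) h"
    by (rule sw_coassoc[OF V_module t h])
  also have "... = sw V (%p z. rb (lb b (rb (u p) (pp b' z))) d) h"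
  proof (rule sw_cong[OF V_module sw_right_bilinear[OF V_module t] h])
    fix p z assume p: "p \<in> cH" and z: "z \<in> cH"
    have "sw V (%q y. ?F p q y) z = lb b (rb (u p) (sw B (%q y. pp (b' \<cdot> act (S y) d) q) z))"
      by (rule sw_post[symmetric, OF base.module_A V_module]) (use b d p z in \<open>auto intro!: li\<close>)
    then show "sw V (%q y. ?F p q y) z = rb (lb b (rb (u p) (pp b' z))) d"
      using b d p z by (simp add: pp_mult_act_S V_bimodule)
  qed
  also have "... = rb (e b b' h) d"
    unfolding e_sw[OF b h]
    by (rule sw_post[symmetric, OF V_module V_module rb_linear[OF lin_id d] _ h]) (auto intro!: li simp: b)
  finally show ?thesis by simp
qed

lemma mu_w:
  assumes h: "h \<in> cH" and z: "z \<in> cV"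
  shows "mu (w h) z = sw V (%x y. rb (U x z) (Tau y)) h"
proof -
  note li = V_linears B_linears H_linears
  have b: "bil H H V (%x y. rb (u x) (Tau y))" by (rule bil_I) (auto intro!: li)
  have "mu (w h) z = sw V (%x y. rb (U x z) (Tau y)) h"
    unfolding w_sw[OF h] by (rule sw_map[OF V_module V_module mu_linear_left[OF lin_id z] b h]) (simp add: z mu_rb mu_u)
  then show ?thesis .
qed

text \<open>The action on d and the factor \<open>Tau\<close> of \<open>w h\<close> stand side by
  side on the right, and their convolution is \<open>pp d\<close>.\<close>

lemma mu_w_target:
  assumes d: "d \<in> cB" and h: "h \<in> cH"
  shows "mu (w h) (rb (u 1\<^sub>H) d) = e 1\<^sub>B d h"
proof -
  note li = sw_linears V_linears B_linears H_linears
  let ?F = "%p q y. rb (u p) (act q d \<cdot> Tau y)"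
  have t: "tril H H H V ?F" by (rule tril_I) (auto intro!: li simp: d)
  have "mu (w h) (rb (u 1\<^sub>H) d) = sw V (%x y. sw V (%p q. ?F p q y) x) h"
    unfolding mu_w[OF h rb_closed[OF u_closed[OF hopf.one_closed_H] d]]
  proof (rule sw_cong[OF V_module _ h])
    show "bil H H V (%x y. rb (U x (rb (u 1\<^sub>H) d)) (Tau y))" by (rule bil_I) (auto intro!: li simp: d)
    fix x y assume x: "x \<in> cH" and y: "y \<in> cH"
    have b: "bil H H V (%p q. rb (u p) (act q d))" by (rule bil_I) (auto intro!: li simp: d)
    have Ux: "U x (rb (u 1\<^sub>H) d) = sw V (%p q. rb (u p) (act q d)) x"
      unfolding U_rb[OF x d u_closed[OF hopf.one_closed_H]]
      by (rule sw_cong[OF V_module _ x]) (auto intro!: li simp: d U_unit)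
    have "rb (U x (rb (u 1\<^sub>H) d)) (Tau y) = sw V (%p q. rb (rb (u p) (act q d)) (Tau y)) x"
      unfolding Ux by (rule sw_post[OF V_module V_module rb_linear[OF lin_id] b x]) (simp add: y)
    also have "... = sw V (%p q. ?F p q y) x"
      by (rule sw_cong[symmetric, OF V_module tril_D(6)[OF t y] x]) (simp add: d y V_bimodule)
    finally show "rb (U x (rb (u 1\<^sub>H) d)) (Tau y) = sw V (%p q. ?F p q y) x" .
  qed
  also have "... = sw V (%p z. sw V (%q y. ?F p q y) z) h"
    by (rule sw_coassoc[OF V_module t h])
  also have "... = sw V (%p z. lb 1\<^sub>B (rb (u p) (pp d z))) h"
  proof (rule sw_cong[OF V_module sw_right_bilinear[OF V_module t] h])
    fix p z assume p: "p \<in> cH" and z: "z \<in> cH"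
    show "sw V (%q y. ?F p q y) z = lb 1\<^sub>B (rb (u p) (pp d z))"
      unfolding V_bimodule(2)[OF rb_closed[OF u_closed[OF p] pp_closed[OF d z]]]
      unfolding pp_sw[OF d z]
      by (rule sw_post[symmetric, OF base.module_A V_module bil_D(1)[OF rb_bilinear u_closed[OF p]]]) (use d p z in \<open>auto intro!: li\<close>)
  qed
  also have "... = e 1\<^sub>B d h" by (simp add: e_sw d h)
  finally show ?thesis .
qed

lemma mu_w_lb:
  assumes c: "c \<in> cB" and h: "h \<in> cH" and z: "z \<in> cV"
  shows "mu (w h) (lb c z) = sw V (%x y. lb (act x c) (mu (w y) z)) h"
proof -
  note li = sw_linears V_linears B_linears H_linears w_linear
  let ?F = "%p q y. lb (act p c) (rb (U q z) (Tau y))"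
  have t: "tril H H H V ?F" by (rule tril_I) (auto intro!: li simp: c z)
  have "mu (w h) (lb c z) = sw V (%x y. sw V (%p q. ?F p q y) x) h"
    unfolding mu_w[OF h lb_closed[OF c z]]
  proof (rule sw_cong[OF V_module _ h])
    show "bil H H V (%x y. rb (U x (lb c z)) (Tau y))" by (rule bil_I) (auto intro!: li simp: c z)
    fix x y assume x: "x \<in> cH" and y: "y \<in> cH"
    have b: "bil H H V (%p q. lb (act p c) (U q z))" by (rule bil_I) (auto intro!: li simp: c z)
    have "rb (U x (lb c z)) (Tau y) = sw V (%p q. rb (lb (act p c) (U q z)) (Tau y)) x"
      unfolding U_lb[OF x c z]
      by (rule sw_post[OF V_module V_module rb_linear[OF lin_id] b x]) (simp add: y)
    also have "... = sw V (%p q. ?F p q y) x"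
      by (rule sw_cong[symmetric, OF V_module tril_D(6)[OF t y] x]) (simp add: c y z V_bimodule)
    finally show "rb (U x (lb c z)) (Tau y) = sw V (%p q. ?F p q y) x" .
  qed
  also have "... = sw V (%p m. sw V (%q y. ?F p q y) m) h"
    by (rule sw_coassoc[OF V_module t h])
  also have "... = sw V (%p m. lb (act p c) (mu (w m) z)) h"
  proof (rule sw_cong[OF V_module sw_right_bilinear[OF V_module t] h])
    fix p m assume p: "p \<in> cH" and m: "m \<in> cH"
    show "sw V (%q y. ?F p q y) m = lb (act p c) (mu (w m) z)"
      unfolding mu_w[OF m z]
      by (rule sw_post[symmetric, OF V_module V_module bil_D(1)[OF lb_bilinear act_closed[OF p c]]]) (use c p m z in \<open>auto intro!: li\<close>)
  qed
  finally show ?thesis .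
qed

lemma e_target:
  assumes "b \<in> cB" "a \<in> cB" "d \<in> cB" "h \<in> cH"
  shows "mu (e b a h) (rb (u 1\<^sub>H) d) = e b (d \<cdot> a) h"
proof -
  have f: "e b c h = lb b (mu (w h) (rb (u 1\<^sub>H) c))" if "c \<in> cB" for c
    using assms that by (simp add: mu_w_target lb_e)
  show ?thesis
    using assms by (simp add: f[OF assms(2)] f[OF base.A.m_closed[OF assms(3,2)]] mu_lb mu_assoc mu_target V_bimodule)
qed

lemma iV_inj: "iV x = iV y ==> x = y"
  using tr.p_i(5) by metis

lemma iV_sw2:
  assumes F: "F \<in> carrier CCR" and G: "G \<in> carrier CCR" and h: "h \<in> cH" and g: "g \<in> cH"
    and f: "!!x y a b. [|x \<in> cH; y \<in> cH; a \<in> cH; b \<in> cH|] ==> F x a \<star>\<^sub>0 G y b = iV (f x y a b)"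
  shows "tr.pV ((F \<star>\<^sub>2 G) h g) = sw V (%x y. sw V (%a b. f x y a b) g) h"
proof -
  have "tr.pV ((F \<star>\<^sub>2 G) h g) = sw V (%x y. sw V (%a b. tr.pV (F x a \<star>\<^sub>0 G y b)) g) h"
    by (rule hopf.conv2_mult_post[OF algebra_RR V_module tr.p_linear(2) F G h g])
  also have "... = sw V (%x y. sw V (%a b. f x y a b) g) h"
  proof (rule sw_cong[OF V_module hopf.conv2_post_pre[OF algebra_RR V_module tr.p_linear(2) F G g] h])
    fix x y assume xy: "x \<in> cH" "y \<in> cH"
    show "sw V (%a b. tr.pV (F x a \<star>\<^sub>0 G y b)) g = sw V (%a b. f x y a b) g"
      by (rule sw_cong[OF V_module bil_post[OF tr.p_linear(2) hopf.conv2_pre(1)[OF algebra_RR F G xy]] g])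
         (simp add: f xy)
  qed
  finally show ?thesis .
qed

definition HT where "HT = iB2 (hat Tau)"

lemma HT_closed [simp]: "HT \<in> carrier CCR"
  unfolding HT_def by (rule hom_D(4)[OF iB2_hom]) simp

lemma HT_apply: "[|h \<in> cH; g \<in> cH|] ==> HT h g = iB (act h (Tau g))"
  by (simp add: HT_def)

text \<open>\<open>w g\<close> is the sum of the u(g1).\<open>Tau g2\<close>, so the action on it is
  the product rule for h \<triangleright> u(g1), given by \<open>KR\<close>, and h \<triangleright>
  \<open>Tau g2\<close>, given by \<open>HT\<close>.\<close>

lemma U_w:
  assumes x: "x \<in> cH" and g: "g \<in> cH"
  shows "iV (U x (w g)) = (KR \<star>\<^sub>2 HT) x g"
proof -
  have ft: "flip HT q = alB (Tau q)" if q: "q \<in> cH" for q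
    by (rule conv_eqI[where R = RR])
       (use q in \<open>auto simp: conv_closed[OF hom_D(4)[OF flip_hom_R HT_closed]] HT_apply alB_apply\<close>)
  have b: "bil H H V (%p q. rb (u p) (Tau q))"
    by (rule bil_I) (auto intro!: V_linears B_linears H_linears)
  have fc: "flip HT \<in> carrier CCR" by (rule hom_D(4)[OF flip_hom_R HT_closed])
  have "aV (w g) = sw CR (%p q. Kt p \<star>\<^sub>1 flip HT q) g"
    unfolding w_sw[OF g] by (rule sw_map[OF V_module CR.module_A aV_linear b g]) (simp add: aV_rb aV_u ft)
  also have "... = flip (KR \<star>\<^sub>2 HT) g"
    using g by (simp add: hom_D(2)[OF flip_hom_R] Kt_def conv_apply)
  finally show ?thesis
    using x g by (simp add: iV_U)
qed

text \<open>The product is h1 \<triangleright> (u(g1) Tau(g2)) . Tau(h2). Expanding the action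
  yields, from left to right, \<sigma>, u of a product, \<sigma>', an action on \<open>Tau g\<close>
  and \<open>Tau h\<close>, all convolved over H \<otimes> H. The last three are grouped as the
  coefficient that \<open>Tau_product\<close> evaluates.\<close>

lemma w_product_conv:
  assumes h: "h \<in> cH" and g: "g \<in> cH"
  shows "mu (w h) (w g) = tr.pV ((SR \<star>\<^sub>2 (mstar uR \<star>\<^sub>2
    iB2 (Sg' *\<^sub>2 (hat Tau *\<^sub>2 cmap (iota B) Tau)))) h g)"
proof -
  let ?T = "cmap (iota B) Tau"
  have Tc: "?T \<in> carrier CCB"
    by (rule cmap_closed[OF hom_D(1)[OF iota_hom[OF algebra_B]]]) simp
  have i2: "iB2 F \<in> carrier CCR" if "F \<in> carrier CCB" for F by (rule hom_D(4)[OF iB2_hom that])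
  have Ti: "iB2 ?T y = iota RR (iB (Tau y))" if y: "y \<in> cH" for y
    by (rule conv_eqI[where R = RR])
       (use y in \<open>auto simp: cmap_closed[OF tr.iB_linear hom_D(4)[OF iota_hom[OF algebra_B]]] hom_D(4)[OF iota_hom[OF algebra_RR]]
          lin_smult[OF tr.iB_linear]\<close>)
  let ?K = "KR \<star>\<^sub>2 HT"
  have Kc: "?K \<in> carrier CCR" by simp
  have b: "bil H H V (%x y. rb (U x (w g)) (Tau y))"
    by (rule bil_I) (auto intro!: V_linears B_linears H_linears simp: g)
  have "iV (mu (w h) (w g)) = sw RR (%x y. (?K x \<star>\<^sub>1 iB2 ?T y) g) h"
    unfolding mu_w[OF h w_closed[OF g]] proof (rule sw_map[OF V_module RR.module_A tr.iV_linear b h])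
    fix x y assume x: "x \<in> cH" and y: "y \<in> cH"
    have "iV (rb (U x (w g)) (Tau y)) = ?K x g \<star>\<^sub>0 iB (Tau y)"
      using x y g by (simp add: U_w[symmetric] tr.i_mult)
    also have "... = (?K x \<star>\<^sub>1 iota RR (iB (Tau y))) g"
      by (rule iota_mult_apply(2)[symmetric, OF algebra_RR _ conv_closed[OF Kc x] g]) (simp add: y)
    finally show "iV (rb (U x (w g)) (Tau y)) = (?K x \<star>\<^sub>1 iB2 ?T y) g" by (simp only: Ti[OF y])
  qed
  also have "... = (?K \<star>\<^sub>2 iB2 ?T) h g"
  proof -
    have "(?K \<star>\<^sub>2 iB2 ?T) h g = sw CR (%x y. ?K x \<star>\<^sub>1 iB2 ?T y) h g"
      using h by (simp add: conv_apply)
    also have "... = sw RR (%x y. (?K x \<star>\<^sub>1 iB2 ?T y) g) h"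
      by (rule sw_post[OF CR.module_A RR.module_A conv_eval_linear[OF g]
            hopf.conv_mult_bilinear_pre[OF algebra_CR Kc i2[OF Tc]] h])
    finally show ?thesis by simp
  qed
  also have "?K \<star>\<^sub>2 iB2 ?T = SR \<star>\<^sub>2 (mstar uR \<star>\<^sub>2 iB2 (Sg' *\<^sub>2 (hat Tau *\<^sub>2 ?T)))"
    by (simp add: KR_def HT_def SR'_def CCR.m_assoc hom_D(2)[OF iB2_hom] Tc i2)
  finally show ?thesis by (metis tr.p_i(5))
qed

end

context hopf_algebra
begin

lemma sw2_post:
  assumes M: "module k M" and N: "module k N" and f: "lin M N f" and h: "h \<in> cH" and g: "g \<in> cH"
    and lin: "!!b c d. [|b \<in> cH; c \<in> cH; d \<in> cH|] ==> lin H M (%a. K a b c d)"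
      "!!a c d. [|a \<in> cH; c \<in> cH; d \<in> cH|] ==> lin H M (%b. K a b c d)"
      "!!a b d. [|a \<in> cH; b \<in> cH; d \<in> cH|] ==> lin H M (%c. K a b c d)"
      "!!a b c. [|a \<in> cH; b \<in> cH; c \<in> cH|] ==> lin H M (%d. K a b c d)"
  shows "f (sw M (%a b. sw M (%c d. K a b c d) g) h) = sw N (%a b. sw N (%c d. f (K a b c d)) g) h"
proof -
  have b: "bil H H M (%a b. sw M (%c d. K a b c d) g)"
    by (auto intro!: bil_I sw_param_linear[OF M module_A] lin g)
  have bi: "bil H H M (K x y)" if "x \<in> cH" "y \<in> cH" for x y
    by (auto intro!: bil_I lin that)
  have "f (sw M (%a b. sw M (%c d. K a b c d) g) h) = sw N (%a b. sw N (%c d. f (K a b c d)) g) h"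
    by (rule sw_map[OF M N f b h]) (rule sw_post[OF M N f bi g])
  then show ?thesis .
qed

lemma sw2_cong:
  assumes M: "module k M" and h: "h \<in> cH" and g: "g \<in> cH"
    and lin: "!!b c d. [|b \<in> cH; c \<in> cH; d \<in> cH|] ==> lin H M (%a. K a b c d)"
      "!!a c d. [|a \<in> cH; c \<in> cH; d \<in> cH|] ==> lin H M (%b. K a b c d)"
      "!!a b d. [|a \<in> cH; b \<in> cH; d \<in> cH|] ==> lin H M (%c. K a b c d)"
      "!!a b c. [|a \<in> cH; b \<in> cH; c \<in> cH|] ==> lin H M (%d. K a b c d)"
    and eq: "!!a b c d. [|a \<in> cH; b \<in> cH; c \<in> cH; d \<in> cH|] ==> K a b c d = K' a b c d"
  shows "sw M (%a b. sw M (%c d. K a b c d) g) h = sw M (%a b. sw M (%c d. K' a b c d) g) h"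
proof (rule sw_cong[OF M _ h])
  show "bil H H M (%a b. sw M (%c d. K a b c d) g)"
    by (auto intro!: bil_I sw_param_linear[OF M module_A] lin g)
  fix a b assume ab: "a \<in> cH" "b \<in> cH"
  show "sw M (%c d. K a b c d) g = sw M (%c d. K' a b c d) g"
    by (rule sw_cong[OF M _ g]) (auto intro!: bil_I lin ab eq)
qed

end

context enveloping_cross_product
begin

lemma iV_conv2:
  assumes F: "F \<in> carrier CCR" and G: "G \<in> carrier CCR" and h: "h \<in> cH" and g: "g \<in> cH"
    and f: "!!x y a b. [|x \<in> cH; y \<in> cH; a \<in> cH; b \<in> cH|] ==> F x a \<star>\<^sub>0 G y b = iV (f x y a b)"
  shows "(F \<star>\<^sub>2 G) h g = iV (sw V (%x y. sw V (%a b. f x y a b) g) h)"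
proof -
  have fc: "f x y a b \<in> cV" if "x \<in> cH" "y \<in> cH" "a \<in> cH" "b \<in> cH" for x y a b
  proof -
    have "iV (f x y a b) \<in> carrier RR"
      unfolding f[OF that, symmetric] by (rule RR.m_closed[OF conv2_closed[OF F] conv2_closed[OF G]]) (use that in simp_all)
    then show ?thesis using tr.p_closed(2) by fastforce
  qed
  have "(F \<star>\<^sub>2 G) h g \<in> tr.degV"
    by (rule conv2_degV[OF F G h g]) (simp add: f fc iV_degV)
  then show ?thesis
    using iV_sw2[OF assms] by (auto simp: tr.degV_def)
qed

text \<open>The part of the product of \<open>w y\<close> and \<open>w b\<close> that stands to the
  right of its leading cocycle factor, already in original coordinates.\<close>

definition Z where "Z y b = sw V (%p q. sw V (%c d. e 1\<^sub>B (\<sigma> (S d) (S q)) (p \<otimes>\<^bsub>H\<^esub> c)) b) y"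

lemmas all_linears = sw_linears V_linears B_linears H_linears w_linear

lemma Z_bilinear: "bil H H V Z"
  unfolding Z_def[abs_def] by (rule bil_I) (auto intro!: all_linears)

lemma Z_linear: "[|lin W H f; b \<in> cH|] ==> lin W V (%x. Z (f x) b)"
  "[|lin W H f; b \<in> cH|] ==> lin W V (%x. Z b (f x))"
  by (rule bil_left[OF Z_bilinear] bil_right[OF Z_bilinear]; assumption)+

lemma Z_closed [simp]: "[|y \<in> cH; b \<in> cH|] ==> Z y b \<in> cV"
  by (rule bil_closed[OF Z_bilinear])

lemma Tau_product_conv:
  assumes q: "q \<in> cH" and d: "d \<in> cH"
  shows "(Sg' *\<^sub>2 (hat Tau *\<^sub>2 cmap (iota B) Tau)) q d
    = sw B (%b c. sw B (%p r. pp (\<sigma> (S r) (S c)) (b \<otimes>\<^bsub>H\<^esub> p)) d) q"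
proof -
  let ?T = "cmap (iota B) Tau" and ?F = "Sg' *\<^sub>2 hat Tau"
  have Tc: "?T \<in> carrier CCB"
    by (rule cmap_closed[OF hom_D(1)[OF iota_hom[OF algebra_B]]]) simp
  have Fc: "?F \<in> carrier CCB" by simp
  note b = hopf.conv_mult_bilinear_pre[OF algebra_CB Fc Tc]
  have "(Sg' *\<^sub>2 (hat Tau *\<^sub>2 ?T)) q d = (?F *\<^sub>2 ?T) q d"
    by (simp add: CCB.m_assoc Tc)
  also have "... = sw CB (%x y. ?F x *\<^sub>1 ?T y) q d"
    by (simp only: conv_apply(1)[OF q])
  also have "... = sw B (%x y. ?F x d \<cdot> Tau y) q"
    by (rule sw_map[OF CB.module_A base.module_A conv_eval_linear[OF d] b q])
       (simp add: iota_mult_apply(2)[OF algebra_B _ conv_closed[OF Fc] d])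
  also have "... = sw B (%b c. sw B (%p r. pp (\<sigma> (S r) (S c)) (b \<otimes>\<^bsub>H\<^esub> p)) d) q"
    by (rule Tau_product[symmetric, OF q d])
  finally show ?thesis .
qed

text \<open>By \<open>Tau_product\<close> the coefficient is \<open>pp\<close> of \<sigma>(S g, S h)
  at a product of legs. As the coproduct of H is multiplicative, u and \<open>pp\<close> at matching
  legs of that product reassemble an element of the original basis.\<close>

lemma Z_conv:
  assumes y: "y \<in> cH" and b: "b \<in> cH"
  shows "(mstar uR \<star>\<^sub>2 iB2 (Sg' *\<^sub>2 (hat Tau *\<^sub>2 cmap (iota B) Tau))) y b = iV (Z y b)"
proof -
  let ?N = "Sg' *\<^sub>2 (hat Tau *\<^sub>2 cmap (iota B) Tau)"
  let ?K = "%a b c d p r. rb (u (a \<otimes>\<^bsub>H\<^esub> d)) (pp (\<sigma> (S r) (S c)) (b \<otimes>\<^bsub>H\<^esub> p))"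
  have Nc: "?N \<in> carrier CCB"
    by (simp add: cmap_closed[OF hom_D(1)[OF iota_hom[OF algebra_B]]])
  note li = all_linears sw_linear[OF base.module_A] sw_param_linear[OF base.module_A hopf.module_A]
  have "(mstar uR \<star>\<^sub>2 iB2 ?N) y b = iV (sw V (%a x. sw V (%d m. rb (u (a \<otimes>\<^bsub>H\<^esub> d)) (?N x m)) b) y)"
    by (rule iV_conv2[OF mu_closed hom_D(4)[OF iB2_hom Nc] y b])
       (simp add: tr.i_mult conv2_closed[OF Nc])
  also have "sw V (%a x. sw V (%d m. rb (u (a \<otimes>\<^bsub>H\<^esub> d)) (?N x m)) b) y
    = sw V (%a x. sw V (%d m. sw V (%b c. sw V (%p r. ?K a b c d p r) m) x) b) y"
  proof (rule hopf.sw2_cong[OF V_module y b])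
    fix a x d m assume a: "a \<in> cH" "x \<in> cH" "d \<in> cH" "m \<in> cH"
    have ud: "u (a \<otimes>\<^bsub>H\<^esub> d) \<in> cV" using a by simp
    show "rb (u (a \<otimes>\<^bsub>H\<^esub> d)) (?N x m) = sw V (%b c. sw V (%p r. ?K a b c d p r) m) x"
      unfolding Tau_product_conv[OF a(2,4)]
      by (rule hopf.sw2_post[OF base.module_A V_module bil_D(1)[OF rb_bilinear ud] a(2,4)]) (auto intro!: li)
  qed (auto intro!: li hopf.conv2_lin1[OF Nc] hopf.conv2_lin2[OF Nc] simp: conv2_closed[OF Nc])
  also have "... = sw V (%x c. sw V (%m r. sw V (%a b. sw V (%d p. ?K a b c d p r) m) x) b) y"
    by (rule hopf.sw2_coassoc[symmetric, OF V_module y b]) (auto intro!: all_linears)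
  also have "... = Z y b"
    unfolding Z_def
  proof (rule hopf.sw2_cong[symmetric, OF V_module y b])
    fix x c m r assume a: "x \<in> cH" "c \<in> cH" "m \<in> cH" "r \<in> cH"
    have bb: "bil H H V (%m n. lb 1\<^sub>B (rb (u m) (pp (\<sigma> (S r) (S c)) n)))"
      by (rule bil_I) (auto intro!: all_linears simp: a)
    have "e 1\<^sub>B (\<sigma> (S r) (S c)) (x \<otimes>\<^bsub>H\<^esub> m)
      = sw V (%a b. sw V (%d p. lb 1\<^sub>B (rb (u (a \<otimes>\<^bsub>H\<^esub> d)) (pp (\<sigma> (S r) (S c)) (b \<otimes>\<^bsub>H\<^esub> p)))) m) x"
      using a by (simp add: e_sw hopf.sw_mult[OF V_module bb])
    also have "... = sw V (%a b. sw V (%d p. ?K a b c d p r) m) x"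
      by (rule hopf.sw2_cong[OF V_module a(1,3)]) (auto intro!: all_linears simp: a V_bimodule)
    finally show "e 1\<^sub>B (\<sigma> (S r) (S c)) (x \<otimes>\<^bsub>H\<^esub> m) = sw V (%a b. sw V (%d p. ?K a b c d p r) m) x" .
  qed (auto intro!: all_linears)
  finally show ?thesis .
qed

lemma w_product:
  assumes h: "h \<in> cH" and g: "g \<in> cH"
  shows "mu (w h) (w g) = sw V (%x y. sw V (%a b. lb (\<sigma> x a) (Z y b)) g) h"
proof -
  let ?N = "Sg' *\<^sub>2 (hat Tau *\<^sub>2 cmap (iota B) Tau)"
  have Nc: "?N \<in> carrier CCB"
    by (simp add: cmap_closed[OF hom_D(1)[OF iota_hom[OF algebra_B]]])
  have "tr.pV ((SR \<star>\<^sub>2 (mstar uR \<star>\<^sub>2 iB2 ?N)) h g)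
    = sw V (%x y. sw V (%a b. lb (\<sigma> x a) (Z y b)) g) h"
    by (rule iV_sw2[OF SR_closed(1) CCR.m_closed[OF mu_closed hom_D(4)[OF iB2_hom Nc]] h g])
       (simp add: Z_conv tr.i_mult)
  then show ?thesis by (simp only: w_product_conv[OF h g])
qed

text \<open>Since 1 \<otimes> d # p is \<open>w p\<close> times t(d), associativity reduces the
  claim to the product of \<open>w x\<close> and \<open>w p\<close>; the factor t(d) then lands to
  the left of \<sigma>(S g3, S h4), the second coefficient being multiplied in the opposite
  order.\<close>

lemma w_e_product:
  assumes x: "x \<in> cH" and p: "p \<in> cH" and d: "d \<in> cB"
  shows "mu (w x) (e 1\<^sub>B d p) = sw V (%h2 y. sw V (%h3 h4. sw V (%g1 q. sw V (%g2 g3.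
    e (\<sigma> h2 g1) (d \<cdot> \<sigma> (S g3) (S h4)) (h3 \<otimes>\<^bsub>H\<^esub> g2)) q) p) y) x"
proof -
  let ?t = "rb (u 1\<^sub>H) d"
  let ?K = "%h2 h3 h4 g1 g2 g3. e (\<sigma> h2 g1) (d \<cdot> \<sigma> (S g3) (S h4)) (h3 \<otimes>\<^bsub>H\<^esub> g2)"
  have t: "?t \<in> cV" using d by simp
  have lt: "lin V V (%v. mu v ?t)" by (rule mu_linear_left[OF lin_id t])
  have "mu (w x) (e 1\<^sub>B d p) = mu (mu (w x) (w p)) ?t"
    using x p d t by (simp add: mu_assoc mu_w_target)
  also have "... = sw V (%h2 y. sw V (%g1 q. mu (lb (\<sigma> h2 g1) (Z y q)) ?t) p) x"
    unfolding w_product[OF x p]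
    by (rule hopf.sw2_post[OF V_module V_module lt x p]) (auto intro!: all_linears Z_linear)
  also have "... = sw V (%h2 y. sw V (%g1 q. sw V (%h3 h4. sw V (%g2 g3. ?K h2 h3 h4 g1 g2 g3) q) y) p) x"
  proof (rule hopf.sw2_cong[OF V_module x p])
    fix h2 y g1 q assume a: "h2 \<in> cH" "y \<in> cH" "g1 \<in> cH" "q \<in> cH"
    have l: "lin V V (%v. mu (lb (\<sigma> h2 g1) v) ?t)"
      by (intro mu_linear_left lb_linear lin_id t sigma_closed a)
    have "mu (lb (\<sigma> h2 g1) (Z y q)) ?t
      = sw V (%p r. sw V (%c m. mu (lb (\<sigma> h2 g1) (e 1\<^sub>B (\<sigma> (S m) (S r)) (p \<otimes>\<^bsub>H\<^esub> c))) ?t) q) y"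
      unfolding Z_def by (rule hopf.sw2_post[OF V_module V_module l a(2,4)]) (auto intro!: all_linears)
    also have "... = sw V (%h3 h4. sw V (%g2 g3. ?K h2 h3 h4 g1 g2 g3) q) y"
      by (rule hopf.sw2_cong[OF V_module a(2,4)])
         (use a d t in \<open>auto intro!: all_linears simp: lb_e e_target\<close>)
    finally show "mu (lb (\<sigma> h2 g1) (Z y q)) ?t = sw V (%h3 h4. sw V (%g2 g3. ?K h2 h3 h4 g1 g2 g3) q) y" .
  qed (use t in \<open>auto intro!: all_linears Z_linear\<close>)
  also have "... = sw V (%h2 y. sw V (%h3 h4. sw V (%g1 q. sw V (%g2 g3. ?K h2 h3 h4 g1 g2 g3) q) p) y) x"
  proof (rule sw_cong[OF V_module _ x])
    show "bil H H V (%h2 y. sw V (%g1 q. sw V (%h3 h4. sw V (%g2 g3. ?K h2 h3 h4 g1 g2 g3) q) y) p)"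
      by (rule bil_I) (auto intro!: all_linears simp: d p)
    fix h2 y assume a: "h2 \<in> cH" "y \<in> cH"
    show "sw V (%g1 q. sw V (%h3 h4. sw V (%g2 g3. ?K h2 h3 h4 g1 g2 g3) q) y) p
      = sw V (%h3 h4. sw V (%g1 q. sw V (%g2 g3. ?K h2 h3 h4 g1 g2 g3) q) p) y"
      by (rule hopf.sw_swap[OF V_module _ _ p a(2)]) (auto intro!: all_linears simp: d a)
  qed
  finally show ?thesis .
qed

text \<open>Write b \<otimes> b' # h as s(b) \<open>w h\<close> t(b') and let t(b') act on the
  second factor first. \<open>rb_e\<close> produces S g4 \<triangleright> b', \<open>mu_w_lb\<close>
  produces h1 \<triangleright> c, and \<open>w_e_product\<close> both cocycle factors. The rest of
  the proof orders the legs.\<close>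

lemma e_product:
  assumes b: "b \<in> cB" "b' \<in> cB" and h: "h \<in> cH"
    and c: "c \<in> cB" "c' \<in> cB" and g: "g \<in> cH"
  shows "mu (e b b' h) (e c c' g) = sw V (%h1 x. sw V (%h2 y. sw V (%h3 h4.
    sw V (%g1 p. sw V (%g2 q. sw V (%g3 g4.
      e (b \<cdot> act h1 c \<cdot> \<sigma> h2 g1) (c' \<cdot> act (S g4) b' \<cdot> \<sigma> (S g3) (S h4)) (h3 \<otimes>\<^bsub>H\<^esub> g2)) q) p) g) y) x) h"
proof -
  let ?K = "%h1 h2 h3 h4 g1 g2 g3 g4.
    e (b \<cdot> act h1 c \<cdot> \<sigma> h2 g1) (c' \<cdot> act (S g4) b' \<cdot> \<sigma> (S g3) (S h4)) (h3 \<otimes>\<^bsub>H\<^esub> g2)"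
  let ?G = "%h1 h2 h3 h4 p g4. sw V (%g1 q. sw V (%g2 g3. ?K h1 h2 h3 h4 g1 g2 g3 g4) q) p"
  note cl = b h c g
  have "mu (e b b' h) (e c c' g) = lb b (mu (w h) (lb c (rb (e 1\<^sub>B c' g) b')))"
  proof -
    have "e b b' h = lb b (mu (w h) (rb (u 1\<^sub>H) b'))" using cl by (simp add: mu_w_target lb_e)
    moreover have "e c c' g = lb c (e 1\<^sub>B c' g)" using cl by (simp add: lb_e)
    ultimately show ?thesis using cl by (simp add: mu_lb mu_assoc mu_target V_bimodule)
  qed
  also have "... = sw V (%p g4. lb b (mu (w h) (lb c (e 1\<^sub>B (c' \<cdot> act (S g4) b') p)))) g"
    unfolding rb_e[OF base.A.one_closed c(2) b(2) g]
    by (rule sw_post[OF V_module V_module _ _ g]) (use cl in \<open>auto intro!: all_linears\<close>)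
  \<comment> \<open>Inside the sum over g the three legs of h beyond h1 come from the product with
    \<open>w\<close>, and the last leg g4 is the one already used up by the action on b'.\<close>
  also have "... = sw V (%p g4. sw V (%h1 x. sw V (%h2 y. sw V (%h3 h4. ?G h1 h2 h3 h4 p g4) y) x) h) g"
  proof (rule sw_cong[OF V_module _ g])
    show "bil H H V (%p g4. lb b (mu (w h) (lb c (e 1\<^sub>B (c' \<cdot> act (S g4) b') p))))"
      using cl by (auto intro!: all_linears)
    fix p g4 assume a: "p \<in> cH" "g4 \<in> cH"
    let ?d = "c' \<cdot> act (S g4) b'"
    have d: "?d \<in> cB" using cl a by simp
    have z: "e 1\<^sub>B ?d p \<in> cV" using d a by simp
    have "lb b (mu (w h) (lb c (e 1\<^sub>B ?d p))) = sw V (%x y. lb b (lb (act x c) (mu (w y) (e 1\<^sub>B ?d p)))) h"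
      unfolding mu_w_lb[OF c(1) h z]
      by (rule sw_post[OF V_module V_module lb_linear[OF lin_id b(1)] _ h]) (use cl z in \<open>auto intro!: all_linears\<close>)
    also have "... = sw V (%h1 x. sw V (%h2 y. sw V (%h3 h4. ?G h1 h2 h3 h4 p g4) y) x) h"
    proof (rule sw_cong[OF V_module _ h])
      show "bil H H V (%x y. lb b (lb (act x c) (mu (w y) (e 1\<^sub>B ?d p))))"
        using cl z by (auto intro!: all_linears)
      fix h1 x assume x: "h1 \<in> cH" "x \<in> cH"
      let ?l = "%v. lb b (lb (act h1 c) v)"
      have l: "lin V V ?l" using cl x by (auto intro!: all_linears)
      let ?k = "%h2 h3 h4 g1 g2 g3. e (\<sigma> h2 g1) (?d \<cdot> \<sigma> (S g3) (S h4)) (h3 \<otimes>\<^bsub>H\<^esub> g2)"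
      let ?k2 = "%h2 h3 h4. sw V (%g1 q. sw V (%g2 g3. ?k h2 h3 h4 g1 g2 g3) q) p"
      have k2: "?l (?k2 h2 h3 h4) = ?G h1 h2 h3 h4 p g4" if hh: "h2 \<in> cH" "h3 \<in> cH" "h4 \<in> cH" for h2 h3 h4
      proof -
        have bi: "bil H H V (%g1 q. sw V (%g2 g3. ?k h2 h3 h4 g1 g2 g3) q)"
          using hh d by (auto intro!: all_linears)
        have "?l (?k2 h2 h3 h4) = ?G h1 h2 h3 h4 p g4"
        proof (rule sw_map[OF V_module V_module l bi a(1)])
          fix g1 q assume gq: "g1 \<in> cH" "q \<in> cH"
          have bj: "bil H H V (%g2 g3. ?k h2 h3 h4 g1 g2 g3)"
            using hh d gq by (auto intro!: all_linears)
          have "?l (sw V (%g2 g3. ?k h2 h3 h4 g1 g2 g3) q) = sw V (%g2 g3. ?K h1 h2 h3 h4 g1 g2 g3 g4) q"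
            by (rule sw_map[OF V_module V_module l bj gq(2)])
               (use cl hh d gq x a in \<open>simp add: lb_e base.A.m_assoc\<close>)
          then show "?l (sw V (%g2 g3. ?k h2 h3 h4 g1 g2 g3) q) = sw V (%g2 g3. ?K h1 h2 h3 h4 g1 g2 g3 g4) q" .
        qed
        then show ?thesis .
      qed
      have bk: "bil H H V (%h2 y. sw V (%h3 h4. ?k2 h2 h3 h4) y)"
        using d a by (auto intro!: all_linears)
      have "?l (mu (w x) (e 1\<^sub>B ?d p)) = sw V (%h2 y. sw V (%h3 h4. ?G h1 h2 h3 h4 p g4) y) x"
        unfolding w_e_product[OF x(2) a(1) d] proof (rule sw_map[OF V_module V_module l bk x(2)])
        fix h2 y assume hy: "h2 \<in> cH" "y \<in> cH"
        have bl: "bil H H V (%h3 h4. ?k2 h2 h3 h4)"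
          using d a hy by (auto intro!: all_linears)
        have "?l (sw V (%h3 h4. ?k2 h2 h3 h4) y) = sw V (%h3 h4. ?G h1 h2 h3 h4 p g4) y"
          by (rule sw_map[OF V_module V_module l bl hy(2)]) (rule k2[OF hy(1)])
        then show "?l (sw V (%h3 h4. ?k2 h2 h3 h4) y) = sw V (%h3 h4. ?G h1 h2 h3 h4 p g4) y" .
      qed
      then show "?l (mu (w x) (e 1\<^sub>B ?d p)) = sw V (%h2 y. sw V (%h3 h4. ?G h1 h2 h3 h4 p g4) y) x" .
    qed
    finally show "lb b (mu (w h) (lb c (e 1\<^sub>B ?d p)))
      = sw V (%h1 x. sw V (%h2 y. sw V (%h3 h4. ?G h1 h2 h3 h4 p g4) y) x) h" .
  qed
  also have "... = sw V (%h1 x. sw V (%h2 y. sw V (%h3 h4. sw V (%p g4. ?G h1 h2 h3 h4 p g4) g) y) x) h"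
    by (rule hopf.sw_swap3[OF V_module h g]) (use cl in \<open>auto intro!: all_linears\<close>)
  also have "... = sw V (%h1 x. sw V (%h2 y. sw V (%h3 h4.
    sw V (%g1 p. sw V (%g2 q. sw V (%g3 g4. ?K h1 h2 h3 h4 g1 g2 g3 g4) q) p) g) y) x) h"
  proof (rule sw_cong[OF V_module _ h])
    show "bil H H V (%h1 x. sw V (%h2 y. sw V (%h3 h4. sw V (%p g4. ?G h1 h2 h3 h4 p g4) g) y) x)"
      using cl by (auto intro!: all_linears)
    fix h1 x assume x: "h1 \<in> cH" "x \<in> cH"
    show "sw V (%h2 y. sw V (%h3 h4. sw V (%p g4. ?G h1 h2 h3 h4 p g4) g) y) x
      = sw V (%h2 y. sw V (%h3 h4.
        sw V (%g1 p. sw V (%g2 q. sw V (%g3 g4. ?K h1 h2 h3 h4 g1 g2 g3 g4) q) p) g) y) x"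
    proof (rule sw_cong[OF V_module _ x(2)])
      show "bil H H V (%h2 y. sw V (%h3 h4. sw V (%p g4. ?G h1 h2 h3 h4 p g4) g) y)"
        using cl x by (auto intro!: all_linears)
      fix h2 y assume y: "h2 \<in> cH" "y \<in> cH"
      show "sw V (%h3 h4. sw V (%p g4. ?G h1 h2 h3 h4 p g4) g) y
        = sw V (%h3 h4. sw V (%g1 p. sw V (%g2 q. sw V (%g3 g4. ?K h1 h2 h3 h4 g1 g2 g3 g4) q) p) g) y"
      proof (rule sw_cong[OF V_module _ y(2)])
        show "bil H H V (%h3 h4. sw V (%p g4. ?G h1 h2 h3 h4 p g4) g)"
          using cl x y by (auto intro!: all_linears)
        fix h3 h4 assume z: "h3 \<in> cH" "h4 \<in> cH"
        show "sw V (%p g4. ?G h1 h2 h3 h4 p g4) g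
          = sw V (%g1 p. sw V (%g2 q. sw V (%g3 g4. ?K h1 h2 h3 h4 g1 g2 g3 g4) q) p) g"
          by (rule hopf.sw_coassoc4[OF V_module g]) (use cl x y z in \<open>auto intro!: all_linears\<close>)
      qed
    qed
  qed
  finally show ?thesis .
qed

lemma qq_one: "h \<in> cH ==> qq 1\<^sub>B h = sw B (%x y. \<sigma>' (S x) y) h"
  unfolding qq_def
  by (rule sw_cong[OF base.module_A qq_inner_bilinear[OF base.A.one_closed]])
     (simp_all add: hom_D(3)[OF al_hom])

lemma E_linears:
  "[|lin W B f; c \<in> cB; h \<in> cH|] ==> lin W V (%x. E (f x) c h)"
  "[|lin W B f; c \<in> cB; h \<in> cH|] ==> lin W V (%x. E c (f x) h)"
  "[|lin W H g; c \<in> cB; b \<in> cB|] ==> lin W V (%x. E b c (g x))"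
  by (rule lin_comp[OF tril_D(1)[OF E_trilinear]] lin_comp[OF tril_D(2)[OF E_trilinear]]
      lin_comp[OF tril_D(3)[OF E_trilinear]]; assumption)+

lemma qq_linear:
  "[|lin W H f; b \<in> cB|] ==> lin W B (%x. qq b (f x))"
  by (rule bil_right[OF qq_bilinear])

lemma sigma'_linear:
  "[|lin W H f; h \<in> cH|] ==> lin W B (%x. \<sigma>' (f x) h)"
  "[|lin W H f; h \<in> cH|] ==> lin W B (%x. \<sigma>' h (f x))"
  by (rule bil_left[OF sigma_inv_bilinear] bil_right[OF sigma_inv_bilinear]; assumption)+

lemma pt_linear:
  "[|lin W V f; y \<in> cV|] ==> lin W TM (%x. pt (f x) y)"
  "[|lin W V f; y \<in> cV|] ==> lin W TM (%x. pt y (f x))"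
  by (rule bil_left[OF VT.pure_bilinear] bil_right[OF VT.pure_bilinear]; assumption)+

lemmas T_linears = all_linears E_linears qq_linear sigma'_linear pt_linear
  sw_linear[OF TM_module] sw_param_linear[OF TM_module hopf.module_A]

lemma E_one: "[|b \<in> cB; h \<in> cH|] ==> E b 1\<^sub>B h = lb b (u h)"
  by (simp add: E_u V_bimodule)

text \<open>The coefficient \<open>pp b'\<close> sits on the right and so stays with the second
  factor of u(h1) \<otimes> u(h2), where it rebuilds an element of the original basis. Only the
  first factor keeps the form b.u(h1).\<close>

lemma Dl_e:
  assumes b: "b \<in> cB" "b' \<in> cB" and h: "h \<in> cH"
  shows "Dl (e b b' h) = sw TM (%x y. pt (E b 1\<^sub>B x) (e 1\<^sub>B b' y)) h"
proof -
  let ?K = "%p q y. pt (E b 1\<^sub>B p) (E 1\<^sub>B (pp b' y) q)"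
  have t: "tril H H H TM ?K" by (rule tril_I) (auto intro!: T_linears simp: b)
  have bb: "bil H H V (%x y. E b (pp b' y) x)" by (auto intro!: T_linears simp: b)
  have DE: "Dl (E b c x) = sw TM (%p q. pt (E b 1\<^sub>B p) (E 1\<^sub>B c q)) x" if c: "c \<in> cB" and x: "x \<in> cH" for c x
  proof -
    have l: "lin TM TM (%t. lT b (rT t c))" by (intro lT_linear rT_linear lin_id b c)
    have "Dl (E b c x) = sw TM (%p q. pt (E b 1\<^sub>B p) (E 1\<^sub>B c q)) x"
      unfolding Dl_E[OF b(1) c x] D0_def by (rule sw_map[OF TM_module TM_module l D0_bilinear x]) (simp add: b c E_u V_bimodule)
    then show ?thesis .
  qed
  have "Dl (e b b' h) = sw TM (%x y. sw TM (%p q. ?K p q y) x) h"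
    unfolding e_E[OF b h] by (rule sw_map[OF V_module TM_module Dl_linear bb h]) (simp add: DE b)
  also have "... = sw TM (%p m. sw TM (%q y. ?K p q y) m) h"
    by (rule sw_coassoc[OF TM_module t h])
  also have "... = sw TM (%x y. pt (E b 1\<^sub>B x) (e 1\<^sub>B b' y)) h"
  proof (rule sw_cong[OF TM_module sw_right_bilinear[OF TM_module t] h])
    fix p m assume a: "p \<in> cH" "m \<in> cH"
    have "pt (E b 1\<^sub>B p) (e 1\<^sub>B b' m) = sw TM (%q y. ?K p q y) m"
      unfolding e_E[OF base.A.one_closed b(2) a(2)]
      by (rule sw_post[OF V_module TM_module bil_D(1)[OF VT.pure_bilinear]]) (use a b in \<open>auto intro!: T_linears\<close>)
    then show "sw TM (%q y. ?K p q y) m = pt (E b 1\<^sub>B p) (e 1\<^sub>B b' m)" by simp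
  qed
  finally show ?thesis .
qed

text \<open>Expressing the first factor b.u(h1) in the original basis introduces \<open>qq\<close>
  at the unit of B, whose value is \<sigma>'(S h2, h3).\<close>

lemma Dl_e4:
  assumes b: "b \<in> cB" "b' \<in> cB" and h: "h \<in> cH"
  shows "Dl (e b b' h) = sw TM (%h1 x. sw TM (%h2 y. sw TM (%h3 h4.
    pt (e b (\<sigma>' (S h2) h3) h1) (e 1\<^sub>B b' h4)) y) x) h"
proof -
  let ?K = "%h1 h2 h3 h4. pt (e b (\<sigma>' (S h2) h3) h1) (e 1\<^sub>B b' h4)"
  have "Dl (e b b' h) = sw TM (%p h4. sw TM (%h1 q. sw TM (%h2 h3. ?K h1 h2 h3 h4) q) p) h"
    unfolding Dl_e[OF b h]
  proof (rule sw_cong[OF TM_module _ h])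
    show "bil H H TM (%x y. pt (E b 1\<^sub>B x) (e 1\<^sub>B b' y))" by (auto intro!: T_linears simp: b)
    fix p h4 assume a: "p \<in> cH" "h4 \<in> cH"
    have lp: "lin V TM (%v. pt v (e 1\<^sub>B b' h4))" using a b by (auto intro!: T_linears)
    have be: "bil H H V (%x y. e b (qq 1\<^sub>B y) x)" by (auto intro!: T_linears simp: b)
    have "pt (E b 1\<^sub>B p) (e 1\<^sub>B b' h4) = sw TM (%h1 q. sw TM (%h2 h3. ?K h1 h2 h3 h4) q) p"
      unfolding E_def proof (rule sw_map[OF V_module TM_module lp be a(1)])
      fix h1 q assume hq: "h1 \<in> cH" "q \<in> cH"
      have lq: "lin B TM (%c. pt (e b c h1) (e 1\<^sub>B b' h4))" using a b hq by (auto intro!: T_linears)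
      show "pt (e b (qq 1\<^sub>B q) h1) (e 1\<^sub>B b' h4) = sw TM (%h2 h3. ?K h1 h2 h3 h4) q"
        unfolding qq_one[OF hq(2)]
        by (rule sw_post[OF base.module_A TM_module lq _ hq(2)]) (auto intro!: T_linears)
    qed
    then show "pt (E b 1\<^sub>B p) (e 1\<^sub>B b' h4) = sw TM (%h1 q. sw TM (%h2 h3. ?K h1 h2 h3 h4) q) p" .
  qed
  also have "... = sw TM (%h1 x. sw TM (%h2 y. sw TM (%h3 h4. ?K h1 h2 h3 h4) y) x) h"
    by (rule hopf.sw_coassoc4[OF TM_module h]) (use b in \<open>auto intro!: T_linears\<close>)
  finally show ?thesis .
qed

lemma epsL_e:
  assumes b: "b \<in> cB" "b' \<in> cB" and h: "h \<in> cH"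
  shows "epsL (e b b' h) = b \<cdot> pp b' h"
proof -
  have bb: "bil H H V (%x y. E b (pp b' y) x)" by (auto intro!: T_linears simp: b)
  have "epsL (e b b' h) = sw B (%x y. epsL (E b (pp b' y) x)) h"
    unfolding e_E[OF b h] by (rule sw_post[OF V_module base.module_A epsL_linear bb h])
  also have "... = b \<cdot> pp b' h"
    by (rule hopf.sw_absorb_left[OF base.module_A bil_post[OF epsL_linear bb] _ h])
       (auto intro!: T_linears simp: b epsL_E)
  finally show ?thesis .
qed

lemma epsL_e3:
  assumes b: "b \<in> cB" "b' \<in> cB" and h: "h \<in> cH"
  shows "epsL (e b b' h) = sw B (%h1 x. sw B (%h2 h3. b \<cdot> act h1 b' \<cdot> \<sigma> h2 (S h3)) x) h"
proof -
  note M = base.module_A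
  have bb: "bil H H B (%x y. act x b' \<cdot> Tau y)" by (auto intro!: T_linears simp: b)
  have lb: "lin B B (%c. b \<cdot> c)" by (auto intro!: T_linears simp: b)
  have "epsL (e b b' h) = sw B (%h1 x. sw B (%h2 h3. b \<cdot> act h1 b' \<cdot> \<sigma> h2 (S h3)) x) h"
    unfolding epsL_e[OF b h] pp_sw[OF b(2) h] proof (rule sw_map[OF M M lb bb h])
    fix x y assume a: "x \<in> cH" "y \<in> cH"
    have "b \<cdot> (act x b' \<cdot> Tau y) = (b \<cdot> act x b') \<cdot> Tau y" using a b by (simp add: base.A.m_assoc)
    also have "... = sw B (%h2 h3. b \<cdot> act x b' \<cdot> \<sigma> h2 (S h3)) y"
      unfolding Tau_sw[OF a(2)]
      by (rule sw_post[OF M M base.linear_mult_right[OF lin_id] _ a(2)]) (use a b in \<open>auto intro!: T_linears\<close>)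
    finally show "b \<cdot> (act x b' \<cdot> Tau y) = sw B (%h2 h3. b \<cdot> act x b' \<cdot> \<sigma> h2 (S h3)) y" .
  qed
  then show ?thesis .
qed

text \<open>The coproduct is reversed once when it passes S, so the coefficient \<sigma>'(S x, y) of
  u is taken at x = S h2 and y = S h1. This is the origin of the square of the antipode in the
  inverse Galois map.\<close>

lemma E_S:
  assumes b: "b \<in> cB" and h: "h \<in> cH"
  shows "E b 1\<^sub>B (S h) = sw V (%m x. sw V (%n z. e b (\<sigma>' (S (S n)) (S m)) (S z)) x) h"
proof -
  let ?K = "%m n z. e b (\<sigma>' (S (S n)) (S m)) (S z)"
  have t: "tril H H H V ?K" by (rule tril_I) (auto intro!: T_linears simp: b)
  have be: "bil H H V (%x y. e b (qq 1\<^sub>B y) x)" by (auto intro!: T_linears simp: b)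
  have "E b 1\<^sub>B (S h) = sw V (%x z. e b (qq 1\<^sub>B (S x)) (S z)) h"
    unfolding E_def by (rule hopf.sw_S[OF V_module be h])
  also have "... = sw V (%x z. sw V (%m n. ?K m n z) x) h"
  proof (rule sw_cong[OF V_module _ h])
    show "bil H H V (%x z. e b (qq 1\<^sub>B (S x)) (S z))" by (auto intro!: T_linears simp: b)
    fix x z assume a: "x \<in> cH" "z \<in> cH"
    have bs: "bil H H B (%x y. \<sigma>' (S x) y)" by (auto intro!: T_linears)
    have "qq 1\<^sub>B (S x) = sw B (%m n. \<sigma>' (S (S n)) (S m)) x"
      using a by (simp add: qq_one hopf.sw_S[OF base.module_A bs])
    moreover have "e b (sw B (%m n. \<sigma>' (S (S n)) (S m)) x) (S z) = sw V (%m n. ?K m n z) x"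
      by (rule sw_post[OF base.module_A V_module tril_D(2)[OF e_trilinear b] _ a(1)]) (use a in \<open>auto intro!: T_linears\<close>)
    ultimately show "e b (qq 1\<^sub>B (S x)) (S z) = sw V (%m n. ?K m n z) x" by simp
  qed
  also have "... = sw V (%m x. sw V (%n z. ?K m n z) x) h"
    by (rule sw_coassoc[OF V_module t h])
  finally show ?thesis .
qed

subsection \<open>The two antipode identities\<close>

text \<open>Inside the truncated ring the sum is the contraction of \<open>KR\<close> times the
  cocycle. There \<sigma>' cancels and leaves \<sigma> times u of a product, which contracts to
  u(1).\<close>

lemma w_u_S:
  assumes m: "m \<in> cH"
  shows "sw V (%q y. mu (w q) (u (S y))) m = lb (Tau m) (u 1\<^sub>H)"
proof -
  note M = RR.module_A
  let ?K = "%x z y. KR x (S y) \<star>\<^sub>0 con RR SR z"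
  have cS: "con RR SR z = iB (Tau z)" if z: "z \<in> cH" for z
  proof -
    have bs: "bil H H B (%x y. \<sigma> x (S y))" by (auto intro!: T_linears)
    have "iB (Tau z) = sw RR (%x y. iB (\<sigma> x (S y))) z"
      unfolding Tau_sw[OF z] by (rule sw_post[OF base.module_A M tr.iB_linear bs z])
    also have "... = con RR SR z"
      unfolding con_def
      by (rule sw_cong[OF M bil_post[OF tr.iB_linear bs] z]) simp
    finally show ?thesis by simp
  qed
  have t: "tril H H H RR ?K"
    by (rule tril_I)
       (auto intro!: RR.linear_mult_left RR.linear_mult_right hopf.conv2_lin1[OF KR_closed] hopf.conv2_lin2[OF KR_closed]
          hopf.con_linear[OF M conv2_bilinear[OF SR_closed(1)]] H_linears
          conv2_closed[OF KR_closed] simp: cS)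
  have bm: "bil H H V (%q y. mu (w q) (u (S y)))" by (auto intro!: T_linears)
  have "iV (sw V (%q y. mu (w q) (u (S y))) m) = sw RR (%q y. sw RR (%x z. ?K x z y) q) m"
  proof (rule sw_map[OF V_module M tr.iV_linear bm m])
    fix q y assume a: "q \<in> cH" "y \<in> cH"
    have bu: "bil H H V (%x z. rb (U x (u (S y))) (Tau z))" using a by (auto intro!: T_linears)
    have "iV (mu (w q) (u (S y))) = sw RR (%x z. iV (rb (U x (u (S y))) (Tau z))) q"
      using a by (simp add: mu_w sw_post[OF V_module M tr.iV_linear bu])
    also have "... = sw RR (%x z. ?K x z y) q"
      by (rule sw_cong[OF M bil_post[OF tr.iV_linear bu] a(1)])
         (simp add: a cS tr.i_mult(3)[symmetric] iV_U aV_u Kt_apply)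
    finally show "iV (mu (w q) (u (S y))) = sw RR (%x z. ?K x z y) q" .
  qed
  also have "... = sw RR (%x n. sw RR (%z y. ?K x z y) n) m"
    by (rule sw_coassoc[OF M t m])
  also have "... = con RR (KR \<star>\<^sub>2 SR) m"
    by (rule hopf.con_mult[symmetric, OF algebra_RR KR_closed SR_closed(1) m])
  also have "KR \<star>\<^sub>2 SR = SR \<star>\<^sub>2 mstar uR"
    by (simp add: KR_def CCR.m_assoc SR_inv)
  also have "con RR (SR \<star>\<^sub>2 mstar uR) m = iB (Tau m) \<star>\<^sub>0 iV (u 1\<^sub>H)"
    by (simp add: hopf.con_C0[OF algebra_RR SR_closed(1) uR_closed m] cS m)
  also have "... = iV (lb (Tau m) (u 1\<^sub>H))" using m by (simp add: tr.i_mult)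
  finally show ?thesis by (rule iV_inj)
qed

text \<open>\<open>mu_w_lb\<close> lets the first leg act on b; \<open>w_u_S\<close> contributes
  \<open>Tau\<close>, and both together make \<open>pp b h\<close>.\<close>

lemma antipode_identity_right:
  assumes b: "b \<in> cB" and h: "h \<in> cH"
  shows "sw V (%x y. mu (w x) (E b 1\<^sub>B (S y))) h = lb (pp b h) (u 1\<^sub>H)"
proof -
  let ?K = "%p q y. lb (act p b) (mu (w q) (u (S y)))"
  have t: "tril H H H V ?K" by (rule tril_I) (auto intro!: T_linears simp: b)
  have "sw V (%x y. mu (w x) (E b 1\<^sub>B (S y))) h = sw V (%x y. sw V (%p q. ?K p q y) x) h"
    by (rule sw_cong[OF V_module _ h]) (auto intro!: T_linears simp: b E_one mu_w_lb)
  also have "... = sw V (%p m. sw V (%q y. ?K p q y) m) h"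
    by (rule sw_coassoc[OF V_module t h])
  also have "... = sw V (%p m. lb (act p b \<cdot> Tau m) (u 1\<^sub>H)) h"
  proof (rule sw_cong[OF V_module sw_right_bilinear[OF V_module t] h])
    fix p m assume a: "p \<in> cH" "m \<in> cH"
    have "sw V (%q y. ?K p q y) m = lb (act p b) (sw V (%q y. mu (w q) (u (S y))) m)"
      by (rule sw_post[symmetric, OF V_module V_module bil_D(1)[OF lb_bilinear]]) (use a b in \<open>auto intro!: T_linears\<close>)
    then show "sw V (%q y. ?K p q y) m = lb (act p b \<cdot> Tau m) (u 1\<^sub>H)"
      using a b by (simp add: w_u_S V_bimodule)
  qed
  also have "... = lb (pp b h) (u 1\<^sub>H)"
    unfolding pp_sw[OF b h]
    by (rule sw_post[symmetric, OF base.module_A V_module bil_D(2)[OF lb_bilinear]]) (use b h in \<open>auto intro!: T_linears\<close>)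
  finally show ?thesis .
qed

text \<open>The coefficient \<open>qq\<close> at the unit is the left contraction of \<sigma>'.
  Multiplying \<sigma>' into \<open>KR\<close> cancels the leading \<sigma> and leaves u of a
  product, which contracts to u(1). The remaining factor, \<sigma>' times the action on
  \<open>Tau\<close>, contracts to the counit by \<open>sigma'_hat_Tau_S\<close>.\<close>

lemma antipode_identity_left:
  assumes h: "h \<in> cH"
  shows "sw V (%a m. sw V (%z c. mu (E (qq 1\<^sub>B z) 1\<^sub>B (S a)) (w c)) m) h = eps h \<odot>\<^bsub>V\<^esub> u 1\<^sub>H"
proof -
  note M = RR.module_A
  let ?J = "KR \<star>\<^sub>2 HT" and ?G = "SR' \<star>\<^sub>2 HT" and ?o = "iV (u 1\<^sub>H)"
  let ?L = "%a z c. hopf.lcon RR SR' z \<star>\<^sub>0 ?J (S a) c"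
  have Jc: "?J \<in> carrier CCR" and Gc: "?G \<in> carrier CCR" by simp_all
  have l': "hopf.lcon RR SR' z = iB (qq 1\<^sub>B z)" if z: "z \<in> cH" for z
  proof -
    have bs: "bil H H B (%x y. \<sigma>' (S x) y)" by (auto intro!: T_linears)
    have "iB (qq 1\<^sub>B z) = sw RR (%x y. iB (\<sigma>' (S x) y)) z"
      unfolding qq_one[OF z] by (rule sw_post[OF base.module_A M tr.iB_linear bs z])
    also have "... = hopf.lcon RR SR' z"
      unfolding hopf.lcon_def
      by (rule sw_cong[OF M bil_post[OF tr.iB_linear bs] z]) simp
    finally show ?thesis by simp
  qed
  let ?m = "%a z c. mu (E (qq 1\<^sub>B z) 1\<^sub>B (S a)) (w c)"
  have bo: "bil H H V (%a m. sw V (%z c. ?m a z c) m)" by (auto intro!: T_linears)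
  have "iV (sw V (%a m. sw V (%z c. ?m a z c) m) h) = sw RR (%a m. sw RR (%z c. ?L a z c) m) h"
  proof (rule sw_map[OF V_module M tr.iV_linear bo h])
    fix a m assume am: "a \<in> cH" "m \<in> cH"
    have bi: "bil H H V (%z c. ?m a z c)" using am by (auto intro!: T_linears)
    have "iV (sw V (%z c. ?m a z c) m) = sw RR (%z c. ?L a z c) m"
      by (rule sw_map[OF V_module M tr.iV_linear bi am(2)])
         (simp add: am l' U_w[symmetric] tr.i_mult E_one mu_lb mu_u)
    then show "iV (sw V (%z c. ?m a z c) m) = sw RR (%z c. ?L a z c) m" .
  qed
  also have "... = hopf.lcon RR (SR' \<star>\<^sub>2 ?J) h"
    by (rule hopf.lcon_mult[symmetric, OF algebra_RR SR_closed(2) Jc h])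
  also have "SR' \<star>\<^sub>2 ?J = mstar uR \<star>\<^sub>2 ?G"
    by (simp add: KR_def CCR.m_assoc[symmetric] SR_inv)
  also have "hopf.lcon RR (mstar uR \<star>\<^sub>2 ?G) h
    = sw RR (%a w. sw RR (%z c. hopf.lcon RR (mstar uR) z \<star>\<^sub>0 ?G (S a) c) w) h"
    by (rule hopf.lcon_mult[OF algebra_RR mu_closed Gc h])
  also have "... = sw RR (%a w. ?o \<star>\<^sub>0 ?G (S a) w) h"
  proof (rule sw_cong[symmetric, OF M _ h])
    show "bil H H RR (%a w. ?o \<star>\<^sub>0 ?G (S a) w)"
      by (auto intro!: bil_I RR.linear_mult_right hopf.conv2_lin1[OF Gc] hopf.conv2_lin2[OF Gc] H_linears)
    fix a w assume a: "a \<in> cH" "w \<in> cH"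
    have mc: "hopf.lcon RR (mstar uR) z = eps z \<odot>\<^bsub>RR\<^esub> ?o" if z: "z \<in> cH" for z
    proof -
      have "hopf.lcon RR (mstar uR) z = sw RR (%x y. uR (S x \<otimes>\<^bsub>H\<^esub> y)) z"
        unfolding hopf.lcon_def
        by (rule sw_cong[OF M bil_comp[OF conv2_bilinear[OF mu_closed] S_linear lin_id] z])
           (simp add: hopf.mstar_apply)
      then show ?thesis using hopf.sw_antipode_left[OF M conv_linear[OF uR_closed] z] by simp
    qed
    have Gl: "lin H RR (%c. ?o \<star>\<^sub>0 ?G (S a) c)"
      using a by (auto intro!: RR.linear_mult_right hopf.conv2_lin2[OF Gc] H_linears)
    have "sw RR (%z c. eps z \<odot>\<^bsub>RR\<^esub> (?o \<star>\<^sub>0 ?G (S a) c)) w = sw RR (%z c. hopf.lcon RR (mstar uR) z \<star>\<^sub>0 ?G (S a) c) w"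
      by (rule sw_cong[OF M hopf.eps_scale_bilinear[OF M Gl] a(2)])
         (use a in \<open>simp add: mc unital_algebra.smult_mult_left[OF algebra_RR] conv2_closed[OF Gc]\<close>)
    then show "?o \<star>\<^sub>0 ?G (S a) w = sw RR (%z c. hopf.lcon RR (mstar uR) z \<star>\<^sub>0 ?G (S a) c) w"
      using hopf.sw_counit_left[OF M Gl a(2)] by simp
  qed
  also have "... = ?o \<star>\<^sub>0 hopf.lcon RR ?G h"
    unfolding hopf.lcon_def
    by (rule sw_post[symmetric, OF M M RR.linear_mult_right[OF lin_id]
          bil_comp[OF conv2_bilinear[OF Gc] S_linear lin_id] h]) simp
  also have "hopf.lcon RR ?G h = eps h \<odot>\<^bsub>RR\<^esub> \<one>\<^bsub>RR\<^esub>"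
  proof -
    let ?N = "Sg' *\<^sub>2 hat Tau"
    have Nc: "?N \<in> carrier CCB" by simp
    have G: "?G = iB2 ?N" by (simp add: SR'_def HT_def hom_D(2)[OF iB2_hom])
    have bs: "bil H H B (%x y. ?N (S x) y)"
      by (rule bil_comp[OF conv2_bilinear[OF Nc] S_linear lin_id])
    have "sw B (%x y. ?N (S x) y) h = eps h \<odot>\<^bsub>B\<^esub> 1\<^sub>B"
      using sigma'_hat_Tau_S[OF CB.one_closed h]
      by (simp add: hom_D(3)[OF mstar_hom_B] conv_apply)
    then have "iB (eps h \<odot>\<^bsub>B\<^esub> 1\<^sub>B) = sw RR (%x y. iB (?N (S x) y)) h"
      using sw_post[OF base.module_A M tr.iB_linear bs h] by simp
    also have "... = hopf.lcon RR ?G h"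
      unfolding hopf.lcon_def G
      by (rule sw_cong[OF M bil_post[OF tr.iB_linear bs] h]) simp
    finally show ?thesis
      using h by (simp add: lin_smult[OF tr.iB_linear] hom_D(3)[OF tr.iB_hom])
  qed
  also have "?o \<star>\<^sub>0 (eps h \<odot>\<^bsub>RR\<^esub> \<one>\<^bsub>RR\<^esub>) = iV (eps h \<odot>\<^bsub>V\<^esub> u 1\<^sub>H)"
    using h by (simp add: unital_algebra.smult_mult_right[OF algebra_RR] lin_smult[OF tr.iV_linear])
  finally show ?thesis by (rule iV_inj)
qed

section \<open>The Galois map and its inverse\<close>

text \<open>Left multiplication by t(b) is the right action of b, which is why \<open>rb\<close>
  appears as the balancing action on the second factor.\<close>

definition OG where "OG = tensor_group (cB) (%x b. mu x (rb (u 1\<^sub>H) b)) (%b y. rb y b) (add_monoid V) (add_monoid V)"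
definition OM where "OM = tensor_space V OG"

lemma VO_pair: "balanced_pair (add_monoid V) (add_monoid V) (cB) (%x b. mu x (rb (u 1\<^sub>H) b)) (%b y. rb y b)"
  using module.comm_group_add_monoid[OF V_module] by (simp add: balanced_pair_def balanced_pair_axioms_def)

lemma VO_T: "balanced_pair.T (add_monoid V) (add_monoid V) (cB) (%x b. mu x (rb (u 1\<^sub>H) b)) (%b y. rb y b) = OG"
  by (simp add: balanced_pair.T_def[OF VO_pair] OG_def)

lemma mu_smult_one: "[|a \<in> carrier k; x \<in> cV|] ==> mu x (a \<odot>\<^bsub>V\<^esub> u 1\<^sub>H) = a \<odot>\<^bsub>V\<^esub> x"
  "[|a \<in> carrier k; x \<in> cV|] ==> mu (a \<odot>\<^bsub>V\<^esub> u 1\<^sub>H) x = a \<odot>\<^bsub>V\<^esub> x"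
  by (simp_all add: lin_smult[OF bil_D(1)[OF mu_bilinear]] lin_smult[OF bil_D(2)[OF mu_bilinear]] mu_one)

sublocale VO: tensor_module k V V "cB" "%x b. mu x (rb (u 1\<^sub>H) b)" "%b y. rb y b" OM
proof (intro tensor_module.intro tensor_module_axioms.intro V_module VO_pair)
  fix a assume a: "a \<in> carrier k"
  show "\<exists>r\<in>cB. (\<forall>x\<in>cV. mu x (rb (u 1\<^sub>H) r) = a \<odot>\<^bsub>V\<^esub> x) \<and> (\<forall>y\<in>cV. rb y r = a \<odot>\<^bsub>V\<^esub> y)"
    by (rule bexI[of _ "a \<odot>\<^bsub>B\<^esub> 1\<^sub>B"]) (use a in \<open>simp_all add: scalar_V mu_smult_one\<close>)
qed (simp_all add: VO_T OM_def tensor_space_def lin_smult[OF bil_D(2)[OF mu_bilinear]])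

lemma OM_module: "module k OM" by (rule VO.module_P)

abbreviation po where "po \<equiv> pure_tensor VO.T"

lemma tensor_base_op_L: "tensor_base_op B L = VO.T"
  unfolding tensor_base_op_def VO_T OG_def
  by (rule tensor_group_cong) (simp_all add: mu_target)

lemma po_linear:
  "[|lin W V f; y \<in> cV|] ==> lin W OM (%x. po (f x) y)"
  "[|lin W V f; y \<in> cV|] ==> lin W OM (%x. po y (f x))"
  by (rule bil_left[OF VO.pure_bilinear] bil_right[OF VO.pure_bilinear]; assumption)+

lemmas O_linears = T_linears po_linear sw_linear[OF OM_module] sw_param_linear[OF OM_module hopf.module_A]

definition gal where "gal x y = tensor_lift (add_monoid TM) (%x1 x2. pt x1 (mu x2 y)) (Dl x)"

lemma gal_pair_ok: "y \<in> cV ==> VT.lift_ok TM (%x1 x2. pt x1 (mu x2 y))"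
  by (rule pair_ok) (auto intro!: mu_linear_left lin_id simp: mu_lb)

lemma gal_bilinear: "bil V V TM gal"
proof (rule bil_I)
  fix x assume x: "x \<in> cV"
  show "lin V TM (gal x)"
    unfolding gal_def
    by (rule VT.tensor_lift_param_linear[OF TM_module V_module gal_pair_ok])
       (auto intro!: pt_linear mu_linear_right lin_id simp: x)
next
  fix y assume "y \<in> cV"
  then show "lin V TM (%x. gal x y)"
    unfolding gal_def by (intro lin_comp[OF VT.tensor_lift_linear[OF TM_module gal_pair_ok] Dl_linear])
qed

text \<open>The coproduct of t(d) is 1 \<otimes> t(d), so by multiplicativity x t(d) has coproduct
  x1 \<otimes> x2 t(d), and t(d) can be passed on to y.\<close>

lemma gal_target:
  assumes x: "x \<in> cV" and d: "d \<in> cB" and y: "y \<in> cV"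
  shows "gal (mu x (rb (u 1\<^sub>H) d)) y = gal x (rb y d)"
proof -
  let ?o = "u 1\<^sub>H"
  have t: "rb ?o d \<in> cV" using d by simp
  have "Dl (mu x (rb ?o d)) = actT x (pt ?o (rb ?o d))"
    using x d by (simp add: Dl_mu Dl_rb Dl_u D0_def hopf.sw_one[OF TM_module D0_bilinear])
  also have "... = tensor_lift (add_monoid TM) (%a b. pt (mu a ?o) (mu b (rb ?o d))) (Dl x)"
    by (rule factor_mult_Dl[symmetric, OF x _ t]) simp
  also have "... = tensor_lift (add_monoid TM) (%a b. pt a (mu b (rb ?o d))) (Dl x)"
    by (rule VT.tensor_lift_cong[OF TM_module mu_pair_ok[OF _ t]]) (simp_all add: x mu_one)
  finally have D: "Dl (mu x (rb ?o d)) = tensor_lift (add_monoid TM) (%a b. pt a (mu b (rb ?o d))) (Dl x)" .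
  have "gal (mu x (rb ?o d)) y
    = tensor_lift (add_monoid TM) (%a b. tensor_lift (add_monoid TM) (%x1 x2. pt x1 (mu x2 y)) (pt a (mu b (rb ?o d)))) (Dl x)"
    unfolding gal_def D
    by (rule VT.tensor_lift_post[OF TM_module TM_module gal_pair_ok[OF t] VT.tensor_lift_linear[OF TM_module gal_pair_ok[OF y]]])
       (simp add: x)
  also have "... = gal x (rb y d)"
    unfolding gal_def
    by (rule VT.tensor_lift_cong[symmetric, OF TM_module gal_pair_ok])
       (use x y d in \<open>simp_all add: VT.tensor_lift_pure[OF TM_module gal_pair_ok[OF y]] mu_assoc mu_target\<close>)
  finally show ?thesis .
qed

definition Gal where "Gal = tensor_lift (add_monoid TM) gal"

lemma gal_ok: "VO.lift_ok TM gal"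
  by (rule VO.lift_okI[OF gal_bilinear]) (simp add: gal_target)

lemma Gal_linear: "lin OM TM Gal"
  unfolding Gal_def by (rule VO.tensor_lift_linear[OF TM_module gal_ok])

lemma Gal_po: "[|x \<in> cV; y \<in> cV|] ==> Gal (po x y) = gal x y"
  unfolding Gal_def by (rule VO.tensor_lift_pure[OF TM_module gal_ok])

lemma galois_map_L: "galois_map B L = Gal"
  unfolding galois_map_def Gal_def gal_def tensor_base_L Let_def tensor_lift_VT
  by simp

lemma gal_e:
  assumes b: "b \<in> cB" and h: "h \<in> cH" and y: "y \<in> cV"
  shows "gal (e b 1\<^sub>B h) y = sw TM (%x c. pt (E b 1\<^sub>B x) (mu (w c) y)) h"
proof -
  let ?l = "tensor_lift (add_monoid TM) (%x1 x2. pt x1 (mu x2 y))"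
  note l = VT.tensor_lift_linear[OF TM_module gal_pair_ok[OF y]]
  have bb: "bil H H TM (%x c. pt (E b 1\<^sub>B x) (e 1\<^sub>B 1\<^sub>B c))" by (auto intro!: T_linears simp: b)
  have "gal (e b 1\<^sub>B h) y = sw TM (%x c. pt (E b 1\<^sub>B x) (mu (w c) y)) h"
    unfolding gal_def Dl_e[OF b base.A.one_closed h] by (rule sw_map[OF TM_module TM_module l bb h])
       (simp add: VT.tensor_lift_pure[OF TM_module gal_pair_ok[OF y]] b y w_def)
  then show ?thesis .
qed

text \<open>The inverse of the Galois map before its last expansion: the second factor is kept as
  b'.u(S h2), the form to which the antipode identities apply. \<open>E_S\<close> turns it into the
  formula of the statement.\<close>

definition kap where
  "kap x y = elift OM (%b b' h. sw OM (%p q. po (e b 1\<^sub>B p) (mu (E b' 1\<^sub>B (S q)) y)) h) x"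

lemma kap_tri:
  "y \<in> cV ==> tril B B H OM (%b b' h. sw OM (%p q. po (e b 1\<^sub>B p) (mu (E b' 1\<^sub>B (S q)) y)) h)"
  by (rule tril_I)
     (auto intro!: O_linears sw_param_linear[OF OM_module base.module_A])

lemma kap_e:
  "[|b \<in> cB; b' \<in> cB; h \<in> cH; y \<in> cV|]
    ==> kap (e b b' h) y = sw OM (%p q. po (e b 1\<^sub>B p) (mu (E b' 1\<^sub>B (S q)) y)) h"
  unfolding kap_def by (rule elift_e[OF OM_module kap_tri])

lemma kap_linear_left: "y \<in> cV ==> lin V OM (%x. kap x y)"
  unfolding kap_def by (rule elift_linear[OF OM_module kap_tri])

lemma kap_bilinear: "bil V V OM kap"
proof (rule bil_I)
  fix x assume x: "x \<in> cV"
  show "lin V OM (kap x)"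
    unfolding kap_def
    by (rule elift_param_linear[OF OM_module V_module kap_tri _ x])
       (auto intro!: O_linears sw_param_linear[OF OM_module V_module])
qed (rule kap_linear_left)

text \<open>When S m acts on d.y, the product rule and the reversal of legs by S place S m2
  \<triangleright> d directly behind b'. By \<open>rb_e\<close> this is how right multiplication by
  d changes b' on the other side.\<close>

lemma kap_balanced:
  assumes x: "x \<in> cV" and d: "d \<in> cB" and y: "y \<in> cV"
  shows "kap (rb x d) y = kap x (lb d y)"
proof (rule e_linear_eqI[OF _ _ _ x])
  have ly: "lb d y \<in> cV" using d y by simp
  show "lin V OM (%x. kap (rb x d) y)"
    by (rule lin_comp[OF kap_linear_left[OF y] rb_linear[OF lin_id d]])
  show "lin V OM (%x. kap x (lb d y))" by (rule kap_linear_left[OF ly])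
  fix b b' h assume a: "b \<in> cB" "b' \<in> cB" "h \<in> cH"
  let ?K = "%p q z. po (e b 1\<^sub>B p) (mu (E (b' \<cdot> act (S z) d) 1\<^sub>B (S q)) y)"
  have t: "tril H H H OM ?K" by (rule tril_I) (auto intro!: O_linears simp: a d y)
  have bb: "bil H H V (%x z. e b (b' \<cdot> act (S z) d) x)" by (auto intro!: T_linears simp: a d)
  have "kap (rb (e b b' h) d) y = sw OM (%x z. sw OM (%p q. ?K p q z) x) h"
    unfolding rb_e[OF a(1,2) d a(3)] by (rule sw_map[OF V_module OM_module kap_linear_left[OF y] bb a(3)]) (simp add: kap_e a d y)
  also have "... = sw OM (%p m. sw OM (%q z. ?K p q z) m) h"
    by (rule sw_coassoc[OF OM_module t a(3)])
  also have "... = sw OM (%p m. po (e b 1\<^sub>B p) (mu (E b' 1\<^sub>B (S m)) (lb d y))) h"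
  proof (rule sw_cong[OF OM_module sw_right_bilinear[OF OM_module t] a(3)])
    fix p m assume pm: "p \<in> cH" "m \<in> cH"
    have bU: "bil H H V (%x z. lb (act x d) (U z y))" using d y by (auto intro!: T_linears)
    have "U (S m) (lb d y) = sw V (%x z. lb (act x d) (U z y)) (S m)"
      using pm d y by (simp add: U_lb)
    also have "... = sw V (%q z. lb (act (S z) d) (U (S q) y)) m"
      by (rule hopf.sw_S[OF V_module bU pm(2)])
    finally have Us: "U (S m) (lb d y) = sw V (%q z. lb (act (S z) d) (U (S q) y)) m" .
    have "po (e b 1\<^sub>B p) (mu (E b' 1\<^sub>B (S m)) (lb d y)) = po (e b 1\<^sub>B p) (lb b' (U (S m) (lb d y)))"
      using a pm ly by (simp add: E_one mu_lb mu_u)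
    also have "... = sw OM (%q z. po (e b 1\<^sub>B p) (lb b' (lb (act (S z) d) (U (S q) y)))) m"
      unfolding Us by (rule sw_post[OF V_module OM_module]) (use a pm d y in \<open>auto intro!: O_linears\<close>)
    also have "... = sw OM (%q z. ?K p q z) m"
      by (rule sw_cong[symmetric, OF OM_module tril_D(4)[OF t pm(1)] pm(2)])
         (use a pm d y in \<open>simp add: E_one mu_lb mu_u V_bimodule\<close>)
    finally show "sw OM (%q z. ?K p q z) m = po (e b 1\<^sub>B p) (mu (E b' 1\<^sub>B (S m)) (lb d y))" by simp
  qed
  also have "... = kap (e b b' h) (lb d y)" by (simp add: kap_e a ly)
  finally show "kap (rb (e b b' h) d) y = kap (e b b' h) (lb d y)" .
qed

definition Kap where "Kap = tensor_lift (add_monoid OM) kap"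

lemma kap_ok: "VT.lift_ok OM kap"
  by (rule VT.lift_okI[OF kap_bilinear]) (rule kap_balanced)

lemma Kap_linear: "lin TM OM Kap"
  unfolding Kap_def by (rule VT.tensor_lift_linear[OF OM_module kap_ok])

lemma Kap_pt: "[|x \<in> cV; y \<in> cV|] ==> Kap (pt x y) = kap x y"
  unfolding Kap_def by (rule VT.tensor_lift_pure[OF OM_module kap_ok])

lemma kap_E:
  assumes b: "b \<in> cB" and h: "h \<in> cH" and y: "y \<in> cV"
  shows "kap (E b 1\<^sub>B h) y = sw OM (%p m. sw OM (%q z. po (e b 1\<^sub>B p) (mu (E (qq 1\<^sub>B z) 1\<^sub>B (S q)) y)) m) h"
proof -
  let ?K = "%p q z. po (e b 1\<^sub>B p) (mu (E (qq 1\<^sub>B z) 1\<^sub>B (S q)) y)"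
  have t: "tril H H H OM ?K" by (rule tril_I) (auto intro!: O_linears simp: b y)
  have be: "bil H H V (%x z. e b (qq 1\<^sub>B z) x)" by (auto intro!: T_linears simp: b)
  have "kap (E b 1\<^sub>B h) y = sw OM (%x z. sw OM (%p q. ?K p q z) x) h"
    unfolding E_def[of b "1\<^sub>B" h] by (rule sw_map[OF V_module OM_module kap_linear_left[OF y] be h]) (simp add: kap_e b y)
  also have "... = sw OM (%p m. sw OM (%q z. ?K p q z) m) h"
    by (rule sw_coassoc[OF OM_module t h])
  finally show ?thesis .
qed

text \<open>Coassociativity gathers the legs h2, h3, h4 of the composite into the left side of
  \<open>antipode_identity_left\<close>, which contributes a counit and the unit element.\<close>

lemma Kap_gal:
  assumes b: "b \<in> cB" and h: "h \<in> cH" and y: "y \<in> cV"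
  shows "Kap (gal (e b 1\<^sub>B h) y) = po (e b 1\<^sub>B h) y"
proof -
  let ?m = "%q z c. mu (E (qq 1\<^sub>B z) 1\<^sub>B (S q)) (w c)"
  let ?K = "%p q z c. po (e b 1\<^sub>B p) (mu (?m q z c) y)"
  have bb: "bil H H TM (%x c. pt (E b 1\<^sub>B x) (mu (w c) y))" by (auto intro!: T_linears simp: b y)
  have "Kap (gal (e b 1\<^sub>B h) y) = sw OM (%x c. sw OM (%p m. sw OM (%q z. ?K p q z c) m) x) h"
    unfolding gal_e[OF b h y] proof (rule sw_map[OF TM_module OM_module Kap_linear bb h])
    fix x c assume a: "x \<in> cH" "c \<in> cH"
    have "Kap (pt (E b 1\<^sub>B x) (mu (w c) y))
      = sw OM (%p m. sw OM (%q z. po (e b 1\<^sub>B p) (mu (E (qq 1\<^sub>B z) 1\<^sub>B (S q)) (mu (w c) y))) m) x"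
      using a b y by (simp add: Kap_pt kap_E)
    also have "... = sw OM (%p m. sw OM (%q z. ?K p q z c) m) x"
    proof (rule sw_cong[OF OM_module _ a(1)])
      show "bil H H OM (%p m. sw OM (%q z. po (e b 1\<^sub>B p) (mu (E (qq 1\<^sub>B z) 1\<^sub>B (S q)) (mu (w c) y))) m)"
        using a b y by (auto intro!: O_linears)
      fix p m assume pm: "p \<in> cH" "m \<in> cH"
      show "sw OM (%q z. po (e b 1\<^sub>B p) (mu (E (qq 1\<^sub>B z) 1\<^sub>B (S q)) (mu (w c) y))) m = sw OM (%q z. ?K p q z c) m"
        by (rule sw_cong[OF OM_module _ pm(2)]) (use a b y pm in \<open>auto intro!: O_linears simp: mu_assoc\<close>)
    qed
    finally show "Kap (pt (E b 1\<^sub>B x) (mu (w c) y)) = sw OM (%p m. sw OM (%q z. ?K p q z c) m) x" .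
  qed
  also have "... = sw OM (%p m. sw OM (%q n. sw OM (%z c. ?K p q z c) n) m) h"
    by (rule hopf.sw_coassoc4[OF OM_module h]) (use b y in \<open>auto intro!: O_linears\<close>)
  also have "... = po (e b 1\<^sub>B h) y"
  proof (rule hopf.sw_absorb_right[OF OM_module _ _ h])
    show "bil H H OM (%p m. sw OM (%q n. sw OM (%z c. ?K p q z c) n) m)"
      using b y by (auto intro!: O_linears)
    show "lin H OM (%p. po (e b 1\<^sub>B p) y)" using b y by (auto intro!: O_linears)
    fix p m assume pm: "p \<in> cH" "m \<in> cH"
    let ?l = "%v. po (e b 1\<^sub>B p) (mu v y)"
    have l: "lin V OM ?l" using b y pm by (auto intro!: O_linears)
    have b1: "bil H H V (%q n. sw V (%z c. ?m q z c) n)" by (auto intro!: O_linears)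
    have "sw OM (%q n. sw OM (%z c. ?K p q z c) n) m = sw OM (%q n. ?l (sw V (%z c. ?m q z c) n)) m"
    proof (rule sw_cong[symmetric, OF OM_module bil_post[OF l b1] pm(2)])
      fix q n assume q: "q \<in> cH" "n \<in> cH"
      show "?l (sw V (%z c. ?m q z c) n) = sw OM (%z c. ?K p q z c) n"
        by (rule sw_post[OF V_module OM_module l _ q(2)]) (use q in \<open>auto intro!: O_linears\<close>)
    qed
    also have "... = ?l (sw V (%q n. sw V (%z c. ?m q z c) n) m)"
      by (rule sw_post[symmetric, OF V_module OM_module l b1 pm(2)])
    also have "... = eps m \<odot>\<^bsub>OM\<^esub> po (e b 1\<^sub>B p) y"
      using pm b y lin_smult[OF bil_D(1)[OF VO.pure_bilinear], of "e b 1\<^sub>B p" "eps m" y]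
      by (simp add: antipode_identity_left mu_smult_one)
    finally show "sw OM (%q n. sw OM (%z c. ?K p q z c) n) m = eps m \<odot>\<^bsub>OM\<^esub> po (e b 1\<^sub>B p) y" .
  qed
  finally show ?thesis .
qed

text \<open>As b \<otimes> b' # h is b \<otimes> 1 # h times t(b'), the coefficient b' can be moved
  across the tensor product over the opposite algebra, and the case b' = 1 suffices.\<close>

lemma Kap_Gal:
  assumes t: "t \<in> carrier OM"
  shows "Kap (Gal t) = t"
proof (rule VO.linear_eqI[OF lin_comp[OF Kap_linear Gal_linear] lin_id _ t])
  fix x y assume x: "x \<in> cV" and y: "y \<in> cV"
  have l: "lin V OM (%x. Kap (Gal (po x y)))" "lin V OM (%x. po x y)"
    using y by (auto intro!: lin_comp[OF Kap_linear] lin_comp[OF Gal_linear] po_linear lin_id)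
  show "Kap (Gal (po x y)) = po x y"
  proof (rule e_linear_eqI[OF l _ x])
    fix b b' h assume a: "b \<in> cB" "b' \<in> cB" "h \<in> cH"
    have "e b b' h = mu (e b 1\<^sub>B h) (rb (u 1\<^sub>H) b')" using a by (simp add: e_target)
    then have "po (e b b' h) y = po (e b 1\<^sub>B h) (rb y b')"
      using a y VO.pure_tensor_balance[of "e b 1\<^sub>B h" b' y] by simp
    then show "Kap (Gal (po (e b b' h) y)) = po (e b b' h) y"
      using a y by (simp add: Gal_po Kap_gal)
  qed
qed

text \<open>The legs h2 and h3 combine by \<open>antipode_identity_right\<close> to the source of
  \<open>pp b'\<close>. That element of B crosses the tensor sign to the first factor and there
  completes the expansion of b \<otimes> b' # h in the free basis.\<close>

lemma Gal_kap:
  assumes b: "b \<in> cB" "b' \<in> cB" and h: "h \<in> cH" and y: "y \<in> cV"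
  shows "Gal (kap (e b b' h) y) = pt (e b b' h) y"
proof -
  let ?m = "%c q. mu (w c) (E b' 1\<^sub>B (S q))"
  let ?K = "%x c q. pt (E b 1\<^sub>B x) (mu (?m c q) y)"
  have t: "tril H H H TM ?K" by (rule tril_I) (auto intro!: T_linears simp: b y)
  have bb: "bil H H OM (%p q. po (e b 1\<^sub>B p) (mu (E b' 1\<^sub>B (S q)) y))" by (auto intro!: O_linears simp: b y)
  have "Gal (kap (e b b' h) y) = sw TM (%p q. sw TM (%x c. ?K x c q) p) h"
    unfolding kap_e[OF b h y] proof (rule sw_map[OF OM_module TM_module Gal_linear bb h])
    fix p q assume a: "p \<in> cH" "q \<in> cH"
    have "Gal (po (e b 1\<^sub>B p) (mu (E b' 1\<^sub>B (S q)) y)) = sw TM (%x c. pt (E b 1\<^sub>B x) (mu (w c) (mu (E b' 1\<^sub>B (S q)) y))) p"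
      using a b y by (simp add: Gal_po gal_e)
    also have "... = sw TM (%x c. ?K x c q) p"
      by (rule sw_cong[OF TM_module _ a(1)]) (use a b y in \<open>auto intro!: T_linears simp: mu_assoc\<close>)
    finally show "Gal (po (e b 1\<^sub>B p) (mu (E b' 1\<^sub>B (S q)) y)) = sw TM (%x c. ?K x c q) p" .
  qed
  also have "... = sw TM (%x m. sw TM (%c q. ?K x c q) m) h"
    by (rule sw_coassoc[OF TM_module t h])
  also have "... = sw TM (%x m. pt (E b (pp b' m) x) y) h"
  proof (rule sw_cong[OF TM_module sw_right_bilinear[OF TM_module t] h])
    fix x m assume a: "x \<in> cH" "m \<in> cH"
    have l: "lin V TM (%v. pt (E b 1\<^sub>B x) (mu v y))" using a b y by (auto intro!: T_linears)
    have bm: "bil H H V ?m" using b by (auto intro!: T_linears)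
    have "sw TM (%c q. ?K x c q) m = pt (E b 1\<^sub>B x) (mu (sw V ?m m) y)"
      by (rule sw_post[symmetric, OF V_module TM_module l bm a(2)])
    also have "... = pt (E b 1\<^sub>B x) (lb (pp b' m) y)"
      using a b y by (simp add: antipode_identity_right mu_source)
    also have "... = pt (rb (E b 1\<^sub>B x) (pp b' m)) y"
      using a b y by (intro VT.pure_tensor_balance[symmetric]) simp_all
    finally show "sw TM (%c q. ?K x c q) m = pt (E b (pp b' m) x) y" using a b by simp
  qed
  also have "... = pt (e b b' h) y"
  proof -
    have l: "lin V TM (%v. pt v y)" using y by (auto intro!: T_linears)
    have bm: "bil H H V (%x m. E b (pp b' m) x)" using b by (auto intro!: T_linears)
    show ?thesis
      unfolding e_E[OF b h] by (rule sw_post[symmetric, OF V_module TM_module l bm h])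
  qed
  finally show ?thesis .
qed

lemma Gal_Kap:
  assumes t: "t \<in> cT"
  shows "Gal (Kap t) = t"
proof (rule T_eqI[OF lin_comp[OF Gal_linear Kap_linear] lin_id _ t])
  fix x y assume x: "x \<in> cV" and y: "y \<in> cV"
  have l: "lin V TM (%x. Gal (Kap (pt x y)))" "lin V TM (%x. pt x y)"
    using y by (auto intro!: lin_comp[OF Kap_linear] lin_comp[OF Gal_linear] pt_linear lin_id)
  show "Gal (Kap (pt x y)) = pt x y"
    by (rule e_linear_eqI[OF l _ x]) (simp add: y Kap_pt Gal_kap)
qed

lemma Gal_bij: "bij_betw Gal (carrier OM) (cT)"
  by (rule bij_betw_byWitness[where f' = Kap])
     (auto simp: Kap_Gal Gal_Kap lin_closed[OF Gal_linear] lin_closed[OF Kap_linear])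

lemma left_hopf_algebroid_L: "left_hopf_algebroid k B L"
  unfolding left_hopf_algebroid_def left_hopf_algebroid_axioms_def
  using left_bialgebroid_L Gal_bij
  by (simp add: galois_map_L tensor_base_L tensor_base_op_L VO.carrier_P[symmetric] VT.carrier_P[symmetric])

lemma inverse_Gal:
  assumes b: "b \<in> cB" "b' \<in> cB" and h: "h \<in> cH" and y: "y \<in> cV"
  shows "inv_into (carrier OM) Gal (pt (e b b' h) y) = sw OM (%h1 x. sw OM (%h2 z. sw OM (%h3 h4.
    po (e b 1\<^sub>B h1) (mu (e b' (\<sigma>' (S (S h3)) (S h2)) (S h4)) y)) z) x) h"
proof -
  have "inv_into (carrier OM) Gal (pt (e b b' h) y) = kap (e b b' h) y"
    by (rule inv_into_f_eq)
       (use Gal_bij b h y in \<open>auto simp: bij_betw_def Gal_kap bil_closed[OF kap_bilinear]\<close>)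
  also have "... = sw OM (%h1 x. sw OM (%h2 z. sw OM (%h3 h4.
    po (e b 1\<^sub>B h1) (mu (e b' (\<sigma>' (S (S h3)) (S h2)) (S h4)) y)) z) x) h"
    unfolding kap_e[OF b h y]
  proof (rule sw_cong[OF OM_module _ h])
    show "bil H H OM (%p q. po (e b 1\<^sub>B p) (mu (E b' 1\<^sub>B (S q)) y))" by (auto intro!: O_linears simp: b y)
    fix p q assume a: "p \<in> cH" "q \<in> cH"
    let ?l = "%v. po (e b 1\<^sub>B p) (mu v y)"
    let ?F = "%m n z. e b' (\<sigma>' (S (S n)) (S m)) (S z)"
    have l: "lin V OM ?l" using a b y by (auto intro!: O_linears)
    have b1: "bil H H V (%m x. sw V (%n z. ?F m n z) x)" using b by (auto intro!: O_linears)
    have "?l (E b' 1\<^sub>B (S q)) = sw OM (%m x. sw OM (%n z. ?l (?F m n z)) x) q"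
      unfolding E_S[OF b(2) a(2)] proof (rule sw_map[OF V_module OM_module l b1 a(2)])
      fix m x assume mx: "m \<in> cH" "x \<in> cH"
      show "?l (sw V (%n z. ?F m n z) x) = sw OM (%n z. ?l (?F m n z)) x"
        by (rule sw_post[OF V_module OM_module l _ mx(2)]) (use mx b in \<open>auto intro!: O_linears\<close>)
    qed
    then show "?l (E b' 1\<^sub>B (S q)) = sw OM (%m x. sw OM (%n z. ?l (?F m n z)) x) q" .
  qed
  finally show ?thesis .
qed

text \<open>At the unit of H the change of coefficient is trivial, \<open>pp c\<close> taking the
  value (1 \<triangleright> c)\<sigma>(1, 1) = c.\<close>

lemma e_at_one: "[|b \<in> cB; c \<in> cB|] ==> e b c 1\<^sub>H = lb b (rb (u 1\<^sub>H) c)"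
proof -
  assume b: "b \<in> cB" and c: "c \<in> cB"
  have bb: "bil H H V (%x y. lb b (rb (u x) (pp c y)))" using b c by (auto intro!: T_linears)
  have "pp c 1\<^sub>H = c"
    using b c hopf.conv_mult_at_one[OF algebra_B al_closed[OF c] Tau_closed]
      hopf.sw_one[OF base.module_A, of "%x y. \<sigma> x (S y)"]
    by (simp add: pp_def one_act Tau_sw T_linears sigma_one_right)
  then show ?thesis using b c by (simp add: e_sw hopf.sw_one[OF V_module bb])
qed

end

theorem proposition3p9:
  fixes k :: "'k ring"
    and B :: "('k, 'b) module"
    and H :: "('k, 'h) hopf_data"
    and act :: "'h \<Rightarrow> 'b \<Rightarrow> 'b"
    and \<sigma> \<sigma>' :: "'h \<Rightarrow> 'h \<Rightarrow> 'b"
  assumes "hopf_algebra k H"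
    and "unital_algebra k B"
    and "cocycle_cross_product k B H act \<sigma> \<sigma>'"
  shows "\<exists>L :: ('k, 'b, (('b \<times> 'b \<Rightarrow>\<^sub>0 int) set \<times> 'h \<Rightarrow>\<^sub>0 int) set) bialgebroid_data.
    let V = tensor_algebra k (enveloping_algebra k B) H;
        e = env_elem k B H;
        S = antipode H
    in
      (carrier L = carrier V \<and> \<zero>\<^bsub>L\<^esub> = \<zero>\<^bsub>V\<^esub> \<and> ring.add L = ring.add V \<and> module.smult L = module.smult V) \<and>
      left_hopf_algebroid k B L \<and>
      (\<forall>b\<in>carrier B. \<forall>b'\<in>carrier B. \<forall>h\<in>carrier H.
       \<forall>c\<in>carrier B. \<forall>c'\<in>carrier B. \<forall>g\<in>carrier H.
        e b b' h \<otimes>\<^bsub>L\<^esub> e c c' g =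
          sweedler4 H (add_monoid L) (\<lambda>h1 h2 h3 h4. sweedler4 H (add_monoid L) (\<lambda>g1 g2 g3 g4.
            e (b \<otimes>\<^bsub>B\<^esub> act h1 c \<otimes>\<^bsub>B\<^esub> \<sigma> h2 g1)
              (c' \<otimes>\<^bsub>B\<^esub> act (S g4) b' \<otimes>\<^bsub>B\<^esub> \<sigma> (S g3) (S h4))
              (h3 \<otimes>\<^bsub>H\<^esub> g2)) g) h) \<and>
      (\<forall>b\<in>carrier B. source L b = e b \<one>\<^bsub>B\<^esub> \<one>\<^bsub>H\<^esub>) \<and>
      (\<forall>b\<in>carrier B. target L b = e \<one>\<^bsub>B\<^esub> b \<one>\<^bsub>H\<^esub>) \<and>
      (\<forall>b\<in>carrier B. \<forall>b'\<in>carrier B. source L b \<otimes>\<^bsub>L\<^esub> target L b' = e b b' \<one>\<^bsub>H\<^esub>) \<and>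
      (\<forall>b\<in>carrier B. \<forall>b'\<in>carrier B. \<forall>h\<in>carrier H.
        coprod L (e b b' h) =
          sweedler4 H (tensor_base B L) (\<lambda>h1 h2 h3 h4.
            pure_tensor (tensor_base B L) (e b (\<sigma>' (S h2) h3) h1) (e \<one>\<^bsub>B\<^esub> b' h4)) h) \<and>
      (\<forall>c\<in>carrier B. \<forall>c'\<in>carrier B. \<forall>b\<in>carrier B. \<forall>b'\<in>carrier B. \<forall>h\<in>carrier H.
        source L c \<otimes>\<^bsub>L\<^esub> target L c' \<otimes>\<^bsub>L\<^esub> e b b' h =
          sweedler2 H (add_monoid L) (\<lambda>h1 h2.
            e (c \<otimes>\<^bsub>B\<^esub> b) (b' \<otimes>\<^bsub>B\<^esub> act (S h2) c') h1) h) \<and>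
      (\<forall>b\<in>carrier B. \<forall>b'\<in>carrier B. \<forall>h\<in>carrier H.
        bcounit L (e b b' h) =
          sweedler3 H (add_monoid B) (\<lambda>h1 h2 h3.
            b \<otimes>\<^bsub>B\<^esub> act h1 b' \<otimes>\<^bsub>B\<^esub> \<sigma> h2 (S h3)) h) \<and>
      (\<forall>b\<in>carrier B. \<forall>b'\<in>carrier B. \<forall>h\<in>carrier H. \<forall>y\<in>carrier L.
        inv_into (carrier (tensor_base_op B L)) (galois_map B L)
            (pure_tensor (tensor_base B L) (e b b' h) y) =
          sweedler4 H (tensor_base_op B L) (\<lambda>h1 h2 h3 h4.
            pure_tensor (tensor_base_op B L) (e b \<one>\<^bsub>B\<^esub> h1)
              (e b' (\<sigma>' (S (S h3)) (S h2)) (S h4) \<otimes>\<^bsub>L\<^esub> y)) h)"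
proof -
  interpret enveloping_cross_product k B H act \<sigma> \<sigma>'
    by (rule enveloping_cross_product.intro[OF assms(3)])
  \<comment> \<open>The statement forms its sums in the groups attached to \<open>L\<close> and to
    the two tensor products; these have the same operations as the additive groups of the k-modules
    used so far, but they are different records.\<close>
  have sw_L: "sweedler2 H (add_monoid L) F h = sweedler2 H (add_monoid V) F h" for F h
    unfolding sweedler2_def by (rule tensor_lift_monoid_cong) simp_all
  have sw_T: "sweedler2 H VT.T F h = sweedler2 H (add_monoid TM) F h" for F h
    unfolding sweedler2_def by (rule tensor_lift_monoid_cong) (simp_all add: VT.carrier_P VT.add_P VT.zero_P)
  have sw_O: "sweedler2 H VO.T F h = sweedler2 H (add_monoid OM) F h" for F h
    unfolding sweedler2_def by (rule tensor_lift_monoid_cong) (simp_all add: VO.carrier_P VO.add_P VO.zero_P)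
  have e: "env_elem k B H = e" by (intro ext) (simp add: env_elem_e)
  show ?thesis
    unfolding Let_def V_enveloping e
  proof (intro exI[of _ L] conjI ballI)
    show "left_hopf_algebroid k B L" by (rule left_hopf_algebroid_L)
    fix b b' h c c' g assume a: "b \<in> cB" "b' \<in> cB" "h \<in> cH" "c \<in> cB" "c' \<in> cB" "g \<in> cH"
    show "e b b' h \<otimes>\<^bsub>L\<^esub> e c c' g =
        sweedler4 H (add_monoid L) (%h1 h2 h3 h4. sweedler4 H (add_monoid L) (%g1 g2 g3 g4.
          e (b \<cdot> act h1 c \<cdot> \<sigma> h2 g1) (c' \<cdot> act (S g4) b' \<cdot> \<sigma> (S g3) (S h4)) (h3 \<otimes>\<^bsub>H\<^esub> g2)) g) h"
      unfolding sweedler4_def sweedler3_def sw_L using e_product[OF a] by simp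
  next
    fix b b' h assume a: "b \<in> cB" "b' \<in> cB" "h \<in> cH"
    show "coprod L (e b b' h) = sweedler4 H (tensor_base B L) (%h1 h2 h3 h4.
        pure_tensor (tensor_base B L) (e b (\<sigma>' (S h2) h3) h1) (e 1\<^sub>B b' h4)) h"
      unfolding sweedler4_def sweedler3_def tensor_base_L sw_T using Dl_e4[OF a] by simp
    show "bcounit L (e b b' h) = sweedler3 H (add_monoid B) (%h1 h2 h3. b \<cdot> act h1 b' \<cdot> \<sigma> h2 (S h3)) h"
      unfolding sweedler3_def using epsL_e3[OF a] by simp
    fix y assume "y \<in> carrier L"
    then have y: "y \<in> cV" by simp
    show "inv_into (carrier (tensor_base_op B L)) (galois_map B L) (pure_tensor (tensor_base B L) (e b b' h) y) =
        sweedler4 H (tensor_base_op B L) (%h1 h2 h3 h4.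
          pure_tensor (tensor_base_op B L) (e b 1\<^sub>B h1) (e b' (\<sigma>' (S (S h3)) (S h2)) (S h4) \<otimes>\<^bsub>L\<^esub> y)) h"
      unfolding sweedler4_def sweedler3_def tensor_base_L tensor_base_op_L sw_O galois_map_L VO.carrier_P[symmetric]
      using inverse_Gal[OF a y] by simp
  next
    fix c c' b b' h assume a: "c \<in> cB" "c' \<in> cB" "b \<in> cB" "b' \<in> cB" "h \<in> cH"
    \<comment> \<open>Multiplying by the source and the target is acting by the bimodule from the
      left and from the right, and the two actions commute.\<close>
    have "lb c (rb (e b b' h) c') = rb (e (c \<cdot> b) b' h) c'" using a by (simp add: V_bimodule(5)[symmetric] lb_e)
    then show "source L c \<otimes>\<^bsub>L\<^esub> target L c' \<otimes>\<^bsub>L\<^esub> e b b' h =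
        sweedler2 H (add_monoid L) (%h1 h2. e (c \<cdot> b) (b' \<cdot> act (S h2) c') h1) h"
      unfolding sw_L using a by (simp add: mu_lb mu_rb mu_one rb_e)
  qed (simp_all add: e_at_one mu_source V_bimodule)
qed

end
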